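(* Let $B\xrightarrow{\beta} C\xrightarrow{\varepsilon} k$ be morphisms of graded-commutative DG algebras, where $k$ is a field, and let $L$ be a DG $C$-module. If there exists a morphism of graded-commutative DG algebras $\alpha\colon A\to B$ such that $\beta\alpha\colon A\to C$ is a quasi-isomorphism, then there is an isomorphism of graded $k$-vector spaces $$\operatorname{Tor}^{B}(L^{\beta},{}^{\varepsilon\beta}k)\;\cong\;\operatorname{Tor}^{C}(L,{}^{\varepsilon}k)\otimes_{k}\operatorname{Tor}^{B}(C^{\beta},{}^{\varepsilon\beta}k).$$
   Context: DG algebras are $\mathbb Z$-graded. Graded-commutative means $bb'=(-1)^{|b||b'|}b'b$ for all homogeneous $b,b'$, and $b^2=0$ when $|b|$ is odd; over such algebras left and right DG modules are identified. The field $k$ is viewed as a DG algebra concentrated in degree $0$. For a morphism $\beta\colon B\to C$ of DG algebras and a DG $C$-module $M$, ${}^{\beta}M$ (respectively $M^{\beta}$) is $M$ viewed as a left (respectively right) DG $B$-module by restriction of scalars along $\beta$. A semibasis of a DG $B$-module $F$ is a well-ordered subset $\boldsymbol f$ of $F$ that is a basis of the underlying graded module $F^\natural$ over the underlying graded ring $B^\natural$ and satisfies $\partial(f)\in\sum_{e<f}Be$ (sum over $e \in \boldsymbol f$, $e<f$) for each $f\in\boldsymbol f$; $F$ is semifree if it has a semibasis. $\operatorname{Tor}^B(L,M)=\operatorname{H}(L\otimes_B F)$, where $F\to M$ is a quasi-isomorphism with $F$ semifree. *)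

theory Defs
  imports "HOL-Algebra.Algebra"
begin

section \<open>DG algebras and DG modules\<close>

text \<open>
  A graded object is an abelian group together with an internal direct sum decomposition indexed by
  the integers; \<open>gr M n\<close> is the component of degree \<open>n\<close>.  Differentials have degree \<open>-1\<close>.
  DG algebras are over the integers, that is, DG rings; a ground ring plays no role.
  As in the library record for modules, the fields \<open>mult\<close> and \<open>one\<close> are irrelevant for
  objects that are not rings.
\<close>

record 'a dg = "'a ring" +
  gr :: "int \<Rightarrow> 'a set"
  diff :: "'a \<Rightarrow> 'a"

text \<open>
  The field \<open>act\<close> holds the scalar action of left as well as of right modules: for a right module
  \<open>M\<close>, the element \<open>act M b m\<close> is the product \<open>m b\<close>.
  Over a graded-commutative DG algebra, left modules turn into right ones via
  \<open>m b = (-1)^(|b| |m|) b m\<close>; the left and right factors of a tensor product are taken as right and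
  left modules from the start.
\<close>

record ('b, 'a) dgmod = "'a dg" +
  act :: "'b \<Rightarrow> 'a \<Rightarrow> 'a"

definition is_decomposition :: "('a, 'm) dg_scheme \<Rightarrow> 'a \<Rightarrow> (int \<Rightarrow> 'a) \<Rightarrow> bool" where
  "is_decomposition M x f \<longleftrightarrow>
     (\<forall>n. f n \<in> gr M n) \<and> finite {n. f n \<noteq> \<zero>\<^bsub>M\<^esub>} \<and>
     x = (\<Oplus>\<^bsub>M\<^esub> n \<in> {n. f n \<noteq> \<zero>\<^bsub>M\<^esub>}. f n)"

definition hcomp :: "('a, 'm) dg_scheme \<Rightarrow> 'a \<Rightarrow> int \<Rightarrow> 'a" where
  "hcomp M x = (THE f. is_decomposition M x f)"

definition koszul :: "('a, 'm) dg_scheme \<Rightarrow> int \<Rightarrow> 'a \<Rightarrow> 'a" where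
  "koszul M i x = (if even i then x else \<ominus>\<^bsub>M\<^esub> x)"

text \<open>The additive involution \<open>x \<mapsto> (-1)^|x| x\<close>, extended to inhomogeneous elements.\<close>

definition signed :: "('a, 'm) dg_scheme \<Rightarrow> 'a \<Rightarrow> 'a" where
  "signed M x = (\<Oplus>\<^bsub>M\<^esub> n \<in> {n. hcomp M x n \<noteq> \<zero>\<^bsub>M\<^esub>}. koszul M n (hcomp M x n))"

locale graded_group = abelian_group M for M :: "('a, 'm) dg_scheme" (structure) +
  assumes gr_subgroup: "subgroup (gr M n) (add_monoid M)"
    and decomposition: "x \<in> carrier M \<Longrightarrow> \<exists>!f. is_decomposition M x f"

locale dg_group = graded_group M for M :: "('a, 'm) dg_scheme" (structure) +
  assumes diff_hom: "diff M \<in> hom (add_monoid M) (add_monoid M)"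
    and diff_degree: "x \<in> gr M n \<Longrightarrow> diff M x \<in> gr M (n - 1)"
    and diff_diff: "x \<in> carrier M \<Longrightarrow> diff M (diff M x) = \<zero>"

locale dg_ring = ring R + dg_group R for R :: "('a, 'm) dg_scheme" (structure) +
  assumes one_degree: "\<one> \<in> gr R 0"
    and mult_degree: "x \<in> gr R i \<Longrightarrow> y \<in> gr R j \<Longrightarrow> x \<otimes> y \<in> gr R (i + j)"
    and leibniz: "x \<in> gr R i \<Longrightarrow> y \<in> carrier R \<Longrightarrow>
      diff R (x \<otimes> y) = diff R x \<otimes> y \<oplus> koszul R i (x \<otimes> diff R y)"

locale gc_dg_ring = dg_ring R for R :: "('a, 'm) dg_scheme" (structure) +
  assumes graded_commute: "x \<in> gr R i \<Longrightarrow> y \<in> gr R j \<Longrightarrow> x \<otimes> y = koszul R (i * j) (y \<otimes> x)"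
    and odd_square: "x \<in> gr R i \<Longrightarrow> odd i \<Longrightarrow> x \<otimes> x = \<zero>"

locale left_dg_module = B?: dg_ring B + M?: dg_group M
  for B :: "('b, 'n) dg_scheme" (structure) and M :: "('b, 'a, 'm) dgmod_scheme" (structure) +
  assumes act_closed: "b \<in> carrier B \<Longrightarrow> x \<in> carrier M \<Longrightarrow> act M b x \<in> carrier M"
    and act_add_left: "b \<in> carrier B \<Longrightarrow> c \<in> carrier B \<Longrightarrow> x \<in> carrier M \<Longrightarrow>
      act M (b \<oplus>\<^bsub>B\<^esub> c) x = act M b x \<oplus>\<^bsub>M\<^esub> act M c x"
    and act_add_right: "b \<in> carrier B \<Longrightarrow> x \<in> carrier M \<Longrightarrow> y \<in> carrier M \<Longrightarrow>
      act M b (x \<oplus>\<^bsub>M\<^esub> y) = act M b x \<oplus>\<^bsub>M\<^esub> act M b y"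
    and act_one: "x \<in> carrier M \<Longrightarrow> act M \<one>\<^bsub>B\<^esub> x = x"
    and act_mult: "b \<in> carrier B \<Longrightarrow> c \<in> carrier B \<Longrightarrow> x \<in> carrier M \<Longrightarrow>
      act M (b \<otimes>\<^bsub>B\<^esub> c) x = act M b (act M c x)"
    and act_degree: "b \<in> gr B i \<Longrightarrow> x \<in> gr M j \<Longrightarrow> act M b x \<in> gr M (i + j)"
    and act_leibniz: "b \<in> gr B i \<Longrightarrow> x \<in> carrier M \<Longrightarrow>
      diff M (act M b x) = act M (diff B b) x \<oplus>\<^bsub>M\<^esub> koszul M i (act M b (diff M x))"

locale right_dg_module = B?: dg_ring B + M?: dg_group M
  for B :: "('b, 'n) dg_scheme" (structure) and M :: "('b, 'a, 'm) dgmod_scheme" (structure) +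
  assumes act_closed: "b \<in> carrier B \<Longrightarrow> x \<in> carrier M \<Longrightarrow> act M b x \<in> carrier M"
    and act_add_left: "b \<in> carrier B \<Longrightarrow> c \<in> carrier B \<Longrightarrow> x \<in> carrier M \<Longrightarrow>
      act M (b \<oplus>\<^bsub>B\<^esub> c) x = act M b x \<oplus>\<^bsub>M\<^esub> act M c x"
    and act_add_right: "b \<in> carrier B \<Longrightarrow> x \<in> carrier M \<Longrightarrow> y \<in> carrier M \<Longrightarrow>
      act M b (x \<oplus>\<^bsub>M\<^esub> y) = act M b x \<oplus>\<^bsub>M\<^esub> act M b y"
    and act_one: "x \<in> carrier M \<Longrightarrow> act M \<one>\<^bsub>B\<^esub> x = x"
    and act_mult: "b \<in> carrier B \<Longrightarrow> c \<in> carrier B \<Longrightarrow> x \<in> carrier M \<Longrightarrow>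
      act M (b \<otimes>\<^bsub>B\<^esub> c) x = act M c (act M b x)"
    and act_degree: "b \<in> gr B i \<Longrightarrow> x \<in> gr M j \<Longrightarrow> act M b x \<in> gr M (j + i)"
    and act_leibniz: "b \<in> carrier B \<Longrightarrow> x \<in> gr M j \<Longrightarrow>
      diff M (act M b x) = act M b (diff M x) \<oplus>\<^bsub>M\<^esub> koszul M j (act M (diff B b) x)"

definition chain_map :: "('a, 'm) dg_scheme \<Rightarrow> ('c, 'n) dg_scheme \<Rightarrow> ('a \<Rightarrow> 'c) \<Rightarrow> bool" where
  "chain_map M N f \<longleftrightarrow>
     f \<in> hom (add_monoid M) (add_monoid N) \<and>
     (\<forall>n. f ` gr M n \<subseteq> gr N n) \<and>
     (\<forall>x\<in>carrier M. f (diff M x) = diff N (f x))"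

definition dg_ring_morphism :: "('a, 'm) dg_scheme \<Rightarrow> ('c, 'n) dg_scheme \<Rightarrow> ('a \<Rightarrow> 'c) \<Rightarrow> bool" where
  "dg_ring_morphism R S f \<longleftrightarrow> f \<in> ring_hom R S \<and> chain_map R S f"

definition dg_module_morphism ::
  "('b, 'p) dg_scheme \<Rightarrow> ('b, 'a, 'm) dgmod_scheme \<Rightarrow> ('b, 'c, 'n) dgmod_scheme \<Rightarrow> ('a \<Rightarrow> 'c) \<Rightarrow> bool" where
  "dg_module_morphism B M N f \<longleftrightarrow>
     chain_map M N f \<and>
     (\<forall>b\<in>carrier B. \<forall>x\<in>carrier M. f (act M b x) = act N b (f x))"

definition concentrated :: "('k, 'm) ring_scheme \<Rightarrow> 'k dg" where
  "concentrated K =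
     \<lparr>carrier = carrier K, monoid.mult = monoid.mult K, one = \<one>\<^bsub>K\<^esub>, ring.zero = \<zero>\<^bsub>K\<^esub>, ring.add = ring.add K,
      gr = (\<lambda>n. if n = 0 then carrier K else {\<zero>\<^bsub>K\<^esub>}), diff = (\<lambda>_. \<zero>\<^bsub>K\<^esub>)\<rparr>"

definition left_regular :: "'b dg \<Rightarrow> ('b, 'b) dgmod" where
  "left_regular B = dg.extend B (dgmod.fields (\<lambda>b x. b \<otimes>\<^bsub>B\<^esub> x))"

definition right_regular :: "'b dg \<Rightarrow> ('b, 'b) dgmod" where
  "right_regular B = dg.extend B (dgmod.fields (\<lambda>b x. x \<otimes>\<^bsub>B\<^esub> b))"

definition restrict_scalars :: "('b \<Rightarrow> 'c) \<Rightarrow> ('c, 'a) dgmod \<Rightarrow> ('b, 'a) dgmod" where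
  "restrict_scalars \<beta> M = dg.extend (dg.truncate M) (dgmod.fields (\<lambda>b. act M (\<beta> b)))"


section \<open>Homology\<close>

definition cycles :: "('a, 'm) dg_scheme \<Rightarrow> 'a set" where
  "cycles M = {x \<in> carrier M. diff M x = \<zero>\<^bsub>M\<^esub>}"

definition boundaries :: "('a, 'm) dg_scheme \<Rightarrow> 'a set" where
  "boundaries M = diff M ` carrier M"

definition homology_class :: "('a, 'm) dg_scheme \<Rightarrow> 'a \<Rightarrow> 'a set" where
  "homology_class M x = boundaries M +>\<^bsub>M\<^esub> x"

definition homology :: "('a, 'm) dg_scheme \<Rightarrow> 'a set dg" where
  "homology M =
     \<lparr>carrier = homology_class M ` cycles M, monoid.mult = undefined, one = undefined,
      ring.zero = boundaries M, ring.add = set_add M,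
      gr = (\<lambda>n. homology_class M ` (cycles M \<inter> gr M n)), diff = (\<lambda>_. boundaries M)\<rparr>"

text \<open>
  Maps out of a set of cosets are given as unions over representatives; for a map that respects
  the cosets all members of the union coincide.
\<close>

definition homology_map ::
  "('a, 'm) dg_scheme \<Rightarrow> ('c, 'n) dg_scheme \<Rightarrow> ('a \<Rightarrow> 'c) \<Rightarrow> 'a set \<Rightarrow> 'c set" where
  "homology_map M N f U = (\<Union>x\<in>U. homology_class N (f x))"

definition quasi_isomorphism :: "('a, 'm) dg_scheme \<Rightarrow> ('c, 'n) dg_scheme \<Rightarrow> ('a \<Rightarrow> 'c) \<Rightarrow> bool" where
  "quasi_isomorphism M N f \<longleftrightarrow>
     chain_map M N f \<and>
     bij_betw (homology_map M N f) (carrier (homology M)) (carrier (homology N))"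


section \<open>Semifree modules\<close>

definition coeff_family :: "('b, 'p) dg_scheme \<Rightarrow> 'a set \<Rightarrow> ('a \<Rightarrow> 'b) \<Rightarrow> bool" where
  "coeff_family B E c \<longleftrightarrow>
     (\<forall>e. c e \<in> carrier B) \<and> (\<forall>e. e \<notin> E \<longrightarrow> c e = \<zero>\<^bsub>B\<^esub>) \<and> finite {e. c e \<noteq> \<zero>\<^bsub>B\<^esub>}"

definition lin_comb :: "('b, 'p) dg_scheme \<Rightarrow> ('b, 'a, 'm) dgmod_scheme \<Rightarrow> ('a \<Rightarrow> 'b) \<Rightarrow> 'a" where
  "lin_comb B M c = (\<Oplus>\<^bsub>M\<^esub> e \<in> {e. c e \<noteq> \<zero>\<^bsub>B\<^esub>}. act M (c e) e)"

definition lin_span :: "('b, 'p) dg_scheme \<Rightarrow> ('b, 'a, 'm) dgmod_scheme \<Rightarrow> 'a set \<Rightarrow> 'a set" where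
  "lin_span B M E = {lin_comb B M c | c. coeff_family B E c}"

text \<open>A basis of the underlying graded module consists of homogeneous elements.\<close>

definition graded_basis :: "('b, 'p) dg_scheme \<Rightarrow> ('b, 'a, 'm) dgmod_scheme \<Rightarrow> 'a set \<Rightarrow> bool" where
  "graded_basis B F E \<longleftrightarrow>
     E \<subseteq> (\<Union>n. gr F n) \<and>
     (\<forall>x\<in>carrier F. \<exists>!c. coeff_family B E c \<and> x = lin_comb B F c)"

definition semibasis ::
  "('b, 'p) dg_scheme \<Rightarrow> ('b, 'a, 'm) dgmod_scheme \<Rightarrow> 'a set \<Rightarrow> ('a \<times> 'a) set \<Rightarrow> bool" where
  "semibasis B F E r \<longleftrightarrow>
     well_order_on E r \<and> graded_basis B F E \<and>
     (\<forall>f\<in>E. diff F f \<in> lin_span B F {e \<in> E. (e, f) \<in> r \<and> e \<noteq> f})"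

definition semifree :: "('b, 'p) dg_scheme \<Rightarrow> ('b, 'a, 'm) dgmod_scheme \<Rightarrow> bool" where
  "semifree B F \<longleftrightarrow> left_dg_module B F \<and> (\<exists>E r. semibasis B F E r)"

definition semifree_resolution ::
  "('b, 'p) dg_scheme \<Rightarrow> ('b, 'c, 'n) dgmod_scheme \<Rightarrow> ('b, 'a, 'm) dgmod_scheme \<Rightarrow> ('a \<Rightarrow> 'c) \<Rightarrow> bool" where
  "semifree_resolution B M F \<pi> \<longleftrightarrow>
     semifree B F \<and> dg_module_morphism B F M \<pi> \<and> quasi_isomorphism F M \<pi>"


section \<open>Tensor products\<close>

text \<open>
  For a right module \<open>L\<close> and a left module \<open>F\<close> over \<open>B\<close>, the tensor product is the free abelian
  group on pairs \<open>(l, f)\<close> modulo biadditivity and \<open>(l b) \<otimes> f = l \<otimes> (b f)\<close>, with differential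
  \<open>\<partial>(l \<otimes> f) = \<partial>l \<otimes> f + (-1)^|l| l \<otimes> \<partial>f\<close>.
\<close>

abbreviation tensor_free ::
  "('b, 'l, 'm) dgmod_scheme \<Rightarrow> ('b, 'f, 'n) dgmod_scheme \<Rightarrow> ('l \<times> 'f \<Rightarrow>\<^sub>0 int) monoid" where
  "tensor_free L F \<equiv> free_Abelian_group (carrier L \<times> carrier F)"

definition tensor_relators ::
  "('b, 'p) dg_scheme \<Rightarrow> ('b, 'l, 'm) dgmod_scheme \<Rightarrow> ('b, 'f, 'n) dgmod_scheme \<Rightarrow> ('l \<times> 'f \<Rightarrow>\<^sub>0 int) set" where
  "tensor_relators B L F =
     {frag_of (l \<oplus>\<^bsub>L\<^esub> l', f) - frag_of (l, f) - frag_of (l', f) | l l' f.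
        l \<in> carrier L \<and> l' \<in> carrier L \<and> f \<in> carrier F} \<union>
     {frag_of (l, f \<oplus>\<^bsub>F\<^esub> f') - frag_of (l, f) - frag_of (l, f') | l f f'.
        l \<in> carrier L \<and> f \<in> carrier F \<and> f' \<in> carrier F} \<union>
     {frag_of (act L b l, f) - frag_of (l, act F b f) | b l f.
        b \<in> carrier B \<and> l \<in> carrier L \<and> f \<in> carrier F}"

definition tensor_kernel ::
  "('b, 'p) dg_scheme \<Rightarrow> ('b, 'l, 'm) dgmod_scheme \<Rightarrow> ('b, 'f, 'n) dgmod_scheme \<Rightarrow> ('l \<times> 'f \<Rightarrow>\<^sub>0 int) set" where
  "tensor_kernel B L F = generate (tensor_free L F) (tensor_relators B L F)"

definition tensor_class ::
  "('b, 'p) dg_scheme \<Rightarrow> ('b, 'l, 'm) dgmod_scheme \<Rightarrow> ('b, 'f, 'n) dgmod_scheme \<Rightarrow>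
     ('l \<times> 'f \<Rightarrow>\<^sub>0 int) \<Rightarrow> ('l \<times> 'f \<Rightarrow>\<^sub>0 int) set" where
  "tensor_class B L F x = tensor_kernel B L F #>\<^bsub>tensor_free L F\<^esub> x"

definition tensor ::
  "('b, 'p) dg_scheme \<Rightarrow> ('b, 'l, 'm) dgmod_scheme \<Rightarrow> ('b, 'f, 'n) dgmod_scheme \<Rightarrow> ('l \<times> 'f \<Rightarrow>\<^sub>0 int) set dg" where
  "tensor B L F =
     \<lparr>carrier = carrier (tensor_free L F Mod tensor_kernel B L F),
      monoid.mult = undefined, one = undefined,
      ring.zero = \<one>\<^bsub>tensor_free L F Mod tensor_kernel B L F\<^esub>,
      ring.add = monoid.mult (tensor_free L F Mod tensor_kernel B L F),
      gr = (\<lambda>n. tensor_class B L F ` carrier (free_Abelian_group (\<Union>i. gr L i \<times> gr F (n - i)))),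
      diff = (\<lambda>U. \<Union>x\<in>U. tensor_class B L F
        (frag_extend (\<lambda>(l, f). frag_of (diff L l, f) + frag_of (signed L l, diff F f)) x))\<rparr>"

text \<open>The map \<open>l \<otimes> f \<mapsto> l \<otimes> \<phi> f\<close>.\<close>

definition tensor_map ::
  "('b, 'p) dg_scheme \<Rightarrow> ('b, 'l, 'm) dgmod_scheme \<Rightarrow> ('b, 'f, 'n) dgmod_scheme \<Rightarrow> ('b, 'g, 'q) dgmod_scheme \<Rightarrow>
     ('f \<Rightarrow> 'g) \<Rightarrow> ('l \<times> 'f \<Rightarrow>\<^sub>0 int) set \<Rightarrow> ('l \<times> 'g \<Rightarrow>\<^sub>0 int) set" where
  "tensor_map B L F G \<phi> U =
     (\<Union>x\<in>U. tensor_class B L G (frag_extend (\<lambda>(l, f). frag_of (l, \<phi> f)) x))"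


section \<open>Graded vector spaces and Tor\<close>

locale graded_vector_space = K?: field K + V?: graded_group V
  for K :: "('k, 'n) ring_scheme" (structure) and V :: "('k, 'v, 'm) dgmod_scheme" (structure) +
  assumes scale_closed: "c \<in> carrier K \<Longrightarrow> v \<in> carrier V \<Longrightarrow> act V c v \<in> carrier V"
    and scale_add_left: "c \<in> carrier K \<Longrightarrow> d \<in> carrier K \<Longrightarrow> v \<in> carrier V \<Longrightarrow>
      act V (c \<oplus>\<^bsub>K\<^esub> d) v = act V c v \<oplus>\<^bsub>V\<^esub> act V d v"
    and scale_add_right: "c \<in> carrier K \<Longrightarrow> v \<in> carrier V \<Longrightarrow> w \<in> carrier V \<Longrightarrow>
      act V c (v \<oplus>\<^bsub>V\<^esub> w) = act V c v \<oplus>\<^bsub>V\<^esub> act V c w"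
    and scale_one: "v \<in> carrier V \<Longrightarrow> act V \<one>\<^bsub>K\<^esub> v = v"
    and scale_mult: "c \<in> carrier K \<Longrightarrow> d \<in> carrier K \<Longrightarrow> v \<in> carrier V \<Longrightarrow>
      act V (c \<otimes>\<^bsub>K\<^esub> d) v = act V c (act V d v)"
    and scale_degree: "c \<in> carrier K \<Longrightarrow> v \<in> gr V n \<Longrightarrow> act V c v \<in> gr V n"

definition graded_vector_space_iso ::
  "('k, 'p) ring_scheme \<Rightarrow> ('k, 'v, 'm) dgmod_scheme \<Rightarrow> ('k, 'w, 'n) dgmod_scheme \<Rightarrow> ('v \<Rightarrow> 'w) \<Rightarrow> bool" where
  "graded_vector_space_iso K V W h \<longleftrightarrow>
     graded_vector_space K V \<and> graded_vector_space K W \<and>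
     bij_betw h (carrier V) (carrier W) \<and>
     h \<in> hom (add_monoid V) (add_monoid W) \<and>
     (\<forall>c\<in>carrier K. \<forall>v\<in>carrier V. h (act V c v) = act W c (h v)) \<and>
     (\<forall>n. h ` gr V n = gr W n)"

text \<open>
  The left \<open>k\<close>-space \<open>V\<close> also serves as a right one, as \<open>k\<close> is commutative and sits in degree 0.
\<close>

definition tensor_space ::
  "('k, 'p) ring_scheme \<Rightarrow> ('k, 'v, 'm) dgmod_scheme \<Rightarrow> ('k, 'w, 'n) dgmod_scheme \<Rightarrow>
     ('k, ('v \<times> 'w \<Rightarrow>\<^sub>0 int) set) dgmod" where
  "tensor_space K V W =
     dg.extend (tensor (concentrated K) V W)
       (dgmod.fields (\<lambda>c. tensor_map (concentrated K) V W W (act W c)))"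

text \<open>
  For a semifree resolution \<open>\<pi>: F \<rightarrow> k\<close>, multiplication by \<open>c\<close> on \<open>k\<close> lifts to \<open>F\<close>, uniquely up to
  homotopy.  A lift with \<open>\<pi> \<phi> = c \<pi>\<close> exists on the nose because \<open>\<pi>\<close> is surjective: the differential
  of \<open>k\<close> vanishes, so that \<open>k\<close> is its own homology.
\<close>

definition scalar_lift ::
  "('k, 'q) ring_scheme \<Rightarrow> ('b, 'p) dg_scheme \<Rightarrow> ('b, 'f, 'm) dgmod_scheme \<Rightarrow> ('f \<Rightarrow> 'k) \<Rightarrow> 'k \<Rightarrow> 'f \<Rightarrow> 'f" where
  "scalar_lift K B F \<pi> c =
     (SOME \<phi>. dg_module_morphism B F F \<phi> \<and> (\<forall>x\<in>carrier F. \<pi> (\<phi> x) = c \<otimes>\<^bsub>K\<^esub> \<pi> x))"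

text \<open>
  \<open>Tor k B L F \<pi>\<close> is \<open>Tor\<^sup>B(L, k) = H(L \<otimes>\<^sub>B F)\<close>, computed from a semifree resolution \<open>\<pi>: F \<rightarrow> k\<close>
  over \<open>B\<close>.  The scalar \<open>c\<close> acts as the map \<open>Tor\<^sup>B(L, c)\<close> induced by multiplication by \<open>c\<close> on the
  second argument.
\<close>

definition Tor ::
  "('k, 'q) ring_scheme \<Rightarrow> ('b, 'p) dg_scheme \<Rightarrow> ('b, 'l, 'm) dgmod_scheme \<Rightarrow> ('b, 'f, 'n) dgmod_scheme \<Rightarrow>
     ('f \<Rightarrow> 'k) \<Rightarrow> ('k, ('l \<times> 'f \<Rightarrow>\<^sub>0 int) set set) dgmod" where
  "Tor K B L F \<pi> =
     dg.extend (homology (tensor B L F))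
       (dgmod.fields (\<lambda>c. homology_map (tensor B L F) (tensor B L F)
         (tensor_map B L F F (scalar_lift K B F \<pi> c))))"

end

theory Submission
  imports Defs "HOL-Library.Multiset"
begin

text \<open>
  Let \<open>T\<close> be a free right \<open>A\<close>-module on cells, with a twisted differential, resolving \<open>L\<close> over \<open>A\<close>.
  As \<open>A \<rightarrow> C\<close> is a quasi-isomorphism, \<open>T \<otimes>\<^sub>A C \<rightarrow> L\<close> is one as well, so that \<open>L \<otimes>\<^sub>B F\<close> and \<open>L \<otimes>\<^sub>C G\<close>
  are quasi-isomorphic to \<open>T \<otimes>\<^sub>A (C \<otimes>\<^sub>B F)\<close> and to \<open>T \<otimes>\<^sub>A G\<close>, the latter being quasi-isomorphic to
  \<open>T \<otimes>\<^sub>A k\<close>.  If \<open>D \<rightarrow> C\<close> is such a resolution over \<open>B\<close>, the quasi-isomorphisms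
  \<open>C \<otimes>\<^sub>B F \<leftarrow> D \<otimes>\<^sub>B F \<rightarrow> D \<otimes>\<^sub>B k\<close> are \<open>B\<close>-linear.  On \<open>D \<otimes>\<^sub>B k\<close> the algebra \<open>A\<close> acts through
  \<open>k\<close>, so over \<open>A\<close> this complex is quasi-isomorphic to its homology \<open>V = Tor\<^sup>B(C, k)\<close>, a sum of copies
  of \<open>k\<close>.  Hence \<open>L \<otimes>\<^sub>B F\<close> is quasi-isomorphic to \<open>T \<otimes>\<^sub>A V = (T \<otimes>\<^sub>A k) \<otimes>\<^sub>k V\<close>.
\<close>

section \<open>Graded groups\<close>

text \<open>The obstacle is linearity. To compute L \<otimes> F from V one would like to split C
  \<otimes> F into its homology over C, but the available comparisons pass through D \<otimes> k,
  which has no action of C; they are linear over B only. On the other hand B acts on D \<otimes> k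
  through k, where splitting is linear algebra. The morphism \<alpha> reconciles the two sides: A
  sees B-linear maps by restriction, and a resolution built over A serves for C as well.

  Every derived tensor product is written as a twisted sum, which is functorial in the module and
  preserves quasi-isomorphisms. The resolutions must live in a type fixed in advance; cells built
  from the ring and the module provide one.

  Scalars act on \<open>Tor\<close> through chosen lifts, which need not be additive or
  multiplicative on chains. All comparisons therefore carry families of chain maps along, and the
  vector space axioms for \<open>Tor\<close> are transported from complexes on which
  \<open>K\<close> acts strictly.\<close>

abbreviation ahom :: "('a, 'm) ring_scheme \<Rightarrow> ('b, 'n) ring_scheme \<Rightarrow> ('a \<Rightarrow> 'b) set" where
  "ahom M N \<equiv> hom (add_monoid M) (add_monoid N)"

lemma ahomI:
  assumes "\<And>x. x \<in> carrier M \<Longrightarrow> f x \<in> carrier N"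
    and "\<And>x y. x \<in> carrier M \<Longrightarrow> y \<in> carrier M \<Longrightarrow> f (x \<oplus>\<^bsub>M\<^esub> y) = f x \<oplus>\<^bsub>N\<^esub> f y"
  shows "f \<in> ahom M N"
  using assms by (auto simp: hom_def)

lemma ahom_closed: "f \<in> ahom M N \<Longrightarrow> x \<in> carrier M \<Longrightarrow> f x \<in> carrier N"
  by (auto simp: hom_def)

lemma ahom_add:
  "f \<in> ahom M N \<Longrightarrow> x \<in> carrier M \<Longrightarrow> y \<in> carrier M \<Longrightarrow> f (x \<oplus>\<^bsub>M\<^esub> y) = f x \<oplus>\<^bsub>N\<^esub> f y"
  by (auto simp: hom_def)

lemma ahom_zero:
  assumes "abelian_group M" "abelian_group N" "f \<in> ahom M N"
  shows "f \<zero>\<^bsub>M\<^esub> = \<zero>\<^bsub>N\<^esub>"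
proof -
  interpret M: abelian_group M by fact
  interpret N: abelian_group N by fact
  have "f \<zero>\<^bsub>M\<^esub> \<oplus>\<^bsub>N\<^esub> f \<zero>\<^bsub>M\<^esub> = f \<zero>\<^bsub>M\<^esub> \<oplus>\<^bsub>N\<^esub> \<zero>\<^bsub>N\<^esub>"
    using ahom_add[OF assms(3), of "\<zero>\<^bsub>M\<^esub>" "\<zero>\<^bsub>M\<^esub>"] ahom_closed[OF assms(3), of "\<zero>\<^bsub>M\<^esub>"] by simp
  then show ?thesis using ahom_closed[OF assms(3), of "\<zero>\<^bsub>M\<^esub>"] by simp
qed

lemma ahom_neg:
  assumes "abelian_group M" "abelian_group N" "f \<in> ahom M N" "x \<in> carrier M"
  shows "f (\<ominus>\<^bsub>M\<^esub> x) = \<ominus>\<^bsub>N\<^esub> f x"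
proof -
  interpret M: abelian_group M by fact
  interpret N: abelian_group N by fact
  have c: "f x \<in> carrier N" "f (\<ominus>\<^bsub>M\<^esub> x) \<in> carrier N"
    using ahom_closed[OF assms(3)] assms(4) by auto
  have "f x \<oplus>\<^bsub>N\<^esub> f (\<ominus>\<^bsub>M\<^esub> x) = \<zero>\<^bsub>N\<^esub>"
    using ahom_add[OF assms(3,4), of "\<ominus>\<^bsub>M\<^esub> x"] ahom_zero[OF assms(1-3)] assms(4)
    by (simp add: M.r_neg)
  then show ?thesis using c by (metis N.minus_equality N.a_comm)
qed

lemma ahom_minus:
  assumes "abelian_group M" "abelian_group N" "f \<in> ahom M N" "x \<in> carrier M" "y \<in> carrier M"
  shows "f (x \<ominus>\<^bsub>M\<^esub> y) = f x \<ominus>\<^bsub>N\<^esub> f y"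
proof -
  interpret M: abelian_group M by fact
  show ?thesis
    using ahom_add[OF assms(3,4), of "\<ominus>\<^bsub>M\<^esub> y"] ahom_neg[OF assms(1-3,5)] assms(5)
    by (simp add: a_minus_def)
qed

lemma ahom_finsum:
  assumes "abelian_group M" "abelian_group N" "f \<in> ahom M N" "finite S" "\<And>i. i \<in> S \<Longrightarrow> x i \<in> carrier M"
  shows "f (finsum M x S) = finsum N (\<lambda>i. f (x i)) S"
proof -
  interpret M: abelian_group M by fact
  interpret N: abelian_group N by fact
  show ?thesis using assms(4,5)
  proof (induction S rule: finite_induct)
    case empty
    then show ?case using ahom_zero[OF assms(1-3)] by (simp add: M.finsum_empty N.finsum_empty)
  next
    case (insert i S)
    have "x \<in> S \<rightarrow> carrier M" "(\<lambda>i. f (x i)) \<in> S \<rightarrow> carrier N"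
      using insert ahom_closed[OF assms(3)] by auto
    then show ?case
      using insert ahom_closed[OF assms(3)] ahom_add[OF assms(3), of "x i" "finsum M x S"]
      by (simp add: M.finsum_insert N.finsum_insert)
  qed
qed

lemma ahom_comp: "f \<in> ahom M N \<Longrightarrow> g \<in> ahom N P \<Longrightarrow> (\<lambda>x. g (f x)) \<in> ahom M P"
  by (rule ahomI) (simp_all add: ahom_closed ahom_add)

lemma (in abelian_group) ahom_plus:
  "f \<in> ahom M G \<Longrightarrow> g \<in> ahom M G \<Longrightarrow> (\<lambda>x. f x \<oplus> g x) \<in> ahom M G"
  by (intro ahomI) (auto simp: ahom_closed ahom_add a_ac)

lemma (in abelian_group) finsum_superset:
  assumes "finite T" "S \<subseteq> T" "\<And>i. i \<in> T - S \<Longrightarrow> f i = \<zero>" "\<And>i. i \<in> S \<Longrightarrow> f i \<in> carrier G"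
  shows "finsum G f S = finsum G f T"
proof -
  have "f \<in> T \<rightarrow> carrier G" using assms(3,4) by (metis DiffI Pi_I zero_closed)
  then show ?thesis
    using add.finprod_mono_neutral_cong_left[OF assms(1,2), of f f] assms(3)
    unfolding finsum_def by blast
qed

lemma (in abelian_group) finsum_single:
  assumes "finite T" "i \<in> T" "f i \<in> carrier G" "\<And>j. j \<in> T \<Longrightarrow> j \<noteq> i \<Longrightarrow> f j = \<zero>"
  shows "finsum G f T = f i"
proof -
  have "finsum G f {i} = finsum G f T"
    by (rule finsum_superset) (use assms in auto)
  then show ?thesis using assms(3) finsum_insert[of "{}" i f] by (simp add: finsum_empty)
qed

lemma (in abelian_group) eq_iff_minus: "x \<in> carrier G \<Longrightarrow> y \<in> carrier G \<Longrightarrow> x = y \<longleftrightarrow> x \<ominus> y = \<zero>"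
proof -
  assume xy: "x \<in> carrier G" "y \<in> carrier G"
  have "x = y" if "x \<ominus> y = \<zero>"
  proof -
    have "x \<oplus> \<ominus> y = \<zero>" using that by (simp add: a_minus_def)
    then have "\<ominus> (\<ominus> y) = x" using xy by (intro minus_equality) auto
    then show ?thesis using xy by simp
  qed
  then show ?thesis using xy by (auto simp: a_minus_def r_neg)
qed

lemma (in abelian_group) minus_cancel:
  "x \<in> carrier G \<Longrightarrow> y \<in> carrier G \<Longrightarrow> (x \<ominus> y) \<oplus> y = x"
  "x \<in> carrier G \<Longrightarrow> y \<in> carrier G \<Longrightarrow> y \<oplus> (x \<ominus> y) = x"
  "x \<in> carrier G \<Longrightarrow> y \<in> carrier G \<Longrightarrow> (x \<oplus> y) \<ominus> y = x"
  "x \<in> carrier G \<Longrightarrow> y \<in> carrier G \<Longrightarrow> (y \<oplus> x) \<ominus> y = x"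
  by (simp_all add: a_minus_def a_assoc l_neg r_neg a_comm a_lcomm)

text \<open>Group axioms pass to the image of a subgroup under an additive map. With homology
  classes of cycles for \<open>c\<close> this gives the group structure on homology; with the
  identity it moves the structure between records.\<close>

lemma abelian_group_surj:
  assumes M: "abelian_group M" and S: "subgroup S (add_monoid M)"
    and Q: "carrier Q = c ` S" "ring.zero Q = c \<zero>\<^bsub>M\<^esub>"
    and add: "\<And>x y. x \<in> S \<Longrightarrow> y \<in> S \<Longrightarrow> c x \<oplus>\<^bsub>Q\<^esub> c y = c (x \<oplus>\<^bsub>M\<^esub> y)"
  shows "abelian_group Q"
proof -
  interpret M: abelian_group M by fact
  have S': "\<And>x y. x \<in> S \<Longrightarrow> y \<in> S \<Longrightarrow> x \<oplus>\<^bsub>M\<^esub> y \<in> S" "\<zero>\<^bsub>M\<^esub> \<in> S" "\<And>x. x \<in> S \<Longrightarrow> \<ominus>\<^bsub>M\<^esub> x \<in> S"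
    "\<And>x. x \<in> S \<Longrightarrow> x \<in> carrier M"
    using subgroup.m_closed[OF S] subgroup.one_closed[OF S] subgroup.m_inv_closed[OF S] subgroup.mem_carrier[OF S]
    by (auto simp: a_inv_def)
  show ?thesis
  proof (rule abelian_groupI)
    show "\<And>x. x \<in> carrier Q \<Longrightarrow> \<exists>y\<in>carrier Q. y \<oplus>\<^bsub>Q\<^esub> x = \<zero>\<^bsub>Q\<^esub>"
    proof -
      fix x assume "x \<in> carrier Q"
      then obtain s where s: "s \<in> S" "x = c s" using Q by auto
      then have "c (\<ominus>\<^bsub>M\<^esub> s) \<oplus>\<^bsub>Q\<^esub> x = \<zero>\<^bsub>Q\<^esub>" using add[of "\<ominus>\<^bsub>M\<^esub> s" s] S' Q by (simp add: M.l_neg)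
      then show "\<exists>y\<in>carrier Q. y \<oplus>\<^bsub>Q\<^esub> x = \<zero>\<^bsub>Q\<^esub>" using s S' Q by auto
    qed
  qed (use S' in \<open>auto simp: Q add M.a_ac\<close>)
qed

context graded_group
begin

lemma gr_closed: "x \<in> gr M n \<Longrightarrow> x \<in> carrier M"
  using subgroup.mem_carrier[OF gr_subgroup] by auto

lemma gr_zero [simp]: "\<zero> \<in> gr M n"
  using subgroup.one_closed[OF gr_subgroup] by auto

lemma gr_add: "x \<in> gr M n \<Longrightarrow> y \<in> gr M n \<Longrightarrow> x \<oplus> y \<in> gr M n"
  using subgroup.m_closed[OF gr_subgroup] by auto

lemma gr_neg: "x \<in> gr M n \<Longrightarrow> \<ominus> x \<in> gr M n"
  using subgroup.m_inv_closed[OF gr_subgroup] by (auto simp: a_inv_def)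

lemma gr_minus: "x \<in> gr M n \<Longrightarrow> y \<in> gr M n \<Longrightarrow> x \<ominus> y \<in> gr M n"
  by (simp add: a_minus_def gr_add gr_neg)

lemma gr_koszul: "x \<in> gr M n \<Longrightarrow> koszul M i x \<in> gr M n"
  by (simp add: koszul_def gr_neg)

lemma gr_finsum: "finite S \<Longrightarrow> (\<And>i. i \<in> S \<Longrightarrow> f i \<in> gr M n) \<Longrightarrow> finsum M f S \<in> gr M n"
proof (induction S rule: finite_induct)
  case (insert x F)
  then have "f \<in> F \<rightarrow> carrier M" "f x \<in> carrier M" using gr_closed by auto
  then show ?case using insert by (simp add: finsum_insert gr_add)
qed (simp add: finsum_empty)

lemma koszul_closed [simp]: "x \<in> carrier M \<Longrightarrow> koszul M i x \<in> carrier M"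
  by (simp add: koszul_def)

lemma koszul_ahom: "koszul M i \<in> ahom M M"
  by (intro ahomI) (auto simp: koszul_def minus_add)

lemma koszul_add: "x \<in> carrier M \<Longrightarrow> y \<in> carrier M \<Longrightarrow> koszul M i (x \<oplus> y) = koszul M i x \<oplus> koszul M i y"
  using ahom_add[OF koszul_ahom] by auto

lemma koszul_zero [simp]: "koszul M i \<zero> = \<zero>"
  by (simp add: koszul_def)

lemma koszul_koszul: "x \<in> carrier M \<Longrightarrow> koszul M i (koszul M j x) = koszul M (i + j) x"
  by (auto simp: koszul_def)

lemma is_decompositionI:
  assumes "\<And>n. f n \<in> gr M n" "finite S" "\<And>n. n \<notin> S \<Longrightarrow> f n = \<zero>" "x = finsum M f S"
  shows "is_decomposition M x f"
proof -
  have "{n. f n \<noteq> \<zero>} \<subseteq> S" using assms by auto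
  moreover have "finsum M f {n. f n \<noteq> \<zero>} = finsum M f S"
    by (rule finsum_superset) (use assms gr_closed in auto)
  ultimately show ?thesis using assms finite_subset by (auto simp: is_decomposition_def)
qed

lemma hcomp_eq: "is_decomposition M x f \<Longrightarrow> hcomp M x = f"
proof -
  assume f: "is_decomposition M x f"
  then have "x \<in> carrier M"
    unfolding is_decomposition_def by (metis (no_types, lifting) Pi_I finsum_closed gr_closed)
  then show ?thesis unfolding hcomp_def using decomposition f by (metis (mono_tags, lifting) the1_equality)
qed

lemma is_decomposition_hcomp: "x \<in> carrier M \<Longrightarrow> is_decomposition M x (hcomp M x)"
  using decomposition hcomp_eq by metis

lemma hcomp_gr: "x \<in> carrier M \<Longrightarrow> hcomp M x n \<in> gr M n"
  using is_decomposition_hcomp by (auto simp: is_decomposition_def)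

lemma hcomp_closed: "x \<in> carrier M \<Longrightarrow> hcomp M x n \<in> carrier M"
  using hcomp_gr gr_closed by blast

lemma hcomp_finite: "x \<in> carrier M \<Longrightarrow> finite {n. hcomp M x n \<noteq> \<zero>}"
  using is_decomposition_hcomp by (auto simp: is_decomposition_def)

lemma hcomp_sum: "x \<in> carrier M \<Longrightarrow> (\<Oplus>n\<in>{n. hcomp M x n \<noteq> \<zero>}. hcomp M x n) = x"
  using is_decomposition_hcomp unfolding is_decomposition_def by (metis (no_types, lifting))

lemma hcomp_homogeneous: "x \<in> gr M n \<Longrightarrow> hcomp M x m = (if m = n then x else \<zero>)"
proof -
  assume x: "x \<in> gr M n"
  have "is_decomposition M x (\<lambda>m. if m = n then x else \<zero>)"
    by (rule is_decompositionI[where S="{n}"])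
      (use x gr_closed in \<open>auto simp: finsum_insert finsum_empty\<close>)
  then show ?thesis by (simp add: hcomp_eq)
qed

lemma hcomp_add:
  assumes "x \<in> carrier M" "y \<in> carrier M"
  shows "hcomp M (x \<oplus> y) n = hcomp M x n \<oplus> hcomp M y n"
proof -
  let ?S = "{n. hcomp M x n \<noteq> \<zero>} \<union> {n. hcomp M y n \<noteq> \<zero>}"
  have fin: "finite ?S" using hcomp_finite assms by auto
  have "finsum M (hcomp M x) {n. hcomp M x n \<noteq> \<zero>} = finsum M (hcomp M x) ?S"
    by (rule finsum_superset) (use fin assms hcomp_closed in auto)
  moreover have "finsum M (hcomp M y) {n. hcomp M y n \<noteq> \<zero>} = finsum M (hcomp M y) ?S"
    by (rule finsum_superset) (use fin assms hcomp_closed in auto)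
  ultimately have "finsum M (hcomp M x) ?S = x" "finsum M (hcomp M y) ?S = y"
    using hcomp_sum[OF assms(1)] hcomp_sum[OF assms(2)] by simp_all
  then have "finsum M (\<lambda>n. hcomp M x n \<oplus> hcomp M y n) ?S = x \<oplus> y"
    using finsum_addf[of "hcomp M x" ?S "hcomp M y"] assms hcomp_closed by auto
  then have "is_decomposition M (x \<oplus> y) (\<lambda>n. hcomp M x n \<oplus> hcomp M y n)"
    by (intro is_decompositionI[where S="?S"]) (use assms hcomp_gr gr_add fin in auto)
  then show ?thesis by (simp add: hcomp_eq)
qed

lemma hcomp_ahom: "(\<lambda>x. hcomp M x n) \<in> ahom M M"
  by (intro ahomI) (auto simp: hcomp_add hcomp_closed)

lemma finsum_mem:
  assumes "finite S" "\<And>i. i \<in> S \<Longrightarrow> f i \<in> carrier M \<and> P (f i)" "P \<zero>"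
    and "\<And>x y. x \<in> carrier M \<Longrightarrow> y \<in> carrier M \<Longrightarrow> P x \<Longrightarrow> P y \<Longrightarrow> P (x \<oplus> y)"
  shows "P (finsum M f S)"
  using assms(1,2)
proof (induction S rule: finite_induct)
  case (insert x F)
  then have "f \<in> F \<rightarrow> carrier M" "f x \<in> carrier M" by auto
  then show ?case using insert assms(4)[of "f x" "finsum M f F"] by (simp add: finsum_insert)
qed (use assms(3) in \<open>simp add: finsum_empty\<close>)

lemma graded_induct [consumes 1, case_names homogeneous add]:
  assumes "x \<in> carrier M" "\<And>n x. x \<in> gr M n \<Longrightarrow> P x"
    and "\<And>x y. x \<in> carrier M \<Longrightarrow> y \<in> carrier M \<Longrightarrow> P x \<Longrightarrow> P y \<Longrightarrow> P (x \<oplus> y)"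
  shows "P x"
proof -
  have "P (\<Oplus>n\<in>{n. hcomp M x n \<noteq> \<zero>}. hcomp M x n)"
  proof (rule finsum_mem)
    show "finite {n. hcomp M x n \<noteq> \<zero>}" by (rule hcomp_finite[OF assms(1)])
    show "P \<zero>" by (rule assms(2)[OF gr_zero])
  qed (use assms(2)[OF hcomp_gr[OF assms(1)]] hcomp_closed[OF assms(1)] assms(3) in auto)
  then show ?thesis using hcomp_sum assms by simp
qed

lemma hcomp_zero_iff: "x \<in> carrier M \<Longrightarrow> (\<forall>n. hcomp M x n = \<zero>) \<Longrightarrow> x = \<zero>"
  using hcomp_sum[of x] by (simp add: finsum_empty)

lemma signed_ahom: "signed M \<in> ahom M M"
proof (rule ahomI)
  fix x assume x: "x \<in> carrier M"
  then show "signed M x \<in> carrier M" unfolding signed_def by (intro finsum_closed) (auto simp: hcomp_closed)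
next
  fix x y assume xy: "x \<in> carrier M" "y \<in> carrier M"
  let ?S = "{n. hcomp M x n \<noteq> \<zero>} \<union> {n. hcomp M y n \<noteq> \<zero>}"
  have fin: "finite ?S" using hcomp_finite xy by auto
  have ext: "signed M z = finsum M (\<lambda>n. koszul M n (hcomp M z n)) ?S"
    if "z \<in> carrier M" "\<And>n. n \<notin> ?S \<Longrightarrow> hcomp M z n = \<zero>" for z
    unfolding signed_def by (rule finsum_superset) (use that fin in \<open>auto simp: hcomp_closed\<close>)
  have "signed M (x \<oplus> y) = finsum M (\<lambda>n. koszul M n (hcomp M x n) \<oplus> koszul M n (hcomp M y n)) ?S"
    by (subst ext) (use xy in \<open>auto simp: hcomp_add koszul_add hcomp_closed intro!: finsum_cong'\<close>)
  also have "\<dots> = signed M x \<oplus> signed M y"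
    using ext[OF xy(1)] ext[OF xy(2)] xy by (subst finsum_addf) (auto simp: hcomp_closed)
  finally show "signed M (x \<oplus> y) = signed M x \<oplus> signed M y" .
qed

lemmas signed_closed [simp] = ahom_closed[OF signed_ahom]
lemmas signed_add = ahom_add[OF signed_ahom]

lemma signed_homogeneous: "x \<in> gr M n \<Longrightarrow> signed M x = koszul M n x"
proof -
  assume x: "x \<in> gr M n"
  have "signed M x = finsum M (\<lambda>m. koszul M m (hcomp M x m)) {n}"
    unfolding signed_def by (rule finsum_superset) (use x gr_closed in \<open>auto simp: hcomp_homogeneous split: if_splits\<close>)
  then show ?thesis using x gr_closed by (simp add: hcomp_homogeneous finsum_insert finsum_empty)
qed

lemma signed_gr: "x \<in> gr M n \<Longrightarrow> signed M x \<in> gr M n"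
  by (simp add: signed_homogeneous gr_koszul)

lemma signed_signed: "x \<in> carrier M \<Longrightarrow> signed M (signed M x) = x"
proof (induction x rule: graded_induct)
  case (homogeneous n x)
  then show ?case using signed_homogeneous[OF signed_gr[OF homogeneous]] gr_closed
    by (auto simp: signed_homogeneous koszul_koszul koszul_def)
qed (simp add: signed_add)

end

text \<open>The projections force the components of any decomposition and so give uniqueness;
  \<open>ind\<close>, which says that homogeneous elements generate under sums, gives existence.
  Homology, twisted sums and tensor products all get their grading this way.\<close>

lemma graded_groupI:
  fixes M (structure)
  assumes M: "abelian_group M" and gr: "\<And>n. subgroup (gr M n) (add_monoid M)"
    and p: "\<And>n. p n \<in> ahom M M" "\<And>n x. x \<in> gr M n \<Longrightarrow> p n x = x" "\<And>n m x. x \<in> gr M m \<Longrightarrow> m \<noteq> n \<Longrightarrow> p n x = \<zero>"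
    and ind: "\<And>x P. x \<in> carrier M \<Longrightarrow> (\<And>n x. x \<in> gr M n \<Longrightarrow> P x) \<Longrightarrow>
      (\<And>x y. x \<in> carrier M \<Longrightarrow> y \<in> carrier M \<Longrightarrow> P x \<Longrightarrow> P y \<Longrightarrow> P (x \<oplus> y)) \<Longrightarrow> P x"
  shows "graded_group M"
proof -
  interpret abelian_group M by fact
  have grc: "x \<in> gr M n \<Longrightarrow> x \<in> carrier M" for x n using subgroup.mem_carrier[OF gr] by auto
  have gr0: "\<zero> \<in> gr M n" for n using subgroup.one_closed[OF gr] by auto
  have gra: "x \<in> gr M n \<Longrightarrow> y \<in> gr M n \<Longrightarrow> x \<oplus> y \<in> gr M n" for x y n using subgroup.m_closed[OF gr] by auto
  have uniq: "f n = p n x" if f: "is_decomposition M x f" for x f n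
  proof -
    have f': "\<And>n. f n \<in> gr M n" "finite {n. f n \<noteq> \<zero>}" "x = finsum M f {n. f n \<noteq> \<zero>}"
      using f by (auto simp: is_decomposition_def)
    have pc: "\<And>x. x \<in> carrier M \<Longrightarrow> p n x \<in> carrier M" and p0: "p n \<zero> = \<zero>"
      using ahom_closed[OF p(1)] ahom_zero[OF M M p(1)] by auto
    have "p n x = finsum M (\<lambda>i. p n (f i)) {n. f n \<noteq> \<zero>}"
      unfolding f'(3) using f' grc by (intro ahom_finsum[OF M M p(1)]) auto
    also have "\<dots> = finsum M (\<lambda>i. p n (f i)) (insert n {n. f n \<noteq> \<zero>})"
      using f'(1,2) pc p0 grc by (intro finsum_superset) auto
    also have "\<dots> = p n (f n)"
      using f'(1,2) pc p0 grc p(3)[OF f'(1)] by (intro finsum_single) auto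
    also have "\<dots> = f n" using p(2) f' by blast
    finally show ?thesis by simp
  qed
  have ex: "\<exists>f. is_decomposition M x f" if "x \<in> carrier M" for x
    using that
  proof (rule ind)
    fix n x assume x: "x \<in> gr M n"
    then have "{m. (if m = n then x else \<zero>) \<noteq> \<zero>} = (if x = \<zero> then {} else {n})" by auto
    then have "is_decomposition M x (\<lambda>m. if m = n then x else \<zero>)"
      using x gr0 grc by (auto simp: is_decomposition_def finsum_insert finsum_empty)
    then show "\<exists>f. is_decomposition M x f" by blast
  next
    fix x y assume xy: "x \<in> carrier M" "y \<in> carrier M"
      "\<exists>f. is_decomposition M x f" "\<exists>f. is_decomposition M y f"
    then obtain f g where fg: "is_decomposition M x f" "is_decomposition M y g" by blast
    let ?F = "{n. f n \<noteq> \<zero>}" and ?G = "{n. g n \<noteq> \<zero>}" let ?S = "?F \<union> ?G"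
    let ?h = "\<lambda>n. f n \<oplus> g n"
    have fg': "\<And>n. f n \<in> gr M n" "finite ?F" "x = finsum M f ?F" "\<And>n. g n \<in> gr M n" "finite ?G" "y = finsum M g ?G"
      using fg by (auto simp: is_decomposition_def)
    have fgc: "\<And>n. f n \<in> carrier M" "\<And>n. g n \<in> carrier M" using fg' grc by auto
    have "finsum M ?h {n. ?h n \<noteq> \<zero>} = finsum M ?h ?S"
      using fg' fgc by (intro finsum_superset) auto
    also have "\<dots> = finsum M f ?S \<oplus> finsum M g ?S"
      using fg' grc by (intro finsum_addf) auto
    also have "finsum M f ?S = x"
      unfolding fg'(3) using fg' grc by (intro finsum_superset[symmetric]) auto
    also have "finsum M g ?S = y"
      unfolding fg'(6) using fg' grc by (intro finsum_superset[symmetric]) auto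
    finally have s: "finsum M ?h {n. ?h n \<noteq> \<zero>} = x \<oplus> y" .
    have "{n. ?h n \<noteq> \<zero>} \<subseteq> ?S" by auto
    then have "finite {n. ?h n \<noteq> \<zero>}" by (rule finite_subset) (use fg' in auto)
    then have "is_decomposition M (x \<oplus> y) ?h"
      using fg' gra s by (simp add: is_decomposition_def)
    then show "\<exists>f. is_decomposition M (x \<oplus> y) f" by blast
  qed
  show ?thesis
  proof (intro graded_group.intro graded_group_axioms.intro M)
    show "\<exists>!f. is_decomposition M x f" if x: "x \<in> carrier M" for x
    proof -
      obtain f where f: "is_decomposition M x f" using ex[OF x] by blast
      moreover have "g = f" if "is_decomposition M x g" for g
        using uniq[OF that] uniq[OF f] by (metis ext)
      ultimately show ?thesis by blast
    qed
  qed (rule gr)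
qed

text \<open>Both sides are additive in \<open>x\<close>, so it suffices to compare them on
  homogeneous elements. The shift \<open>k\<close> is kept general: it is -1 for differentials, 0
  for chain maps and the degree of \<open>b\<close> for multiplication by \<open>b\<close>.\<close>

lemma hcomp_hom:
  assumes "graded_group M" "graded_group N" "f \<in> ahom M N" "\<And>n x. x \<in> gr M n \<Longrightarrow> f x \<in> gr N (n + k)"
    and "x \<in> carrier M"
  shows "hcomp N (f x) (n + k) = f (hcomp M x n)"
proof -
  interpret M: graded_group M by fact
  interpret N: graded_group N by fact
  note ag = M.abelian_group_axioms N.abelian_group_axioms
  show ?thesis using assms(5)
  proof (induction x rule: M.graded_induct)
    case (homogeneous m x)
    have "(n + k = m + k) = (n = m)" by auto
    then show ?case using N.hcomp_homogeneous[OF assms(4)[OF homogeneous], of "n + k"] M.hcomp_homogeneous[OF homogeneous, of n]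
      ahom_zero[OF ag assms(3)] by (simp only: if_distrib if_cancel split: if_splits)
  next
    case (add x y)
    then show ?case using ahom_add[OF assms(3)] ahom_closed[OF assms(3)]
      by (simp add: M.hcomp_add N.hcomp_add M.hcomp_closed)
  qed
qed

lemma koszul_hom:
  assumes "abelian_group M" "abelian_group N" "f \<in> ahom M N" "x \<in> carrier M"
  shows "f (koszul M i x) = koszul N i (f x)"
  using ahom_neg[OF assms] by (simp add: koszul_def)

text \<open>A map of degree \<open>k\<close> crosses the sign involution at the cost of (-1)^k. For
  the differential this is the anticommutation that makes \<partial>\<partial> vanish on tensor
  products.\<close>

lemma signed_hom:
  assumes "graded_group M" "graded_group N" "f \<in> ahom M N" "\<And>n x. x \<in> gr M n \<Longrightarrow> f x \<in> gr N (n + k)"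
    and "x \<in> carrier M"
  shows "signed N (f x) = koszul N k (f (signed M x))"
proof -
  interpret M: graded_group M by fact
  interpret N: graded_group N by fact
  note ag = M.abelian_group_axioms N.abelian_group_axioms
  show ?thesis using assms(5)
  proof (induction x rule: M.graded_induct)
    case (homogeneous m x)
    then show ?case using N.signed_homogeneous[OF assms(4)[OF homogeneous]] ahom_closed[OF assms(3)]
      M.gr_closed[OF homogeneous]
      by (simp add: M.signed_homogeneous koszul_hom[OF ag assms(3)] N.koszul_koszul add.commute)
  next
    case (add x y)
    then show ?case using ahom_add[OF assms(3)] ahom_closed[OF assms(3)]
      by (simp add: M.signed_add N.signed_add N.koszul_add)
  qed
qed

section \<open>Elementary rules for differentials\<close>

lemma (in dg_group) diff_closed [simp]: "x \<in> carrier M \<Longrightarrow> diff M x \<in> carrier M"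
  using ahom_closed[OF diff_hom] by auto

lemma (in dg_group) diff_add: "x \<in> carrier M \<Longrightarrow> y \<in> carrier M \<Longrightarrow> diff M (x \<oplus> y) = diff M x \<oplus> diff M y"
  using ahom_add[OF diff_hom] by auto

lemma (in dg_group) diff_zero [simp]: "diff M \<zero> = \<zero>"
  using ahom_zero[OF _ _ diff_hom] abelian_group_axioms by auto

lemma (in dg_group) diff_neg: "x \<in> carrier M \<Longrightarrow> diff M (\<ominus> x) = \<ominus> diff M x"
  using ahom_neg[OF _ _ diff_hom] abelian_group_axioms by auto

lemma (in dg_group) diff_minus: "x \<in> carrier M \<Longrightarrow> y \<in> carrier M \<Longrightarrow> diff M (x \<ominus> y) = diff M x \<ominus> diff M y"
  using ahom_minus[OF _ _ diff_hom] abelian_group_axioms by auto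

lemma (in dg_group) diff_koszul: "x \<in> carrier M \<Longrightarrow> diff M (koszul M i x) = koszul M i (diff M x)"
  by (simp add: koszul_def diff_neg)

lemma (in dg_group) diff_signed: "x \<in> carrier M \<Longrightarrow> diff M (signed M x) = \<ominus> signed M (diff M x)"
  using signed_hom[OF graded_group_axioms graded_group_axioms diff_hom, of "-1" x] diff_degree
  by (simp add: koszul_def)

lemma (in dg_group) hcomp_diff: "x \<in> carrier M \<Longrightarrow> hcomp M (diff M x) n = diff M (hcomp M x (n + 1))"
  using hcomp_hom[OF graded_group_axioms graded_group_axioms diff_hom, of "-1" x "n + 1"] diff_degree
  by simp

lemma dg_groupI:
  assumes "graded_group M" "diff M \<in> ahom M M" "\<And>n x. x \<in> gr M n \<Longrightarrow> diff M x \<in> gr M (n - 1)"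
    "\<And>x. x \<in> carrier M \<Longrightarrow> diff M (diff M x) = \<zero>\<^bsub>M\<^esub>"
  shows "dg_group M"
  using assms by (simp add: dg_group_def dg_group_axioms_def)

section \<open>Homology\<close>

text \<open>
  Exactness of the mapping cone, spelled out on elements; unlike the bijectivity of the map in
  homology it can be verified by peeling off leading terms.
\<close>

definition qi :: "('a, 'm) dg_scheme \<Rightarrow> ('c, 'n) dg_scheme \<Rightarrow> ('a \<Rightarrow> 'c) \<Rightarrow> bool" where
  "qi M N f \<longleftrightarrow> chain_map M N f \<and>
     (\<forall>y\<in>carrier M. \<forall>x\<in>carrier N. diff M y = \<zero>\<^bsub>M\<^esub> \<longrightarrow> f y = diff N x \<longrightarrow>
       (\<exists>y'\<in>carrier M. \<exists>x'\<in>carrier N. diff M y' = y \<and> f y' = x \<oplus>\<^bsub>N\<^esub> diff N x'))"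

lemma (in abelian_group) minus_zero: "x \<in> carrier G \<Longrightarrow> x \<ominus> \<zero> = x"
  by (simp add: a_minus_def)

lemma qiI:
  assumes "chain_map M N f"
    and "\<And>y x. y \<in> carrier M \<Longrightarrow> x \<in> carrier N \<Longrightarrow> diff M y = \<zero>\<^bsub>M\<^esub> \<Longrightarrow> f y = diff N x \<Longrightarrow>
      \<exists>y'\<in>carrier M. \<exists>x'\<in>carrier N. diff M y' = y \<and> f y' = x \<oplus>\<^bsub>N\<^esub> diff N x'"
  shows "qi M N f"
  using assms by (auto simp: qi_def)

lemma qiE:
  assumes "qi M N f" "y \<in> carrier M" "x \<in> carrier N" "diff M y = \<zero>\<^bsub>M\<^esub>" "f y = diff N x"
  obtains y' x' where "y' \<in> carrier M" "x' \<in> carrier N" "diff M y' = y" "f y' = x \<oplus>\<^bsub>N\<^esub> diff N x'"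
  using assms unfolding qi_def by blast

lemma chain_mapI:
  assumes "f \<in> ahom M N" "\<And>n x. x \<in> gr M n \<Longrightarrow> f x \<in> gr N n"
    "\<And>x. x \<in> carrier M \<Longrightarrow> f (diff M x) = diff N (f x)"
  shows "chain_map M N f"
  using assms by (auto simp: chain_map_def)

lemma chain_mapD:
  assumes "chain_map M N f"
  shows "f \<in> ahom M N" "\<And>n x. x \<in> gr M n \<Longrightarrow> f x \<in> gr N n"
    "\<And>x. x \<in> carrier M \<Longrightarrow> f (diff M x) = diff N (f x)"
  using assms by (auto simp: chain_map_def)

lemma qi_chain_map: "qi M N f \<Longrightarrow> chain_map M N f"
  by (simp add: qi_def)

lemma chain_map_comp:
  assumes "chain_map M N f" "chain_map N P g"
  shows "chain_map M P (\<lambda>x. g (f x))"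
  using assms by (intro chain_mapI ahom_comp[of f M N g P]) (simp_all add: chain_mapD ahom_closed[of f M N])

context dg_group
begin

lemma mem_homology_class: "u \<in> homology_class M x \<longleftrightarrow> (\<exists>z\<in>carrier M. u = diff M z \<oplus> x)"
  by (auto simp: homology_class_def a_r_coset_def r_coset_def boundaries_def)

lemma homology_class_eqI:
  assumes "x \<in> carrier M" "y \<in> carrier M" "z \<in> carrier M" "x = y \<oplus> diff M z"
  shows "homology_class M x = homology_class M y"
proof (rule Set.set_eqI, unfold mem_homology_class, rule iffI)
  fix u assume "\<exists>w\<in>carrier M. u = diff M w \<oplus> x"
  then obtain w where "w \<in> carrier M" "u = diff M w \<oplus> x" by blast
  then have "u = diff M (w \<oplus> z) \<oplus> y" using assms by (simp add: diff_add a_ac)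
  then show "\<exists>w\<in>carrier M. u = diff M w \<oplus> y" using assms \<open>w \<in> carrier M\<close> by blast
next
  fix u assume "\<exists>w\<in>carrier M. u = diff M w \<oplus> y"
  then obtain w where w: "w \<in> carrier M" "u = diff M w \<oplus> y" by blast
  have "diff M (w \<ominus> z) \<oplus> x = (diff M w \<oplus> y) \<oplus> (\<ominus> diff M z \<oplus> diff M z)"
    using assms w by (simp add: diff_add diff_neg a_minus_def a_ac)
  also have "\<dots> = u" using assms w by (simp add: l_neg)
  finally show "\<exists>w\<in>carrier M. u = diff M w \<oplus> x" using assms w by (metis minus_closed)
qed

lemma homology_class_self: "x \<in> carrier M \<Longrightarrow> x \<in> homology_class M x"
  unfolding mem_homology_class by (rule bexI[of _ \<zero>]) auto

lemma homology_class_eq_iff: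
  assumes "x \<in> carrier M" "y \<in> carrier M"
  shows "homology_class M x = homology_class M y \<longleftrightarrow> (\<exists>z\<in>carrier M. x = y \<oplus> diff M z)"
proof
  assume "homology_class M x = homology_class M y"
  then have "x \<in> homology_class M y" using homology_class_self assms by blast
  then show "\<exists>z\<in>carrier M. x = y \<oplus> diff M z" using assms unfolding mem_homology_class by (metis a_comm diff_closed)
qed (use homology_class_eqI assms in blast)

lemma homology_class_add:
  assumes "x \<in> carrier M" "y \<in> carrier M"
  shows "homology_class M x <+>\<^bsub>M\<^esub> homology_class M y = homology_class M (x \<oplus> y)"
proof (rule Set.set_eqI, unfold mem_homology_class, rule iffI)
  fix u assume "u \<in> homology_class M x <+>\<^bsub>M\<^esub> homology_class M y"
  then obtain a b where ab: "a \<in> carrier M" "b \<in> carrier M" "u = (diff M a \<oplus> x) \<oplus> (diff M b \<oplus> y)"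
    by (auto simp: set_add_def set_mult_def mem_homology_class)
  have "u = diff M (a \<oplus> b) \<oplus> (x \<oplus> y)"
    unfolding ab(3) using ab(1,2) assms by (simp add: diff_add a_ac)
  then show "\<exists>z\<in>carrier M. u = diff M z \<oplus> (x \<oplus> y)" using ab by blast
next
  fix u assume "\<exists>z\<in>carrier M. u = diff M z \<oplus> (x \<oplus> y)"
  then obtain z where z: "z \<in> carrier M" "u = diff M z \<oplus> (x \<oplus> y)" by blast
  then have u: "u = (diff M z \<oplus> x) \<oplus> y" using assms by (simp add: a_ac)
  have "diff M z \<oplus> x \<in> homology_class M x" using z by (auto simp: mem_homology_class)
  then show "u \<in> homology_class M x <+>\<^bsub>M\<^esub> homology_class M y"
    unfolding u set_add_def set_mult_def using homology_class_self[OF assms(2)] by auto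
qed

lemma boundaries_eq_class: "boundaries M = homology_class M \<zero>"
  by (auto simp: mem_homology_class boundaries_def)

lemma cyclesD: "x \<in> cycles M \<Longrightarrow> x \<in> carrier M" "x \<in> cycles M \<Longrightarrow> diff M x = \<zero>"
  by (auto simp: cycles_def)

lemma cyclesI: "x \<in> carrier M \<Longrightarrow> diff M x = \<zero> \<Longrightarrow> x \<in> cycles M"
  by (auto simp: cycles_def)

lemma cycles_add: "x \<in> cycles M \<Longrightarrow> y \<in> cycles M \<Longrightarrow> x \<oplus> y \<in> cycles M"
  by (simp add: cycles_def diff_add)

lemma cycles_zero: "\<zero> \<in> cycles M"
  by (simp add: cycles_def)

lemma subgroup_cycles: "subgroup (cycles M) (add_monoid M)"
proof (rule group.subgroupI)
  show "inv\<^bsub>add_monoid M\<^esub> a \<in> cycles M" if "a \<in> cycles M" for a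
    using that by (auto simp: cycles_def diff_neg simp flip: a_inv_def)
qed (auto simp: cycles_def diff_add group.is_group add.is_group)

lemma carrier_homology: "carrier (homology M) = homology_class M ` cycles M"
  and add_homology: "x \<in> carrier M \<Longrightarrow> y \<in> carrier M \<Longrightarrow>
    homology_class M x \<oplus>\<^bsub>homology M\<^esub> homology_class M y = homology_class M (x \<oplus> y)"
  and zero_homology: "\<zero>\<^bsub>homology M\<^esub> = homology_class M \<zero>"
  and gr_homology: "gr (homology M) n = homology_class M ` (cycles M \<inter> gr M n)"
  by (auto simp: homology_def homology_class_add boundaries_eq_class)

lemma homology_class_zero_iff:
  "x \<in> carrier M \<Longrightarrow> homology_class M x = \<zero>\<^bsub>homology M\<^esub> \<longleftrightarrow> (\<exists>z\<in>carrier M. x = diff M z)"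
  by (simp add: zero_homology homology_class_eq_iff)

lemma abelian_group_homology: "abelian_group (homology M)"
  by (rule abelian_group_surj[OF abelian_group_axioms subgroup_cycles])
    (auto simp: carrier_homology zero_homology add_homology cyclesD)

end

text \<open>If boundaries go to boundaries, the union over representatives is constant. In this
  generality the lemma covers two maps that are not chain maps: the projection to a homogeneous
  component, which does not commute with the differential, and the coordinates of a sum of shifted
  copies, which change degrees.\<close>

lemma homology_map_class:
  assumes "dg_group M" "dg_group N" "f \<in> ahom M N"
    and "\<And>z. z \<in> carrier M \<Longrightarrow> \<exists>w\<in>carrier N. f (diff M z) = diff N w" and "x \<in> carrier M"
  shows "homology_map M N f (homology_class M x) = homology_class N (f x)"
proof -
  interpret M: dg_group M by fact
  interpret N: dg_group N by fact
  have "homology_class N (f u) = homology_class N (f x)" if u: "u \<in> homology_class M x" for u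
  proof -
    obtain z where z: "z \<in> carrier M" "u = diff M z \<oplus>\<^bsub>M\<^esub> x" using u M.mem_homology_class by auto
    obtain w where w: "w \<in> carrier N" "f (diff M z) = diff N w" using assms(4) z by blast
    have fx: "f x \<in> carrier N" by (rule ahom_closed[OF assms(3,5)])
    have "f u = f x \<oplus>\<^bsub>N\<^esub> diff N w"
      using z w ahom_add[OF assms(3), of "diff M z" x] assms(5) fx by (simp add: N.a_comm)
    then show ?thesis using N.homology_class_eqI[of "f u" "f x" w] w fx by simp
  qed
  then show ?thesis
    unfolding homology_map_def by (intro UN_constant_eq[OF M.homology_class_self[OF assms(5)]]) blast
qed

lemma homology_map_ahom:
  assumes "dg_group M" "dg_group N" "f \<in> ahom M N"
    and "\<And>z. z \<in> carrier M \<Longrightarrow> \<exists>w\<in>carrier N. f (diff M z) = diff N w"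
    and "\<And>z. z \<in> cycles M \<Longrightarrow> f z \<in> cycles N"
  shows "homology_map M N f \<in> ahom (homology M) (homology N)"
proof -
  interpret M: dg_group M by fact
  interpret N: dg_group N by fact
  note hm = homology_map_class[OF assms(1-4)]
  show ?thesis
  proof (rule ahomI)
    fix U assume "U \<in> carrier (homology M)"
    then show "homology_map M N f U \<in> carrier (homology N)"
      using assms(5) by (auto simp: M.carrier_homology N.carrier_homology hm M.cyclesD)
  next
    fix U V assume "U \<in> carrier (homology M)" "V \<in> carrier (homology M)"
    then show "homology_map M N f (U \<oplus>\<^bsub>homology M\<^esub> V) = homology_map M N f U \<oplus>\<^bsub>homology N\<^esub> homology_map M N f V"
      by (auto simp: M.carrier_homology hm M.cyclesD M.add_homology N.add_homology ahom_add[OF assms(3)] ahom_closed[OF assms(3)])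
  qed
qed

lemma chain_map_boundaries:
  assumes "chain_map M N f" "z \<in> carrier M"
  shows "\<exists>w\<in>carrier N. f (diff M z) = diff N w"
  using chain_mapD(3)[OF assms] ahom_closed[OF chain_mapD(1)[OF assms(1)] assms(2)] by blast

lemma chain_map_cycles:
  assumes "dg_group M" "dg_group N" "chain_map M N f" "z \<in> cycles M"
  shows "f z \<in> cycles N"
proof -
  interpret M: dg_group M by fact
  interpret N: dg_group N by fact
  show ?thesis using assms(4) chain_mapD[OF assms(3)] ahom_closed
      ahom_zero[OF M.abelian_group_axioms N.abelian_group_axioms chain_mapD(1)[OF assms(3)]]
    by (metis M.cyclesD N.cyclesI)
qed

lemma homology_map_chain_map:
  assumes "dg_group M" "dg_group N" "chain_map M N f" "x \<in> carrier M"
  shows "homology_map M N f (homology_class M x) = homology_class N (f x)"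
  by (rule homology_map_class[OF assms(1,2) chain_mapD(1)[OF assms(3)] chain_map_boundaries[OF assms(3)] assms(4)])

text \<open>The differential is homogeneous, so the components of a cycle are cycles and those of a
  boundary are boundaries; hence the component projections of \<open>M\<close> descend to
  homology.\<close>

lemma (in dg_group) graded_group_homology: "graded_group (homology M)"
proof (rule graded_groupI[where p="\<lambda>n. homology_map M M (\<lambda>x. hcomp M x n)"])
  have b: "\<exists>w\<in>carrier M. hcomp M (diff M z) n = diff M w" if "z \<in> carrier M" for z n
    using that hcomp_diff hcomp_closed by blast
  have c: "hcomp M z n \<in> cycles M" if "z \<in> cycles M" for z n
    using hcomp_diff[of z "n - 1"] that hcomp_homogeneous[OF gr_zero, of "n-1"]
    by (simp add: cycles_def hcomp_closed)
  note hm = homology_map_class[OF dg_group_axioms dg_group_axioms hcomp_ahom b]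
  show "homology_map M M (\<lambda>x. hcomp M x n) \<in> ahom (homology M) (homology M)" for n
    by (rule homology_map_ahom[OF dg_group_axioms dg_group_axioms hcomp_ahom b c])
  show "abelian_group (homology M)" by (rule abelian_group_homology)
  show "homology_map M M (\<lambda>x. hcomp M x n) U = U" if "U \<in> gr (homology M) n" for n U
    using that by (auto simp: gr_homology hm gr_closed hcomp_homogeneous)
  show "homology_map M M (\<lambda>x. hcomp M x n) U = \<zero>\<^bsub>homology M\<^esub>" if "U \<in> gr (homology M) m" "m \<noteq> n" for n m U
    using that by (auto simp: gr_homology hm gr_closed hcomp_homogeneous zero_homology)
  show "subgroup (gr (homology M) n) (add_monoid (homology M))" for n
  proof (rule group.subgroupI)
    show "group (add_monoid (homology M))" using abelian_group_homology abelian_group.a_group by blast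
    show "gr (homology M) n \<subseteq> carrier (add_monoid (homology M))" by (auto simp: gr_homology carrier_homology)
    show "gr (homology M) n \<noteq> {}" using cycles_zero gr_zero by (auto simp: gr_homology)
    show "a \<otimes>\<^bsub>add_monoid (homology M)\<^esub> b \<in> gr (homology M) n" if "a \<in> gr (homology M) n" "b \<in> gr (homology M) n" for a b
      using that by (auto simp: gr_homology add_homology gr_closed intro!: imageI cycles_add gr_add)
    show "inv\<^bsub>add_monoid (homology M)\<^esub> a \<in> gr (homology M) n" if a: "a \<in> gr (homology M) n" for a
    proof -
      obtain x where x: "x \<in> cycles M" "x \<in> gr M n" "a = homology_class M x" using a by (auto simp: gr_homology)
      have nx: "\<ominus> x \<in> cycles M" "\<ominus> x \<in> gr M n"
        using x gr_neg by (auto simp: cycles_def diff_neg)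
      have "inv\<^bsub>add_monoid (homology M)\<^esub> a = homology_class M (\<ominus> x)"
        using x nx abelian_group.minus_equality[OF abelian_group_homology, of "homology_class M (\<ominus> x)" a]
        by (auto simp: a_inv_def carrier_homology add_homology zero_homology gr_closed l_neg)
      then show ?thesis using nx by (auto simp: gr_homology)
    qed
  qed
  fix U P assume U: "U \<in> carrier (homology M)" and P: "\<And>n U. U \<in> gr (homology M) n \<Longrightarrow> P U"
    "\<And>U V. U \<in> carrier (homology M) \<Longrightarrow> V \<in> carrier (homology M) \<Longrightarrow> P U \<Longrightarrow> P V \<Longrightarrow> P (U \<oplus>\<^bsub>homology M\<^esub> V)"
  obtain x where x: "x \<in> cycles M" "U = homology_class M x" using U by (auto simp: carrier_homology)
  \<comment> \<open>Being a cycle is carried along because \<open>P\<close> can be added up only on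
    classes of cycles.\<close>
  let ?Q = "\<lambda>x. x \<in> cycles M \<and> P (homology_class M x)"
  have "?Q (\<Oplus>n\<in>{n. hcomp M x n \<noteq> \<zero>}. hcomp M x n)"
  proof (rule finsum_mem)
    show "hcomp M x i \<in> carrier M \<and> ?Q (hcomp M x i)" for i
      using c[OF x(1)] x(1) P(1)[of "homology_class M (hcomp M x i)" i] by (auto simp: gr_homology cyclesD hcomp_gr)
    show "?Q \<zero>" using P(1)[of "homology_class M \<zero>" 0] cycles_zero by (auto simp: gr_homology)
    show "?Q (x \<oplus> y)" if "?Q x" "?Q y" "x \<in> carrier M" "y \<in> carrier M" for x y
      using that P(2)[of "homology_class M x" "homology_class M y"]
      by (auto simp: add_homology carrier_homology cycles_add)
  qed (use x cyclesD hcomp_finite in auto)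
  then show "P U" using x hcomp_sum cyclesD by auto
qed

text \<open>Injectivity in homology gives \<open>y = diff M y1\<close>. The defect between
  \<open>f y1\<close> and \<open>x\<close> is then a cycle, and surjectivity corrects
  \<open>y1\<close> by a cycle \<open>y2\<close> so that the defect becomes a boundary.\<close>

lemma quasi_isomorphism_qi:
  assumes "dg_group M" "dg_group N" "quasi_isomorphism M N f"
  shows "qi M N f"
proof -
  interpret M: dg_group M by fact
  interpret N: dg_group N by fact
  have f: "chain_map M N f" and bij: "bij_betw (homology_map M N f) (carrier (homology M)) (carrier (homology N))"
    using assms(3) by (auto simp: quasi_isomorphism_def)
  note fh = chain_mapD(1)[OF f] and hm = homology_map_chain_map[OF assms(1,2) f]
  note ag = M.abelian_group_axioms N.abelian_group_axioms
  show ?thesis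
  proof (rule qiI[OF f])
    fix y x assume yx: "y \<in> carrier M" "x \<in> carrier N" "diff M y = \<zero>\<^bsub>M\<^esub>" "f y = diff N x"
    have "homology_map M N f (homology_class M y) = homology_map M N f (homology_class M \<zero>\<^bsub>M\<^esub>)"
      using yx ahom_closed[OF fh, of y] ahom_zero[OF ag fh]
      by (auto simp: hm N.homology_class_eq_iff)
    moreover have "y \<in> cycles M" using yx by (auto simp: cycles_def)
    ultimately have "homology_class M y = homology_class M \<zero>\<^bsub>M\<^esub>"
      using bij M.cycles_zero unfolding bij_betw_def inj_on_def M.carrier_homology by blast
    then obtain y1 where y1: "y1 \<in> carrier M" "y = diff M y1"
      using yx by (auto simp: M.homology_class_eq_iff)
    let ?w = "f y1 \<ominus>\<^bsub>N\<^esub> x"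
    have w: "?w \<in> carrier N" "diff N ?w = \<zero>\<^bsub>N\<^esub>"
      using y1 yx ahom_closed[OF fh, of y1] chain_mapD(3)[OF f y1(1)] N.eq_iff_minus[of "diff N x" "diff N x"]
      by (auto simp: N.diff_minus)
    then have "homology_class N ?w \<in> carrier (homology N)" by (auto simp: N.carrier_homology cycles_def)
    then obtain y2 where y2: "y2 \<in> cycles M" "homology_class N ?w = homology_map M N f (homology_class M y2)"
      using bij unfolding bij_betw_def M.carrier_homology by blast
    then have y2': "y2 \<in> carrier M" "diff M y2 = \<zero>\<^bsub>M\<^esub>" "f y2 \<in> carrier N"
      using ahom_closed[OF fh] by (auto simp: cycles_def)
    then have "homology_class N ?w = homology_class N (f y2)" using y2 hm by simp
    then obtain z where z: "z \<in> carrier N" "?w = f y2 \<oplus>\<^bsub>N\<^esub> diff N z"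
      using w y2' by (auto simp: N.homology_class_eq_iff)
    have fy1: "f y1 \<in> carrier N" using ahom_closed[OF fh y1(1)] .
    have "f (y1 \<ominus>\<^bsub>M\<^esub> y2) = f y1 \<ominus>\<^bsub>N\<^esub> f y2" using ahom_minus[OF ag fh y1(1) y2'(1)] .
    also have "f y1 = (f y2 \<oplus>\<^bsub>N\<^esub> diff N z) \<oplus>\<^bsub>N\<^esub> x" using N.minus_cancel(1)[OF fy1 yx(2)] z by simp
    also have "\<dots> = (x \<oplus>\<^bsub>N\<^esub> diff N z) \<oplus>\<^bsub>N\<^esub> f y2" using y2' z yx by (simp add: N.a_ac)
    also have "\<dots> \<ominus>\<^bsub>N\<^esub> f y2 = x \<oplus>\<^bsub>N\<^esub> diff N z"
      using y2' z yx by (intro N.minus_cancel) auto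
    finally have "f (y1 \<ominus>\<^bsub>M\<^esub> y2) = x \<oplus>\<^bsub>N\<^esub> diff N z" .
    moreover have "diff M (y1 \<ominus>\<^bsub>M\<^esub> y2) = y" using y1 y2' by (simp add: M.diff_minus M.minus_zero)
    ultimately show "\<exists>y'\<in>carrier M. \<exists>x'\<in>carrier N. diff M y' = y \<and> f y' = x \<oplus>\<^bsub>N\<^esub> diff N x'"
      using y1 y2' z M.minus_closed by blast
  qed
qed

lemma qi_cong:
  assumes "qi M N f" "\<And>x. x \<in> carrier M \<Longrightarrow> f x = g x" "dg_group M"
  shows "qi M N g"
proof -
  interpret M: dg_group M by fact
  have "chain_map M N g"
    using qi_chain_map[OF assms(1)] assms(2) M.gr_closed
    by (auto simp: chain_map_def hom_def Pi_iff)
  then show ?thesis using assms(1,2) unfolding qi_def by simp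
qed

text \<open>A cycle \<open>y\<close> is replaced by a homologous \<open>f x0\<close> with
  \<open>x0\<close> a cycle. The condition for the composite is applied to \<open>x0\<close>, and
  the correction \<open>y1\<close> is subtracted again at the end.\<close>

lemma qi_cancel:
  assumes M: "dg_group M" and N: "dg_group N" and P: "dg_group P" and f: "qi M N f" and g: "chain_map N P g" and gf: "qi M P (\<lambda>x. g (f x))"
  shows "qi N P g"
proof (rule qiI[OF g])
  interpret M: dg_group M by fact
  interpret N: dg_group N by fact
  interpret P: dg_group P by fact
  note fh = chain_mapD(1)[OF qi_chain_map[OF f]] and gh = chain_mapD(1)[OF g]
  note fd = chain_mapD(3)[OF qi_chain_map[OF f]] and gd = chain_mapD(3)[OF g]
  note MN = M.abelian_group_axioms N.abelian_group_axioms and NP = N.abelian_group_axioms P.abelian_group_axioms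
  fix y z assume yz: "y \<in> carrier N" "z \<in> carrier P" "diff N y = \<zero>\<^bsub>N\<^esub>" "g y = diff P z"
  \<comment> \<open>The cone condition at the pair of zero and \<open>y\<close> is surjectivity in
    homology.\<close>
  obtain x0 y1 where x0: "x0 \<in> carrier M" "y1 \<in> carrier N" "diff M x0 = \<zero>\<^bsub>M\<^esub>" "f x0 = y \<oplus>\<^bsub>N\<^esub> diff N y1"
    using qiE[OF f, of "\<zero>\<^bsub>M\<^esub>" y] yz ahom_zero[OF MN fh] by auto
  have gy1: "g y1 \<in> carrier P" using ahom_closed[OF gh x0(2)] .
  have "g (f x0) = diff P (z \<oplus>\<^bsub>P\<^esub> g y1)"
    using x0 yz gy1 gd[of y1] ahom_add[OF gh, of y "diff N y1"] by (simp add: P.diff_add)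
  from qiE[OF gf x0(1) _ x0(3) this] obtain x1 z' where
    x1: "x1 \<in> carrier M" "z' \<in> carrier P" "diff M x1 = x0" "g (f x1) = z \<oplus>\<^bsub>P\<^esub> g y1 \<oplus>\<^bsub>P\<^esub> diff P z'"
    using yz gy1 by auto
  have fx1: "f x1 \<in> carrier N" using ahom_closed[OF fh x1(1)] .
  have "diff N (f x1 \<ominus>\<^bsub>N\<^esub> y1) = y"
    using fx1 x0 x1 fd[OF x1(1)] yz N.minus_cancel(3)[of y "diff N y1"] by (simp add: N.diff_minus)
  moreover have "g (f x1 \<ominus>\<^bsub>N\<^esub> y1) = z \<oplus>\<^bsub>P\<^esub> diff P z'"
  proof -
    have "g (f x1 \<ominus>\<^bsub>N\<^esub> y1) = (z \<oplus>\<^bsub>P\<^esub> diff P z') \<oplus>\<^bsub>P\<^esub> g y1 \<ominus>\<^bsub>P\<^esub> g y1"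
      using ahom_minus[OF NP gh fx1 x0(2)] x1 yz gy1 by (simp add: P.a_ac)
    then show ?thesis using P.minus_cancel(3)[of "z \<oplus>\<^bsub>P\<^esub> diff P z'" "g y1"] x1 yz gy1 by simp
  qed
  ultimately show "\<exists>y'\<in>carrier N. \<exists>x'\<in>carrier P. diff N y' = y \<and> g y' = z \<oplus>\<^bsub>P\<^esub> diff P x'"
    using x1 fx1 x0 N.minus_closed by blast
qed

lemma qi_bij_comp:
  assumes M: "dg_group M" and N: "dg_group N" and f: "chain_map M N f" "bij_betw f (carrier M) (carrier N)" and g: "qi N P g"
  shows "qi M P (\<lambda>x. g (f x))"
proof (rule qiI)
  interpret M: dg_group M by fact
  interpret N: dg_group N by fact
  note fh = chain_mapD(1)[OF f(1)]
  show "chain_map M P (\<lambda>x. g (f x))" by (rule chain_map_comp[OF f(1) qi_chain_map[OF g]])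
  fix y x assume yx: "y \<in> carrier M" "x \<in> carrier P" "diff M y = \<zero>\<^bsub>M\<^esub>" "g (f y) = diff P x"
  have fy: "f y \<in> carrier N" "diff N (f y) = \<zero>\<^bsub>N\<^esub>"
    using yx ahom_closed[OF fh] chain_mapD(3)[OF f(1), of y] ahom_zero[OF M.abelian_group_axioms N.abelian_group_axioms fh] by auto
  obtain y' x' where y': "y' \<in> carrier N" "x' \<in> carrier P" "diff N y' = f y" "g y' = x \<oplus>\<^bsub>P\<^esub> diff P x'"
    using qiE[OF g fy(1) yx(2) fy(2) yx(4)] by blast
  obtain z where z: "z \<in> carrier M" "f z = y'" using f(2) y'(1) unfolding bij_betw_def by (metis imageE)
  have "f (diff M z) = f y" using chain_mapD(3)[OF f(1) z(1)] z y' by simp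
  then have "diff M z = y" using f(2) z yx by (auto simp: bij_betw_def inj_on_def)
  then show "\<exists>y'\<in>carrier M. \<exists>x'\<in>carrier P. diff M y' = y \<and> g (f y') = x \<oplus>\<^bsub>P\<^esub> diff P x'"
    using z y' by blast
qed

section \<open>Graded spaces with scalars\<close>

text \<open>Scalars enter as a mere family of maps on \<open>M\<close>. For \<open>Tor\<close> these
  are chosen lifts, which need not add or compose strictly on chains, so \<open>M\<close> cannot be
  asked to be a complex of vector spaces.\<close>

definition hscal :: "('a, 'm) dg_scheme \<Rightarrow> ('k \<Rightarrow> 'a \<Rightarrow> 'a) \<Rightarrow> ('k, 'a set) dgmod" where
  "hscal M s = dg.extend (homology M) (dgmod.fields (\<lambda>c. homology_map M M (s c)))"

text \<open>This is \<open>graded_vector_space_iso\<close> without the demand that both sides are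
  vector spaces. For \<open>Tor\<close> with its chosen lifts that is known only after transport
  along such a map.\<close>

definition giso :: "('k, 'p) ring_scheme \<Rightarrow> ('k, 'v, 'm) dgmod_scheme \<Rightarrow> ('k, 'w, 'n) dgmod_scheme \<Rightarrow> ('v \<Rightarrow> 'w) \<Rightarrow> bool" where
  "giso K V W h \<longleftrightarrow> bij_betw h (carrier V) (carrier W) \<and> h \<in> ahom V W \<and>
     (\<forall>c\<in>carrier K. \<forall>v\<in>carrier V. h (act V c v) = act W c (h v)) \<and> (\<forall>n. h ` gr V n = gr W n)"

lemma hscal_simps [simp]:
  "carrier (hscal M s) = carrier (homology M)" "ring.add (hscal M s) = ring.add (homology M)"
  "ring.zero (hscal M s) = ring.zero (homology M)" "gr (hscal M s) = gr (homology M)"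
  "act (hscal M s) c = homology_map M M (s c)" "diff (hscal M s) = diff (homology M)"
  by (simp_all add: hscal_def dg.defs dgmod.defs)

lemma giso_comp: "giso K U V f \<Longrightarrow> giso K V W g \<Longrightarrow> giso K U W (g \<circ> f)"
  unfolding giso_def
proof (elim conjE, intro conjI)
  assume *: "bij_betw f (carrier U) (carrier V)" "bij_betw g (carrier V) (carrier W)" "f \<in> ahom U V" "g \<in> ahom V W"
    "\<forall>c\<in>carrier K. \<forall>v\<in>carrier U. f (act U c v) = act V c (f v)"
    "\<forall>c\<in>carrier K. \<forall>v\<in>carrier V. g (act V c v) = act W c (g v)"
    "\<forall>n. f ` gr U n = gr V n" "\<forall>n. g ` gr V n = gr W n"
  show "bij_betw (g \<circ> f) (carrier U) (carrier W)" using * by (blast intro: bij_betw_trans)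
  show "g \<circ> f \<in> ahom U W" using * ahom_comp by (auto simp: comp_def)
  show "\<forall>c\<in>carrier K. \<forall>v\<in>carrier U. (g \<circ> f) (act U c v) = act W c ((g \<circ> f) v)"
    using * ahom_closed[OF *(3)] by simp
  show "\<forall>n. (g \<circ> f) ` gr U n = gr W n" using * by (metis image_comp)
qed

lemma giso_inv:
  assumes "giso K V W h" "graded_group V" "\<And>c v. c \<in> carrier K \<Longrightarrow> v \<in> carrier V \<Longrightarrow> act V c v \<in> carrier V"
  shows "giso K W V (inv_into (carrier V) h)"
proof -
  interpret V: graded_group V by fact
  let ?g = "inv_into (carrier V) h"
  have h: "bij_betw h (carrier V) (carrier W)" "h \<in> ahom V W"
    "\<And>c v. c\<in>carrier K \<Longrightarrow> v\<in>carrier V \<Longrightarrow> h (act V c v) = act W c (h v)" "\<And>n. h ` gr V n = gr W n"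
    using assms(1) by (auto simp: giso_def)
  have gh: "?g (h v) = v" if "v \<in> carrier V" for v using h(1) that by (auto simp: bij_betw_def)
  have hg: "\<exists>v\<in>carrier V. w = h v" if "w \<in> carrier W" for w using h(1) that by (auto simp: bij_betw_def)
  show ?thesis unfolding giso_def
  proof (intro conjI allI ballI ahomI)
    show "bij_betw ?g (carrier W) (carrier V)" by (rule bij_betw_inv_into[OF h(1)])
    fix w assume w: "w \<in> carrier W" then show "?g w \<in> carrier V" using hg gh by force
    fix w' assume w': "w' \<in> carrier W"
    obtain v v' where "v \<in> carrier V" "w = h v" "v' \<in> carrier V" "w' = h v'" using w w' hg by meson
    then show "?g (w \<oplus>\<^bsub>W\<^esub> w') = ?g w \<oplus>\<^bsub>V\<^esub> ?g w'"
      using gh ahom_add[OF h(2), of v v'] V.a_closed by metis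
  next
    fix c w assume cw: "c \<in> carrier K" "w \<in> carrier W"
    obtain v where "v \<in> carrier V" "w = h v" using cw hg by meson
    then show "?g (act W c w) = act V c (?g w)" using gh h(3)[OF cw(1)] assms(3)[OF cw(1)] by metis
  next
    fix n show "?g ` gr W n = gr V n"
      unfolding h(4)[symmetric] image_image using gh V.gr_closed by force
  qed
qed

text \<open>Surjectivity in homology is the cone condition at the pair of zero and a cycle;
  injectivity is the condition at the difference of two cycles with homologous images.\<close>

lemma qi_giso:
  assumes "dg_group M" "dg_group N" "qi M N f"
    and "\<And>c. c \<in> carrier K \<Longrightarrow> chain_map M M (s c)" "\<And>c. c \<in> carrier K \<Longrightarrow> chain_map N N (t c)"
    and "\<And>c x. c \<in> carrier K \<Longrightarrow> x \<in> carrier M \<Longrightarrow> f (s c x) = t c (f x)"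
  shows "giso K (hscal M s) (hscal N t) (homology_map M N f)"
proof -
  interpret M: dg_group M by fact
  interpret N: dg_group N by fact
  note f = qi_chain_map[OF assms(3)]
  note fh = chain_mapD(1)[OF f] and hm = homology_map_chain_map[OF assms(1,2) f]
  note ag = M.abelian_group_axioms N.abelian_group_axioms
  have fc: "x \<in> carrier M \<Longrightarrow> f x \<in> carrier N" for x using ahom_closed[OF fh] .
  have fz: "f \<zero>\<^bsub>M\<^esub> = \<zero>\<^bsub>N\<^esub>" using ahom_zero[OF ag fh] .
  have ch: "homology_map M N f \<in> ahom (homology M) (homology N)"
    by (rule homology_map_ahom[OF assms(1,2) fh chain_map_boundaries[OF f] chain_map_cycles[OF assms(1,2) f]])
  have surj: "\<exists>x\<in>cycles M \<inter> gr M n. homology_class N y = homology_class N (f x)" if y: "y \<in> cycles N" "y \<in> gr N n" for y n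
  proof -
    obtain x z where x: "x \<in> carrier M" "z \<in> carrier N" "diff M x = \<zero>\<^bsub>M\<^esub>" "f x = y \<oplus>\<^bsub>N\<^esub> diff N z"
      using qiE[OF assms(3), of "\<zero>\<^bsub>M\<^esub>" y] y fz by (auto simp: cycles_def)
    \<comment> \<open>The preimage given by the cone condition may have components in other degrees.
      As \<open>y\<close> has degree \<open>n\<close>, the component of degree \<open>n\<close>
      alone is still a preimage up to a boundary.\<close>
    let ?x = "hcomp M x n"
    have "f ?x = hcomp N (f x) n"
      using hcomp_hom[OF M.graded_group_axioms N.graded_group_axioms fh, of 0 x n] chain_mapD(2)[OF f] x by simp
    also have "\<dots> = y \<oplus>\<^bsub>N\<^esub> diff N (hcomp N z (n + 1))"
      using x y by (simp add: N.cyclesD N.hcomp_add N.hcomp_homogeneous N.hcomp_diff)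
    finally have "homology_class N y = homology_class N (f ?x)"
      using N.homology_class_eqI[of "f ?x" y "hcomp N z (n + 1)"] x y fc[of ?x] by (simp add: N.cyclesD N.hcomp_closed M.hcomp_closed)
    moreover have "?x \<in> cycles M"
      using M.hcomp_diff[of x "n - 1"] M.hcomp_homogeneous[OF M.gr_zero, of "n - 1"] x
      by (simp add: cycles_def M.hcomp_closed)
    ultimately show ?thesis using x M.hcomp_gr by blast
  qed
  have surj': "\<exists>x\<in>cycles M. homology_class N y = homology_class N (f x)" if y: "y \<in> cycles N" for y
  proof -
    obtain x z where x: "x \<in> carrier M" "z \<in> carrier N" "diff M x = \<zero>\<^bsub>M\<^esub>" "f x = y \<oplus>\<^bsub>N\<^esub> diff N z"
      using qiE[OF assms(3), of "\<zero>\<^bsub>M\<^esub>" y] y fz by (auto simp: cycles_def)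
    then have "homology_class N y = homology_class N (f x)"
      using N.homology_class_eqI[of "f x" y z] y fc[of x] by (simp add: N.cyclesD)
    then show ?thesis using x M.cyclesI by blast
  qed
  have inj: "inj_on (homology_map M N f) (carrier (homology M))"
  proof (rule inj_onI)
    fix U V assume "U \<in> carrier (homology M)" "V \<in> carrier (homology M)" and eq: "homology_map M N f U = homology_map M N f V"
    then obtain u v where uv: "u \<in> cycles M" "v \<in> cycles M" "U = homology_class M u" "V = homology_class M v"
      by (auto simp: M.carrier_homology)
    then have uv': "u \<in> carrier M" "v \<in> carrier M" "diff M u = \<zero>\<^bsub>M\<^esub>" "diff M v = \<zero>\<^bsub>M\<^esub>" by (auto simp: cycles_def)
    then obtain z where z: "z \<in> carrier N" "f u = f v \<oplus>\<^bsub>N\<^esub> diff N z"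
      using eq uv fc by (auto simp: hm N.homology_class_eq_iff)
    have "f (u \<ominus>\<^bsub>M\<^esub> v) = diff N z"
      using ahom_minus[OF ag fh uv'(1,2)] z fc[OF uv'(2)] by (simp add: N.minus_cancel)
    then obtain y' where "y' \<in> carrier M" "diff M y' = u \<ominus>\<^bsub>M\<^esub> v"
      using qiE[OF assms(3), of "u \<ominus>\<^bsub>M\<^esub> v" z] uv' z by (auto simp: M.diff_minus M.minus_zero)
    then have "u = v \<oplus>\<^bsub>M\<^esub> diff M y'" using uv' by (simp add: M.minus_cancel)
    then show "U = V" using uv uv' \<open>y' \<in> carrier M\<close> M.homology_class_eqI by blast
  qed
  show ?thesis unfolding giso_def
  proof (intro conjI allI ballI)
    have "homology_map M N f ` carrier (homology M) = carrier (homology N)"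
    proof
      show "homology_map M N f ` carrier (homology M) \<subseteq> carrier (homology N)" using ahom_closed[OF ch] by auto
      show "carrier (homology N) \<subseteq> homology_map M N f ` carrier (homology M)"
        using surj' by (auto simp: N.carrier_homology M.carrier_homology image_image hm M.cyclesD cong: image_cong)
    qed
    then show "bij_betw (homology_map M N f) (carrier (hscal M s)) (carrier (hscal N t))"
      using inj by (simp add: bij_betw_def)
    show "homology_map M N f \<in> hom (add_monoid (hscal M s)) (add_monoid (hscal N t))"
      using ch by (simp add: hom_def)
  next
    fix c U assume c: "c \<in> carrier K" and "U \<in> carrier (hscal M s)"
    then obtain u where u: "u \<in> cycles M" "U = homology_class M u" by (auto simp: M.carrier_homology)
    then have u': "u \<in> carrier M" by (simp add: cycles_def)
    note sm = homology_map_chain_map[OF assms(1,1) assms(4)[OF c]] and tm = homology_map_chain_map[OF assms(2,2) assms(5)[OF c]]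
    have "s c u \<in> carrier M" using ahom_closed[OF chain_mapD(1)[OF assms(4)[OF c]] u'] .
    then show "homology_map M N f (act (hscal M s) c U) = act (hscal N t) c (homology_map M N f U)"
      using u u' fc[OF u'] by (simp add: sm tm hm assms(6)[OF c])
  next
    fix n show "homology_map M N f ` gr (hscal M s) n = gr (hscal N t) n" unfolding hscal_simps
    proof
      show "homology_map M N f ` gr (homology M) n \<subseteq> gr (homology N) n"
        using chain_map_cycles[OF assms(1,2) f] chain_mapD(2)[OF f]
        by (auto simp: M.gr_homology N.gr_homology hm M.cyclesD)
      show "gr (homology N) n \<subseteq> homology_map M N f ` gr (homology M) n"
        
      proof
        fix V assume "V \<in> gr (homology N) n"
        then obtain y where y: "y \<in> cycles N" "y \<in> gr N n" "V = homology_class N y" by (auto simp: N.gr_homology)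
        obtain x where x: "x \<in> cycles M" "x \<in> gr M n" "homology_class N y = homology_class N (f x)"
          using surj[OF y(1,2)] by blast
        have "V = homology_map M N f (homology_class M x)" using x y by (simp add: hm M.cyclesD)
        then show "V \<in> homology_map M N f ` gr (homology M) n" using x by (auto simp: M.gr_homology)
      qed
    qed
  qed
qed

section \<open>Finitely supported families\<close>

lemma subgroup_addI:
  assumes "abelian_group M" "H \<subseteq> carrier M" "\<zero>\<^bsub>M\<^esub> \<in> H" "\<And>x y. x \<in> H \<Longrightarrow> y \<in> H \<Longrightarrow> x \<oplus>\<^bsub>M\<^esub> y \<in> H"
    "\<And>x. x \<in> H \<Longrightarrow> \<ominus>\<^bsub>M\<^esub> x \<in> H"
  shows "subgroup H (add_monoid M)"
  using assms by (intro group.subgroupI) (auto simp: abelian_group.a_group a_inv_def[symmetric])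

lemma koszul_parity: "even i = even j \<Longrightarrow> koszul M i x = koszul M j x"
  by (simp add: koszul_def)

text \<open>The direct sum of copies of \<open>M\<close> over \<open>I\<close>. Its elements are
  total functions that vanish off \<open>I\<close>, so that equality in the sum is equality of
  functions.\<close>

definition fsupp :: "'e set \<Rightarrow> ('a, 'm) ring_scheme \<Rightarrow> ('e \<Rightarrow> 'a) set" where
  "fsupp I M = {x. (\<forall>i. x i \<in> carrier M) \<and> (\<forall>i. i \<notin> I \<longrightarrow> x i = \<zero>\<^bsub>M\<^esub>) \<and> finite {i. x i \<noteq> \<zero>\<^bsub>M\<^esub>}}"

definition delta :: "('a, 'm) ring_scheme \<Rightarrow> 'e \<Rightarrow> 'a \<Rightarrow> 'e \<Rightarrow> 'a" where
  "delta M i m = (\<lambda>j. if j = i then m else \<zero>\<^bsub>M\<^esub>)"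

text \<open>The map out of a direct sum with components \<open>u i\<close>. Summing over the support
  keeps the index set out of the formula.\<close>

definition fs_ext :: "('a, 'm) ring_scheme \<Rightarrow> ('b, 'n) ring_scheme \<Rightarrow> ('e \<Rightarrow> 'a \<Rightarrow> 'b) \<Rightarrow> ('e \<Rightarrow> 'a) \<Rightarrow> 'b" where
  "fs_ext M N u x = (\<Oplus>\<^bsub>N\<^esub>i\<in>{i. x i \<noteq> \<zero>\<^bsub>M\<^esub>}. u i (x i))"

lemma fsuppD:
  "x \<in> fsupp I M \<Longrightarrow> x i \<in> carrier M" "x \<in> fsupp I M \<Longrightarrow> i \<notin> I \<Longrightarrow> x i = \<zero>\<^bsub>M\<^esub>"
  "x \<in> fsupp I M \<Longrightarrow> finite {i. x i \<noteq> \<zero>\<^bsub>M\<^esub>}"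
  by (auto simp: fsupp_def)

lemma fsuppI:
  assumes "finite S" "S \<subseteq> I" "\<And>i. i \<notin> S \<Longrightarrow> x i = \<zero>\<^bsub>M\<^esub>" "\<And>i. i \<in> S \<Longrightarrow> x i \<in> carrier M" "abelian_group M"
  shows "x \<in> fsupp I M"
proof -
  interpret abelian_group M by fact
  have "{i. x i \<noteq> \<zero>\<^bsub>M\<^esub>} \<subseteq> S" using assms by auto
  moreover have "x i \<in> carrier M" for i using assms(3,4) zero_closed by (cases "i \<in> S") auto
  ultimately show ?thesis using assms finite_subset unfolding fsupp_def by blast
qed

lemma delta_same [simp]: "delta M i m i = m"
  and delta_other [simp]: "j \<noteq> i \<Longrightarrow> delta M i m j = \<zero>\<^bsub>M\<^esub>"
  by (auto simp: delta_def)

context abelian_group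
begin

lemma fsupp_add: "x \<in> fsupp I G \<Longrightarrow> y \<in> fsupp I G \<Longrightarrow> (\<lambda>i. x i \<oplus> y i) \<in> fsupp I G"
proof -
  assume xy: "x \<in> fsupp I G" "y \<in> fsupp I G"
  show ?thesis
  proof (rule fsuppI[where S="{i. x i \<noteq> \<zero>} \<union> {i. y i \<noteq> \<zero>}"])
    show "finite ({i. x i \<noteq> \<zero>} \<union> {i. y i \<noteq> \<zero>})" using fsuppD(3)[OF xy(1)] fsuppD(3)[OF xy(2)] by simp
    show "{i. x i \<noteq> \<zero>} \<union> {i. y i \<noteq> \<zero>} \<subseteq> I" using xy by (auto simp: fsupp_def)
  qed (use xy in \<open>auto simp: fsupp_def abelian_group_axioms\<close>)
qed

lemma fsupp_zero: "(\<lambda>i. \<zero>) \<in> fsupp I G"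
  by (simp add: fsupp_def)

lemma fsupp_map:
  assumes "x \<in> fsupp I M" "\<And>i m. m \<in> carrier M \<Longrightarrow> f i m \<in> carrier G" "\<And>i. f i \<zero>\<^bsub>M\<^esub> = \<zero>"
  shows "(\<lambda>i. f i (x i)) \<in> fsupp I G"
  using assms(1)
  by (intro fsuppI[where S="{i. x i \<noteq> \<zero>\<^bsub>M\<^esub>}"]) (auto simp: fsupp_def assms abelian_group_axioms)

lemma fsupp_neg: "x \<in> fsupp I G \<Longrightarrow> (\<lambda>i. \<ominus> x i) \<in> fsupp I G"
  by (rule fsupp_map[where f="\<lambda>i. a_inv G"]) auto

lemma fsupp_delta: "i \<in> I \<Longrightarrow> m \<in> carrier G \<Longrightarrow> delta G i m \<in> fsupp I G"
  by (rule fsuppI[where S="{i}"]) (auto simp: abelian_group_axioms)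

lemma delta_add: "m \<in> carrier G \<Longrightarrow> m' \<in> carrier G \<Longrightarrow> delta G i (m \<oplus> m') = (\<lambda>j. delta G i m j \<oplus> delta G i m' j)"
  by (rule ext) (auto simp: delta_def)

lemma fsupp_induct [consumes 1, case_names zero delta add]:
  assumes "x \<in> fsupp I G" "P (\<lambda>i. \<zero>)" "\<And>i m. i \<in> I \<Longrightarrow> m \<in> carrier G \<Longrightarrow> P (delta G i m)"
    and "\<And>x y. x \<in> fsupp I G \<Longrightarrow> y \<in> fsupp I G \<Longrightarrow> P x \<Longrightarrow> P y \<Longrightarrow> P (\<lambda>i. x i \<oplus> y i)"
  shows "P x"
  using assms(1)
proof (induction "card {i. x i \<noteq> \<zero>}" arbitrary: x)
  case 0
  then have "x = (\<lambda>i. \<zero>)" using fsuppD(3)[OF 0(2)] by auto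
  then show ?case using assms(2) by simp
next
  case (Suc n)
  then obtain i where i: "x i \<noteq> \<zero>" using card_gt_0_iff[of "{i. x i \<noteq> \<zero>}"] by auto
  then have iI: "i \<in> I" using fsuppD(2)[OF Suc(3)] by blast
  let ?y = "x(i := \<zero>)"
  have "{j. ?y j \<noteq> \<zero>} = {j. x j \<noteq> \<zero>} - {i}" by auto
  then have "card {j. ?y j \<noteq> \<zero>} = n" using Suc(2) i fsuppD(3)[OF Suc(3)] by simp
  moreover have y: "?y \<in> fsupp I G"
    using Suc(3) by (intro fsuppI[where S="{j. x j \<noteq> \<zero>}"]) (auto simp: fsupp_def abelian_group_axioms)
  ultimately have Py: "P ?y" using Suc(1) by blast
  have xi: "x i \<in> carrier G" using fsuppD(1)[OF Suc(3)] .
  have "P (\<lambda>j. delta G i (x i) j \<oplus> ?y j)"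
    by (rule assms(4)[OF fsupp_delta[OF iI xi] y assms(3)[OF iI xi] Py])
  moreover have "(\<lambda>j. delta G i (x i) j \<oplus> ?y j) = x"
    using fsuppD(1)[OF Suc(3)] by (intro ext) (auto simp: delta_def)
  ultimately show ?case by simp
qed

end

locale ab_hom_family = M: abelian_group M + N: abelian_group N
  for M :: "('a, 'm) ring_scheme" and N :: "('b, 'n) ring_scheme" +
  fixes I :: "'e set" and u :: "'e \<Rightarrow> 'a \<Rightarrow> 'b"
  assumes hom: "i \<in> I \<Longrightarrow> u i \<in> ahom M N"
begin

lemma u_closed: "i \<in> I \<Longrightarrow> m \<in> carrier M \<Longrightarrow> u i m \<in> carrier N"
  using ahom_closed[OF hom] .

lemma u_zero: "i \<in> I \<Longrightarrow> u i \<zero>\<^bsub>M\<^esub> = \<zero>\<^bsub>N\<^esub>"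
  using ahom_zero[OF M.abelian_group_axioms N.abelian_group_axioms hom] .

lemma fs_ext_superset:
  assumes "x \<in> fsupp I M" "finite S" "\<And>i. i \<notin> S \<Longrightarrow> x i = \<zero>\<^bsub>M\<^esub>" "S \<subseteq> I"
  shows "fs_ext M N u x = (\<Oplus>\<^bsub>N\<^esub>i\<in>S. u i (x i))"
  unfolding fs_ext_def using assms
  by (intro N.finsum_superset) (auto simp: fsupp_def u_zero intro!: u_closed)

lemma fs_ext_closed: "x \<in> fsupp I M \<Longrightarrow> fs_ext M N u x \<in> carrier N"
  unfolding fs_ext_def by (intro N.finsum_closed Pi_I u_closed) (auto simp: fsupp_def)

lemma fs_ext_add:
  assumes "x \<in> fsupp I M" "y \<in> fsupp I M"
  shows "fs_ext M N u (\<lambda>i. x i \<oplus>\<^bsub>M\<^esub> y i) = fs_ext M N u x \<oplus>\<^bsub>N\<^esub> fs_ext M N u y"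
proof -
  let ?S = "{i. x i \<noteq> \<zero>\<^bsub>M\<^esub>} \<union> {i. y i \<noteq> \<zero>\<^bsub>M\<^esub>}"
  have S: "finite ?S" "?S \<subseteq> I" using assms by (auto simp: fsupp_def)
  have "fs_ext M N u (\<lambda>i. x i \<oplus>\<^bsub>M\<^esub> y i) = (\<Oplus>\<^bsub>N\<^esub>i\<in>?S. u i (x i \<oplus>\<^bsub>M\<^esub> y i))"
    using S by (intro fs_ext_superset M.fsupp_add assms) auto
  also have "\<dots> = (\<Oplus>\<^bsub>N\<^esub>i\<in>?S. u i (x i) \<oplus>\<^bsub>N\<^esub> u i (y i))"
    using S fsuppD(1)[OF assms(1)] fsuppD(1)[OF assms(2)]
    by (intro N.finsum_cong' Pi_I refl) (auto intro!: N.a_closed u_closed ahom_add[OF hom])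
  also have "\<dots> = (\<Oplus>\<^bsub>N\<^esub>i\<in>?S. u i (x i)) \<oplus>\<^bsub>N\<^esub> (\<Oplus>\<^bsub>N\<^esub>i\<in>?S. u i (y i))"
    using S fsuppD(1)[OF assms(1)] fsuppD(1)[OF assms(2)]
    by (intro N.finsum_addf Pi_I) (auto intro!: u_closed)
  also have "\<dots> = fs_ext M N u x \<oplus>\<^bsub>N\<^esub> fs_ext M N u y"
    using fs_ext_superset[OF assms(1) S(1) _ S(2)] fs_ext_superset[OF assms(2) S(1) _ S(2)] by auto
  finally show ?thesis .
qed

lemma fs_ext_delta:
  assumes "i \<in> I" "m \<in> carrier M"
  shows "fs_ext M N u (delta M i m) = u i m"
proof -
  have "fs_ext M N u (delta M i m) = (\<Oplus>\<^bsub>N\<^esub>j\<in>{i}. u j (delta M i m j))"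
    using assms by (intro fs_ext_superset M.fsupp_delta) auto
  also have "\<dots> = u i m" using assms u_closed by (simp add: N.finsum_insert N.finsum_empty)
  finally show ?thesis .
qed

lemma fs_ext_zero: "fs_ext M N u (\<lambda>i. \<zero>\<^bsub>M\<^esub>) = \<zero>\<^bsub>N\<^esub>"
  by (simp add: fs_ext_def N.finsum_empty)

end

section \<open>Modules over a DG ring\<close>

context left_dg_module
begin

lemma act_left: "x \<in> carrier M \<Longrightarrow> (\<lambda>b. act M b x) \<in> ahom B M"
  by (intro ahomI) (auto simp: act_closed act_add_left)

lemma act_right: "b \<in> carrier B \<Longrightarrow> act M b \<in> ahom M M"
  by (intro ahomI) (auto simp: act_closed act_add_right)

lemmas ag = B.abelian_group_axioms M.abelian_group_axioms

lemma act_zero_left [simp]: "x \<in> carrier M \<Longrightarrow> act M \<zero>\<^bsub>B\<^esub> x = \<zero>\<^bsub>M\<^esub>"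
  using ahom_zero[OF ag act_left] .

lemma act_zero_right [simp]: "b \<in> carrier B \<Longrightarrow> act M b \<zero>\<^bsub>M\<^esub> = \<zero>\<^bsub>M\<^esub>"
  using ahom_zero[OF ag(2,2) act_right] .

lemma act_koszul_left: "b \<in> carrier B \<Longrightarrow> x \<in> carrier M \<Longrightarrow> act M (koszul B i b) x = koszul M i (act M b x)"
  using koszul_hom[OF ag act_left] .

lemma act_koszul_right: "b \<in> carrier B \<Longrightarrow> x \<in> carrier M \<Longrightarrow> act M b (koszul M i x) = koszul M i (act M b x)"
  using koszul_hom[OF ag(2,2) act_right] .

text \<open>With \<open>signed\<close> in place of a sign that depends on the degree, the Leibniz
  rule becomes additive in \<open>b\<close> and extends to inhomogeneous elements.\<close>

lemma act_leibniz_signed: "b \<in> carrier B \<Longrightarrow> x \<in> carrier M \<Longrightarrow>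
  diff M (act M b x) = act M (diff B b) x \<oplus>\<^bsub>M\<^esub> act M (signed B b) (diff M x)"
proof (induction b rule: B.graded_induct)
  case (homogeneous n b)
  then show ?case using B.gr_closed[of b n]
    by (simp add: B.signed_homogeneous act_leibniz act_koszul_left)
next
  case (add b c)
  then show ?case
    by (simp add: B.signed_add B.diff_add act_add_left act_closed M.diff_add M.a_ac)
qed

end

context right_dg_module
begin

lemma act_left: "x \<in> carrier M \<Longrightarrow> (\<lambda>b. act M b x) \<in> ahom B M"
  by (intro ahomI) (auto simp: act_closed act_add_left)

lemma act_right: "b \<in> carrier B \<Longrightarrow> act M b \<in> ahom M M"
  by (intro ahomI) (auto simp: act_closed act_add_right)

lemmas ag = B.abelian_group_axioms M.abelian_group_axioms

lemma act_zero_left [simp]: "x \<in> carrier M \<Longrightarrow> act M \<zero>\<^bsub>B\<^esub> x = \<zero>\<^bsub>M\<^esub>"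
  using ahom_zero[OF ag act_left] .

lemma act_koszul_left: "b \<in> carrier B \<Longrightarrow> x \<in> carrier M \<Longrightarrow> act M (koszul B i b) x = koszul M i (act M b x)"
  using koszul_hom[OF ag act_left] .

lemma act_koszul_right: "b \<in> carrier B \<Longrightarrow> x \<in> carrier M \<Longrightarrow> act M b (koszul M i x) = koszul M i (act M b x)"
  using koszul_hom[OF ag(2,2) act_right] .

lemma signed_act: "b \<in> carrier B \<Longrightarrow> x \<in> carrier M \<Longrightarrow> signed M (act M b x) = act M (signed B b) (signed M x)"
proof (induction b rule: B.graded_induct)
  case (homogeneous n b)
  note bn = homogeneous
  have b: "b \<in> carrier B" using B.gr_closed[OF bn(1)] .
  show ?case using homogeneous(2)
  proof (induction x rule: M.graded_induct)
    case (homogeneous m x)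
    then have "x \<in> carrier M" using M.gr_closed by simp
    then show ?case using b bn homogeneous act_degree[of b n x m]
      by (simp add: M.signed_homogeneous B.signed_homogeneous act_koszul_left act_koszul_right M.koszul_koszul act_closed add.commute)
  next
    case (add x y)
    then show ?case using b by (simp add: M.signed_add act_add_right act_closed)
  qed
next
  case (add b c)
  then show ?case by (simp add: B.signed_add M.signed_add act_add_left act_closed)
qed

lemma act_leibniz_signed:
  assumes "b \<in> carrier B" "x \<in> carrier M"
  shows "diff M (act M b x) = act M b (diff M x) \<oplus>\<^bsub>M\<^esub> act M (diff B b) (signed M x)"
  using assms(2,1)
proof (induction x rule: M.graded_induct)
  case (homogeneous n x)
  then show ?case using M.gr_closed[of x n]
    by (simp add: M.signed_homogeneous act_leibniz act_koszul_right)
next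
  case (add x y)
  then show ?case
    by (simp add: M.signed_add M.diff_add act_add_right act_closed M.a_ac)
qed

end

section \<open>Twisted sums\<close>

text \<open>
  The underlying graded group is the direct sum of copies \<open>g M\<close> of \<open>M\<close>, one for each \<open>g\<close> in \<open>I\<close>,
  and the differential is \<open>\<partial>(g m) = (\<Sum>h. h a\<^sub>h\<^sub>g m) + (-1)^|g| g \<partial>m\<close>: this is the tensor product over
  \<open>R\<close> of the free right module on \<open>I\<close> with \<open>\<partial>g = \<Sum>h. h a\<^sub>h\<^sub>g\<close> and the left module \<open>M\<close>.
  The left action \<open>b (g m) = (-1)^(|b| |g|) g (b m)\<close> uses that \<open>R\<close> is graded-commutative.
\<close>

definition twisted :: "'g set \<Rightarrow> ('g \<Rightarrow> int) \<Rightarrow> ('g \<Rightarrow> 'g \<Rightarrow> 'r) \<Rightarrow> ('r, 'p) dg_scheme \<Rightarrow>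
    ('r, 'm) dgmod \<Rightarrow> ('r, 'g \<Rightarrow> 'm) dgmod" where
  "twisted I wt a R M =
    \<lparr>carrier = fsupp I M, monoid.mult = undefined, one = undefined,
     ring.zero = (\<lambda>i. \<zero>\<^bsub>M\<^esub>), ring.add = (\<lambda>x y i. x i \<oplus>\<^bsub>M\<^esub> y i),
     gr = (\<lambda>n. {x \<in> fsupp I M. \<forall>i. x i \<in> gr M (n - wt i)}),
     diff = (\<lambda>x i. fs_ext M M (\<lambda>j. act M (a i j)) x \<oplus>\<^bsub>M\<^esub> koszul M (wt i) (diff M (x i))),
     act = (\<lambda>b x i. act M (if even (wt i) then b else signed R b) (x i))\<rparr>"

lemma twisted_simps [simp]:
  "carrier (twisted I wt a R M) = fsupp I M"
  "ring.zero (twisted I wt a R M) = (\<lambda>i. \<zero>\<^bsub>M\<^esub>)"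
  "ring.add (twisted I wt a R M) x y = (\<lambda>i. x i \<oplus>\<^bsub>M\<^esub> y i)"
  "gr (twisted I wt a R M) n = {x \<in> fsupp I M. \<forall>i. x i \<in> gr M (n - wt i)}"
  "act (twisted I wt a R M) b x = (\<lambda>i. act M (if even (wt i) then b else signed R b) (x i))"
  by (simp_all add: twisted_def)

text \<open>\<open>a_square\<close> is the coefficient of \<open>i\<close> in \<partial>\<partial>j
  = 0, where \<partial>j is the sum of l a(l,j) and the Leibniz rule puts the sign (-1)^|i| on the
  differential of a(i,j). Well-foundedness of \<open>r\<close> takes the place of the well-order of
  a semibasis; \<open>r\<close> need not be linear.\<close>

locale twisting = gc_dg_ring R for R :: "('r, 'p) dg_scheme" (structure) +
  fixes I :: "'g set" and wt :: "'g \<Rightarrow> int" and a :: "'g \<Rightarrow> 'g \<Rightarrow> 'r" and r :: "('g \<times> 'g) set"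
  assumes a_gr: "j \<in> I \<Longrightarrow> a i j \<in> gr R (wt j - wt i - 1)"
    and a_supp: "j \<in> I \<Longrightarrow> a i j \<noteq> \<zero> \<Longrightarrow> i \<in> I \<and> (i, j) \<in> r"
    and a_fin: "j \<in> I \<Longrightarrow> finite {i. a i j \<noteq> \<zero>}"
    and a_square: "j \<in> I \<Longrightarrow> (\<Oplus>l\<in>{l. a l j \<noteq> \<zero>}. a i l \<otimes> a l j) \<oplus> koszul R (wt i) (diff R (a i j)) = \<zero>"
    and wf: "wf r"
begin

lemma a_closed: "j \<in> I \<Longrightarrow> a i j \<in> carrier R"
  using a_gr gr_closed by blast

end

locale twisted_module = twisting R I wt a r + M: left_dg_module R M
  for R :: "('r, 'p) dg_scheme" (structure) and I :: "'g set" and wt :: "'g \<Rightarrow> int" and a :: "'g \<Rightarrow> 'g \<Rightarrow> 'r"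
    and r :: "('g \<times> 'g) set" and M :: "('r, 'm) dgmod" (structure)
begin

abbreviation "T \<equiv> twisted I wt a R M"

sublocale col: ab_hom_family M M I "\<lambda>j. act M (a i j)" for i
  by unfold_locales (simp add: M.act_right a_closed)

lemma T_abelian: "abelian_group T"
proof (rule abelian_groupI, goal_cases)
  case (6 x)
  have "(\<lambda>i. \<ominus>\<^bsub>M\<^esub> x i) \<in> fsupp I M"
    using 6 by (simp add: M.fsupp_neg)
  then show ?case using 6 by (intro bexI[of _ "\<lambda>i. \<ominus>\<^bsub>M\<^esub> x i"]) (auto simp: fsuppD(1) M.l_neg)
qed (auto simp: M.fsupp_add M.fsupp_zero fsuppD(1) M.a_ac)

lemma T_neg: "x \<in> carrier T \<Longrightarrow> \<ominus>\<^bsub>T\<^esub> x = (\<lambda>i. \<ominus>\<^bsub>M\<^esub> x i)"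
proof -
  assume x: "x \<in> carrier T"
  have "(\<lambda>i. \<ominus>\<^bsub>M\<^esub> x i) \<in> carrier T"
    using x by (simp add: M.fsupp_neg)
  then show ?thesis using x
    by (intro abelian_group.minus_equality[OF T_abelian]) (auto simp: fsuppD(1) M.l_neg)
qed

lemma T_koszul: "x \<in> carrier T \<Longrightarrow> koszul T k x = (\<lambda>i. koszul M k (x i))"
  by (auto simp: koszul_def T_neg)

lemma delta_ahom: "i \<in> I \<Longrightarrow> delta M i \<in> ahom M T"
  by (intro ahomI) (auto simp: M.fsupp_delta M.delta_add)

lemma delta_gr: "i \<in> I \<Longrightarrow> m \<in> gr M n \<Longrightarrow> delta M i m \<in> gr T (n + wt i)"
  by (simp add: M.fsupp_delta M.M.gr_closed) (simp add: delta_def)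

lemma diff_T: "diff T x i = fs_ext M M (\<lambda>j. act M (a i j)) x \<oplus>\<^bsub>M\<^esub> koszul M (wt i) (diff M (x i))"
  by (simp add: twisted_def)

lemma col_fsupp: "j \<in> I \<Longrightarrow> m \<in> carrier M \<Longrightarrow> (\<lambda>i. act M (a i j) m) \<in> fsupp I M"
  using a_supp[of j] a_fin[of j]
  by (intro fsuppI[where S="{i. a i j \<noteq> \<zero>}"]) (auto simp: M.act_closed a_closed M.M.abelian_group_axioms)

lemma diff_delta:
  assumes "j \<in> I" "m \<in> carrier M"
  shows "diff T (delta M j m) = (\<lambda>i. act M (a i j) m \<oplus>\<^bsub>M\<^esub> delta M j (koszul M (wt j) (diff M m)) i)"
  using assms by (intro ext) (simp add: diff_T col.fs_ext_delta, simp add: delta_def)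

lemma diff_T_add: "x \<in> carrier T \<Longrightarrow> y \<in> carrier T \<Longrightarrow> diff T (\<lambda>i. x i \<oplus>\<^bsub>M\<^esub> y i) = (\<lambda>i. diff T x i \<oplus>\<^bsub>M\<^esub> diff T y i)"
  by (intro ext) (simp add: diff_T col.fs_ext_add fsuppD(1) col.fs_ext_closed M.diff_add M.koszul_add M.a_ac)

lemma diff_T_zero: "diff T (\<lambda>i. \<zero>\<^bsub>M\<^esub>) = (\<lambda>i. \<zero>\<^bsub>M\<^esub>)"
  by (intro ext) (simp add: diff_T col.fs_ext_zero)

lemma diff_T_closed: "x \<in> fsupp I M \<Longrightarrow> diff T x \<in> fsupp I M"
proof (induction x rule: M.fsupp_induct)
  case (delta i m)
  then show ?case by (simp add: diff_delta M.fsupp_add M.fsupp_delta col_fsupp)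
qed (simp_all add: diff_T_add diff_T_zero M.fsupp_add M.fsupp_zero)

lemma diff_T_ahom: "diff T \<in> ahom T T"
  by (intro ahomI) (simp_all add: diff_T_closed diff_T_add)

text \<open>Column \<open>j\<close> applied to \<open>m\<close> is (\<partial>j)m. As
  \<partial>\<partial>j = 0 by \<open>a_square\<close>, only the term with \<partial>m survives,
  with the sign given by the degree \<open>wt j - 1\<close> of \<partial>j.\<close>

lemma diff_col:
  assumes "j \<in> I" "m \<in> carrier M"
  shows "diff T (\<lambda>i. act M (a i j) m) = (\<lambda>i. koszul M (wt j - 1) (act M (a i j) (diff M m)))"
proof
  fix i
  let ?S = "{l. a l j \<noteq> \<zero>}"
  have S: "finite ?S" "?S \<subseteq> I" using a_fin a_supp assms by auto
  have "fs_ext M M (\<lambda>l. act M (a i l)) (\<lambda>l. act M (a l j) m) = (\<Oplus>\<^bsub>M\<^esub>l\<in>?S. act M (a i l) (act M (a l j) m))"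
    using S assms by (intro col.fs_ext_superset col_fsupp) auto
  also have "\<dots> = (\<Oplus>\<^bsub>M\<^esub>l\<in>?S. act M (a i l \<otimes> a l j) m)"
    using S assms a_closed by (intro M.finsum_cong' refl Pi_I) (auto intro!: M.act_closed M.act_mult[symmetric])
  also have "\<dots> = act M (\<Oplus>l\<in>?S. a i l \<otimes> a l j) m"
    using S assms a_closed by (intro ahom_finsum[OF M.ag M.act_left, symmetric]) auto
  finally have 1: "fs_ext M M (\<lambda>l. act M (a i l)) (\<lambda>l. act M (a l j) m) = act M (\<Oplus>l\<in>?S. a i l \<otimes> a l j) m" .
  have 2: "koszul M (wt i) (diff M (act M (a i j) m)) =
      act M (koszul R (wt i) (diff R (a i j))) m \<oplus>\<^bsub>M\<^esub> koszul M (wt j - 1) (act M (a i j) (diff M m))"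
    using assms a_closed[of j i] M.act_leibniz[OF a_gr[OF assms(1)] assms(2), of i]
    by (simp add: M.koszul_add M.koszul_koszul M.act_koszul_left M.act_closed algebra_simps)
  have c: "(\<Oplus>l\<in>?S. a i l \<otimes> a l j) \<in> carrier R" using S assms a_closed by (intro finsum_closed) auto
  have "diff T (\<lambda>i. act M (a i j) m) i =
      act M ((\<Oplus>l\<in>?S. a i l \<otimes> a l j) \<oplus> koszul R (wt i) (diff R (a i j))) m \<oplus>\<^bsub>M\<^esub> koszul M (wt j - 1) (act M (a i j) (diff M m))"
    unfolding diff_T 1 2 using assms a_closed[of j i] c by (simp add: M.act_add_left M.act_closed M.a_ac)
  then show "diff T (\<lambda>i. act M (a i j) m) i = koszul M (wt j - 1) (act M (a i j) (diff M m))"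
    using assms a_closed[of j i] by (simp add: a_square M.act_closed)
qed

lemma diff_T_diff_T: "x \<in> fsupp I M \<Longrightarrow> diff T (diff T x) = (\<lambda>i. \<zero>\<^bsub>M\<^esub>)"
proof (induction x rule: M.fsupp_induct)
  case (delta j m)
  \<comment> \<open>The term (\<partial>j)\<partial>m occurs twice in \<partial>\<partial>(jm), with
    the signs of the degrees \<open>wt j - 1\<close> and \<open>wt j\<close>.\<close>
  have "koszul M (wt j - 1) x \<oplus>\<^bsub>M\<^esub> koszul M (wt j) x = \<zero>\<^bsub>M\<^esub>" if "x \<in> carrier M" for x
    using that by (auto simp: koszul_def M.r_neg M.l_neg)
  moreover have "koszul M (wt j) (diff M (koszul M (wt j) (diff M m))) = \<zero>\<^bsub>M\<^esub>"
    using delta by (simp add: M.diff_koszul M.M.diff_diff)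
  moreover have "delta M j \<zero>\<^bsub>M\<^esub> = (\<lambda>i. \<zero>\<^bsub>M\<^esub>)" by (rule ext) (simp add: delta_def)
  ultimately show ?case using delta a_closed[of j]
    by (simp add: diff_delta diff_T_add col_fsupp M.fsupp_delta diff_col M.act_koszul_right M.act_closed)
qed (simp_all add: diff_T_add diff_T_zero diff_T_closed)

lemma T_graded: "graded_group T"
proof (rule graded_groupI[where p="\<lambda>n x i. hcomp M (x i) (n - wt i)"])
  show "abelian_group T" by (rule T_abelian)
  have "hcomp M \<zero>\<^bsub>M\<^esub> n = \<zero>\<^bsub>M\<^esub>" for n
    using M.hcomp_homogeneous[OF M.gr_zero[of n], of n] by simp
  then show "(\<lambda>x i. hcomp M (x i) (n - wt i)) \<in> ahom T T" for n
    by (intro ahomI) (auto simp: M.hcomp_closed M.hcomp_add fsuppD(1)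
      intro!: M.fsupp_map[where M=M and f="\<lambda>i m. hcomp M m (n - wt i)"])
  show "(\<lambda>i. hcomp M (x i) (n - wt i)) = x" if "x \<in> gr T n" for x n
  proof
    show "hcomp M (x i) (n - wt i) = x i" for i
      using that M.hcomp_homogeneous[of "x i" "n - wt i"] by simp
  qed
  show "(\<lambda>i. hcomp M (x i) (n - wt i)) = \<zero>\<^bsub>T\<^esub>" if "x \<in> gr T m" "m \<noteq> n" for x n m
  proof
    fix i
    have "x i \<in> gr M (m - wt i)" "m - wt i \<noteq> n - wt i" using that by auto
    then show "hcomp M (x i) (n - wt i) = \<zero>\<^bsub>T\<^esub> i" by (simp add: M.hcomp_homogeneous)
  qed
  show "subgroup (gr T n) (add_monoid T)" for n
    by (rule subgroup_addI[OF T_abelian])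
      (auto simp: M.fsupp_add M.fsupp_zero M.fsupp_neg M.gr_add M.gr_neg T_neg)
  fix x P assume x: "x \<in> carrier T" and hom: "\<And>n x. x \<in> gr T n \<Longrightarrow> P x"
    and padd: "\<And>x y. x \<in> carrier T \<Longrightarrow> y \<in> carrier T \<Longrightarrow> P x \<Longrightarrow> P y \<Longrightarrow> P (x \<oplus>\<^bsub>T\<^esub> y)"
  from x have "x \<in> fsupp I M" by simp
  then show "P x"
  proof (induction x rule: M.fsupp_induct)
    case zero
    show ?case by (rule hom[of _ 0]) (simp add: M.fsupp_zero)
  next
    case (delta i m)
    from delta(2) show ?case
    proof (induction m rule: M.graded_induct)
      case (homogeneous n m)
      show ?case by (rule hom[OF delta_gr[OF delta(1) homogeneous]])
    next
      case (add m m')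
      then show ?case using M.fsupp_delta[OF delta(1)] M.delta_add[of m m' i]
          padd[of "delta M i m" "delta M i m'"] by simp
    qed
  next
    case (add x y)
    then show ?case using padd[of x y] by simp
  qed
qed

lemma T_dg: "dg_group T"
proof (rule dg_groupI[OF T_graded diff_T_ahom])
  fix n x assume "x \<in> gr T n"
  then have x: "x \<in> fsupp I M" "\<And>i. x i \<in> gr M (n - wt i)" by auto
  have "diff T x i \<in> gr M (n - 1 - wt i)" for i
  proof -
    have "fs_ext M M (\<lambda>j. act M (a i j)) x \<in> gr M (n - 1 - wt i)"
      unfolding fs_ext_def
    proof (rule M.gr_finsum)
      show "finite {i. x i \<noteq> \<zero>\<^bsub>M\<^esub>}" by (rule fsuppD(3)[OF x(1)])
      fix j assume "j \<in> {j. x j \<noteq> \<zero>\<^bsub>M\<^esub>}"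
      then have j: "j \<in> I" using fsuppD(2)[OF x(1)] by auto
      have xj: "x j \<in> gr M (n - wt j)" using x by auto
      show "act M (a i j) (x j) \<in> gr M (n - 1 - wt i)"
        using M.act_degree[OF a_gr[OF j, of i] xj] by (simp add: algebra_simps)
    qed
    moreover have "diff M (x i) \<in> gr M (n - 1 - wt i)"
      using M.diff_degree[of "x i" "n - wt i"] x by (simp add: algebra_simps)
    ultimately show ?thesis by (simp add: diff_T M.gr_add M.gr_koszul)
  qed
  then show "diff T x \<in> gr T (n - 1)" using x diff_T_closed by auto
qed (simp add: diff_T_diff_T)

end

section \<open>The left action on a twisted sum\<close>

lemma (in dg_ring) signed_mult: "b \<in> carrier R \<Longrightarrow> c \<in> carrier R \<Longrightarrow> signed R (b \<otimes> c) = signed R b \<otimes> signed R c"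
proof (induction b rule: graded_induct)
  case (homogeneous n b)
  note bn = homogeneous
  have b: "b \<in> carrier R" using gr_closed[OF bn(1)] .
  show ?case using homogeneous(2)
  proof (induction c rule: graded_induct)
    case (homogeneous m c)
    then have "c \<in> carrier R" using gr_closed by simp
    then show ?case using b bn homogeneous mult_degree[of b n c m]
      by (auto simp: signed_homogeneous koszul_def l_minus r_minus)
  next
    case (add x y)
    then show ?case using b by (simp add: signed_add r_distr)
  qed
next
  case (add b c)
  then show ?case by (simp add: signed_add l_distr)
qed

lemma (in dg_ring) signed_one: "signed R \<one> = \<one>"
  using signed_homogeneous[OF one_degree] by (simp add: koszul_def)

context twisted_module
begin

lemma act_T_delta: "b \<in> carrier R \<Longrightarrow> act T b (delta M j m) = delta M j (act M (if even (wt j) then b else signed R b) m)"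
  by (rule ext) (auto simp: delta_def)

lemma act_T_closed: "b \<in> carrier R \<Longrightarrow> x \<in> fsupp I M \<Longrightarrow> act T b x \<in> fsupp I M"
  unfolding twisted_simps
  by (rule M.fsupp_map[where M=M and f="\<lambda>i. act M (if even (wt i) then b else signed R b)"])
    (auto intro!: M.act_closed)

text \<open>On \<open>j m\<close> everything hinges on moving \<open>b\<close> across the
  coefficient a(i,j), for which graded commutativity is used. The sign produced must match the
  difference between the signs of the action on the copies \<open>i\<close> and
  \<open>j\<close>.\<close>

lemma act_T_leibniz:
  assumes b: "b \<in> gr R n" and x: "x \<in> fsupp I M"
  shows "diff T (act T b x) = act T (diff R b) x \<oplus>\<^bsub>T\<^esub> koszul T n (act T b (diff T x))"
  using x
proof (induction x rule: M.fsupp_induct)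
  case zero
  have "act T c (\<lambda>i. \<zero>\<^bsub>M\<^esub>) = (\<lambda>i. \<zero>\<^bsub>M\<^esub>)" if "c \<in> carrier R" for c using that by auto
  then show ?case using gr_closed[OF b] by (simp add: diff_T_zero T_koszul M.fsupp_zero del: twisted_simps(5))
next
  case (delta j m)
  have bc: "b \<in> carrier R" "diff R b \<in> carrier R" using gr_closed[OF b] by auto
  have tw: "act M (if even (wt i) then b else signed R b) y = koszul M (n * wt i) (act M b y)"
    if "y \<in> carrier M" for i y
    using b bc that by (auto simp: signed_homogeneous koszul_def M.act_koszul_left ahom_neg[OF M.ag M.act_left])
  have twd: "act M (if even (wt i) then diff R b else signed R (diff R b)) y = koszul M ((n - 1) * wt i) (act M (diff R b) y)"
    if "y \<in> carrier M" for i y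
    using diff_degree[OF b] bc that by (auto simp: signed_homogeneous koszul_def M.act_koszul_left ahom_neg[OF M.ag M.act_left])
  have ac: "a i j \<in> carrier R" for i using a_closed delta(1) .
  have comm: "act M (a i j) (act M b m) = koszul M (n * (wt j - wt i - 1)) (act M b (act M (a i j) m))" for i
    using delta ac bc graded_commute[OF a_gr[OF delta(1), of i] b]
    by (simp add: M.act_mult[symmetric] M.act_koszul_left mult.commute)
  \<comment> \<open>In n|j| + n(|j| - |i| - 1) the term 2n|j| drops out, which leaves the parity of
    n + n|i|.\<close>
  have 1: "act M (a i j) (koszul M (n * wt j) (act M b m)) = koszul M (n + n * wt i) (act M b (act M (a i j) m))" for i
    using delta ac bc by (auto simp: M.act_koszul_right M.act_closed comm M.koszul_koszul algebra_simps intro!: koszul_parity)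
  have 2: "koszul M (wt j) (diff M (koszul M (n * wt j) (act M b m))) =
      koszul M ((n - 1) * wt j) (act M (diff R b) m) \<oplus>\<^bsub>M\<^esub> koszul M (n + n * wt j) (act M b (koszul M (wt j) (diff M m)))"
  proof -
    have "koszul M (wt j) (diff M (koszul M (n * wt j) (act M b m))) =
        koszul M (wt j + n * wt j) (act M (diff R b) m) \<oplus>\<^bsub>M\<^esub> koszul M (wt j + n * wt j + n) (act M b (diff M m))"
      using delta bc b by (simp add: M.diff_koszul M.act_leibniz M.act_closed M.koszul_add M.koszul_koszul add.assoc)
    also have "koszul M (wt j + n * wt j) (act M (diff R b) m) = koszul M ((n - 1) * wt j) (act M (diff R b) m)"
      by (rule koszul_parity) (auto simp: algebra_simps)
    also have "koszul M (wt j + n * wt j + n) (act M b (diff M m)) = koszul M (n + n * wt j) (act M b (koszul M (wt j) (diff M m)))"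
      using delta bc by (simp add: M.act_koszul_right M.koszul_koszul M.act_closed) (rule koszul_parity, auto)
    finally show ?thesis .
  qed
  have Dm: "diff T (delta M j m) \<in> fsupp I M" using delta by (simp add: diff_T_closed M.fsupp_delta)
  have dc: "delta M j y i \<in> carrier M" if "y \<in> carrier M" for y i using that by (simp add: delta_def)
  show ?case
  proof
    fix i
    have "diff T (act T b (delta M j m)) i = act M (a i j) (koszul M (n * wt j) (act M b m)) \<oplus>\<^bsub>M\<^esub>
        delta M j (koszul M (wt j) (diff M (koszul M (n * wt j) (act M b m)))) i"
      using delta bc by (simp add: act_T_delta tw diff_delta M.act_closed del: twisted_simps(5))
    also have "\<dots> = koszul M (n + n * wt i) (act M b (act M (a i j) m)) \<oplus>\<^bsub>M\<^esub>
        (delta M j (koszul M ((n - 1) * wt j) (act M (diff R b) m)) i \<oplus>\<^bsub>M\<^esub>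
         delta M j (koszul M (n + n * wt j) (act M b (koszul M (wt j) (diff M m)))) i)"
      unfolding 1 2 using delta bc by (simp add: delta_def M.act_closed)
    also have "delta M j (koszul M (n + n * wt j) (act M b (koszul M (wt j) (diff M m)))) i =
        koszul M (n + n * wt i) (act M b (delta M j (koszul M (wt j) (diff M m)) i))"
      using bc by (simp add: delta_def)
    also have "koszul M (n + n * wt i) (act M b (act M (a i j) m)) \<oplus>\<^bsub>M\<^esub>
        (delta M j (koszul M ((n - 1) * wt j) (act M (diff R b) m)) i \<oplus>\<^bsub>M\<^esub>
         koszul M (n + n * wt i) (act M b (delta M j (koszul M (wt j) (diff M m)) i))) =
        delta M j (koszul M ((n - 1) * wt j) (act M (diff R b) m)) i \<oplus>\<^bsub>M\<^esub>
          koszul M n (koszul M (n * wt i) (act M b (diff T (delta M j m) i)))"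
      using delta bc ac dc
      by (simp add: diff_delta M.act_add_right M.koszul_add M.koszul_koszul M.act_closed M.a_ac)
    also have "\<dots> = (act T (diff R b) (delta M j m) \<oplus>\<^bsub>T\<^esub> koszul T n (act T b (diff T (delta M j m)))) i"
      using delta bc Dm act_T_closed[OF bc(1) Dm] fsuppD(1)[OF Dm]
      by (simp add: act_T_delta twd T_koszul tw[OF fsuppD(1)[OF Dm]] del: twisted_simps(5)) (simp add: tw[OF fsuppD(1)[OF Dm]])
    finally show "diff T (act T b (delta M j m)) i =
      (act T (diff R b) (delta M j m) \<oplus>\<^bsub>T\<^esub> koszul T n (act T b (diff T (delta M j m)))) i" .
  qed
next
  case (add x y)
  interpret T: dg_group T by (rule T_dg)
  have bc: "b \<in> carrier R" "diff R b \<in> carrier R" using gr_closed[OF b] by auto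
  have a1: "act T c (x' \<oplus>\<^bsub>T\<^esub> y') = act T c x' \<oplus>\<^bsub>T\<^esub> act T c y'" if "c \<in> carrier R" "x' \<in> fsupp I M" "y' \<in> fsupp I M" for c x' y'
    using that by (auto simp: fsuppD(1) M.act_add_right)
  have c: "x \<in> carrier T" "y \<in> carrier T" using add by auto
  have e: "(\<lambda>i. x i \<oplus>\<^bsub>M\<^esub> y i) = x \<oplus>\<^bsub>T\<^esub> y" by simp
  have tc: "\<And>c x. c \<in> carrier R \<Longrightarrow> x \<in> carrier T \<Longrightarrow> act T c x \<in> carrier T" using act_T_closed by simp
  note T.diff_add[simp] T.koszul_add[simp] a1[simp] tc[simp]
  have *: "diff T x \<in> fsupp I M" "diff T y \<in> fsupp I M" using T.diff_closed c by simp_all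
  have **: "act T b (diff T x) \<in> carrier T" "act T b (diff T y) \<in> carrier T" using * bc tc by simp_all
  have kc: "koszul T k x \<in> fsupp I M" if "x \<in> fsupp I M" for k x
    using that T.koszul_closed[of x k] by simp
  have four: "(p \<oplus>\<^bsub>T\<^esub> q) \<oplus>\<^bsub>T\<^esub> (u \<oplus>\<^bsub>T\<^esub> v) = (p \<oplus>\<^bsub>T\<^esub> u) \<oplus>\<^bsub>T\<^esub> (q \<oplus>\<^bsub>T\<^esub> v)"
    if "p \<in> carrier T" "q \<in> carrier T" "u \<in> carrier T" "v \<in> carrier T" for p q u v
    using that by (simp add: T.a_ac del: twisted_simps)
  show ?case unfolding e
    using kc add c bc * **
    by (simp add: act_T_closed diff_T_closed del: twisted_simps(3,5))
      (rule four, auto simp: act_T_closed diff_T_closed simp del: twisted_simps(3,5))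
qed

lemma T_left_dg_module: "left_dg_module R T"
proof -
  interpret T: dg_group T by (rule T_dg)
  have R: "dg_ring R" by unfold_locales
  show ?thesis
  proof (intro left_dg_module.intro left_dg_module_axioms.intro R T_dg)
    fix b c x assume bc: "b \<in> carrier R" "c \<in> carrier R" and x: "x \<in> carrier T"
    show "act T b x \<in> carrier T" using bc x act_T_closed by simp
    show "act T (b \<oplus> c) x = act T b x \<oplus>\<^bsub>T\<^esub> act T c x"
      using bc x by (auto simp: signed_add M.act_add_left fsuppD(1))
    show "act T (b \<otimes> c) x = act T b (act T c x)"
      using bc x by (auto simp: signed_mult M.act_mult fsuppD(1))
  next
    fix b x y assume "b \<in> carrier R" "x \<in> carrier T" "y \<in> carrier T"
    then show "act T b (x \<oplus>\<^bsub>T\<^esub> y) = act T b x \<oplus>\<^bsub>T\<^esub> act T b y"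
      by (auto simp: M.act_add_right fsuppD(1))
  next
    fix x assume "x \<in> carrier T" then show "act T \<one> x = x" by (auto simp: signed_one M.act_one fsuppD(1))
  next
    fix b n x m assume b: "b \<in> gr R n" and "x \<in> gr T m"
    then have x: "x \<in> fsupp I M" "\<And>i. x i \<in> gr M (m - wt i)" by auto
    have "act T b x i \<in> gr M (n + m - wt i)" for i
      using M.act_degree[OF b x(2)[of i]] M.act_degree[OF signed_gr[OF b] x(2)[of i]] by (simp add: algebra_simps)
    then show "act T b x \<in> gr T (n + m)" using act_T_closed[OF gr_closed[OF b] x(1)] by simp
  next
    fix b n x assume "b \<in> gr R n" "x \<in> carrier T"
    then show "diff T (act T b x) = act T (diff R b) x \<oplus>\<^bsub>T\<^esub> koszul T n (act T b (diff T x))"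
      using act_T_leibniz by (simp del: twisted_simps(3,5))
  qed
qed

end

lemma dg_module_morphismD:
  assumes "dg_module_morphism B M N f"
  shows "chain_map M N f" "\<And>b x. b \<in> carrier B \<Longrightarrow> x \<in> carrier M \<Longrightarrow> f (act M b x) = act N b (f x)"
  using assms by (auto simp: dg_module_morphism_def)

section \<open>Functoriality of twisted sums\<close>

context twisting
begin

lemma twisted_moduleI: "left_dg_module R M \<Longrightarrow> twisted_module R I wt a r M"
  by (simp add: twisted_module_def twisting_axioms)

lemma twisted_map:
  assumes M: "left_dg_module R M" and N: "left_dg_module R N" and f: "dg_module_morphism R M N f"
  shows "dg_module_morphism R (twisted I wt a R M) (twisted I wt a R N) (\<lambda>x i. f (x i))"
proof -
  interpret M: twisted_module R I wt a r M by (rule twisted_moduleI[OF M])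
  interpret N: twisted_module R I wt a r N by (rule twisted_moduleI[OF N])
  note fh = chain_mapD[OF dg_module_morphismD(1)[OF f]] and fl = dg_module_morphismD(2)[OF f]
  note ag = M.M.M.abelian_group_axioms N.M.M.abelian_group_axioms
  have f0: "f \<zero>\<^bsub>M\<^esub> = \<zero>\<^bsub>N\<^esub>" using ahom_zero[OF ag fh(1)] .
  have fc: "x \<in> carrier M \<Longrightarrow> f x \<in> carrier N" for x using ahom_closed[OF fh(1)] .
  have fsc: "x \<in> fsupp I M \<Longrightarrow> (\<lambda>i. f (x i)) \<in> fsupp I N" for x
    by (rule N.M.fsupp_map[where M=M and f="\<lambda>i. f"]) (simp_all add: fc f0)
  have fa: "x \<in> fsupp I M \<Longrightarrow> y \<in> fsupp I M \<Longrightarrow> (\<lambda>i. f (x i \<oplus>\<^bsub>M\<^esub> y i)) = (\<lambda>i. f (x i) \<oplus>\<^bsub>N\<^esub> f (y i))" for x y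
    using ahom_add[OF fh(1)] by (auto simp: fsuppD(1))
  have d: "(\<lambda>i. f (diff (twisted I wt a R M) x i)) = diff (twisted I wt a R N) (\<lambda>i. f (x i))" if "x \<in> fsupp I M" for x
    using that
  proof (induction x rule: M.M.fsupp_induct)
    case zero
    then show ?case by (simp add: M.diff_T_zero N.diff_T_zero f0)
  next
    case (delta j m)
    have e: "(\<lambda>i. f (delta M j m' i)) = delta N j (f m')" for m' by (rule ext) (simp add: delta_def f0)
    have "f (act M (a i j) m \<oplus>\<^bsub>M\<^esub> delta M j (koszul M (wt j) (diff M m)) i) =
        act N (a i j) (f m) \<oplus>\<^bsub>N\<^esub> delta N j (koszul N (wt j) (diff N (f m))) i" for i
      using delta a_closed[of j i] fh(3)[of m] koszul_hom[OF ag fh(1)]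
        ahom_add[OF fh(1), of "act M (a i j) m" "delta M j (koszul M (wt j) (diff M m)) i"]
      by (cases "i = j") (simp_all add: fl M.M.act_closed f0 del: M.M.r_zero N.M.r_zero)
    then show ?case using delta fc by (simp add: M.diff_delta N.diff_delta e)
  next
    case (add x y)
    then show ?case
      using fa[OF M.diff_T_closed[of x] M.diff_T_closed[of y]] fun_cong[OF add(3)] fun_cong[OF add(4)]
      by (simp add: M.diff_T_add N.diff_T_add fsc fa)
  qed
  show ?thesis unfolding dg_module_morphism_def
  proof (intro conjI ballI chain_mapI ahomI)
    fix b x assume "b \<in> carrier R" "x \<in> carrier (twisted I wt a R M)"
    then show "(\<lambda>i. f (act (twisted I wt a R M) b x i)) = act (twisted I wt a R N) b (\<lambda>i. f (x i))"
      by (auto simp: fl fsuppD(1))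
  qed (use fsc fa fh(2) d in auto)
qed

end

section \<open>Triangular complexes\<close>

text \<open>
  A complex filtered along a well-founded relation, with copies of a group \<open>M\<close> as subquotients;
  \<open>dM e\<close> is the differential on the copy of index \<open>e\<close>.
\<close>

locale triangular = Y: dg_group Y + M: abelian_group M
  for Y :: "('y, 'p) dg_scheme" and M :: "('m, 'q) ring_scheme" +
  fixes E :: "'e set" and r :: "('e \<times> 'e) set" and dM :: "'e \<Rightarrow> 'm \<Rightarrow> 'm"
    and coord :: "'e \<Rightarrow> 'y \<Rightarrow> 'm" and inc :: "'e \<Rightarrow> 'm \<Rightarrow> 'y"
  assumes inc_hom: "e \<in> E \<Longrightarrow> inc e \<in> ahom M Y"
    and coord_hom: "e \<in> E \<Longrightarrow> coord e \<in> ahom Y M"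
    and coord_finite: "x \<in> carrier Y \<Longrightarrow> finite {e \<in> E. coord e x \<noteq> \<zero>\<^bsub>M\<^esub>}"
    and coord_zero: "x \<in> carrier Y \<Longrightarrow> (\<And>e. e \<in> E \<Longrightarrow> coord e x = \<zero>\<^bsub>M\<^esub>) \<Longrightarrow> x = \<zero>\<^bsub>Y\<^esub>"
    and coord_inc: "e \<in> E \<Longrightarrow> m \<in> carrier M \<Longrightarrow> coord e (inc e m) = m"
    and coord_inc_other: "e \<in> E \<Longrightarrow> e' \<in> E \<Longrightarrow> e' \<noteq> e \<Longrightarrow> m \<in> carrier M \<Longrightarrow> coord e' (inc e m) = \<zero>\<^bsub>M\<^esub>"
    and diff_diag: "e \<in> E \<Longrightarrow> m \<in> carrier M \<Longrightarrow> coord e (diff Y (inc e m)) = dM e m"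
    and diff_lower: "e \<in> E \<Longrightarrow> e' \<in> E \<Longrightarrow> e' \<noteq> e \<Longrightarrow> (e', e) \<notin> r \<Longrightarrow> m \<in> carrier M \<Longrightarrow>
      coord e' (diff Y (inc e m)) = \<zero>\<^bsub>M\<^esub>"
begin

lemmas ag = M.abelian_group_axioms Y.abelian_group_axioms

lemma inc_closed: "e \<in> E \<Longrightarrow> m \<in> carrier M \<Longrightarrow> inc e m \<in> carrier Y"
  using ahom_closed[OF inc_hom] .

lemma coord_closed: "e \<in> E \<Longrightarrow> x \<in> carrier Y \<Longrightarrow> coord e x \<in> carrier M"
  using ahom_closed[OF coord_hom] .

lemma coord_eqI:
  assumes "x \<in> carrier Y" "y \<in> carrier Y" "\<And>e. e \<in> E \<Longrightarrow> coord e x = coord e y"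
  shows "x = y"
proof -
  have "x \<ominus>\<^bsub>Y\<^esub> y = \<zero>\<^bsub>Y\<^esub>"
    using assms coord_closed M.eq_iff_minus
    by (intro coord_zero) (auto simp: ahom_minus[OF ag(2,1) coord_hom])
  then show ?thesis using assms Y.eq_iff_minus by blast
qed

lemma coord_expansion:
  assumes x: "x \<in> carrier Y"
  shows "x = (\<Oplus>\<^bsub>Y\<^esub>e\<in>{e \<in> E. coord e x \<noteq> \<zero>\<^bsub>M\<^esub>}. inc e (coord e x))"
proof (rule coord_eqI)
  let ?S = "{e \<in> E. coord e x \<noteq> \<zero>\<^bsub>M\<^esub>}"
  have S: "finite ?S" by (rule coord_finite[OF x])
  show "(\<Oplus>\<^bsub>Y\<^esub>e\<in>?S. inc e (coord e x)) \<in> carrier Y"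
    using x by (intro Y.finsum_closed Pi_I) (auto intro!: inc_closed coord_closed)
  fix e assume e: "e \<in> E"
  have "coord e (\<Oplus>\<^bsub>Y\<^esub>e\<in>?S. inc e (coord e x)) = (\<Oplus>\<^bsub>M\<^esub>e'\<in>?S. coord e (inc e' (coord e' x)))"
    using x S by (intro ahom_finsum[OF ag(2,1) coord_hom[OF e]]) (auto intro!: inc_closed coord_closed)
  also have "\<dots> = (\<Oplus>\<^bsub>M\<^esub>e'\<in>insert e ?S. coord e (inc e' (coord e' x)))"
    using x S e by (intro M.finsum_superset) (auto intro!: coord_closed inc_closed simp: coord_inc coord_inc_other)
  also have "\<dots> = coord e (inc e (coord e x))"
    using x S e coord_closed by (intro M.finsum_single) (auto simp: coord_inc coord_inc_other)
  finally show "coord e x = coord e (\<Oplus>\<^bsub>Y\<^esub>e\<in>?S. inc e (coord e x))"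
    using coord_inc[OF e coord_closed[OF e x]] by simp
qed (fact x)

text \<open>Coordinate \<open>e\<close> of the differential of \<open>x\<close> receives
  contributions only from \<open>e\<close> itself and from indices above \<open>e\<close>; by
  \<open>top\<close> none of the latter occurs in \<open>x\<close>.\<close>

lemma coord_diff:
  assumes x: "x \<in> carrier Y" and e: "e \<in> E" and top: "\<And>e'. e' \<in> E \<Longrightarrow> coord e' x \<noteq> \<zero>\<^bsub>M\<^esub> \<Longrightarrow> (e, e') \<notin> r"
  shows "coord e (diff Y x) = dM e (coord e x)"
proof -
  let ?S = "{e \<in> E. coord e x \<noteq> \<zero>\<^bsub>M\<^esub>}"
  let ?h = "\<lambda>x. coord e (diff Y x)"
  have S: "finite ?S" by (rule coord_finite[OF x])
  have h: "?h \<in> ahom Y M" by (rule ahom_comp[OF Y.diff_hom coord_hom[OF e]])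
  have "?h x = ?h (\<Oplus>\<^bsub>Y\<^esub>e\<in>?S. inc e (coord e x))" using coord_expansion[OF x] by simp
  also have "\<dots> = (\<Oplus>\<^bsub>M\<^esub>e'\<in>?S. ?h (inc e' (coord e' x)))"
    using x S by (intro ahom_finsum[OF ag(2,1) h]) (auto intro!: inc_closed coord_closed)
  also have "\<dots> = (\<Oplus>\<^bsub>M\<^esub>e'\<in>insert e ?S. ?h (inc e' (coord e' x)))"
    using x S e ahom_zero[OF ag inc_hom[OF e]] ahom_zero[OF ag(2,1) h]
    by (intro M.finsum_superset) (auto intro!: coord_closed inc_closed Y.diff_closed)
  also have "\<dots> = ?h (inc e (coord e x))"
    using x S e top by (intro M.finsum_single) (auto intro!: coord_closed inc_closed Y.diff_closed diff_lower)
  finally show ?thesis using diff_diag[OF e coord_closed[OF e x]] by simp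
qed

end

text \<open>This measures the progress of peeling: removing \<open>e\<close> from a finite set while
  adding finitely many elements below \<open>e\<close> is a descent in the multiset order. As
  \<open>r\<close> need not be linear, there is no single leading term whose descent could serve
  instead.\<close>

lemma mset_set_mult:
  assumes "finite S" "finite S'" "e \<in> S" "S' \<subseteq> (S - {e}) \<union> {e'. (e', e) \<in> r}"
  shows "(mset_set S', mset_set S) \<in> mult r"
proof -
  let ?I = "S' \<inter> (S - {e})"
  have fin: "finite ?I" "finite (S' - ?I)" "finite (S - ?I)" using assms by auto
  have "mset_set S' = mset_set ?I + mset_set (S' - ?I)"
    using mset_set_Union[OF fin(1,2)] by (simp add: Un_Diff_Int inf_commute Un_commute Int_absorb1 Un_absorb1)
  moreover have "?I \<union> (S - ?I) = S" by blast
  then have "mset_set S = mset_set ?I + mset_set (S - ?I)"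
    using mset_set_Union[OF fin(1,3)] by (metis Diff_disjoint)
  moreover have "(mset_set ?I + mset_set (S' - ?I), mset_set ?I + mset_set (S - ?I)) \<in> mult r"
  proof (rule one_step_implies_mult)
    show "mset_set (S - ?I) \<noteq> {#}" using fin assms by (auto simp: mset_set_empty_iff)
    show "\<forall>k\<in>#mset_set (S' - ?I). \<exists>j\<in>#mset_set (S - ?I). (k, j) \<in> r"
      using fin assms by auto
  qed
  ultimately show ?thesis by simp
qed

text \<open>On a finite set a well-founded relation is acyclic, hence so is its converse, which is
  then well-founded too.\<close>

lemma wf_finite_maximal:
  assumes "wf r" "finite S" "S \<noteq> {}"
  shows "\<exists>e\<in>S. \<forall>e'\<in>S. (e, e') \<notin> r"
proof -
  let ?r = "r \<inter> S \<times> S"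
  have "wf (?r\<inverse>)"
    using assms wf_acyclic[OF wf_subset[OF assms(1), of ?r]] by (intro finite_acyclic_wf_converse) auto
  then obtain e where "e \<in> S" "\<And>e'. (e', e) \<in> ?r\<inverse> \<Longrightarrow> e' \<notin> S"
    using assms(3) by (metis wfE_min all_not_in_conv)
  then show ?thesis by blast
qed

text \<open>The cone condition is solved at a maximal index \<open>e\<close> by \<open>loc\<close>
  and the solution is subtracted: \<open>e\<close> leaves the support and only smaller indices can
  enter. Induction on the joint support of \<open>y\<close> and \<open>x\<close>, ordered as a
  multiset, finishes the argument.\<close>

lemma triangular_qi:
  fixes Y :: "('y, 'p) dg_scheme" and Z :: "('z, 's) dg_scheme"
  assumes tY: "triangular Y M E r dM coord inc" and tZ: "triangular Z N E r dN coord' inc'"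
    and wf: "wf r" and f: "chain_map Y Z f" and f0: "f0 \<in> ahom M N"
    and coord_f: "\<And>e y. e \<in> E \<Longrightarrow> y \<in> carrier Y \<Longrightarrow> coord' e (f y) = f0 (coord e y)"
    and loc: "\<And>e y x. e \<in> E \<Longrightarrow> y \<in> carrier M \<Longrightarrow> x \<in> carrier N \<Longrightarrow> dM e y = \<zero>\<^bsub>M\<^esub> \<Longrightarrow> f0 y = dN e x \<Longrightarrow>
      \<exists>y'\<in>carrier M. \<exists>x'\<in>carrier N. dM e y' = y \<and> f0 y' = x \<oplus>\<^bsub>N\<^esub> dN e x'"
  shows "qi Y Z f"
proof (rule qiI[OF f])
  interpret Y: triangular Y M E r dM coord inc by (rule tY)
  interpret Z: triangular Z N E r dN coord' inc' by (rule tZ)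
  note fh = chain_mapD(1)[OF f] and fd = chain_mapD(3)[OF f]
  have fc: "y \<in> carrier Y \<Longrightarrow> f y \<in> carrier Z" for y using ahom_closed[OF fh] .
  let ?S = "\<lambda>y x. {e \<in> E. coord e y \<noteq> \<zero>\<^bsub>M\<^esub>} \<union> {e \<in> E. coord' e x \<noteq> \<zero>\<^bsub>N\<^esub>}"
  have S_fin: "finite (?S y x)" if "y \<in> carrier Y" "x \<in> carrier Z" for y x
    using Y.coord_finite[OF that(1)] Z.coord_finite[OF that(2)] by simp
  have "\<exists>y'\<in>carrier Y. \<exists>x'\<in>carrier Z. diff Y y' = y \<and> f y' = x \<oplus>\<^bsub>Z\<^esub> diff Z x'"
    if "y \<in> carrier Y" "x \<in> carrier Z" "diff Y y = \<zero>\<^bsub>Y\<^esub>" "f y = diff Z x" "s = mset_set (?S y x)" for y x s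
    using wf_mult[OF wf] that
  proof (induction s arbitrary: y x rule: wf_induct_rule)
    case (less s)
    note yx = less.prems(1-4)
    show ?case
    proof (cases "?S y x = {}")
      case True
      then have "y = \<zero>\<^bsub>Y\<^esub>" "x = \<zero>\<^bsub>Z\<^esub>" using Y.coord_zero[OF yx(1)] Z.coord_zero[OF yx(2)] by blast+
      moreover have "f \<zero>\<^bsub>Y\<^esub> = \<zero>\<^bsub>Z\<^esub>" using ahom_zero[OF Y.ag(2) Z.ag(2) fh] .
      ultimately show ?thesis by (intro bexI[of _ "\<zero>\<^bsub>Y\<^esub>"] bexI[of _ "\<zero>\<^bsub>Z\<^esub>"]) auto
    next
      case False
      obtain e where e: "e \<in> ?S y x" and top: "\<And>e'. e' \<in> ?S y x \<Longrightarrow> (e, e') \<notin> r"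
        using wf_finite_maximal[OF wf S_fin[OF yx(1,2)] False] by blast
      then have eE: "e \<in> E" by auto
      have ye: "coord e y \<in> carrier M" and xe: "coord' e x \<in> carrier N"
        using Y.coord_closed Z.coord_closed eE yx by auto
      have "dM e (coord e y) = \<zero>\<^bsub>M\<^esub>"
        using Y.coord_diff[OF yx(1) eE] top yx(3) ahom_zero[OF Y.ag(2,1) Y.coord_hom[OF eE]] by auto
      moreover have "f0 (coord e y) = dN e (coord' e x)"
        using Z.coord_diff[OF yx(2) eE] top yx(4) coord_f[OF eE yx(1)] by auto
      ultimately obtain y' x' where y'x': "y' \<in> carrier M" "x' \<in> carrier N" "dM e y' = coord e y"
        "f0 y' = coord' e x \<oplus>\<^bsub>N\<^esub> dN e x'"
        using loc[OF eE ye xe] by blast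
      let ?u = "inc e y'" and ?v = "inc' e x'"
      have u: "?u \<in> carrier Y" "?v \<in> carrier Z" "f ?u \<in> carrier Z"
        using Y.inc_closed[OF eE y'x'(1)] Z.inc_closed[OF eE y'x'(2)] fc by auto
      \<comment> \<open>Up to signs a boundary of the cone, formed from \<open>?u\<close> and
        \<open>?v\<close>, is subtracted. Thus \<open>f y1 = diff Z x1\<close> persists, and
        coordinate \<open>e\<close> vanishes in both, since \<open>f0 y'\<close> is coordinate
        \<open>e\<close> of \<open>x\<close> plus \<open>dN e x'\<close>.\<close>
      define y1 where "y1 = y \<ominus>\<^bsub>Y\<^esub> diff Y ?u"
      define x1 where "x1 = (x \<ominus>\<^bsub>Z\<^esub> f ?u) \<oplus>\<^bsub>Z\<^esub> diff Z ?v"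
      have y1: "y1 \<in> carrier Y" and x1: "x1 \<in> carrier Z" using yx u by (auto simp: y1_def x1_def)
      have dy1: "diff Y y1 = \<zero>\<^bsub>Y\<^esub>" using yx u by (simp add: y1_def Y.Y.diff_minus Y.Y.diff_diff Y.Y.minus_zero)
      have fy1: "f y1 = diff Z x1"
        using yx u ahom_minus[OF Y.ag(2) Z.ag(2) fh, of y "diff Y ?u"]
        by (simp add: y1_def x1_def Z.Y.diff_add Z.Y.diff_minus Z.Y.diff_diff fd)
      have cy1: "coord e' y1 = coord e' y \<ominus>\<^bsub>M\<^esub> coord e' (diff Y ?u)" if "e' \<in> E" for e'
        using ahom_minus[OF Y.ag(2,1) Y.coord_hom[OF that]] yx u by (simp add: y1_def)
      have cx1: "coord' e' x1 = (coord' e' x \<ominus>\<^bsub>N\<^esub> f0 (coord e' ?u)) \<oplus>\<^bsub>N\<^esub> coord' e' (diff Z ?v)" if "e' \<in> E" for e'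
        using ahom_minus[OF Z.ag(2,1) Z.coord_hom[OF that]] ahom_add[OF Z.coord_hom[OF that]] yx u coord_f[OF that u(1)]
        by (simp add: x1_def)
      have f00: "f0 \<zero>\<^bsub>M\<^esub> = \<zero>\<^bsub>N\<^esub>" using ahom_zero[OF Y.ag(1) Z.ag(1) f0] .
      have dNx': "dN e x' \<in> carrier N"
        using Z.diff_diag[OF eE y'x'(2)] Z.coord_closed[OF eE, of "diff Z ?v"] u by simp
      have "coord e y1 = \<zero>\<^bsub>M\<^esub>"
        using cy1[OF eE] Y.diff_diag[OF eE y'x'(1)] y'x' ye Y.M.eq_iff_minus[of "coord e y" "coord e y"] by auto
      moreover have "coord' e x1 = \<zero>\<^bsub>N\<^esub>"
      proof -
        have "coord' e x1 = (coord' e x \<ominus>\<^bsub>N\<^esub> (coord' e x \<oplus>\<^bsub>N\<^esub> dN e x')) \<oplus>\<^bsub>N\<^esub> dN e x'"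
          using cx1[OF eE] Y.coord_inc[OF eE y'x'(1)] Z.diff_diag[OF eE y'x'(2)] y'x' by simp
        also have "\<dots> = (coord' e x \<oplus>\<^bsub>N\<^esub> \<ominus>\<^bsub>N\<^esub> coord' e x) \<oplus>\<^bsub>N\<^esub> (\<ominus>\<^bsub>N\<^esub> dN e x' \<oplus>\<^bsub>N\<^esub> dN e x')"
          using xe dNx' by (simp add: a_minus_def Z.M.minus_add Z.M.a_ac)
        finally show ?thesis using xe dNx' by (simp add: Z.M.r_neg Z.M.l_neg)
      qed
      moreover have "coord e' y1 = \<zero>\<^bsub>M\<^esub>" if "e' \<in> E" "e' \<notin> ?S y x" "(e', e) \<notin> r" "e' \<noteq> e" for e'
        using that cy1[OF that(1)] Y.diff_lower[OF eE that(1,4,3) y'x'(1)] by (simp add: Y.M.minus_zero)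
      moreover have "coord' e' x1 = \<zero>\<^bsub>N\<^esub>" if "e' \<in> E" "e' \<notin> ?S y x" "(e', e) \<notin> r" "e' \<noteq> e" for e'
        using that cx1[OF that(1)] Z.diff_lower[OF eE that(1,4,3) y'x'(2)] Y.coord_inc_other[OF eE that(1,4) y'x'(1)]
        by (simp add: Z.M.minus_zero f00)
      ultimately have "?S y1 x1 \<subseteq> (?S y x - {e}) \<union> {e'. (e', e) \<in> r}" by blast
      then have "(mset_set (?S y1 x1), s) \<in> mult r"
        unfolding less.prems(5) using S_fin yx y1 x1 e by (intro mset_set_mult) auto
      from less.IH[OF this y1 x1 dy1 fy1 refl] obtain y2 x2 where
        y2: "y2 \<in> carrier Y" "x2 \<in> carrier Z" "diff Y y2 = y1" "f y2 = x1 \<oplus>\<^bsub>Z\<^esub> diff Z x2" by blast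
      have "diff Y (?u \<oplus>\<^bsub>Y\<^esub> y2) = y"
        using u y2 yx by (simp add: Y.Y.diff_add y1_def Y.Y.minus_cancel)
      moreover have "f (?u \<oplus>\<^bsub>Y\<^esub> y2) = x \<oplus>\<^bsub>Z\<^esub> diff Z (?v \<oplus>\<^bsub>Z\<^esub> x2)"
      proof -
        have "f (?u \<oplus>\<^bsub>Y\<^esub> y2) = f ?u \<oplus>\<^bsub>Z\<^esub> ((x \<ominus>\<^bsub>Z\<^esub> f ?u) \<oplus>\<^bsub>Z\<^esub> diff Z ?v \<oplus>\<^bsub>Z\<^esub> diff Z x2)"
          using ahom_add[OF fh u(1) y2(1)] y2 by (simp add: x1_def)
        also have "\<dots> = (f ?u \<oplus>\<^bsub>Z\<^esub> (x \<ominus>\<^bsub>Z\<^esub> f ?u)) \<oplus>\<^bsub>Z\<^esub> (diff Z ?v \<oplus>\<^bsub>Z\<^esub> diff Z x2)"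
          using u yx y2 by (simp add: Z.Y.a_assoc)
        finally show ?thesis using u yx y2 by (simp add: Z.Y.minus_cancel Z.Y.diff_add)
      qed
      ultimately show ?thesis using u y2 Y.Y.a_closed Z.Y.a_closed by blast
    qed
  qed
  then show "\<exists>y'\<in>carrier Y. \<exists>x'\<in>carrier Z. diff Y y' = y \<and> f y' = x \<oplus>\<^bsub>Z\<^esub> diff Z x'"
    if "y \<in> carrier Y" "x \<in> carrier Z" "diff Y y = \<zero>\<^bsub>Y\<^esub>" "f y = diff Z x" for y x
    using that by blast
qed

context twisted_module
begin

lemma T_triangular: "triangular T M I r (\<lambda>i m. koszul M (wt i) (diff M m)) (\<lambda>i x. x i) (delta M)"
proof -
  interpret T: dg_group T by (rule T_dg)
  have irr: "(i, i) \<notin> r" for i using wf by auto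
  have a_zero: "a i j = \<zero>" if "j \<in> I" "(i, j) \<notin> r" for i j using a_supp that by blast
  show ?thesis
  proof unfold_locales
    show "delta M e \<in> ahom M T" if "e \<in> I" for e by (rule delta_ahom[OF that])
    show "(\<lambda>x. x e) \<in> ahom T M" for e by (intro ahomI) (auto dest: fsuppD(1))
    fix x assume "x \<in> carrier T"
    then have "x \<in> fsupp I M" by simp
    from fsuppD(3)[OF this] show "finite {e \<in> I. x e \<noteq> \<zero>\<^bsub>M\<^esub>}" by (rule finite_subset[rotated]) auto
  next
    fix x assume "x \<in> carrier T" "\<And>e. e \<in> I \<Longrightarrow> x e = \<zero>\<^bsub>M\<^esub>"
    then show "x = \<zero>\<^bsub>T\<^esub>" by (auto simp: fsupp_def)
  next
    fix e m assume "e \<in> I" "m \<in> carrier M"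
    then show "diff T (delta M e m) e = koszul M (wt e) (diff M m)"
      using irr a_zero[of e e] by (simp add: diff_delta)
  next
    fix e e' m assume "e \<in> I" "e' \<noteq> e" "(e', e) \<notin> r" "m \<in> carrier M"
    then show "diff T (delta M e m) e' = \<zero>\<^bsub>M\<^esub>"
      using a_zero[of e e'] by (simp add: diff_delta)
  qed auto
qed

end

text \<open>Both sides are triangular over the cells, with subquotients \<open>M\<close> and
  \<open>N\<close>, and on each of these the map is \<open>f\<close>. The differential on copy
  \<open>i\<close> carries the sign (-1)^|i|; multiplying \<open>x\<close> and the solution
  \<open>y'\<close> by this sign reduces the local problem to the condition for
  \<open>f\<close>.\<close>

lemma (in twisting) twisted_qi:
  assumes M: "left_dg_module R M" and N: "left_dg_module R N" and f: "dg_module_morphism R M N f" and q: "qi M N f"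
  shows "qi (twisted I wt a R M) (twisted I wt a R N) (\<lambda>x i. f (x i))"
proof -
  interpret M: twisted_module R I wt a r M by (rule twisted_moduleI[OF M])
  interpret N: twisted_module R I wt a r N by (rule twisted_moduleI[OF N])
  show ?thesis
  proof (rule triangular_qi[OF M.T_triangular N.T_triangular wf, where ?f0.0=f])
    show "chain_map (twisted I wt a R M) (twisted I wt a R N) (\<lambda>x i. f (x i))"
      using twisted_map[OF M N f] by (simp add: dg_module_morphism_def)
    show "f \<in> ahom M N" using chain_mapD(1)[OF dg_module_morphismD(1)[OF f]] .
    fix i y x assume yx: "y \<in> carrier M" "x \<in> carrier N" "koszul M (wt i) (diff M y) = \<zero>\<^bsub>M\<^esub>" "f y = koszul N (wt i) (diff N x)"
    have "koszul M (wt i) (koszul M (wt i) (diff M y)) = diff M y"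
      using M.M.koszul_koszul[of "diff M y" "wt i" "wt i"] yx(1) by (simp add: koszul_def)
    then have "diff M y = \<zero>\<^bsub>M\<^esub>" using yx by simp
    moreover have "f y = diff N (koszul N (wt i) x)" using yx by (simp add: N.M.diff_koszul)
    ultimately obtain y' x' where y': "y' \<in> carrier M" "x' \<in> carrier N" "diff M y' = y" "f y' = koszul N (wt i) x \<oplus>\<^bsub>N\<^esub> diff N x'"
      using qiE[OF q yx(1), of "koszul N (wt i) x"] yx by auto
    have kk: "koszul M (wt i) (koszul M (wt i) z) = z" if "z \<in> carrier M" for z
      using that by (simp only: M.M.koszul_koszul) (simp add: koszul_def)
    have kk': "koszul N (wt i) (koszul N (wt i) z) = z" if "z \<in> carrier N" for z
      using that by (simp only: N.M.koszul_koszul) (simp add: koszul_def)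
    have "koszul M (wt i) (diff M (koszul M (wt i) y')) = y" using y' kk[of y] yx by (simp add: M.M.diff_koszul kk)
    moreover have "f (koszul M (wt i) y') = x \<oplus>\<^bsub>N\<^esub> koszul N (wt i) (diff N x')"
      using y' yx koszul_hom[OF M.M.M.abelian_group_axioms N.M.M.abelian_group_axioms chain_mapD(1)[OF dg_module_morphismD(1)[OF f]] y'(1)]
      by (simp add: N.M.koszul_add kk')
    ultimately show "\<exists>y'\<in>carrier M. \<exists>x'\<in>carrier N. koszul M (wt i) (diff M y') = y \<and> f y' = x \<oplus>\<^bsub>N\<^esub> koszul N (wt i) (diff N x')"
      using y' by (intro bexI[of _ "koszul M (wt i) y'"] bexI[of _ x']) auto
  qed auto
qed

section \<open>Tensor products\<close>

definition pure_tensor :: "('b, 'p) dg_scheme \<Rightarrow> ('b, 'l, 'm) dgmod_scheme \<Rightarrow> ('b, 'f, 'n) dgmod_scheme \<Rightarrow>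
    'l \<Rightarrow> 'f \<Rightarrow> ('l \<times> 'f \<Rightarrow>\<^sub>0 int) set" where
  "pure_tensor B L F l f = tensor_class B L F (frag_of (l, f))"

definition balanced :: "('b, 'p) dg_scheme \<Rightarrow> ('b, 'l, 'm) dgmod_scheme \<Rightarrow> ('b, 'f, 'n) dgmod_scheme \<Rightarrow>
    ('a, 'q) ring_scheme \<Rightarrow> ('l \<Rightarrow> 'f \<Rightarrow> 'a) \<Rightarrow> bool" where
  "balanced B L F N u \<longleftrightarrow>
     (\<forall>l\<in>carrier L. u l \<in> ahom F N) \<and> (\<forall>f\<in>carrier F. (\<lambda>l. u l f) \<in> ahom L N) \<and>
     (\<forall>b\<in>carrier B. \<forall>l\<in>carrier L. \<forall>f\<in>carrier F. u (act L b l) f = u l (act F b f))"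

text \<open>For balanced \<open>u\<close> such an \<open>h\<close> exists and is unique on the
  carrier, so the choice is harmless; it spares picking representatives each time.\<close>

definition tlift :: "('b, 'p) dg_scheme \<Rightarrow> ('b, 'l, 'm) dgmod_scheme \<Rightarrow> ('b, 'f, 'n) dgmod_scheme \<Rightarrow>
    ('a, 'q) ring_scheme \<Rightarrow> ('l \<Rightarrow> 'f \<Rightarrow> 'a) \<Rightarrow> ('l \<times> 'f \<Rightarrow>\<^sub>0 int) set \<Rightarrow> 'a" where
  "tlift B L F N u = (SOME h. h \<in> ahom (tensor B L F) N \<and>
     (\<forall>l\<in>carrier L. \<forall>f\<in>carrier F. h (pure_tensor B L F l f) = u l f))"

lemma frag_subset_induct [consumes 1, case_names zero diff one]:
  assumes "Poly_Mapping.keys x \<subseteq> S" "P 0"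
    "\<And>x y. Poly_Mapping.keys x \<subseteq> S \<Longrightarrow> Poly_Mapping.keys y \<subseteq> S \<Longrightarrow> P x \<Longrightarrow> P y \<Longrightarrow> P (x - y)"
    "\<And>a. a \<in> S \<Longrightarrow> P (frag_of a)"
  shows "P x"
  using assms by (rule free_Abelian_group_induct)

lemma balancedI:
  assumes "\<And>l. l \<in> carrier L \<Longrightarrow> u l \<in> ahom F N" "\<And>f. f \<in> carrier F \<Longrightarrow> (\<lambda>l. u l f) \<in> ahom L N"
    "\<And>b l f. b \<in> carrier B \<Longrightarrow> l \<in> carrier L \<Longrightarrow> f \<in> carrier F \<Longrightarrow> u (act L b l) f = u l (act F b f)"
  shows "balanced B L F N u"
  using assms by (auto simp: balanced_def)

lemma balancedD:
  assumes "balanced B L F N u"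
  shows "\<And>l. l \<in> carrier L \<Longrightarrow> u l \<in> ahom F N" "\<And>f. f \<in> carrier F \<Longrightarrow> (\<lambda>l. u l f) \<in> ahom L N"
    "\<And>b l f. b \<in> carrier B \<Longrightarrow> l \<in> carrier L \<Longrightarrow> f \<in> carrier F \<Longrightarrow> u (act L b l) f = u l (act F b f)"
    "\<And>l f. l \<in> carrier L \<Longrightarrow> f \<in> carrier F \<Longrightarrow> u l f \<in> carrier N"
proof -
  show 1: "\<And>l. l \<in> carrier L \<Longrightarrow> u l \<in> ahom F N" "\<And>f. f \<in> carrier F \<Longrightarrow> (\<lambda>l. u l f) \<in> ahom L N"
    "\<And>b l f. b \<in> carrier B \<Longrightarrow> l \<in> carrier L \<Longrightarrow> f \<in> carrier F \<Longrightarrow> u (act L b l) f = u l (act F b f)"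
    using assms unfolding balanced_def by blast+
  show "\<And>l f. l \<in> carrier L \<Longrightarrow> f \<in> carrier F \<Longrightarrow> u l f \<in> carrier N"
    using ahom_closed[OF 1(1)] .
qed

locale tensor_pair = L: right_dg_module B L + F: left_dg_module B F
  for B :: "('b, 'p) dg_scheme" and L :: "('b, 'l, 'm) dgmod_scheme" and F :: "('b, 'f, 'n) dgmod_scheme"
begin

abbreviation "S \<equiv> carrier L \<times> carrier F"
abbreviation "ker \<equiv> tensor_kernel B L F"
abbreviation "cl \<equiv> tensor_class B L F"
abbreviation "pt \<equiv> pure_tensor B L F"
abbreviation "T \<equiv> tensor B L F"

lemma relators_closed: "tensor_relators B L F \<subseteq> carrier (tensor_free L F)"
proof
  have k2: "Poly_Mapping.keys (frag_of p - frag_of q) \<subseteq> S" if "p \<in> S" "q \<in> S" for p q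
    using that keys_diff[of "frag_of p" "frag_of q"] by auto
  have k3: "Poly_Mapping.keys (frag_of p - frag_of q - frag_of s) \<subseteq> S"
    if "p \<in> S" "q \<in> S" "s \<in> S" for p q s
    using that keys_diff[of "frag_of p" "frag_of q"] keys_diff[of "frag_of p - frag_of q" "frag_of s"] by auto
  fix x assume "x \<in> tensor_relators B L F"
  then show "x \<in> carrier (tensor_free L F)"
    unfolding tensor_relators_def carrier_free_Abelian_group_iff
    by (elim UnE CollectE exE conjE; hypsubst)
      ((rule k3 k2, simp_all add: L.act_closed F.act_closed)+)
qed

lemma relators_keys: "x \<in> tensor_relators B L F \<Longrightarrow> Poly_Mapping.keys x \<subseteq> S"
  using subsetD[OF relators_closed] by (simp only: carrier_free_Abelian_group_iff)

lemma keys_add_closed: "Poly_Mapping.keys x \<subseteq> U \<Longrightarrow> Poly_Mapping.keys y \<subseteq> U \<Longrightarrow> Poly_Mapping.keys (x + y) \<subseteq> U"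
  using keys_add[of x y] by blast

lemma ker_subgroup: "subgroup ker (tensor_free L F)"
  unfolding tensor_kernel_def
  by (rule group.generate_is_subgroup[OF group_free_Abelian_group relators_closed])

lemma ker_closed: "x \<in> ker \<Longrightarrow> Poly_Mapping.keys x \<subseteq> S"
  using subgroup.mem_carrier[OF ker_subgroup] by simp

lemma ker_zero: "0 \<in> ker"
  using subgroup.one_closed[OF ker_subgroup] by simp

lemma ker_add: "x \<in> ker \<Longrightarrow> y \<in> ker \<Longrightarrow> x + y \<in> ker"
  using subgroup.m_closed[OF ker_subgroup, of x y] by simp

lemma ker_minus: "x \<in> ker \<Longrightarrow> - x \<in> ker"
  using subgroup.m_inv_closed[OF ker_subgroup, of x] ker_closed[of x] by simp

lemma ker_relator: "x \<in> tensor_relators B L F \<Longrightarrow> x \<in> ker"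
  unfolding tensor_kernel_def by (rule generate.incl)

lemma ker_induct:
  assumes "x \<in> ker" "P 0" "\<And>x. x \<in> tensor_relators B L F \<Longrightarrow> P x"
    "\<And>x. Poly_Mapping.keys x \<subseteq> S \<Longrightarrow> P x \<Longrightarrow> P (- x)"
    "\<And>x y. Poly_Mapping.keys x \<subseteq> S \<Longrightarrow> Poly_Mapping.keys y \<subseteq> S \<Longrightarrow> P x \<Longrightarrow> P y \<Longrightarrow> P (x + y)"
  shows "P x"
proof -
  have "P x \<and> Poly_Mapping.keys x \<subseteq> S" using assms(1) unfolding tensor_kernel_def
  proof (induction rule: generate.induct)
    case one then show ?case using assms(2) by simp
  next
    case (incl h) then show ?case using assms(3) relators_keys by simp
  next
    case (inv h)
    then have "Poly_Mapping.keys h \<subseteq> S" using relators_keys by simp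
    then show ?case using assms(3,4) inv by simp
  next
    case (eng h k) then show ?case using assms(5) keys_add_closed[of h S k] by simp
  qed
  then show ?thesis by simp
qed

lemma mem_cl: "y \<in> cl x \<longleftrightarrow> y - x \<in> ker"
proof -
  have "y \<in> cl x \<longleftrightarrow> (\<exists>k\<in>ker. y = k + x)"
    by (auto simp: tensor_class_def r_coset_def)
  also have "\<dots> \<longleftrightarrow> y - x \<in> ker" by (metis add_diff_cancel diff_add_cancel)
  finally show ?thesis .
qed

lemma cl_eq_iff: "cl x = cl y \<longleftrightarrow> x - y \<in> ker"
proof
  assume "cl x = cl y"
  moreover have "x \<in> cl x" using ker_zero by (simp add: mem_cl)
  ultimately show "x - y \<in> ker" using mem_cl by blast
next
  assume xy: "x - y \<in> ker"
  show "cl x = cl y"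
  proof (rule Set.set_eqI)
    fix z
    have "z - x \<in> ker \<longleftrightarrow> z - y \<in> ker"
      using ker_add[OF _ xy, of "z - x"] ker_add[OF _ ker_minus[OF xy], of "z - y"] by auto
    then show "z \<in> cl x \<longleftrightarrow> z \<in> cl y" by (simp add: mem_cl)
  qed
qed

lemma cl_self: "x \<in> cl x"
  using ker_zero by (simp add: mem_cl)

lemma cl_mult: "cl x <#>\<^bsub>tensor_free L F\<^esub> cl y = cl (x + y)"
proof (rule Set.set_eqI)
  fix z
  have "z \<in> cl x <#>\<^bsub>tensor_free L F\<^esub> cl y \<longleftrightarrow> (\<exists>p q. p - x \<in> ker \<and> q - y \<in> ker \<and> z = p + q)"
    unfolding mem_cl[symmetric] by (auto simp: set_mult_def)
  also have "\<dots> \<longleftrightarrow> z - (x + y) \<in> ker"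
  proof
    assume "\<exists>p q. p - x \<in> ker \<and> q - y \<in> ker \<and> z = p + q"
    then obtain p q where "p - x \<in> ker" "q - y \<in> ker" "z = p + q" by blast
    then show "z - (x + y) \<in> ker" using ker_add[of "p - x" "q - y"] by (simp add: algebra_simps)
  next
    assume "z - (x + y) \<in> ker"
    then show "\<exists>p q. p - x \<in> ker \<and> q - y \<in> ker \<and> z = p + q"
      using ker_zero by (intro exI[of _ "z - y"] exI[of _ y]) (simp add: algebra_simps)
  qed
  finally show "z \<in> cl x <#>\<^bsub>tensor_free L F\<^esub> cl y \<longleftrightarrow> z \<in> cl (x + y)" by (simp add: mem_cl)
qed

lemma carrier_T: "carrier T = cl ` {x. Poly_Mapping.keys x \<subseteq> S}"
  by (auto simp: tensor_def carrier_FactGroup tensor_class_def)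

lemma add_T: "cl x \<oplus>\<^bsub>T\<^esub> cl y = cl (x + y)"
  by (simp add: tensor_def cl_mult)

lemma zero_T: "\<zero>\<^bsub>T\<^esub> = cl 0"
proof -
  have "cl 0 = ker" by (auto simp: mem_cl)
  then show ?thesis by (simp add: tensor_def)
qed

lemma T_abelian: "abelian_group T"
proof (rule abelian_groupI)
  fix x y assume "x \<in> carrier T" "y \<in> carrier T"
  then obtain a b where ab: "Poly_Mapping.keys a \<subseteq> S" "x = cl a" "Poly_Mapping.keys b \<subseteq> S" "y = cl b"
    by (auto simp: carrier_T)
  then show "x \<oplus>\<^bsub>T\<^esub> y \<in> carrier T"
    using keys_add_closed[OF ab(1,3)] by (simp add: carrier_T add_T)
next
  fix x assume "x \<in> carrier T"
  then obtain a where "Poly_Mapping.keys a \<subseteq> S" "x = cl a" by (auto simp: carrier_T)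
  then show "\<exists>y\<in>carrier T. y \<oplus>\<^bsub>T\<^esub> x = \<zero>\<^bsub>T\<^esub>"
    by (intro bexI[of _ "cl (- a)"]) (auto simp: carrier_T add_T zero_T)
next
  fix x y z assume "x \<in> carrier T" "y \<in> carrier T" "z \<in> carrier T"
  then obtain a b c where abc: "x = cl a" "y = cl b" "z = cl c" by (auto simp: carrier_T)
  show "x \<oplus>\<^bsub>T\<^esub> y \<oplus>\<^bsub>T\<^esub> z = x \<oplus>\<^bsub>T\<^esub> (y \<oplus>\<^bsub>T\<^esub> z)" by (simp only: abc add_T add.assoc)
next
  fix x y assume "x \<in> carrier T" "y \<in> carrier T"
  then obtain a b where ab: "x = cl a" "y = cl b" by (auto simp: carrier_T)
  show "x \<oplus>\<^bsub>T\<^esub> y = y \<oplus>\<^bsub>T\<^esub> x" by (simp only: ab add_T add.commute)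
qed (auto simp: carrier_T add_T zero_T)

sublocale T: abelian_group T
  by (rule T_abelian)

lemma cl_closed: "Poly_Mapping.keys x \<subseteq> S \<Longrightarrow> cl x \<in> carrier T"
  by (auto simp: carrier_T)

lemma cl_minus: "Poly_Mapping.keys x \<subseteq> S \<Longrightarrow> cl (- x) = \<ominus>\<^bsub>T\<^esub> cl x"
  by (rule T.minus_equality[symmetric]) (auto simp: add_T zero_T cl_closed)

lemma cl_diff: "Poly_Mapping.keys x \<subseteq> S \<Longrightarrow> Poly_Mapping.keys y \<subseteq> S \<Longrightarrow> cl (x - y) = cl x \<ominus>\<^bsub>T\<^esub> cl y"
  unfolding a_minus_def cl_minus[symmetric] add_T by simp

lemma pt_closed: "l \<in> carrier L \<Longrightarrow> f \<in> carrier F \<Longrightarrow> pt l f \<in> carrier T"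
  by (auto simp: carrier_T pure_tensor_def)

lemma pt_add_left:
  assumes "l \<in> carrier L" "l' \<in> carrier L" "f \<in> carrier F"
  shows "pt (l \<oplus>\<^bsub>L\<^esub> l') f = pt l f \<oplus>\<^bsub>T\<^esub> pt l' f"
proof -
  have "frag_of (l \<oplus>\<^bsub>L\<^esub> l', f) - frag_of (l, f) - frag_of (l', f) \<in> ker"
    using assms by (intro ker_relator) (auto simp: tensor_relators_def)
  then show ?thesis by (simp add: pure_tensor_def add_T cl_eq_iff diff_diff_eq)
qed

lemma pt_add_right:
  assumes "l \<in> carrier L" "f \<in> carrier F" "f' \<in> carrier F"
  shows "pt l (f \<oplus>\<^bsub>F\<^esub> f') = pt l f \<oplus>\<^bsub>T\<^esub> pt l f'"
proof -
  have "frag_of (l, f \<oplus>\<^bsub>F\<^esub> f') - frag_of (l, f) - frag_of (l, f') \<in> ker"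
    using assms by (intro ker_relator) (auto simp: tensor_relators_def)
  then show ?thesis by (simp add: pure_tensor_def add_T cl_eq_iff diff_diff_eq)
qed

lemma pt_act:
  assumes "b \<in> carrier B" "l \<in> carrier L" "f \<in> carrier F"
  shows "pt (act L b l) f = pt l (act F b f)"
proof -
  have "frag_of (act L b l, f) - frag_of (l, act F b f) \<in> ker"
    using assms by (intro ker_relator) (auto simp: tensor_relators_def)
  then show ?thesis by (simp add: pure_tensor_def cl_eq_iff)
qed

lemma pt_left: "f \<in> carrier F \<Longrightarrow> (\<lambda>l. pt l f) \<in> ahom L T"
  by (intro ahomI) (simp_all add: pt_closed pt_add_left)

lemma pt_right: "l \<in> carrier L \<Longrightarrow> pt l \<in> ahom F T"
  by (intro ahomI) (simp_all add: pt_closed pt_add_right)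

lemmas agL = L.M.abelian_group_axioms and agF = F.M.abelian_group_axioms and agT = T.abelian_group_axioms

lemma pt_zero_left [simp]: "f \<in> carrier F \<Longrightarrow> pt \<zero>\<^bsub>L\<^esub> f = \<zero>\<^bsub>T\<^esub>"
  using ahom_zero[OF agL agT pt_left] .

lemma pt_zero_right [simp]: "l \<in> carrier L \<Longrightarrow> pt l \<zero>\<^bsub>F\<^esub> = \<zero>\<^bsub>T\<^esub>"
  using ahom_zero[OF agF agT pt_right] .

lemma pt_neg_left: "l \<in> carrier L \<Longrightarrow> f \<in> carrier F \<Longrightarrow> pt (\<ominus>\<^bsub>L\<^esub> l) f = \<ominus>\<^bsub>T\<^esub> pt l f"
  using ahom_neg[OF agL agT pt_left] .

lemma T_induct [consumes 1, case_names pure add]: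
  assumes "x \<in> carrier T" "\<And>l f. l \<in> carrier L \<Longrightarrow> f \<in> carrier F \<Longrightarrow> P (pt l f)"
    "\<And>x y. x \<in> carrier T \<Longrightarrow> y \<in> carrier T \<Longrightarrow> P x \<Longrightarrow> P y \<Longrightarrow> P (x \<oplus>\<^bsub>T\<^esub> y)"
  shows "P x"
proof -
  obtain a where a: "Poly_Mapping.keys a \<subseteq> S" "x = cl a" using assms(1) by (auto simp: carrier_T)
  \<comment> \<open>The free group is generated under differences, but the negative of a pure tensor
    is the pure tensor with the left factor negated. Carrying negatives along turns differences into
    sums.\<close>
  let ?Q = "\<lambda>a. P (cl a) \<and> P (cl (- a))"
  have "?Q a \<and> Poly_Mapping.keys a \<subseteq> S" using a(1)
  proof (induction a rule: frag_subset_induct)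
    case zero
    show ?case using assms(2)[of "\<zero>\<^bsub>L\<^esub>" "\<zero>\<^bsub>F\<^esub>"] by (simp add: zero_T)
  next
    case (diff a b)
    have "cl (a - b) = cl a \<oplus>\<^bsub>T\<^esub> cl (- b)" "cl (- (a - b)) = cl b \<oplus>\<^bsub>T\<^esub> cl (- a)" by (simp_all add: add_T)
    moreover have "cl a \<in> carrier T" "cl (- a) \<in> carrier T" "cl b \<in> carrier T" "cl (- b) \<in> carrier T"
      using diff by (auto intro!: cl_closed)
    ultimately show ?case using diff assms(3) keys_diff[of a b] by auto
  next
    case (one p)
    then obtain l f where p: "p = (l, f)" "l \<in> carrier L" "f \<in> carrier F" by auto
    have "cl (- frag_of p) = pt (\<ominus>\<^bsub>L\<^esub> l) f" using p pt_neg_left[of l f] by (simp add: cl_minus pure_tensor_def)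
    then show ?case using p assms(2)[of l f] assms(2)[of "\<ominus>\<^bsub>L\<^esub> l" f] by (simp add: pure_tensor_def)
  qed
  then show ?thesis using a by simp
qed

lemma T_hom_eq:
  assumes "g \<in> ahom T N" "h \<in> ahom T N" "\<And>l f. l \<in> carrier L \<Longrightarrow> f \<in> carrier F \<Longrightarrow> g (pt l f) = h (pt l f)" "x \<in> carrier T"
  shows "g x = h x"
  using assms(4) by (induction x rule: T_induct) (simp_all add: assms(3) ahom_add[OF assms(1)] ahom_add[OF assms(2)])

lemma T_universal:
  assumes N: "abelian_group N" and u: "balanced B L F N u"
  obtains h where "h \<in> hom (tensor_free L F) (add_monoid N)" "\<And>l f. l \<in> carrier L \<Longrightarrow> f \<in> carrier F \<Longrightarrow> h (frag_of (l, f)) = u l f"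
    "\<And>x. x \<in> ker \<Longrightarrow> h x = \<zero>\<^bsub>N\<^esub>"
proof -
  interpret N: abelian_group N by fact
  note uD = balancedD[OF u]
  have "(\<lambda>(l, f). u l f) ` S \<subseteq> carrier (add_monoid N)" using uD(4) by auto
  from comm_group.free_Abelian_group_universal[OF N.a_comm_group this] obtain h where
    h: "h \<in> hom (tensor_free L F) (add_monoid N)" "\<And>p. p \<in> S \<Longrightarrow> h (frag_of p) = (case p of (l, f) \<Rightarrow> u l f)"
    by metis
  have hc: "h x \<in> carrier N" if "Poly_Mapping.keys x \<subseteq> S" for x using h(1) that by (auto simp: hom_def)
  have ha: "h (x + y) = h x \<oplus>\<^bsub>N\<^esub> h y" if "Poly_Mapping.keys x \<subseteq> S" "Poly_Mapping.keys y \<subseteq> S" for x y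
    using h(1) that by (auto simp: hom_def)
  have h0: "h 0 = \<zero>\<^bsub>N\<^esub>" using ha[of 0 0] hc[of 0] by simp
  have hm: "h (- x) = \<ominus>\<^bsub>N\<^esub> h x" if "Poly_Mapping.keys x \<subseteq> S" for x
    using ha[of "- x" x] h0 that hc by (intro N.minus_equality[symmetric]) auto
  have hd: "h (x - y) = h x \<ominus>\<^bsub>N\<^esub> h y" if "Poly_Mapping.keys x \<subseteq> S" "Poly_Mapping.keys y \<subseteq> S" for x y
    using ha[of x "- y"] hm that by (simp add: a_minus_def)
  have h3: "h (frag_of p - frag_of q - frag_of s) = h (frag_of p) \<ominus>\<^bsub>N\<^esub> (h (frag_of q) \<oplus>\<^bsub>N\<^esub> h (frag_of s))"
    if "p \<in> S" "q \<in> S" "s \<in> S" for p q s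
  proof -
    have "Poly_Mapping.keys (frag_of q + frag_of s) \<subseteq> S" using that keys_add[of "frag_of q" "frag_of s"] by auto
    then show ?thesis using hd[of "frag_of p" "frag_of q + frag_of s"] ha[of "frag_of q" "frag_of s"] that
      by (simp add: diff_diff_eq)
  qed
  have uc: "u l f \<in> carrier N" if "l \<in> carrier L" "f \<in> carrier F" for l f using uD(4) that .
  have zz: "x \<ominus>\<^bsub>N\<^esub> x = \<zero>\<^bsub>N\<^esub>" if "x \<in> carrier N" for x using that N.eq_iff_minus[of x x] by simp
  have rel: "h x = \<zero>\<^bsub>N\<^esub>" if "x \<in> tensor_relators B L F" for x
    using that unfolding tensor_relators_def
    by (elim UnE CollectE exE conjE; hypsubst)
      (simp_all add: h3 h(2) hd uD(3) ahom_add[OF uD(1)] ahom_add[OF uD(2)] uc zz L.act_closed F.act_closed)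
  have "h x = \<zero>\<^bsub>N\<^esub>" if "x \<in> ker" for x
    using that by (rule ker_induct) (simp_all add: h0 rel hm ha)
  then show ?thesis using that h by auto
qed

lemma tlift:
  assumes N: "abelian_group N" and u: "balanced B L F N u"
  shows "tlift B L F N u \<in> ahom T N"
    and "\<And>l f. l \<in> carrier L \<Longrightarrow> f \<in> carrier F \<Longrightarrow> tlift B L F N u (pt l f) = u l f"
proof -
  interpret N: abelian_group N by fact
  obtain h where h: "h \<in> hom (tensor_free L F) (add_monoid N)"
    "\<And>l f. l \<in> carrier L \<Longrightarrow> f \<in> carrier F \<Longrightarrow> h (frag_of (l, f)) = u l f" "\<And>x. x \<in> ker \<Longrightarrow> h x = \<zero>\<^bsub>N\<^esub>"
    using T_universal[OF N u] by blast
  have hc: "h x \<in> carrier N" if "Poly_Mapping.keys x \<subseteq> S" for x using h(1) that by (auto simp: hom_def)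
  have ha: "h (x + y) = h x \<oplus>\<^bsub>N\<^esub> h y" if "Poly_Mapping.keys x \<subseteq> S" "Poly_Mapping.keys y \<subseteq> S" for x y
    using h(1) that by (auto simp: hom_def)
  define h' where "h' U = h (SOME x. x \<in> U \<and> Poly_Mapping.keys x \<subseteq> S)" for U
  have h': "h' (cl x) = h x" if x: "Poly_Mapping.keys x \<subseteq> S" for x
  proof -
    let ?y = "SOME y. y \<in> cl x \<and> Poly_Mapping.keys y \<subseteq> S"
    have y: "?y \<in> cl x \<and> Poly_Mapping.keys ?y \<subseteq> S" by (rule someI[of _ x]) (simp add: x cl_self)
    then have k: "?y - x \<in> ker" by (simp add: mem_cl)
    have "h ?y = h (?y - x) \<oplus>\<^bsub>N\<^esub> h x" using ha[OF ker_closed[OF k] x] by simp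
    then show ?thesis using h(3)[OF k] hc[OF x] by (simp add: h'_def)
  qed
  have "h' \<in> ahom T N"
  proof (rule ahomI)
    fix x y assume "x \<in> carrier T" "y \<in> carrier T"
    then obtain a b where ab: "Poly_Mapping.keys a \<subseteq> S" "x = cl a" "Poly_Mapping.keys b \<subseteq> S" "y = cl b"
      by (auto simp: carrier_T)
    then have "Poly_Mapping.keys (a + b) \<subseteq> S" using keys_add[of a b] by auto
    then show "h' (x \<oplus>\<^bsub>T\<^esub> y) = h' x \<oplus>\<^bsub>N\<^esub> h' y" using ab ha by (simp add: add_T h')
  qed (auto simp: carrier_T h' hc)
  then have "\<exists>h. h \<in> ahom T N \<and> (\<forall>l\<in>carrier L. \<forall>f\<in>carrier F. h (pt l f) = u l f)"
    using h(2) by (intro exI[of _ h']) (simp add: pure_tensor_def h')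
  from someI_ex[OF this] show "tlift B L F N u \<in> ahom T N"
    "\<And>l f. l \<in> carrier L \<Longrightarrow> f \<in> carrier F \<Longrightarrow> tlift B L F N u (pt l f) = u l f"
    unfolding tlift_def[symmetric] by auto
qed

end

text \<open>The differential and the induced maps on a tensor product are defined as unions over
  representatives. The homomorphism from the universal property agrees with
  \<open>frag_extend g\<close> on the free group, so the latter respects the kernel and all members
  of the union coincide.\<close>

lemma union_map:
  assumes P: "tensor_pair B L F" and Q: "tensor_pair B' L' F'"
    and bal: "balanced B L F (tensor B' L' F') (\<lambda>l f. tensor_class B' L' F' (g (l, f)))"
    and keys: "\<forall>p\<in>carrier L \<times> carrier F. Poly_Mapping.keys (g p) \<subseteq> carrier L' \<times> carrier F'"
  defines "D \<equiv> \<lambda>U. \<Union>x\<in>U. tensor_class B' L' F' (frag_extend g x)"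
  shows "D \<in> ahom (tensor B L F) (tensor B' L' F')"
    and "l \<in> carrier L \<Longrightarrow> f \<in> carrier F \<Longrightarrow> D (pure_tensor B L F l f) = tensor_class B' L' F' (g (l, f))"
    and "Poly_Mapping.keys x \<subseteq> carrier L \<times> carrier F \<Longrightarrow> D (tensor_class B L F x) = tensor_class B' L' F' (frag_extend g x)"
proof -
  interpret P: tensor_pair B L F by fact
  interpret Q: tensor_pair B' L' F' by fact
  obtain h where h: "h \<in> hom (tensor_free L F) (add_monoid Q.T)"
    "\<And>l f. l \<in> carrier L \<Longrightarrow> f \<in> carrier F \<Longrightarrow> h (frag_of (l, f)) = Q.cl (g (l, f))" "\<And>x. x \<in> P.ker \<Longrightarrow> h x = \<zero>\<^bsub>Q.T\<^esub>"
    using P.T_universal[OF Q.T_abelian bal] by blast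
  have ha: "h (x + y) = h x \<oplus>\<^bsub>Q.T\<^esub> h y" if "Poly_Mapping.keys x \<subseteq> P.S" "Poly_Mapping.keys y \<subseteq> P.S" for x y
    using h(1) that by (auto simp: hom_def)
  have hc: "h x \<in> carrier Q.T" if "Poly_Mapping.keys x \<subseteq> P.S" for x using h(1) that by (auto simp: hom_def)
  have gk: "Poly_Mapping.keys (frag_extend g x) \<subseteq> Q.S" if "Poly_Mapping.keys x \<subseteq> P.S" for x
    using keys_frag_extend[of g x] keys that by blast
  have h_eq: "h x = Q.cl (frag_extend g x)" if "Poly_Mapping.keys x \<subseteq> P.S" for x
    using that
  proof (induction x rule: frag_subset_induct)
    case zero
    have "h 0 = \<zero>\<^bsub>Q.T\<^esub>" by (rule h(3)[OF P.ker_zero])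
    then show ?case by (simp add: Q.zero_T)
  next
    case (diff x y)
    have "Poly_Mapping.keys (x - y) \<subseteq> P.S" using keys_diff[of x y] diff by auto
    then have "h x = h (x - y) \<oplus>\<^bsub>Q.T\<^esub> h y" "h (x - y) \<in> carrier Q.T" using ha[of "x - y" y] diff hc by simp_all
    then have "h (x - y) = h x \<ominus>\<^bsub>Q.T\<^esub> h y" using hc[of y] diff by (simp add: Q.T.minus_cancel)
    then show ?case using diff gk by (simp add: frag_extend_diff Q.cl_diff)
  next
    case (one p) then show ?case using h(2) by auto
  qed
  show D: "D (P.cl x) = Q.cl (frag_extend g x)" if x: "Poly_Mapping.keys x \<subseteq> P.S" for x
  proof -
    have "Q.cl (frag_extend g y) = Q.cl (frag_extend g x)" if "y \<in> P.cl x" for y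
    proof -
      have k: "y - x \<in> P.ker" using that by (simp add: P.mem_cl)
      have "Q.cl (frag_extend g (y - x)) = Q.cl 0" using h(3)[OF k] h_eq[OF P.ker_closed[OF k]] by (simp add: Q.zero_T)
      then show ?thesis by (simp add: Q.cl_eq_iff frag_extend_diff)
    qed
    then show ?thesis unfolding D_def by (intro UN_constant_eq[OF P.cl_self]) blast
  qed
  then show "D (P.pt l f) = Q.cl (g (l, f))" if "l \<in> carrier L" "f \<in> carrier F"
    using that D[of "frag_of (l, f)"] by (simp add: pure_tensor_def)
  show "D \<in> ahom P.T Q.T"
  proof (rule ahomI)
    fix x y assume "x \<in> carrier P.T" "y \<in> carrier P.T"
    then obtain a b where ab: "Poly_Mapping.keys a \<subseteq> P.S" "x = P.cl a" "Poly_Mapping.keys b \<subseteq> P.S" "y = P.cl b"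
      by (auto simp: P.carrier_T)
    then have "Poly_Mapping.keys (a + b) \<subseteq> P.S" using keys_add[of a b] by auto
    then show "D (x \<oplus>\<^bsub>P.T\<^esub> y) = D x \<oplus>\<^bsub>Q.T\<^esub> D y"
      using ab by (simp add: P.add_T Q.add_T D frag_extend_add)
  qed (auto simp: P.carrier_T D Q.cl_closed gk)
qed

section \<open>Differential and grading of a tensor product\<close>

context tensor_pair
begin

text \<open>The Leibniz rules for \<open>L\<close> and for \<open>F\<close> produce the same three
  terms; in the middle one \<open>diff B b\<close> crosses the tensor sign next to
  \<open>signed L l\<close>.\<close>

lemma balanced_diff: "balanced B L F T (\<lambda>l f. pt (diff L l) f \<oplus>\<^bsub>T\<^esub> pt (signed L l) (diff F f))"
proof (rule balancedI)
  fix l assume l: "l \<in> carrier L"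
  show "(\<lambda>f. pt (diff L l) f \<oplus>\<^bsub>T\<^esub> pt (signed L l) (diff F f)) \<in> ahom F T"
    using l by (intro T.ahom_plus pt_right ahom_comp[OF F.diff_hom]) auto
next
  fix f assume f: "f \<in> carrier F"
  show "(\<lambda>l. pt (diff L l) f \<oplus>\<^bsub>T\<^esub> pt (signed L l) (diff F f)) \<in> ahom L T"
    using f by (intro T.ahom_plus ahom_comp[OF L.diff_hom pt_left] ahom_comp[OF L.signed_ahom pt_left]) auto
next
  fix b l f assume b: "b \<in> carrier B" and l: "l \<in> carrier L" and f: "f \<in> carrier F"
  show "pt (diff L (act L b l)) f \<oplus>\<^bsub>T\<^esub> pt (signed L (act L b l)) (diff F f) =
      pt (diff L l) (act F b f) \<oplus>\<^bsub>T\<^esub> pt (signed L l) (diff F (act F b f))"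
    using b l f
    by (simp add: L.act_leibniz_signed F.act_leibniz_signed L.signed_act pt_add_left pt_add_right pt_act
        L.act_closed F.act_closed pt_closed T.a_assoc)
qed

lemma diff_T_eq: "diff T = (\<lambda>U. \<Union>x\<in>U. cl (frag_extend (\<lambda>(l, f). frag_of (diff L l, f) + frag_of (signed L l, diff F f)) x))"
  by (simp add: tensor_def)

lemma diff_T: "diff T \<in> ahom T T"
  and diff_pt: "l \<in> carrier L \<Longrightarrow> f \<in> carrier F \<Longrightarrow> diff T (pt l f) = pt (diff L l) f \<oplus>\<^bsub>T\<^esub> pt (signed L l) (diff F f)"
proof -
  let ?g = "\<lambda>(l, f). frag_of (diff L l, f) + frag_of (signed L l, diff F f)"
  have bal: "balanced B L F T (\<lambda>l f. cl (?g (l, f)))"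
    using balanced_diff by (simp add: add_T[symmetric] pure_tensor_def)
  have keys: "\<forall>p\<in>S. Poly_Mapping.keys (?g p) \<subseteq> S"
    by (auto dest!: subsetD[OF keys_add])
  note um = union_map[OF tensor_pair_axioms tensor_pair_axioms bal keys, folded diff_T_eq]
  show "diff T \<in> ahom T T" by (rule um(1))
  show "diff T (pt l f) = pt (diff L l) f \<oplus>\<^bsub>T\<^esub> pt (signed L l) (diff F f)" if "l \<in> carrier L" "f \<in> carrier F"
    using um(2)[OF that] by (simp add: diff_T_eq add_T[symmetric] pure_tensor_def)
qed

lemma gr_T: "gr T n = cl ` {x. Poly_Mapping.keys x \<subseteq> (\<Union>i. gr L i \<times> gr F (n - i))}"
  by (auto simp: tensor_def)

lemma gr_S: "(\<Union>i. gr L i \<times> gr F (n - i)) \<subseteq> S"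
  using L.M.gr_closed F.M.gr_closed by blast

lemma pt_gr: "l \<in> gr L i \<Longrightarrow> f \<in> gr F j \<Longrightarrow> pt l f \<in> gr T (i + j)"
  unfolding gr_T pure_tensor_def by (intro imageI CollectI) (auto intro!: exI[of _ i])

lemma gr_T_induct [consumes 1, case_names pure diff]:
  assumes "x \<in> gr T n" "\<And>i l f. l \<in> gr L i \<Longrightarrow> f \<in> gr F (n - i) \<Longrightarrow> P (pt l f)"
    "\<And>x y. x \<in> gr T n \<Longrightarrow> y \<in> gr T n \<Longrightarrow> x \<in> carrier T \<Longrightarrow> y \<in> carrier T \<Longrightarrow> P x \<Longrightarrow> P y \<Longrightarrow> P (x \<ominus>\<^bsub>T\<^esub> y)"
  shows "P x"
proof -
  let ?S = "\<Union>i. gr L i \<times> gr F (n - i)"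
  obtain a where a: "Poly_Mapping.keys a \<subseteq> ?S" "x = cl a" using assms(1) by (auto simp: gr_T)
  have "P (cl a) \<and> Poly_Mapping.keys a \<subseteq> ?S" using a(1)
  proof (induction a rule: frag_subset_induct)
    case zero
    show ?case using assms(2)[of "\<zero>\<^bsub>L\<^esub>" 0 "\<zero>\<^bsub>F\<^esub>"] by (simp add: zero_T)
  next
    case (diff a b)
    have "cl (a - b) = cl a \<ominus>\<^bsub>T\<^esub> cl b" using diff gr_S[of n] by (intro cl_diff) blast+
    moreover have "cl a \<in> gr T n" "cl b \<in> gr T n" using diff by (auto simp: gr_T)
    moreover have "cl a \<in> carrier T" "cl b \<in> carrier T" using diff cl_closed[OF order_trans[OF _ gr_S[of n]]] by simp_all
    ultimately show ?case using diff assms(3) keys_diff[of a b] by auto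
  next
    case (one p)
    then show ?case using assms(2) by (auto simp: pure_tensor_def)
  qed
  then show ?thesis using a by simp
qed

lemma gr_T_closed: "x \<in> gr T n \<Longrightarrow> x \<in> carrier T"
  unfolding gr_T by (elim imageE CollectE) (simp only: cl_closed[OF order_trans[OF _ gr_S]])

lemma gr_T_subgroup: "subgroup (gr T n) (add_monoid T)"
proof (rule subgroup_addI[OF T_abelian])
  show "gr T n \<subseteq> carrier T" using gr_T_closed by auto
  show "\<zero>\<^bsub>T\<^esub> \<in> gr T n" by (auto simp: gr_T zero_T)
  show "x \<oplus>\<^bsub>T\<^esub> y \<in> gr T n" if "x \<in> gr T n" "y \<in> gr T n" for x y
  proof -
    obtain a b where ab: "Poly_Mapping.keys a \<subseteq> (\<Union>i. gr L i \<times> gr F (n - i))" "x = cl a"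
      "Poly_Mapping.keys b \<subseteq> (\<Union>i. gr L i \<times> gr F (n - i))" "y = cl b" using \<open>x \<in> gr T n\<close> \<open>y \<in> gr T n\<close> by (auto simp: gr_T)
    then have "Poly_Mapping.keys (a + b) \<subseteq> (\<Union>i. gr L i \<times> gr F (n - i))" using keys_add[of a b] by blast
    then show ?thesis using ab by (auto simp: gr_T add_T)
  qed
  show "\<ominus>\<^bsub>T\<^esub> x \<in> gr T n" if x: "x \<in> gr T n" for x
  proof -
    obtain a where a: "Poly_Mapping.keys a \<subseteq> (\<Union>i. gr L i \<times> gr F (n - i))" "x = cl a" using x by (auto simp: gr_T)
    then have "\<ominus>\<^bsub>T\<^esub> x = cl (- a)" using cl_minus[OF order_trans[OF a(1) gr_S]] by simp
    then show ?thesis using a by (auto simp: gr_T)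
  qed
qed

text \<open>The component of degree \<open>n\<close> of l \<otimes> f, that is, the sum of the
  tensors of components of degrees \<open>i\<close> and \<open>n - i\<close>. The grading of a
  tensor product is given by generators; these maps are the projections that show it to be a direct
  sum.\<close>

definition comp_part :: "int \<Rightarrow> 'l \<Rightarrow> 'f \<Rightarrow> ('l \<times> 'f \<Rightarrow>\<^sub>0 int) set" where
  "comp_part n l f = fs_ext L T (\<lambda>i m. pt m (hcomp F f (n - i))) (hcomp L l)"

lemma hcomp_fsupp: "l \<in> carrier L \<Longrightarrow> hcomp L l \<in> fsupp UNIV L"
  by (simp add: fsupp_def L.M.hcomp_closed L.M.hcomp_finite)

lemma comp_part_homogeneous:
  assumes "l \<in> gr L i" "f \<in> carrier F"
  shows "comp_part n l f = pt l (hcomp F f (n - i))"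
proof -
  interpret ab_hom_family L T UNIV "\<lambda>i m. pt m (hcomp F f (n - i))"
    by unfold_locales (simp add: pt_left F.M.hcomp_closed assms)
  have "hcomp L l = delta L i l" using assms by (intro ext) (simp add: L.M.hcomp_homogeneous delta_def)
  then show ?thesis using fs_ext_delta[of i l] L.M.gr_closed[OF assms(1)] by (simp add: comp_part_def)
qed

lemma comp_part_left: "f \<in> carrier F \<Longrightarrow> (\<lambda>l. comp_part n l f) \<in> ahom L T"
proof -
  assume f: "f \<in> carrier F"
  interpret ab_hom_family L T UNIV "\<lambda>i m. pt m (hcomp F f (n - i))"
    by unfold_locales (simp add: pt_left F.M.hcomp_closed f)
  have "hcomp L (l \<oplus>\<^bsub>L\<^esub> l') = (\<lambda>i. hcomp L l i \<oplus>\<^bsub>L\<^esub> hcomp L l' i)" if "l \<in> carrier L" "l' \<in> carrier L" for l l'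
    using that by (intro ext) (simp add: L.M.hcomp_add)
  then show ?thesis
    by (intro ahomI) (simp_all add: comp_part_def hcomp_fsupp fs_ext_closed fs_ext_add)
qed

lemma comp_part_right: "l \<in> carrier L \<Longrightarrow> comp_part n l \<in> ahom F T"
proof (induction l rule: L.M.graded_induct)
  case (homogeneous i l)
  have "(\<lambda>f. pt l (hcomp F f (n - i))) \<in> ahom F T"
    using L.M.gr_closed[OF homogeneous] by (intro ahom_comp[OF F.M.hcomp_ahom] pt_right)
  then show ?case
    using comp_part_homogeneous[OF homogeneous] by (auto simp: hom_def)
next
  case (add l l')
  then show ?case using T.ahom_plus[OF add(3,4)] ahom_add[OF comp_part_left add(1,2)] by (auto simp: hom_def)
qed

text \<open>For \<open>b\<close> of degree \<open>k\<close> and \<open>l\<close> of degree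
  \<open>j\<close> the right factor is cut at degree n - (j + k) before \<open>b\<close> has moved
  across and at degree n - j afterwards. The two agree since \<open>b\<close> raises degrees by
  \<open>k\<close>.\<close>

lemma balanced_comp_part: "balanced B L F T (comp_part n)"
proof (rule balancedI)
  fix b l f assume b: "b \<in> carrier B" and l: "l \<in> carrier L" and f: "f \<in> carrier F"
  show "comp_part n (act L b l) f = comp_part n l (act F b f)" using b
  proof (induction b rule: L.B.graded_induct)
    case (homogeneous k b)
    note bk = homogeneous
    have b: "b \<in> carrier B" using L.B.gr_closed[OF bk] .
    show ?case using l
    proof (induction l rule: L.M.graded_induct)
      case (homogeneous j l)
      have l: "l \<in> carrier L" using L.M.gr_closed[OF homogeneous] .
      have "hcomp F (act F b f) (n - (j + k) + k) = act F b (hcomp F f (n - (j + k)))"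
        using F.act_degree[OF bk] f
        by (intro hcomp_hom[OF F.M.graded_group_axioms F.M.graded_group_axioms F.act_right[OF b]]) (auto simp: add.commute)
      then show ?case
        using b l f comp_part_homogeneous[OF L.act_degree[OF bk homogeneous] f] comp_part_homogeneous[OF homogeneous F.act_closed[OF b f]]
        by (simp add: pt_act F.M.hcomp_closed algebra_simps)
    next
      case (add l l')
      then show ?case using b f
        by (simp add: L.act_add_right L.act_closed F.act_closed ahom_add[OF comp_part_left])
    qed
  next
    case (add b c)
    then show ?case using l f
      by (simp add: L.act_add_left F.act_add_left L.act_closed F.act_closed ahom_add[OF comp_part_left] ahom_add[OF comp_part_right])
  qed
qed (simp_all add: comp_part_left comp_part_right)

lemma T_graded: "graded_group T"
proof (rule graded_groupI[where p="\<lambda>n. tlift B L F T (comp_part n)"])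
  note tl = tlift[OF T_abelian balanced_comp_part]
  show "abelian_group T" by (rule T_abelian)
  show "subgroup (gr T n) (add_monoid T)" for n by (rule gr_T_subgroup)
  show "tlift B L F T (comp_part n) \<in> ahom T T" for n by (rule tl)
  have pp: "tlift B L F T (comp_part n) (pt l f) = (if n = i + j then pt l f else \<zero>\<^bsub>T\<^esub>)"
    if "l \<in> gr L i" "f \<in> gr F j" for n l f i j
    using that tl(2) L.M.gr_closed F.M.gr_closed
    by (auto simp: comp_part_homogeneous F.M.hcomp_homogeneous)
  show "tlift B L F T (comp_part n) x = x" if "x \<in> gr T n" for x n
    using that
  proof (induction x rule: gr_T_induct)
    case (pure i l f) then show ?case using pp[OF pure, of n] by simp
  next
    case (diff x y) then show ?case using ahom_minus[OF T_abelian T_abelian tl(1)] by simp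
  qed
  show "tlift B L F T (comp_part n) x = \<zero>\<^bsub>T\<^esub>" if "x \<in> gr T m" "m \<noteq> n" for x n m
    using that(1)
  proof (induction x rule: gr_T_induct)
    case (pure i l f) then show ?case using pp[OF pure, of n] that(2) by simp
  next
    case (diff x y) then show ?case using ahom_minus[OF T_abelian T_abelian tl(1)] by (simp add: T.minus_zero)
  qed
  fix x P assume x: "x \<in> carrier T" and hom: "\<And>n x. x \<in> gr T n \<Longrightarrow> P x"
    and padd: "\<And>x y. x \<in> carrier T \<Longrightarrow> y \<in> carrier T \<Longrightarrow> P x \<Longrightarrow> P y \<Longrightarrow> P (x \<oplus>\<^bsub>T\<^esub> y)"
  from x show "P x"
  proof (induction x rule: T_induct)
    case (pure l f)
    from pure(1) show ?case
    proof (induction l rule: L.M.graded_induct)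
      case (homogeneous i l)
      note li = homogeneous
      from pure(2) show ?case
      proof (induction f rule: F.M.graded_induct)
        case (homogeneous j f)
        show ?case by (rule hom[OF pt_gr[OF li homogeneous]])
      next
        case (add f f')
        then show ?case using L.M.gr_closed[OF li] by (simp add: pt_add_right padd pt_closed)
      qed
    next
      case (add l l')
      then show ?case using pure by (simp add: pt_add_left padd pt_closed)
    qed
  qed (rule padd)
qed

lemma T_dg: "dg_group T"
proof (rule dg_groupI[OF T_graded diff_T])
  interpret T': graded_group T by (rule T_graded)
  show "diff T x \<in> gr T (n - 1)" if "x \<in> gr T n" for x n
    using that
  proof (induction x rule: gr_T_induct)
    case (pure i l f)
    have "pt (diff L l) f \<in> gr T (n - 1)" "pt (signed L l) (diff F f) \<in> gr T (n - 1)"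
      using pt_gr[OF L.diff_degree[OF pure(1)] pure(2)] pt_gr[OF L.M.signed_gr[OF pure(1)] F.diff_degree[OF pure(2)]]
      by (simp_all add: algebra_simps)
    then show ?case using pure L.M.gr_closed F.M.gr_closed by (simp add: diff_pt T'.gr_add)
  next
    case (diff x y)
    then show ?case using ahom_minus[OF T_abelian T_abelian diff_T] T'.gr_minus by simp
  qed
  show "diff T (diff T x) = \<zero>\<^bsub>T\<^esub>" if "x \<in> carrier T" for x
    using that
  proof (induction x rule: T_induct)
    case (pure l f)
    then show ?case
      by (simp add: diff_pt ahom_add[OF diff_T] pt_closed L.M.diff_diff F.M.diff_diff L.diff_signed L.M.signed_signed
          pt_neg_left T.r_neg)
  next
    case (add x y)
    then show ?case by (simp add: ahom_add[OF diff_T] ahom_closed[OF diff_T])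
  qed
qed

end

lemma tensor_map:
  assumes P: "tensor_pair B L F" and Q: "tensor_pair B L F'" and \<phi>: "dg_module_morphism B F F' \<phi>"
  shows "chain_map (tensor B L F) (tensor B L F') (tensor_map B L F F' \<phi>)"
    and "l \<in> carrier L \<Longrightarrow> f \<in> carrier F \<Longrightarrow> tensor_map B L F F' \<phi> (pure_tensor B L F l f) = pure_tensor B L F' l (\<phi> f)"
proof -
  interpret P: tensor_pair B L F by fact
  interpret Q: tensor_pair B L F' by fact
  interpret QT: dg_group Q.T by (rule Q.T_dg)
  note \<phi>h = chain_mapD[OF dg_module_morphismD(1)[OF \<phi>]] and \<phi>l = dg_module_morphismD(2)[OF \<phi>]
  have \<phi>c: "f \<in> carrier F \<Longrightarrow> \<phi> f \<in> carrier F'" for f using ahom_closed[OF \<phi>h(1)] .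
  let ?g = "\<lambda>(l, f). frag_of (l, \<phi> f)"
  have eq: "tensor_map B L F F' \<phi> = (\<lambda>U. \<Union>x\<in>U. Q.cl (frag_extend ?g x))"
    by (simp add: tensor_map_def[abs_def])
  have bal: "balanced B L F Q.T (\<lambda>l f. Q.cl (?g (l, f)))"
    unfolding prod.case pure_tensor_def[symmetric]
    by (rule balancedI) (simp_all add: ahom_comp[OF \<phi>h(1) Q.pt_right] Q.pt_left \<phi>c \<phi>l Q.pt_act)
  have keys: "\<forall>p\<in>P.S. Poly_Mapping.keys (?g p) \<subseteq> Q.S" using \<phi>c by auto
  note um = union_map[OF P Q bal keys, folded eq]
  show pp: "tensor_map B L F F' \<phi> (P.pt l f) = Q.pt l (\<phi> f)" if "l \<in> carrier L" "f \<in> carrier F" for l f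
    using um(2)[OF that] by (simp add: eq pure_tensor_def)
  show "chain_map P.T Q.T (tensor_map B L F F' \<phi>)"
  proof (rule chain_mapI)
    show th: "tensor_map B L F F' \<phi> \<in> ahom P.T Q.T" by (rule um(1))
    show "tensor_map B L F F' \<phi> x \<in> gr Q.T n" if "x \<in> gr P.T n" for n x
      using that
    proof (induction x rule: P.gr_T_induct)
      case (pure i l f)
      then show ?case using pp[of l f] Q.pt_gr[OF pure(1) \<phi>h(2)[OF pure(2)]] P.L.M.gr_closed P.F.M.gr_closed by simp
    next
      case (diff x y)
      then show ?case using ahom_minus[OF P.T_abelian Q.T_abelian th] QT.gr_minus by simp
    qed
    show "tensor_map B L F F' \<phi> (diff P.T x) = diff Q.T (tensor_map B L F F' \<phi> x)" if "x \<in> carrier P.T" for x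
      using ahom_comp[OF P.diff_T th] ahom_comp[OF th Q.diff_T] _ that
      by (rule P.T_hom_eq) (simp add: P.diff_pt Q.diff_pt pp ahom_add[OF th] P.pt_closed \<phi>c \<phi>h(3))
  qed
qed

section \<open>Change of records and of rings\<close>

text \<open>Regular modules, restrictions, tensor products with an action and homology with scalars
  are different records over one complex; this relation carries facts about the complex from one to
  another.\<close>

definition same_dg :: "('a, 'm) dg_scheme \<Rightarrow> ('a, 'n) dg_scheme \<Rightarrow> bool" where
  "same_dg M N \<longleftrightarrow> carrier M = carrier N \<and> ring.add M = ring.add N \<and> ring.zero M = ring.zero N \<and>
     gr M = gr N \<and> diff M = diff N"

lemma same_dg_abelian:
  assumes "same_dg M N" "abelian_group M"
  shows "abelian_group N"
proof -
  interpret abelian_group M by fact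
  have "subgroup (carrier M) (add_monoid M)" by (rule subgroup_addI) (auto simp: abelian_group_axioms)
  then show ?thesis
    by (rule abelian_group_surj[OF assms(2), of _ _ "\<lambda>x. x"]) (use assms(1) in \<open>auto simp: same_dg_def\<close>)
qed

lemma same_dg_neg: "same_dg M N \<Longrightarrow> a_inv M = a_inv N"
  by (intro ext) (simp add: same_dg_def a_inv_def m_inv_def)

lemma same_dg_finsum: "same_dg M N \<Longrightarrow> finsum M = finsum N"
  by (intro ext) (simp add: same_dg_def finsum_def finprod_def)

lemma same_dg_hcomp: "same_dg M N \<Longrightarrow> hcomp M = hcomp N"
  by (intro ext) (simp add: hcomp_def is_decomposition_def same_dg_finsum, simp add: same_dg_def)

lemma same_dg_koszul: "same_dg M N \<Longrightarrow> koszul M = koszul N"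
  by (intro ext) (simp add: koszul_def same_dg_neg)

lemma same_dg_signed: "same_dg M N \<Longrightarrow> signed M = signed N"
  by (intro ext) (simp add: signed_def same_dg_hcomp same_dg_finsum same_dg_koszul, simp add: same_dg_def)

lemma same_dg_ahom:
  "same_dg M N \<Longrightarrow> f \<in> ahom M P \<longleftrightarrow> f \<in> ahom N P"
  "same_dg M N \<Longrightarrow> g \<in> ahom Q M \<longleftrightarrow> g \<in> ahom Q N"
  by (simp_all add: same_dg_def hom_def)

lemma same_dg_group:
  assumes "same_dg M N" "dg_group M"
  shows "dg_group N"
proof -
  interpret M: dg_group M by fact
  have N: "abelian_group N" by (rule same_dg_abelian[OF assms(1) M.abelian_group_axioms])
  have s: "carrier M = carrier N" "ring.add M = ring.add N" "ring.zero M = ring.zero N" "gr M = gr N" "diff M = diff N"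
    using assms(1) by (auto simp: same_dg_def)
  have "graded_group N"
  proof (intro graded_group.intro graded_group_axioms.intro N)
    show "subgroup (gr N n) (add_monoid N)" for n
    proof (rule subgroup_addI[OF N])
      show "gr N n \<subseteq> carrier N" using M.gr_closed s by auto
      show "\<zero>\<^bsub>N\<^esub> \<in> gr N n" using M.gr_zero s by metis
      show "x \<oplus>\<^bsub>N\<^esub> y \<in> gr N n" if "x \<in> gr N n" "y \<in> gr N n" for x y using M.gr_add that s by metis
      show "\<ominus>\<^bsub>N\<^esub> x \<in> gr N n" if "x \<in> gr N n" for x using M.gr_neg that s same_dg_neg[OF assms(1)] by metis
    qed
    show "\<exists>!f. is_decomposition N x f" if "x \<in> carrier N" for x
      using M.decomposition[of x] that s by (simp add: is_decomposition_def same_dg_finsum[OF assms(1)])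
  qed
  then show ?thesis
    by (rule dg_groupI)
      (use M.diff_hom M.diff_degree M.diff_diff s same_dg_ahom[OF assms(1)] in \<open>auto simp: hom_def\<close>)
qed

lemma same_dg_chain_map:
  "same_dg M N \<Longrightarrow> chain_map M P f \<longleftrightarrow> chain_map N P f"
  "same_dg M N \<Longrightarrow> chain_map Q M g \<longleftrightarrow> chain_map Q N g"
  by (simp_all add: same_dg_def chain_map_def hom_def)

lemma same_dg_qi:
  "same_dg M N \<Longrightarrow> qi M P f \<longleftrightarrow> qi N P f"
  "same_dg M N \<Longrightarrow> qi Q M g \<longleftrightarrow> qi Q N g"
  by (simp_all add: qi_def same_dg_chain_map) (simp_all add: same_dg_def)

lemma dg_extend_simps [simp]:
  "carrier (dg.extend M m) = carrier M" "ring.add (dg.extend M m) = ring.add M" "ring.zero (dg.extend M m) = ring.zero M"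
  "gr (dg.extend M m) = gr M" "diff (dg.extend M m) = diff M"
  "act (dg.extend M (dgmod.fields u)) = u"
  by (simp_all add: dg.defs dgmod.defs)

lemma dg_truncate_simps [simp]:
  "carrier (dg.truncate M) = carrier M" "ring.add (dg.truncate M) = ring.add M" "ring.zero (dg.truncate M) = ring.zero M"
  "gr (dg.truncate M) = gr M" "diff (dg.truncate M) = diff M"
  by (simp_all add: dg.defs)

section \<open>Restriction of scalars and regular modules\<close>

lemma restrict_scalars_simps [simp]:
  "carrier (restrict_scalars \<beta> M) = carrier M" "ring.add (restrict_scalars \<beta> M) = ring.add M"
  "ring.zero (restrict_scalars \<beta> M) = ring.zero M" "gr (restrict_scalars \<beta> M) = gr M"
  "diff (restrict_scalars \<beta> M) = diff M" "act (restrict_scalars \<beta> M) = (\<lambda>b. act M (\<beta> b))"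
  by (simp_all add: restrict_scalars_def)

lemma same_dg_restrict: "same_dg M (restrict_scalars \<beta> M)"
  by (simp add: same_dg_def)

lemma dg_ring_morphismD:
  assumes "dg_ring_morphism R S f"
  shows "f \<in> ahom R S" "\<And>n x. x \<in> gr R n \<Longrightarrow> f x \<in> gr S n" "\<And>x. x \<in> carrier R \<Longrightarrow> f (diff R x) = diff S (f x)"
    "\<And>x y. x \<in> carrier R \<Longrightarrow> y \<in> carrier R \<Longrightarrow> f (x \<otimes>\<^bsub>R\<^esub> y) = f x \<otimes>\<^bsub>S\<^esub> f y" "f \<one>\<^bsub>R\<^esub> = \<one>\<^bsub>S\<^esub>"
    "\<And>x. x \<in> carrier R \<Longrightarrow> f x \<in> carrier S"
    "\<And>x y. x \<in> carrier R \<Longrightarrow> y \<in> carrier R \<Longrightarrow> f (x \<oplus>\<^bsub>R\<^esub> y) = f x \<oplus>\<^bsub>S\<^esub> f y"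
  using assms chain_mapD[of R S f] by (auto simp: dg_ring_morphism_def ring_hom_def)

lemma left_restrict:
  assumes R: "dg_ring R" and f: "dg_ring_morphism R S f" and M: "left_dg_module S M"
  shows "left_dg_module R (restrict_scalars f M)"
proof -
  interpret M: left_dg_module S M by fact
  interpret R: dg_ring R by fact
  note k = same_dg_koszul[OF same_dg_restrict[of M f], symmetric]
  show ?thesis
    by (intro left_dg_module.intro left_dg_module_axioms.intro R same_dg_group[OF same_dg_restrict M.M.dg_group_axioms])
      (simp_all add: k dg_ring_morphismD[OF f] M.act_closed M.act_add_left M.act_add_right M.act_one M.act_mult
        M.act_degree M.act_leibniz[OF dg_ring_morphismD(2)[OF f]] R.gr_closed)
qed

lemma right_restrict:
  assumes R: "dg_ring R" and f: "dg_ring_morphism R S f" and M: "right_dg_module S M"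
  shows "right_dg_module R (restrict_scalars f M)"
proof -
  interpret M: right_dg_module S M by fact
  note k = same_dg_koszul[OF same_dg_restrict[of M f], symmetric]
  show ?thesis
    by (intro right_dg_module.intro right_dg_module_axioms.intro R same_dg_group[OF same_dg_restrict M.M.dg_group_axioms])
      (simp_all add: k dg_ring_morphismD[OF f] M.act_closed M.act_add_left M.act_add_right M.act_one M.act_mult
        M.act_degree M.act_leibniz)
qed

lemma regular_simps [simp]:
  "carrier (left_regular S) = carrier S" "ring.add (left_regular S) = ring.add S" "ring.zero (left_regular S) = ring.zero S"
  "gr (left_regular S) = gr S" "diff (left_regular S) = diff S" "act (left_regular S) = (\<lambda>b x. b \<otimes>\<^bsub>S\<^esub> x)"
  "carrier (right_regular S) = carrier S" "ring.add (right_regular S) = ring.add S" "ring.zero (right_regular S) = ring.zero S"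
  "gr (right_regular S) = gr S" "diff (right_regular S) = diff S" "act (right_regular S) = (\<lambda>b x. x \<otimes>\<^bsub>S\<^esub> b)"
  by (simp_all add: left_regular_def right_regular_def)

lemma same_dg_regular: "same_dg S (left_regular S)" "same_dg S (right_regular S)"
  by (simp_all add: same_dg_def)

lemma left_regular:
  assumes "dg_ring S"
  shows "left_dg_module S (left_regular S)"
proof -
  interpret dg_ring S by fact
  note k = same_dg_koszul[OF same_dg_regular(1)[of S], symmetric]
  show ?thesis
    by (intro left_dg_module.intro left_dg_module_axioms.intro assms same_dg_group[OF same_dg_regular(1) dg_group_axioms])
      (simp_all add: k l_distr r_distr m_assoc mult_degree leibniz)
qed

lemma right_regular:
  assumes "dg_ring S"
  shows "right_dg_module S (right_regular S)"
proof -
  interpret dg_ring S by fact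
  note k = same_dg_koszul[OF same_dg_regular(2)[of S], symmetric]
  show ?thesis
    by (intro right_dg_module.intro right_dg_module_axioms.intro assms same_dg_group[OF same_dg_regular(2) dg_group_axioms])
      (auto simp: k l_distr r_distr m_assoc mult_degree leibniz gr_closed a_comm koszul_def)
qed

lemma (in dg_ring) diff_one: "diff R \<one> = \<zero>"
proof -
  have "diff R (\<one> \<otimes> \<one>) = diff R \<one> \<otimes> \<one> \<oplus> koszul R 0 (\<one> \<otimes> diff R \<one>)"
    by (rule leibniz[OF one_degree]) simp
  then have "diff R \<one> = diff R \<one> \<oplus> diff R \<one>" by (simp add: koszul_def)
  then show ?thesis by (metis add.r_cancel_one' diff_closed one_closed)
qed

section \<open>Modules with a basis\<close>

lemma coeff_family_fsupp: "coeff_family B E c \<longleftrightarrow> c \<in> fsupp E B"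
  by (auto simp: coeff_family_def fsupp_def)

lemma lin_comb_fs_ext: "lin_comb B F c = fs_ext B F (\<lambda>e b. act F b e) c"
  by (simp add: lin_comb_def fs_ext_def)

definition coeffs :: "('b, 'p) dg_scheme \<Rightarrow> ('b, 'f, 'n) dgmod_scheme \<Rightarrow> 'f set \<Rightarrow> 'f \<Rightarrow> 'f \<Rightarrow> 'b" where
  "coeffs B F E f = (THE c. c \<in> fsupp E B \<and> f = lin_comb B F c)"

text \<open>Over a nonzero ring basis elements are nonzero, so that their degree is unique; only
  over the zero ring is there a choice.\<close>

definition some_degree :: "('a, 'm) dg_scheme \<Rightarrow> 'a \<Rightarrow> int" where
  "some_degree F e = (SOME n. e \<in> gr F n)"

locale based_module = F: left_dg_module B F
  for B :: "('b, 'p) dg_scheme" and F :: "('b, 'f, 'n) dgmod_scheme" +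
  fixes E :: "'f set"
  assumes basis: "graded_basis B F E"
begin

abbreviation "cf \<equiv> coeffs B F E"

lemma E_gr: "e \<in> E \<Longrightarrow> e \<in> gr F (some_degree F e)"
  using basis unfolding graded_basis_def some_degree_def by (metis (mono_tags, lifting) UN_E someI_ex subsetD)

lemma E_closed: "e \<in> E \<Longrightarrow> e \<in> carrier F"
  using E_gr F.M.gr_closed by blast

sublocale lc: ab_hom_family B F E "\<lambda>e b. act F b e"
  by unfold_locales (simp add: F.act_left E_closed)

lemma coeffs_ex1: "f \<in> carrier F \<Longrightarrow> \<exists>!c. c \<in> fsupp E B \<and> f = lin_comb B F c"
  using basis by (simp add: graded_basis_def coeff_family_fsupp)

lemma coeffs_fsupp: "f \<in> carrier F \<Longrightarrow> cf f \<in> fsupp E B"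
  and lin_comb_coeffs: "f \<in> carrier F \<Longrightarrow> lin_comb B F (cf f) = f"
  unfolding coeffs_def using theI'[OF coeffs_ex1, of f] by auto

lemma coeffs_closed: "f \<in> carrier F \<Longrightarrow> cf f e \<in> carrier B"
  using fsuppD(1)[OF coeffs_fsupp] .

lemma lin_comb_closed: "c \<in> fsupp E B \<Longrightarrow> lin_comb B F c \<in> carrier F"
  by (simp add: lin_comb_fs_ext lc.fs_ext_closed)

lemma coeffs_lin_comb: "c \<in> fsupp E B \<Longrightarrow> cf (lin_comb B F c) = c"
  using coeffs_ex1[OF lin_comb_closed, of c] coeffs_fsupp[OF lin_comb_closed, of c] lin_comb_coeffs[OF lin_comb_closed, of c]
  by metis

lemma coeffs_add: "f \<in> carrier F \<Longrightarrow> g \<in> carrier F \<Longrightarrow> cf (f \<oplus>\<^bsub>F\<^esub> g) = (\<lambda>e. cf f e \<oplus>\<^bsub>B\<^esub> cf g e)"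
proof -
  assume fg: "f \<in> carrier F" "g \<in> carrier F"
  then have "f \<oplus>\<^bsub>F\<^esub> g = lin_comb B F (\<lambda>e. cf f e \<oplus>\<^bsub>B\<^esub> cf g e)"
    using lc.fs_ext_add[OF coeffs_fsupp coeffs_fsupp, of f g] lin_comb_coeffs by (simp add: lin_comb_fs_ext)
  then show ?thesis using coeffs_lin_comb F.B.fsupp_add[OF coeffs_fsupp coeffs_fsupp] fg by simp
qed

lemma coeffs_ahom: "(\<lambda>f. cf f e) \<in> ahom F B"
  by (intro ahomI) (simp_all add: coeffs_closed coeffs_add)

lemma scale_fsupp: "b \<in> carrier B \<Longrightarrow> c \<in> fsupp E B \<Longrightarrow> (\<lambda>e. b \<otimes>\<^bsub>B\<^esub> c e) \<in> fsupp E B"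
  by (rule F.B.fsupp_map[where M=B and f="\<lambda>e x. b \<otimes>\<^bsub>B\<^esub> x"]) auto

lemma lin_comb_scale: "b \<in> carrier B \<Longrightarrow> c \<in> fsupp E B \<Longrightarrow> lin_comb B F (\<lambda>e. b \<otimes>\<^bsub>B\<^esub> c e) = act F b (lin_comb B F c)"
proof -
  assume b: "b \<in> carrier B" and c: "c \<in> fsupp E B"
  show ?thesis using c
  proof (induction c rule: F.B.fsupp_induct)
    case zero
    then show ?case using b by (simp add: lin_comb_fs_ext lc.fs_ext_zero)
  next
    case (delta e m)
    have "(\<lambda>e'. b \<otimes>\<^bsub>B\<^esub> delta B e m e') = delta B e (b \<otimes>\<^bsub>B\<^esub> m)" using b by (auto simp: delta_def)
    then show ?case using b delta by (simp add: lin_comb_fs_ext lc.fs_ext_delta F.act_mult E_closed)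
  next
    case (add x y)
    have "(\<lambda>e. b \<otimes>\<^bsub>B\<^esub> (x e \<oplus>\<^bsub>B\<^esub> y e)) = (\<lambda>e. b \<otimes>\<^bsub>B\<^esub> x e \<oplus>\<^bsub>B\<^esub> b \<otimes>\<^bsub>B\<^esub> y e)"
      using add b by (auto simp: fsuppD(1)[OF add(1)] fsuppD(1)[OF add(2)] F.B.r_distr)
    then show ?case
      using add b lc.fs_ext_add[OF scale_fsupp[OF b add(1)] scale_fsupp[OF b add(2)]]
      by (simp add: lin_comb_fs_ext lc.fs_ext_add F.act_add_right lc.fs_ext_closed)
  qed
qed

lemma coeffs_act: "b \<in> carrier B \<Longrightarrow> f \<in> carrier F \<Longrightarrow> cf (act F b f) = (\<lambda>e. b \<otimes>\<^bsub>B\<^esub> cf f e)"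
  using lin_comb_scale[OF _ coeffs_fsupp, of b f] coeffs_lin_comb[OF scale_fsupp[OF _ coeffs_fsupp], of b f] lin_comb_coeffs[of f]
  by simp

lemma coeffs_basis: "e \<in> E \<Longrightarrow> cf e = delta B e \<one>\<^bsub>B\<^esub>"
proof -
  assume e: "e \<in> E"
  have "lin_comb B F (delta B e \<one>\<^bsub>B\<^esub>) = e" using e by (simp add: lin_comb_fs_ext lc.fs_ext_delta F.act_one E_closed)
  then show ?thesis using coeffs_lin_comb[OF F.B.fsupp_delta[OF e F.B.one_closed]] by simp
qed

lemma basis_induct [consumes 1, case_names zero basis add]:
  assumes "f \<in> carrier F" "P \<zero>\<^bsub>F\<^esub>" "\<And>b e. b \<in> carrier B \<Longrightarrow> e \<in> E \<Longrightarrow> P (act F b e)"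
    "\<And>f g. f \<in> carrier F \<Longrightarrow> g \<in> carrier F \<Longrightarrow> P f \<Longrightarrow> P g \<Longrightarrow> P (f \<oplus>\<^bsub>F\<^esub> g)"
  shows "P f"
proof -
  have "P (lin_comb B F c)" if "c \<in> fsupp E B" for c
    using that
    by (induction c rule: F.B.fsupp_induct)
      (use assms(2-4) in \<open>simp_all add: lin_comb_fs_ext lc.fs_ext_zero lc.fs_ext_delta lc.fs_ext_add lc.fs_ext_closed\<close>)
  then show ?thesis using lin_comb_coeffs[OF assms(1)] coeffs_fsupp[OF assms(1)] by metis
qed

text \<open>Cutting every coefficient down to the expected degree yields an expansion of the
  component of degree \<open>n\<close>, which is \<open>f\<close> again; uniqueness of coefficients
  does the rest.\<close>

lemma coeffs_gr:
  assumes f: "f \<in> gr F n" and e: "e \<in> E"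
  shows "cf f e \<in> gr B (n - some_degree F e)"
proof -
  let ?p = "\<lambda>c e. hcomp B (c e) (n - some_degree F e)"
  have p: "?p c \<in> fsupp E B \<and> lin_comb B F (?p c) = hcomp F (lin_comb B F c) n" if "c \<in> fsupp E B" for c
    using that
  proof (induction c rule: F.B.fsupp_induct)
    case zero
    have "hcomp B \<zero>\<^bsub>B\<^esub> m = \<zero>\<^bsub>B\<^esub>" "hcomp F \<zero>\<^bsub>F\<^esub> m = \<zero>\<^bsub>F\<^esub>" for m
      using F.B.hcomp_homogeneous[OF F.B.gr_zero[of m], of m] F.M.hcomp_homogeneous[OF F.M.gr_zero[of m], of m] by simp_all
    then show ?case by (simp add: F.B.fsupp_zero lin_comb_fs_ext lc.fs_ext_zero)
  next
    case (delta e b)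
    have "hcomp B \<zero>\<^bsub>B\<^esub> m = \<zero>\<^bsub>B\<^esub>" for m
      using F.B.hcomp_homogeneous[OF F.B.gr_zero[of m], of m] by simp
    then have "?p (delta B e b) = delta B e (hcomp B b (n - some_degree F e))" by (auto simp: delta_def)
    moreover have "hcomp F (act F b e) (n - some_degree F e + some_degree F e) = act F (hcomp B b (n - some_degree F e)) e"
      using delta F.act_degree[OF _ E_gr[OF delta(1)]]
      by (intro hcomp_hom[OF F.B.graded_group_axioms F.M.graded_group_axioms F.act_left]) (auto simp: E_closed)
    ultimately show ?case using delta F.B.hcomp_closed
      by (simp add: F.B.fsupp_delta lin_comb_fs_ext lc.fs_ext_delta)
  next
    case (add x y)
    have "?p (\<lambda>e. x e \<oplus>\<^bsub>B\<^esub> y e) = (\<lambda>e. ?p x e \<oplus>\<^bsub>B\<^esub> ?p y e)"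
      using fsuppD(1)[OF add(1)] fsuppD(1)[OF add(2)] by (simp add: F.B.hcomp_add)
    then show ?case
      using add by (simp add: F.B.fsupp_add lin_comb_fs_ext lc.fs_ext_add F.M.hcomp_add lc.fs_ext_closed)
  qed
  have fc: "f \<in> carrier F" using f F.M.gr_closed by blast
  have "lin_comb B F (?p (cf f)) = f"
    using p[OF coeffs_fsupp[OF fc]] f by (simp add: lin_comb_coeffs[OF fc] F.M.hcomp_homogeneous)
  then have "cf f = ?p (cf f)" using coeffs_lin_comb p[OF coeffs_fsupp[OF fc]] by metis
  then have "cf f e = hcomp B (cf f e) (n - some_degree F e)" by (rule fun_cong)
  then show ?thesis using F.B.hcomp_gr[OF coeffs_closed[OF fc]] by metis
qed

end

section \<open>Tensor products with a based module\<close>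

locale tensor_basis = tensor_pair B L F + based_module B F E
  for B :: "('b, 'p) dg_scheme" and L :: "('b, 'l, 'm) dgmod_scheme" and F :: "('b, 'f, 'n) dgmod_scheme" and E :: "'f set"
begin

text \<open>L \<otimes> F over B is a direct sum of copies of \<open>L\<close>, one for each basis
  element of \<open>F\<close>; this is the coordinate at \<open>e\<close>.\<close>

definition tcoord :: "'f \<Rightarrow> ('l \<times> 'f \<Rightarrow>\<^sub>0 int) set \<Rightarrow> 'l" where
  "tcoord e = tlift B L F L (\<lambda>l f. act L (cf f e) l)"

lemma balanced_tcoord: "balanced B L F L (\<lambda>l f. act L (cf f e) l)"
proof (rule balancedI)
  show "(\<lambda>f. act L (cf f e) l) \<in> ahom F L" if "l \<in> carrier L" for l
    by (rule ahom_comp[OF coeffs_ahom L.act_left[OF that]])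
  show "(\<lambda>l. act L (cf f e) l) \<in> ahom L L" if "f \<in> carrier F" for f
    using L.act_right[OF coeffs_closed[OF that]] by simp
qed (simp add: coeffs_act L.act_mult coeffs_closed)

lemma tcoord_hom: "tcoord e \<in> ahom T L"
  unfolding tcoord_def by (rule tlift(1)[OF agL balanced_tcoord])

lemma tcoord_pt: "l \<in> carrier L \<Longrightarrow> f \<in> carrier F \<Longrightarrow> tcoord e (pt l f) = act L (cf f e) l"
  unfolding tcoord_def by (rule tlift(2)[OF agL balanced_tcoord])

lemma tcoord_basis: "l \<in> carrier L \<Longrightarrow> e' \<in> E \<Longrightarrow> tcoord e (pt l e') = (if e = e' then l else \<zero>\<^bsub>L\<^esub>)"
  by (simp add: tcoord_pt E_closed coeffs_basis delta_def L.act_one)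

lemma tcoord_fsupp: "x \<in> carrier T \<Longrightarrow> (\<lambda>e. tcoord e x) \<in> fsupp E L"
proof (induction x rule: T_induct)
  case (pure l f)
  then show ?case
    using L.M.fsupp_map[OF coeffs_fsupp[OF pure(2)], of "\<lambda>e b. act L b l"] by (simp add: tcoord_pt L.act_closed)
next
  case (add x y)
  then show ?case by (simp add: ahom_add[OF tcoord_hom] L.M.fsupp_add)
qed

sublocale ex: ab_hom_family L T E "\<lambda>e l. pt l e"
  by unfold_locales (simp add: pt_left E_closed)

lemma tcoord_expansion: "x \<in> carrier T \<Longrightarrow> fs_ext L T (\<lambda>e l. pt l e) (\<lambda>e. tcoord e x) = x"
proof (induction x rule: T_induct)
  case (pure l f)
  from pure(2) show ?case
  proof (induction f rule: basis_induct)
    case zero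
    then show ?case using pure by (simp add: ahom_zero[OF agT agL tcoord_hom] ex.fs_ext_zero)
  next
    case (basis b e)
    have "(\<lambda>e'. tcoord e' (pt l (act F b e))) = delta L e (act L b l)"
      using basis pure by (auto simp: pt_act[symmetric] E_closed L.act_closed tcoord_basis delta_def)
    then show ?case using basis pure by (simp add: ex.fs_ext_delta L.act_closed pt_act E_closed)
  next
    case (add f g)
    then show ?case using pure
      by (simp add: pt_add_right ahom_add[OF tcoord_hom] pt_closed ex.fs_ext_add tcoord_fsupp)
  qed
next
  case (add x y)
  then show ?case by (simp add: ahom_add[OF tcoord_hom] ex.fs_ext_add tcoord_fsupp)
qed

lemma tcoord_ext: "x \<in> fsupp E L \<Longrightarrow> tcoord e (fs_ext L T (\<lambda>e l. pt l e) x) = x e"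
proof (induction x rule: L.M.fsupp_induct)
  case zero
  then show ?case by (simp add: ex.fs_ext_zero ahom_zero[OF agT agL tcoord_hom])
next
  case (delta e' l)
  then show ?case by (simp add: ex.fs_ext_delta tcoord_basis)
next
  case (add x y)
  then show ?case by (simp add: ex.fs_ext_add ahom_add[OF tcoord_hom] ex.fs_ext_closed)
qed

lemma tcoord_eqI:
  assumes "x \<in> carrier T" "y \<in> carrier T" "\<And>e. e \<in> E \<Longrightarrow> tcoord e x = tcoord e y"
  shows "x = y"
proof -
  have "(\<lambda>e. tcoord e x) = (\<lambda>e. tcoord e y)"
    using assms(3) fsuppD(2)[OF tcoord_fsupp[OF assms(1)]] fsuppD(2)[OF tcoord_fsupp[OF assms(2)]] by (metis ext)
  then show ?thesis using tcoord_expansion assms(1,2) by metis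
qed

text \<open>The differential of l \<otimes> e is \<partial>l \<otimes> e plus a term with
  \<partial>e, which involves only smaller basis elements. So the differential on the subquotient at
  \<open>e\<close> is that of \<open>L\<close>, without a sign.\<close>

lemma T_triangular:
  assumes r: "\<And>e f. f \<in> E \<Longrightarrow> e \<in> E \<Longrightarrow> cf (diff F f) e \<noteq> \<zero>\<^bsub>B\<^esub> \<Longrightarrow> (e, f) \<in> r" and irr: "\<And>e. (e, e) \<notin> r"
  shows "triangular T L E r (\<lambda>e. diff L) tcoord (\<lambda>e l. pt l e)"
proof -
  interpret T': dg_group T by (rule T_dg)
  have d: "tcoord e' (diff T (pt l e)) = (if e' = e then diff L l else \<zero>\<^bsub>L\<^esub>)"
    if "e \<in> E" "e' \<in> E" "l \<in> carrier L" "e' = e \<or> (e', e) \<notin> r" for e e' l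
  proof -
    have z: "cf (diff F e) e' = \<zero>\<^bsub>B\<^esub>" using that r irr by blast
    have "act L (cf (diff F e) e') (signed L l) = \<zero>\<^bsub>L\<^esub>" unfolding z using that by simp
    then show ?thesis using that
      by (simp add: diff_pt E_closed ahom_add[OF tcoord_hom] pt_closed tcoord_basis tcoord_pt[of "signed L l"])
  qed
  show ?thesis
  proof unfold_locales
    show "(\<lambda>l. pt l e) \<in> ahom L T" if "e \<in> E" for e using that by (simp add: pt_left E_closed)
    show "tcoord e \<in> ahom T L" for e by (rule tcoord_hom)
    show "finite {e \<in> E. tcoord e x \<noteq> \<zero>\<^bsub>L\<^esub>}" if "x \<in> carrier T" for x
      by (rule finite_subset[OF _ fsuppD(3)[OF tcoord_fsupp[OF that]]]) auto
    show "x = \<zero>\<^bsub>T\<^esub>" if "x \<in> carrier T" "\<And>e. e \<in> E \<Longrightarrow> tcoord e x = \<zero>\<^bsub>L\<^esub>" for x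
      using that by (intro tcoord_eqI) (auto simp: ahom_zero[OF agT agL tcoord_hom])
  qed (simp_all add: tcoord_basis d)
qed

end

lemma semibasis_coeffs:
  assumes "left_dg_module B F" "semibasis B F E r" "f \<in> E" "coeffs B F E (diff F f) e \<noteq> \<zero>\<^bsub>B\<^esub>"
  shows "(e, f) \<in> r - Id"
proof -
  interpret based_module B F E
    using assms(1,2) by (simp add: based_module_def based_module_axioms_def semibasis_def)
  obtain c where c: "coeff_family B {e \<in> E. (e, f) \<in> r \<and> e \<noteq> f} c" "diff F f = lin_comb B F c"
    using assms(2,3) by (auto simp: semibasis_def lin_span_def)
  then have "c \<in> fsupp E B" by (auto simp: coeff_family_def fsupp_def)
  then have "cf (diff F f) = c" using coeffs_lin_comb c(2) by simp
  then show ?thesis using c(1) assms(4) by (auto simp: coeff_family_def)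
qed

lemma semibasis_wf: "semibasis B F E r \<Longrightarrow> wf (r - Id)"
  by (simp add: semibasis_def well_order_on_def)

section \<open>Maps out of twisted sums\<close>

context twisted_module
begin

text \<open>The hypothesis \<open>comm\<close> is the chain map condition on a single term
  \<open>j m\<close>; the rest is additivity.\<close>

lemma T_hom:
  assumes Y: "dg_group Y" and th: "\<And>i. i \<in> I \<Longrightarrow> \<theta> i \<in> ahom M Y"
    and gr: "\<And>i n x. i \<in> I \<Longrightarrow> x \<in> gr M n \<Longrightarrow> \<theta> i x \<in> gr Y (n + wt i)"
    and comm: "\<And>j m. j \<in> I \<Longrightarrow> m \<in> carrier M \<Longrightarrow>
      (\<Oplus>\<^bsub>Y\<^esub>i\<in>{i. a i j \<noteq> \<zero>}. \<theta> i (act M (a i j) m)) \<oplus>\<^bsub>Y\<^esub> koszul Y (wt j) (\<theta> j (diff M m)) = diff Y (\<theta> j m)"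
  shows "chain_map T Y (fs_ext M Y \<theta>)"
proof -
  interpret Y: dg_group Y by fact
  interpret u: ab_hom_family M Y I \<theta> by unfold_locales (rule th)
  show ?thesis
  proof (rule chain_mapI)
    show "fs_ext M Y \<theta> \<in> ahom T Y" by (intro ahomI) (simp_all add: u.fs_ext_closed u.fs_ext_add)
    show "fs_ext M Y \<theta> x \<in> gr Y n" if "x \<in> gr T n" for n x
    proof -
      have x: "x \<in> fsupp I M" "\<And>i. x i \<in> gr M (n - wt i)" using that by auto
      show ?thesis unfolding fs_ext_def
      proof (rule Y.gr_finsum[OF fsuppD(3)[OF x(1)]])
        fix i assume "i \<in> {i. x i \<noteq> \<zero>\<^bsub>M\<^esub>}"
        then have "i \<in> I" using fsuppD(2)[OF x(1)] by auto
        then show "\<theta> i (x i) \<in> gr Y n" using gr[OF _ x(2)[of i], of i] by simp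
      qed
    qed
    fix x assume "x \<in> carrier T"
    then have "x \<in> fsupp I M" by simp
    then show "fs_ext M Y \<theta> (diff T x) = diff Y (fs_ext M Y \<theta> x)"
    proof (induction x rule: M.fsupp_induct)
      case zero
      then show ?case by (simp add: diff_T_zero u.fs_ext_zero)
    next
      case (delta j m)
      have "fs_ext M Y \<theta> (\<lambda>i. act M (a i j) m) = (\<Oplus>\<^bsub>Y\<^esub>i\<in>{i. a i j \<noteq> \<zero>}. \<theta> i (act M (a i j) m))"
        using delta a_fin a_supp by (intro u.fs_ext_superset col_fsupp) auto
      moreover have "\<theta> j (koszul M (wt j) (diff M m)) = koszul Y (wt j) (\<theta> j (diff M m))"
        using delta by (intro koszul_hom[OF M.M.abelian_group_axioms Y.abelian_group_axioms th]) auto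
      ultimately show ?case
        using comm[OF delta] delta
        by (simp add: diff_delta u.fs_ext_add col_fsupp M.fsupp_delta u.fs_ext_delta)
    next
      case (add x y)
      then show ?case by (simp add: diff_T_add u.fs_ext_add diff_T_closed Y.diff_add u.fs_ext_closed)
    qed
  qed
qed

end

section \<open>Extension of scalars\<close>

text \<open>S \<otimes> F over B as a left S-module: \<open>S\<close> becomes a right B-module
  through \<beta> and keeps its left multiplication.\<close>

definition ltensor :: "'s dg \<Rightarrow> 'b dg \<Rightarrow> ('b \<Rightarrow> 's) \<Rightarrow> ('b, 'f) dgmod \<Rightarrow> ('s, ('s \<times> 'f \<Rightarrow>\<^sub>0 int) set) dgmod" where
  "ltensor S B \<beta> F = (let N = restrict_scalars \<beta> (right_regular S) in
    dg.extend (tensor B N F) (dgmod.fields (\<lambda>s. tlift B N F (tensor B N F) (\<lambda>s' f. pure_tensor B N F (s \<otimes>\<^bsub>S\<^esub> s') f))))"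

lemma ltensor_simps [simp]:
  fixes \<beta> defines "N S \<equiv> restrict_scalars \<beta> (right_regular S)"
  shows "carrier (ltensor S B \<beta> F) = carrier (tensor B (N S) F)"
    "ring.add (ltensor S B \<beta> F) = ring.add (tensor B (N S) F)"
    "ring.zero (ltensor S B \<beta> F) = ring.zero (tensor B (N S) F)" "gr (ltensor S B \<beta> F) = gr (tensor B (N S) F)"
    "diff (ltensor S B \<beta> F) = diff (tensor B (N S) F)"
    "act (ltensor S B \<beta> F) s = tlift B (N S) F (tensor B (N S) F) (\<lambda>s' f. pure_tensor B (N S) F (s \<otimes>\<^bsub>S\<^esub> s') f)"
  by (simp_all add: ltensor_def N_def Let_def)

lemma same_dg_ltensor: "same_dg (tensor B (restrict_scalars \<beta> (right_regular S)) F) (ltensor S B \<beta> F)"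
  by (simp add: same_dg_def)

locale scalar_extension = S: dg_ring S + F: left_dg_module B F
  for S :: "'s dg" and B :: "'b dg" and F :: "('b, 'f) dgmod" +
  fixes \<beta> :: "'b \<Rightarrow> 's"
  assumes \<beta>: "dg_ring_morphism B S \<beta>"
begin

abbreviation "N \<equiv> restrict_scalars \<beta> (right_regular S)"

lemma N_module: "right_dg_module B N"
  by (rule right_restrict[OF F.B.dg_ring_axioms \<beta> right_regular[OF S.dg_ring_axioms]])

sublocale P: tensor_pair B N F
  by (intro tensor_pair.intro N_module) unfold_locales

lemma signed_N: "signed N = signed S"
  using same_dg_signed[OF same_dg_restrict[of "right_regular S" \<beta>]] same_dg_signed[OF same_dg_regular(2)[of S]] by simp

lemma balanced_act: "s \<in> carrier S \<Longrightarrow> balanced B N F P.T (\<lambda>s' f. P.pt (s \<otimes>\<^bsub>S\<^esub> s') f)"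
proof (rule balancedI)
  fix f assume s: "s \<in> carrier S" and f: "f \<in> carrier F"
  show "(\<lambda>s'. P.pt (s \<otimes>\<^bsub>S\<^esub> s') f) \<in> ahom N P.T"
    using s f P.pt_add_left[of "s \<otimes>\<^bsub>S\<^esub> x" "s \<otimes>\<^bsub>S\<^esub> y" f for x y]
    by (intro ahomI) (simp_all add: P.pt_closed S.r_distr)
next
  fix b l f assume "s \<in> carrier S" "b \<in> carrier B" "l \<in> carrier N" "f \<in> carrier F"
  then show "P.pt (s \<otimes>\<^bsub>S\<^esub> act N b l) f = P.pt (s \<otimes>\<^bsub>S\<^esub> l) (act F b f)"
    using P.pt_act[of b "s \<otimes>\<^bsub>S\<^esub> l" f] dg_ring_morphismD(6)[OF \<beta>] by (simp add: S.m_assoc)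
qed (simp add: P.pt_right)

lemma act_hom: "s \<in> carrier S \<Longrightarrow> act (ltensor S B \<beta> F) s \<in> ahom P.T P.T"
  using P.tlift(1)[OF P.T_abelian balanced_act] by simp

lemma act_pt: "s \<in> carrier S \<Longrightarrow> s' \<in> carrier S \<Longrightarrow> f \<in> carrier F \<Longrightarrow>
  act (ltensor S B \<beta> F) s (P.pt s' f) = P.pt (s \<otimes>\<^bsub>S\<^esub> s') f"
  using P.tlift(2)[OF P.T_abelian balanced_act] by simp

lemma act_closed': "s \<in> carrier S \<Longrightarrow> x \<in> carrier P.T \<Longrightarrow> act (ltensor S B \<beta> F) s x \<in> carrier P.T"
  using ahom_closed[OF act_hom] .

lemma ltensor_module: "left_dg_module S (ltensor S B \<beta> F)"
proof -
  interpret T: dg_group P.T by (rule P.T_dg)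
  note k = same_dg_koszul[OF same_dg_ltensor[of B \<beta> S F], symmetric]
  show ?thesis
  proof (intro left_dg_module.intro left_dg_module_axioms.intro S.dg_ring_axioms same_dg_group[OF same_dg_ltensor P.T_dg])
    fix b c x assume b: "b \<in> carrier S" and c: "c \<in> carrier S" and "x \<in> carrier (ltensor S B \<beta> F)"
    then have x: "x \<in> carrier P.T" by simp
    show "act (ltensor S B \<beta> F) b x \<in> carrier (ltensor S B \<beta> F)" using act_closed'[OF b x] by simp
    have bc: "b \<oplus>\<^bsub>S\<^esub> c \<in> carrier S" "b \<otimes>\<^bsub>S\<^esub> c \<in> carrier S" using b c by auto
    have "act (ltensor S B \<beta> F) (b \<oplus>\<^bsub>S\<^esub> c) x = act (ltensor S B \<beta> F) b x \<oplus>\<^bsub>P.T\<^esub> act (ltensor S B \<beta> F) c x"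
      by (rule P.T_hom_eq[OF act_hom[OF bc(1)] P.T.ahom_plus[OF act_hom[OF b] act_hom[OF c]] _ x])
        (use b c in \<open>simp add: act_pt P.pt_add_left[symmetric] S.l_distr del: ltensor_simps\<close>)
    then show "act (ltensor S B \<beta> F) (b \<oplus>\<^bsub>S\<^esub> c) x = act (ltensor S B \<beta> F) b x \<oplus>\<^bsub>ltensor S B \<beta> F\<^esub> act (ltensor S B \<beta> F) c x"
      by (simp only: ltensor_simps(2))
    show "act (ltensor S B \<beta> F) (b \<otimes>\<^bsub>S\<^esub> c) x = act (ltensor S B \<beta> F) b (act (ltensor S B \<beta> F) c x)"
      by (rule P.T_hom_eq[OF act_hom[OF bc(2)] ahom_comp[OF act_hom[OF c] act_hom[OF b]] _ x])
        (use b c in \<open>simp add: act_pt S.m_assoc del: ltensor_simps\<close>)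
  next
    fix b x y assume "b \<in> carrier S" "x \<in> carrier (ltensor S B \<beta> F)" "y \<in> carrier (ltensor S B \<beta> F)"
    then show "act (ltensor S B \<beta> F) b (x \<oplus>\<^bsub>ltensor S B \<beta> F\<^esub> y) =
        act (ltensor S B \<beta> F) b x \<oplus>\<^bsub>ltensor S B \<beta> F\<^esub> act (ltensor S B \<beta> F) b y"
      by (simp only: ltensor_simps(1,2) ahom_add[OF act_hom])
  next
    fix x assume "x \<in> carrier (ltensor S B \<beta> F)"
    then have x: "x \<in> carrier P.T" by simp
    have id: "(\<lambda>x. x) \<in> ahom P.T P.T" by (intro ahomI) auto
    show "act (ltensor S B \<beta> F) \<one>\<^bsub>S\<^esub> x = x"
      by (rule P.T_hom_eq[OF act_hom[OF S.one_closed] id _ x]) (simp add: act_pt del: ltensor_simps)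
  next
    fix b i x j assume b: "b \<in> gr S i" and "x \<in> gr (ltensor S B \<beta> F) j"
    then have x: "x \<in> gr P.T j" by simp
    have bc: "b \<in> carrier S" using S.gr_closed[OF b] .
    from x have "act (ltensor S B \<beta> F) b x \<in> gr P.T (i + j)"
    proof (induction x rule: P.gr_T_induct)
      case (pure l s f)
      then have "s \<in> gr S l" "s \<in> carrier S" "f \<in> carrier F" using S.gr_closed F.M.gr_closed by auto
      then show ?case
        using P.pt_gr[of "b \<otimes>\<^bsub>S\<^esub> s" "i + l" f "j - l"] S.mult_degree[OF b] pure bc
        by (simp add: act_pt del: ltensor_simps)
    next
      case (diff x y)
      then show ?case using ahom_minus[OF P.T_abelian P.T_abelian act_hom[OF bc]] T.gr_minus by simp
    qed
    then show "act (ltensor S B \<beta> F) b x \<in> gr (ltensor S B \<beta> F) (i + j)" by (simp only: ltensor_simps(4))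
  next
    fix b i x assume b: "b \<in> gr S i" and "x \<in> carrier (ltensor S B \<beta> F)"
    then have x: "x \<in> carrier P.T" by simp
    have bc: "b \<in> carrier S" "diff S b \<in> carrier S" using S.gr_closed[OF b] by auto
    have "diff P.T (act (ltensor S B \<beta> F) b x) =
        act (ltensor S B \<beta> F) (diff S b) x \<oplus>\<^bsub>P.T\<^esub> koszul P.T i (act (ltensor S B \<beta> F) b (diff P.T x))"
    proof (rule P.T_hom_eq[OF ahom_comp[OF act_hom[OF bc(1)] P.diff_T]
          P.T.ahom_plus[OF act_hom[OF bc(2)] ahom_comp[OF ahom_comp[OF P.diff_T act_hom[OF bc(1)]] T.koszul_ahom]] _ x])
      fix s f assume "s \<in> carrier N" and f: "f \<in> carrier F"
      then have s: "s \<in> carrier S" by simp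
      have kl: "koszul P.T i (P.pt s' f') = P.pt (koszul S i s') f'" if "s' \<in> carrier S" "f' \<in> carrier F" for s' f'
        using P.pt_neg_left[of s' f'] that same_dg_neg[OF same_dg_restrict[of "right_regular S" \<beta>]] same_dg_neg[OF same_dg_regular(2)[of S]]
        by (simp add: koszul_def)
      have sg: "signed S (b \<otimes>\<^bsub>S\<^esub> s) = koszul S i (b \<otimes>\<^bsub>S\<^esub> signed S s)"
        using b bc s by (simp add: S.signed_mult S.signed_homogeneous koszul_def S.l_minus)
      have a1: "act (ltensor S B \<beta> F) b (P.pt s' f' \<oplus>\<^bsub>P.T\<^esub> P.pt t' g') =
          P.pt (b \<otimes>\<^bsub>S\<^esub> s') f' \<oplus>\<^bsub>P.T\<^esub> P.pt (b \<otimes>\<^bsub>S\<^esub> t') g'" if "s' \<in> carrier S" "f' \<in> carrier F" "t' \<in> carrier S" "g' \<in> carrier F" for s' f' t' g'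
        using that bc ahom_add[OF act_hom[OF bc(1)], of "P.pt s' f'" "P.pt t' g'"]
        by (simp add: act_pt P.pt_closed del: ltensor_simps)
      have e: "P.pt (x \<oplus>\<^bsub>S\<^esub> y) f = P.pt x f \<oplus>\<^bsub>P.T\<^esub> P.pt y f" if "x \<in> carrier S" "y \<in> carrier S" for x y
        using P.pt_add_left[of x y f] that f by simp
      have dp: "diff P.T (P.pt s' f') = P.pt (diff S s') f' \<oplus>\<^bsub>P.T\<^esub> P.pt (signed S s') (diff F f')"
        if "s' \<in> carrier S" "f' \<in> carrier F" for s' f'
        using P.diff_pt[of s' f'] that by (simp add: signed_N)
      have lhs: "diff P.T (act (ltensor S B \<beta> F) b (P.pt s f)) =
          P.pt (diff S b \<otimes>\<^bsub>S\<^esub> s) f \<oplus>\<^bsub>P.T\<^esub> (P.pt (koszul S i (b \<otimes>\<^bsub>S\<^esub> diff S s)) f \<oplus>\<^bsub>P.T\<^esub> P.pt (koszul S i (b \<otimes>\<^bsub>S\<^esub> signed S s)) (diff F f))"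
        using s f bc S.leibniz[OF b s] by (simp add: act_pt dp e sg P.pt_closed P.T.a_assoc del: ltensor_simps)
      show "diff P.T (act (ltensor S B \<beta> F) b (P.pt s f)) =
          act (ltensor S B \<beta> F) (diff S b) (P.pt s f) \<oplus>\<^bsub>P.T\<^esub> koszul P.T i (act (ltensor S B \<beta> F) b (diff P.T (P.pt s f)))"
        unfolding lhs using s f bc by (simp add: dp a1 T.koszul_add P.pt_closed kl act_pt del: ltensor_simps)
    qed
    then show "diff (ltensor S B \<beta> F) (act (ltensor S B \<beta> F) b x) =
        act (ltensor S B \<beta> F) (diff S b) x \<oplus>\<^bsub>ltensor S B \<beta> F\<^esub> koszul (ltensor S B \<beta> F) i (act (ltensor S B \<beta> F) b (diff (ltensor S B \<beta> F) x))"
      by (simp only: ltensor_simps(2,5) k)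
  qed
qed

end

section \<open>Twisted sums over a right module\<close>

text \<open>Let T be the free right R-module on \<open>I\<close> with \<partial>j the sum of i
  a(i,j). The elements \<open>v i\<close> amount to a \<gamma>-linear chain map from T to
  \<open>N\<close>, and \<Lambda> is its extension to T \<otimes> S over R, which takes i s to v(i)
  s.\<close>

locale twisted_map = twisting R I wt a r + S: dg_ring S + N: right_dg_module S N
  for R :: "'r dg" (structure) and I :: "'g set" and wt :: "'g \<Rightarrow> int" and a :: "'g \<Rightarrow> 'g \<Rightarrow> 'r"
    and r :: "('g \<times> 'g) set" and S :: "'s dg" and N :: "('s, 'n) dgmod" +
  fixes \<gamma> :: "'r \<Rightarrow> 's" and v :: "'g \<Rightarrow> 'n"
  assumes \<gamma>: "dg_ring_morphism R S \<gamma>"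
    and v_gr: "i \<in> I \<Longrightarrow> v i \<in> gr N (wt i)"
    and v_diff: "j \<in> I \<Longrightarrow> diff N (v j) = (\<Oplus>\<^bsub>N\<^esub>i\<in>{i. a i j \<noteq> \<zero>}. act N (\<gamma> (a i j)) (v i))"
begin

definition \<Lambda> :: "('g \<Rightarrow> 's) \<Rightarrow> 'n" where
  "\<Lambda> = fs_ext S N (\<lambda>i s. act N s (v i))"

abbreviation "SR \<equiv> restrict_scalars \<gamma> (left_regular S)"

lemma v_closed: "i \<in> I \<Longrightarrow> v i \<in> carrier N"
  using v_gr N.M.gr_closed by blast

lemma SR_module: "left_dg_module R SR"
  by (rule left_restrict[OF dg_ring_axioms \<gamma> left_regular[OF S.dg_ring_axioms]])

sublocale SR: twisted_module R I wt a r SR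
  by (rule twisted_moduleI[OF SR_module])

lemma S_SR: "same_dg S SR"
  by (simp add: same_dg_def)

lemma v_diff_act:
  assumes j: "j \<in> I" and s: "s \<in> carrier S"
  shows "act N s (diff N (v j)) = (\<Oplus>\<^bsub>N\<^esub>i\<in>{i. a i j \<noteq> \<zero>}. act N (\<gamma> (a i j) \<otimes>\<^bsub>S\<^esub> s) (v i))"
proof -
  note D = a_fin[OF j] a_supp[OF j] a_closed[OF j] dg_ring_morphismD(6)[OF \<gamma>] v_closed
  have "act N s (diff N (v j)) = (\<Oplus>\<^bsub>N\<^esub>i\<in>{i. a i j \<noteq> \<zero>}. act N s (act N (\<gamma> (a i j)) (v i)))"
    unfolding v_diff[OF j] using D s
    by (intro ahom_finsum[OF N.M.abelian_group_axioms N.M.abelian_group_axioms N.act_right]) (auto intro!: N.act_closed)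
  also have "\<dots> = (\<Oplus>\<^bsub>N\<^esub>i\<in>{i. a i j \<noteq> \<zero>}. act N (\<gamma> (a i j) \<otimes>\<^bsub>S\<^esub> s) (v i))"
    using D s by (intro N.finsum_cong' refl Pi_I) (auto intro!: N.act_closed N.act_mult[symmetric])
  finally show ?thesis .
qed

lemma \<Lambda>_eq: "\<Lambda> = fs_ext SR N (\<lambda>i s. act N s (v i))"
  by (intro ext) (simp add: \<Lambda>_def fs_ext_def)

lemma \<Lambda>_family: "ab_hom_family SR N I (\<lambda>i s. act N s (v i))"
  by (intro ab_hom_family.intro ab_hom_family_axioms.intro SR.M.M.abelian_group_axioms N.M.abelian_group_axioms)
    (rule iffD1[OF same_dg_ahom(1)[OF S_SR] N.act_left[OF v_closed]])

sublocale \<Lambda>: ab_hom_family SR N I "\<lambda>i s. act N s (v i)"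
  by (rule \<Lambda>_family)

lemma \<Lambda>_delta: "i \<in> I \<Longrightarrow> s \<in> carrier S \<Longrightarrow> \<Lambda> (delta SR i s) = act N s (v i)"
  unfolding \<Lambda>_eq by (rule \<Lambda>.fs_ext_delta) auto

lemma \<Lambda>_chain_map: "chain_map SR.T N \<Lambda>"
  unfolding \<Lambda>_eq
proof (rule SR.T_hom[OF N.M.dg_group_axioms])
  show "\<And>i. i \<in> I \<Longrightarrow> (\<lambda>s. act N s (v i)) \<in> ahom SR N" by (rule \<Lambda>.hom)
  show "act N x (v i) \<in> gr N (n + wt i)" if "i \<in> I" "x \<in> gr SR n" for i n x
    using N.act_degree[of x n "v i" "wt i"] v_gr[OF that(1)] that(2) by (simp add: add.commute)
  fix j m assume j: "j \<in> I" and "m \<in> carrier SR"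
  then have m: "m \<in> carrier S" by simp
  show "(\<Oplus>\<^bsub>N\<^esub>i\<in>{i. a i j \<noteq> \<zero>}. act N (act SR (a i j) m) (v i)) \<oplus>\<^bsub>N\<^esub> koszul N (wt j) (act N (diff SR m) (v j)) =
      diff N (act N m (v j))"
    using v_diff_act[OF j m] N.act_leibniz[OF m v_gr[OF j]] by simp
qed

end

section \<open>Comparison of twisted sums with tensor products over \<open>B\<close>\<close>

locale twisted_tensor = twisted_map R I wt a r S N \<gamma> v + E: scalar_extension S B F \<beta>
  for R :: "'r dg" (structure) and I :: "'g set" and wt :: "'g \<Rightarrow> int" and a :: "'g \<Rightarrow> 'g \<Rightarrow> 'r"
    and r :: "('g \<times> 'g) set" and S :: "'s dg" and N :: "('s, 'n) dgmod" and \<gamma> :: "'r \<Rightarrow> 's" and v :: "'g \<Rightarrow> 'n"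
    and B :: "'b dg" and F :: "('b, 'f) dgmod" and \<beta> :: "'b \<Rightarrow> 's"
begin

abbreviation "NB \<equiv> restrict_scalars \<beta> N"
abbreviation "SF \<equiv> restrict_scalars \<gamma> (ltensor S B \<beta> F)"

lemma NB_module: "right_dg_module B NB"
  by (rule right_restrict[OF E.F.B.dg_ring_axioms E.\<beta> N.right_dg_module_axioms])

sublocale Q: tensor_pair B NB F
  by (intro tensor_pair.intro NB_module) unfold_locales

lemma SF_module: "left_dg_module R SF"
  by (rule left_restrict[OF dg_ring_axioms \<gamma> E.ltensor_module])

sublocale SF: twisted_module R I wt a r SF
  by (rule twisted_moduleI[OF SF_module])

lemma SF_same: "same_dg E.P.T SF"
  by (simp add: same_dg_def)

definition theta :: "'g \<Rightarrow> ('s \<times> 'f \<Rightarrow>\<^sub>0 int) set \<Rightarrow> ('n \<times> 'f \<Rightarrow>\<^sub>0 int) set" where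
  "theta i = tlift B E.N F Q.T (\<lambda>s f. Q.pt (act N s (v i)) f)"

text \<open>This is \<Lambda> tensored with \<open>F\<close> over B: the map from T \<otimes> (S
  \<otimes> F) to N \<otimes> F that takes i (s \<otimes> f) to v(i) s \<otimes> f.\<close>

definition \<Theta> :: "('g \<Rightarrow> ('s \<times> 'f \<Rightarrow>\<^sub>0 int) set) \<Rightarrow> ('n \<times> 'f \<Rightarrow>\<^sub>0 int) set" where
  "\<Theta> = fs_ext SF Q.T theta"

lemma \<beta>_closed: "b \<in> carrier B \<Longrightarrow> \<beta> b \<in> carrier S"
  using dg_ring_morphismD(6)[OF E.\<beta>] .

lemma theta_balanced: "i \<in> I \<Longrightarrow> balanced B E.N F Q.T (\<lambda>s f. Q.pt (act N s (v i)) f)"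
proof (rule balancedI)
  assume i: "i \<in> I"
  show "Q.pt (act N s (v i)) \<in> ahom F Q.T" if "s \<in> carrier E.N" for s
    using that i by (intro Q.pt_right) (simp add: N.act_closed v_closed)
  show "(\<lambda>s. Q.pt (act N s (v i)) f) \<in> ahom E.N Q.T" if "f \<in> carrier F" for f
    using that i Q.pt_add_left[of _ _ f]
    by (intro ahomI) (simp_all add: N.act_closed v_closed Q.pt_closed N.act_add_left)
  show "Q.pt (act N (act E.N b s) (v i)) f = Q.pt (act N s (v i)) (act F b f)"
    if "b \<in> carrier B" "s \<in> carrier E.N" "f \<in> carrier F" for b s f
    using that i Q.pt_act[of b "act N s (v i)" f] by (simp add: N.act_closed v_closed N.act_mult \<beta>_closed)
qed

lemma theta_hom: "i \<in> I \<Longrightarrow> theta i \<in> ahom E.P.T Q.T"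
  unfolding theta_def by (rule E.P.tlift(1)[OF Q.T_abelian theta_balanced])

lemma theta_pt: "i \<in> I \<Longrightarrow> s \<in> carrier S \<Longrightarrow> f \<in> carrier F \<Longrightarrow> theta i (E.P.pt s f) = Q.pt (act N s (v i)) f"
  unfolding theta_def using E.P.tlift(2)[OF Q.T_abelian theta_balanced] by simp

sublocale \<Theta>: ab_hom_family SF Q.T I theta
  by (intro ab_hom_family.intro ab_hom_family_axioms.intro SF.M.M.abelian_group_axioms Q.T_abelian)
    (rule iffD1[OF same_dg_ahom(1)[OF SF_same] theta_hom])

lemma \<Theta>_delta: "i \<in> I \<Longrightarrow> t \<in> carrier E.P.T \<Longrightarrow> \<Theta> (delta SF i t) = theta i t"
  unfolding \<Theta>_def by (rule \<Theta>.fs_ext_delta) auto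

lemma \<Theta>_chain_map: "chain_map SF.T Q.T \<Theta>"
  unfolding \<Theta>_def
proof (rule SF.T_hom[OF Q.T_dg])
  interpret QT: dg_group Q.T by (rule Q.T_dg)
  interpret PT: dg_group E.P.T by (rule E.P.T_dg)
  show "\<And>i. i \<in> I \<Longrightarrow> theta i \<in> ahom SF Q.T" by (rule \<Theta>.hom)
  show "theta i x \<in> gr Q.T (n + wt i)" if i: "i \<in> I" and "x \<in> gr SF n" for i n x
  proof -
    have "x \<in> gr E.P.T n" using that by simp
    then show ?thesis
    proof (induction x rule: E.P.gr_T_induct)
      case (pure j s f)
      then have s: "s \<in> gr S j" "s \<in> carrier S" "f \<in> carrier F" using S.gr_closed E.F.M.gr_closed by auto
      have "act N s (v i) \<in> gr NB (wt i + j)" using N.act_degree[OF s(1) v_gr[OF i]] by simp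
      from Q.pt_gr[OF this pure(2)] show ?case using theta_pt[OF i s(2,3)] by (simp add: algebra_simps)
    next
      case (diff x y)
      then show ?case using ahom_minus[OF E.P.T_abelian Q.T_abelian theta_hom[OF i]] QT.gr_minus by simp
    qed
  qed
  fix j t assume j: "j \<in> I" and "t \<in> carrier SF"
  then have t: "t \<in> carrier E.P.T" by simp
  let ?J = "{i. a i j \<noteq> \<zero>}"
  note D = a_fin[OF j] a_supp[OF j] a_closed[OF j] dg_ring_morphismD(6)[OF \<gamma>] v_closed
  have ac: "act SF (a i j) x \<in> carrier E.P.T" if "x \<in> carrier E.P.T" for i x
    using E.act_closed'[of "\<gamma> (a i j)" x] D that by simp
  have th: "theta i (act SF (a i j) x) \<in> carrier Q.T" if "i \<in> ?J" "x \<in> carrier E.P.T" for i x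
    using ahom_closed[OF theta_hom ac] D that by auto
  \<comment> \<open>Additivity in \<open>t\<close> of both sides reduces the compatibility with
    differentials to pure tensors.\<close>
  have h1: "(\<lambda>t. \<Oplus>\<^bsub>Q.T\<^esub>i\<in>?J. theta i (act SF (a i j) t)) \<in> ahom E.P.T Q.T"
  proof (rule ahomI)
    fix x y assume xy: "x \<in> carrier E.P.T" "y \<in> carrier E.P.T"
    then show "(\<Oplus>\<^bsub>Q.T\<^esub>i\<in>?J. theta i (act SF (a i j) x)) \<in> carrier Q.T" using th by (intro Q.T.finsum_closed) auto
    have "(\<Oplus>\<^bsub>Q.T\<^esub>i\<in>?J. theta i (act SF (a i j) (x \<oplus>\<^bsub>E.P.T\<^esub> y))) =
        (\<Oplus>\<^bsub>Q.T\<^esub>i\<in>?J. theta i (act SF (a i j) x) \<oplus>\<^bsub>Q.T\<^esub> theta i (act SF (a i j) y))"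
    proof (intro Q.T.finsum_cong' refl Pi_I)
      fix i assume i: "i \<in> ?J"
      then have "i \<in> I" using D by auto
      have "act SF (a i j) (x \<oplus>\<^bsub>E.P.T\<^esub> y) = act SF (a i j) x \<oplus>\<^bsub>E.P.T\<^esub> act SF (a i j) y"
        using ahom_add[OF E.act_hom[of "\<gamma> (a i j)"]] D xy by simp
      then show "theta i (act SF (a i j) (x \<oplus>\<^bsub>E.P.T\<^esub> y)) = theta i (act SF (a i j) x) \<oplus>\<^bsub>Q.T\<^esub> theta i (act SF (a i j) y)"
        using ahom_add[OF theta_hom[OF \<open>i \<in> I\<close>] ac ac] xy by simp
    qed (use th xy in auto)
    then show "(\<Oplus>\<^bsub>Q.T\<^esub>i\<in>?J. theta i (act SF (a i j) (x \<oplus>\<^bsub>E.P.T\<^esub> y))) =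
        (\<Oplus>\<^bsub>Q.T\<^esub>i\<in>?J. theta i (act SF (a i j) x)) \<oplus>\<^bsub>Q.T\<^esub> (\<Oplus>\<^bsub>Q.T\<^esub>i\<in>?J. theta i (act SF (a i j) y))"
      using th xy by (simp add: Q.T.finsum_addf)
  qed
  have "(\<Oplus>\<^bsub>Q.T\<^esub>i\<in>?J. theta i (act SF (a i j) t)) \<oplus>\<^bsub>Q.T\<^esub> koszul Q.T (wt j) (theta j (diff E.P.T t)) = diff Q.T (theta j t)"
  proof (rule E.P.T_hom_eq[OF Q.T.ahom_plus[OF h1 ahom_comp[OF ahom_comp[OF E.P.diff_T theta_hom[OF j]] QT.koszul_ahom]]
        ahom_comp[OF theta_hom[OF j] Q.diff_T] _ t])
    fix s f assume "s \<in> carrier E.N" and f: "f \<in> carrier F"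
    then have s: "s \<in> carrier S" by simp
    have vj: "v j \<in> carrier N" by (rule v_closed[OF j])
    have "(\<Oplus>\<^bsub>Q.T\<^esub>i\<in>?J. theta i (act SF (a i j) (E.P.pt s f))) = (\<Oplus>\<^bsub>Q.T\<^esub>i\<in>?J. Q.pt (act N (\<gamma> (a i j) \<otimes>\<^bsub>S\<^esub> s) (v i)) f)"
    proof (intro Q.T.finsum_cong' refl Pi_I)
      fix i assume "i \<in> ?J"
      then have i: "i \<in> I" "\<gamma> (a i j) \<in> carrier S" using D by auto
      then show "theta i (act SF (a i j) (E.P.pt s f)) = Q.pt (act N (\<gamma> (a i j) \<otimes>\<^bsub>S\<^esub> s) (v i)) f"
        using E.act_pt[OF i(2) s f] s f theta_pt[OF i(1), of "\<gamma> (a i j) \<otimes>\<^bsub>S\<^esub> s" f] by simp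
      show "Q.pt (act N (\<gamma> (a i j) \<otimes>\<^bsub>S\<^esub> s) (v i)) f \<in> carrier Q.T"
        using i s f by (intro Q.pt_closed) (simp_all add: N.act_closed v_closed)
    qed
    also have "\<dots> = Q.pt (\<Oplus>\<^bsub>NB\<^esub>i\<in>?J. act N (\<gamma> (a i j) \<otimes>\<^bsub>S\<^esub> s) (v i)) f"
      using D s by (intro ahom_finsum[OF Q.agL Q.agT Q.pt_left[OF f], symmetric]) (auto intro!: N.act_closed)
    also have "(\<Oplus>\<^bsub>NB\<^esub>i\<in>?J. act N (\<gamma> (a i j) \<otimes>\<^bsub>S\<^esub> s) (v i)) = act N s (diff N (v j))"
      unfolding v_diff_act[OF j s] by (simp add: same_dg_finsum[OF same_dg_restrict[of N \<beta>]])
    finally have sum: "(\<Oplus>\<^bsub>Q.T\<^esub>i\<in>?J. theta i (act SF (a i j) (E.P.pt s f))) = Q.pt (act N s (diff N (v j))) f" .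
    have kp: "koszul Q.T (wt j) (Q.pt n f') = Q.pt (koszul N (wt j) n) f'" if "n \<in> carrier N" "f' \<in> carrier F" for n f'
      using Q.pt_neg_left[of n f'] that same_dg_neg[OF same_dg_restrict[of N \<beta>]] by (simp add: koszul_def)
    have sN: "signed NB = signed N" using same_dg_signed[OF same_dg_restrict[of N \<beta>]] by simp
    have sg: "signed N (act N s (v j)) = koszul N (wt j) (act N (signed S s) (v j))"
      using s vj v_gr[OF j] by (simp add: N.signed_act N.M.signed_homogeneous N.act_koszul_right)
    have dth: "theta j (diff E.P.T (E.P.pt s f)) = Q.pt (act N (diff S s) (v j)) f \<oplus>\<^bsub>Q.T\<^esub> Q.pt (act N (signed S s) (v j)) (diff F f)"
      using s f E.P.diff_pt[of s f] ahom_add[OF theta_hom[OF j], of "E.P.pt (diff S s) f" "E.P.pt (signed S s) (diff F f)"]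
      by (simp add: E.signed_N theta_pt[OF j] E.P.pt_closed)
    have dQ: "diff Q.T (Q.pt (act N s (v j)) f) =
        Q.pt (act N s (diff N (v j)) \<oplus>\<^bsub>N\<^esub> koszul N (wt j) (act N (diff S s) (v j))) f \<oplus>\<^bsub>Q.T\<^esub>
        Q.pt (koszul N (wt j) (act N (signed S s) (v j))) (diff F f)"
      using s f vj Q.diff_pt[of "act N s (v j)" f] by (simp add: N.act_closed sN sg N.act_leibniz[OF s v_gr[OF j]])
    have c: "act N s (diff N (v j)) \<in> carrier N" "act N (diff S s) (v j) \<in> carrier N" "act N (signed S s) (v j) \<in> carrier N"
      using s vj by (simp_all add: N.act_closed)
    show "(\<Oplus>\<^bsub>Q.T\<^esub>i\<in>?J. theta i (act SF (a i j) (E.P.pt s f))) \<oplus>\<^bsub>Q.T\<^esub> koszul Q.T (wt j) (theta j (diff E.P.T (E.P.pt s f))) =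
        diff Q.T (theta j (E.P.pt s f))"
      unfolding sum using Q.pt_add_left[of "act N s (diff N (v j))" "koszul N (wt j) (act N (diff S s) (v j))" f] c f
      by (simp add: dth theta_pt[OF j s f] dQ QT.koszul_add Q.pt_closed kp Q.T.a_assoc)
  qed
  then show "(\<Oplus>\<^bsub>Q.T\<^esub>i\<in>?J. theta i (act SF (a i j) t)) \<oplus>\<^bsub>Q.T\<^esub> koszul Q.T (wt j) (theta j (diff SF t)) = diff Q.T (theta j t)"
    by simp
qed

end

lemma ahom_pointwise:
  assumes "twisted_module R I wt a r M" "twisted_module R' I' wt' a' r' M'" "f \<in> ahom M M'"
    "I = I'"
  shows "(\<lambda>x i. f (x i)) \<in> ahom (twisted I wt a R M) (twisted I' wt' a' R' M')"
proof -
  interpret M: twisted_module R I wt a r M by fact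
  interpret M': twisted_module R' I' wt' a' r' M' by fact
  have f0: "f \<zero>\<^bsub>M\<^esub> = \<zero>\<^bsub>M'\<^esub>" using ahom_zero[OF M.M.M.abelian_group_axioms M'.M.M.abelian_group_axioms assms(3)] .
  show ?thesis
  proof (rule ahomI)
    fix x assume "x \<in> carrier (twisted I wt a R M)"
    then have "x \<in> fsupp I M" by simp
    then have "(\<lambda>i. f (x i)) \<in> fsupp I M'"
      by (rule M'.M.fsupp_map[where f="\<lambda>i. f"]) (simp_all add: ahom_closed[OF assms(3)] f0)
    then show "(\<lambda>i. f (x i)) \<in> carrier (twisted I' wt' a' R' M')" using assms(4) by simp
  next
    fix x y assume "x \<in> carrier (twisted I wt a R M)" "y \<in> carrier (twisted I wt a R M)"
    then have "f (x i \<oplus>\<^bsub>M\<^esub> y i) = f (x i) \<oplus>\<^bsub>M'\<^esub> f (y i)" for i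
      using ahom_add[OF assms(3) fsuppD(1)[of x I M i] fsuppD(1)[of y I M i]] by simp
    then show "(\<lambda>i. f ((x \<oplus>\<^bsub>twisted I wt a R M\<^esub> y) i)) =
        (\<lambda>i. f (x i)) \<oplus>\<^bsub>twisted I' wt' a' R' M'\<^esub> (\<lambda>i. f (y i))" by simp
  qed
qed

context twisted_tensor
begin

text \<open>Tensoring with the semifree module \<open>F\<close> preserves the quasi-isomorphism
  \<Lambda>. Along the semibasis both sides are triangular, with subquotients T \<otimes> S and
  \<open>N\<close>, and \<Theta> acts as \<Lambda> on each coordinate.\<close>

lemma \<Theta>_qi:
  assumes sb: "semibasis B F Eb r'" and q: "qi SR.T N \<Lambda>"
  shows "qi SF.T Q.T \<Theta>"
proof -
  interpret bas: based_module B F Eb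
    using sb E.F.left_dg_module_axioms by (simp add: based_module_def based_module_axioms_def semibasis_def)
  interpret P': tensor_basis B E.N F Eb
    by (intro tensor_basis.intro E.P.tensor_pair_axioms bas.based_module_axioms)
  interpret Q': tensor_basis B NB F Eb
    by (intro tensor_basis.intro Q.tensor_pair_axioms bas.based_module_axioms)
  interpret PT: dg_group E.P.T by (rule E.P.T_dg)
  interpret SFT: dg_group SF.T by (rule SF.T_dg)
  interpret SRT: dg_group SR.T by (rule SR.T_dg)
  let ?r = "r' - Id"
  have r1: "(e, f) \<in> ?r" if "f \<in> Eb" "e \<in> Eb" "coeffs B F Eb (diff F f) e \<noteq> \<zero>\<^bsub>B\<^esub>" for e f
    using semibasis_coeffs[OF E.F.left_dg_module_axioms sb that(1,3)] .
  have irr: "(e, e) \<notin> ?r" for e by simp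
  interpret Pt: triangular E.P.T E.N Eb ?r "\<lambda>e. diff E.N" P'.tcoord "\<lambda>e l. E.P.pt l e"
    by (rule P'.T_triangular[OF r1 irr])
  let ?c = "\<lambda>e x i. P'.tcoord e (x i)" and ?i = "\<lambda>e x i. E.P.pt (x i) e"
  have tc_hom: "P'.tcoord e \<in> ahom SF SR" for e
    using P'.tcoord_hom[of e] by (simp add: hom_def)
  have pt_hom: "(\<lambda>l. E.P.pt l e) \<in> ahom SR SF" if "e \<in> Eb" for e
    using E.P.pt_left[OF bas.E_closed[OF that]] by (simp add: hom_def)
  have c_hom: "?c e \<in> ahom SF.T SR.T" for e
    by (rule ahom_pointwise[OF SF.twisted_module_axioms SR.twisted_module_axioms tc_hom refl])
  have i_hom: "?i e \<in> ahom SR.T SF.T" if "e \<in> Eb" for e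
    by (rule ahom_pointwise[OF SR.twisted_module_axioms SF.twisted_module_axioms pt_hom[OF that] refl])
  have tc0: "P'.tcoord e \<zero>\<^bsub>E.P.T\<^esub> = \<zero>\<^bsub>S\<^esub>" for e using ahom_zero[OF E.P.T_abelian E.P.agL P'.tcoord_hom] by simp
  \<comment> \<open>The twist acts on the factor \<open>S\<close> alone and so commutes with taking
    coordinates along the basis of \<open>F\<close>; what remains is the triangularity of S
    \<otimes> F itself.\<close>
  have d: "?c e' (diff SF.T (?i e x)) = (if e' = e then diff SR.T x else \<zero>\<^bsub>SR.T\<^esub>)"
    if e: "e \<in> Eb" "e' \<in> Eb" "e' = e \<or> (e', e) \<notin> ?r" and x: "x \<in> fsupp I SR" for e e' x
    using x
  proof (induction x rule: SR.M.fsupp_induct)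
    case zero
    have z: "?i e (\<lambda>i. \<zero>\<^bsub>SR\<^esub>) = (\<lambda>i. \<zero>\<^bsub>SF\<^esub>)" using E.P.pt_zero_left[OF bas.E_closed[OF e(1)]] by simp
    show ?case unfolding z SF.diff_T_zero SR.diff_T_zero by (simp add: tc0)
  next
    case (delta j s)
    have s: "s \<in> carrier S" using delta by simp
    have ec: "e \<in> carrier F" by (rule bas.E_closed[OF e(1)])
    have ga: "\<gamma> (a i j) \<in> carrier S" for i using dg_ring_morphismD(6)[OF \<gamma>] a_closed[OF delta(1)] by blast
    have "?i e (delta SR j s) = delta SF j (E.P.pt s e)"
      using E.P.pt_zero_left[OF ec] by (intro ext) (simp add: delta_def)
    then have "diff SF.T (?i e (delta SR j s)) = (\<lambda>i. act SF (a i j) (E.P.pt s e) \<oplus>\<^bsub>SF\<^esub> delta SF j (koszul SF (wt j) (diff SF (E.P.pt s e))) i)"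
      using SF.diff_delta[OF delta(1), of "E.P.pt s e"] E.P.pt_closed[of s e] s ec by simp
    moreover have "P'.tcoord e' (act SF (a i j) (E.P.pt s e) \<oplus>\<^bsub>SF\<^esub> delta SF j (koszul SF (wt j) (diff SF (E.P.pt s e))) i) =
       (if e' = e then act SR (a i j) s \<oplus>\<^bsub>SR\<^esub> delta SR j (koszul SR (wt j) (diff SR s)) i else \<zero>\<^bsub>S\<^esub>)" for i
    proof -
      have 1: "act SF (a i j) (E.P.pt s e) = E.P.pt (\<gamma> (a i j) \<otimes>\<^bsub>S\<^esub> s) e"
        using E.act_pt[OF ga s ec] by simp
      have 2: "P'.tcoord e' (diff E.P.T (E.P.pt s e)) = (if e' = e then diff S s else \<zero>\<^bsub>S\<^esub>)"
        using Pt.diff_diag[OF e(1), of s] Pt.diff_lower[OF e(1,2), of s] e(3) s by auto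
      have 3: "P'.tcoord e' (delta SF j (koszul SF (wt j) (diff SF (E.P.pt s e))) i) =
          (if e' = e then delta SR j (koszul SR (wt j) (diff SR s)) i else \<zero>\<^bsub>S\<^esub>)"
        using koszul_hom[OF SF.M.M.abelian_group_axioms SR.M.M.abelian_group_axioms tc_hom, of "diff E.P.T (E.P.pt s e)" e' "wt j"] 2
          E.P.pt_closed[of s e] s ec SR.M.koszul_zero[of "wt j"]
        by (auto simp: delta_def tc0)
      have "P'.tcoord e' (E.P.pt (\<gamma> (a i j) \<otimes>\<^bsub>S\<^esub> s) e) = (if e' = e then \<gamma> (a i j) \<otimes>\<^bsub>S\<^esub> s else \<zero>\<^bsub>S\<^esub>)"
        using P'.tcoord_basis[of "\<gamma> (a i j) \<otimes>\<^bsub>S\<^esub> s" e e'] s ga e by simp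
      moreover have "delta SF j (koszul SF (wt j) (diff SF (E.P.pt s e))) i \<in> carrier SF"
        using SF.M.koszul_closed[of "diff SF (E.P.pt s e)" "wt j"] E.P.pt_closed[of s e] s ec by (simp add: delta_def)
      moreover have "E.P.pt (\<gamma> (a i j) \<otimes>\<^bsub>S\<^esub> s) e \<in> carrier SF" using E.P.pt_closed[of "\<gamma> (a i j) \<otimes>\<^bsub>S\<^esub> s" e] s ga ec by simp
      ultimately show ?thesis unfolding 1 using ahom_add[OF tc_hom, of "E.P.pt (\<gamma> (a i j) \<otimes>\<^bsub>S\<^esub> s) e"] 3 by simp
    qed
    ultimately show ?case using SR.diff_delta[OF delta] by (auto simp: fun_eq_iff)
  next
    case (add x y)
    have xy: "x \<in> carrier SR.T" "y \<in> carrier SR.T" using add by auto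
    have h: "(\<lambda>x. ?c e' (diff SF.T (?i e x))) \<in> ahom SR.T SR.T"
      by (rule ahom_comp[OF ahom_comp[OF i_hom[OF e(1)] SF.diff_T_ahom] c_hom])
    have "?c e' (diff SF.T (?i e (x \<oplus>\<^bsub>SR.T\<^esub> y))) = ?c e' (diff SF.T (?i e x)) \<oplus>\<^bsub>SR.T\<^esub> ?c e' (diff SF.T (?i e y))"
      by (rule ahom_add[OF h xy])
    then have "?c e' (diff SF.T (?i e (x \<oplus>\<^bsub>SR.T\<^esub> y))) = (if e' = e then diff SR.T (x \<oplus>\<^bsub>SR.T\<^esub> y) else \<zero>\<^bsub>SR.T\<^esub>)"
      using add(3,4) SRT.diff_add[OF xy] SRT.r_zero[OF SRT.zero_closed] by (simp del: twisted_simps)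
    then show ?case by (simp only: twisted_simps)
  qed
  have tri: "triangular SF.T SR.T Eb ?r (\<lambda>e. diff SR.T) ?c ?i"
  proof (intro triangular.intro triangular_axioms.intro SF.T_dg SR.T_abelian)
    show "?i e \<in> ahom SR.T SF.T" if "e \<in> Eb" for e by (rule i_hom[OF that])
    show "?c e \<in> ahom SF.T SR.T" for e by (rule c_hom)
    show "finite {e \<in> Eb. ?c e x \<noteq> \<zero>\<^bsub>SR.T\<^esub>}" if "x \<in> carrier SF.T" for x
    proof (rule finite_subset)
      have x: "x \<in> fsupp I SF" using that by simp
      show "{e \<in> Eb. ?c e x \<noteq> \<zero>\<^bsub>SR.T\<^esub>} \<subseteq> (\<Union>i\<in>{i. x i \<noteq> \<zero>\<^bsub>SF\<^esub>}. {e. P'.tcoord e (x i) \<noteq> \<zero>\<^bsub>E.N\<^esub>})"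
        using tc0 by (auto simp: fun_eq_iff) metis
      have "finite {e. P'.tcoord e (x i) \<noteq> \<zero>\<^bsub>E.N\<^esub>}" for i
        using fsuppD(1)[OF x, of i] by (intro fsuppD(3)[OF P'.tcoord_fsupp]) simp
      then show "finite (\<Union>i\<in>{i. x i \<noteq> \<zero>\<^bsub>SF\<^esub>}. {e. P'.tcoord e (x i) \<noteq> \<zero>\<^bsub>E.N\<^esub>})"
        using fsuppD(3)[OF x] by blast
    qed
    show "x = \<zero>\<^bsub>SF.T\<^esub>" if x: "x \<in> carrier SF.T" and z: "\<And>e. e \<in> Eb \<Longrightarrow> ?c e x = \<zero>\<^bsub>SR.T\<^esub>" for x
    proof
      fix i
      have "x i \<in> carrier E.P.T" using fsuppD(1)[of x I SF i] x by simp
      then have "x i = \<zero>\<^bsub>E.P.T\<^esub>"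
        using z tc0 by (intro P'.tcoord_eqI) (auto simp: fun_eq_iff)
      then show "x i = \<zero>\<^bsub>SF.T\<^esub> i" by simp
    qed
    show "?c e (?i e m) = m" if "e \<in> Eb" "m \<in> carrier SR.T" for e m
      using that P'.tcoord_basis[of _ e e] fsuppD(1)[of m I SR] by (intro ext) simp
    show "?c e' (?i e m) = \<zero>\<^bsub>SR.T\<^esub>" if "e \<in> Eb" "e' \<in> Eb" "e' \<noteq> e" "m \<in> carrier SR.T" for e e' m
      using that P'.tcoord_basis[of _ e e'] fsuppD(1)[of m I SR] by (intro ext) simp
    show "?c e (diff SF.T (?i e m)) = diff SR.T m" if "e \<in> Eb" "m \<in> carrier SR.T" for e m
      using d[OF that(1,1)] that(2) by simp
    show "?c e' (diff SF.T (?i e m)) = \<zero>\<^bsub>SR.T\<^esub>" if "e \<in> Eb" "e' \<in> Eb" "e' \<noteq> e" "(e', e) \<notin> ?r" "m \<in> carrier SR.T" for e e' m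
      using d[OF that(1,2)] that by auto
  qed
  show ?thesis
  proof (rule triangular_qi[OF tri Q'.T_triangular[OF r1 irr] semibasis_wf[OF sb] \<Theta>_chain_map])
    show L: "\<Lambda> \<in> ahom SR.T NB" using chain_mapD(1)[OF \<Lambda>_chain_map] by (simp add: hom_def)
    show "Q'.tcoord e (\<Theta> y) = \<Lambda> (?c e y)" if e: "e \<in> Eb" and y: "y \<in> carrier SF.T" for e y
    proof -
      have h1: "(\<lambda>y. Q'.tcoord e (\<Theta> y)) \<in> ahom SF.T NB"
        by (rule ahom_comp[OF chain_mapD(1)[OF \<Theta>_chain_map] Q'.tcoord_hom])
      have h2: "(\<lambda>y. \<Lambda> (?c e y)) \<in> ahom SF.T NB" by (rule ahom_comp[OF c_hom L])
      have "y \<in> fsupp I SF" using y by simp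
      then show ?thesis
      proof (induction y rule: SF.M.fsupp_induct)
        case zero
        show ?case using ahom_zero[OF SF.T_abelian Q.agL h1] ahom_zero[OF SF.T_abelian Q.agL h2] by simp
      next
        case (delta j t)
        then have t: "t \<in> carrier E.P.T" by simp
        have dl: "?c e (delta SF j t') = delta SR j (P'.tcoord e t')" for t' by (auto simp: delta_def tc0)
        have ft: "(\<lambda>t. Q'.tcoord e (theta j t)) \<in> ahom E.P.T NB" by (rule ahom_comp[OF theta_hom[OF delta(1)] Q'.tcoord_hom])
        have gt: "(\<lambda>t. act N (P'.tcoord e t) (v j)) \<in> ahom E.P.T NB"
          using P'.tcoord_hom[of e] N.act_left[OF v_closed[OF delta(1)]] by (simp add: hom_def Pi_iff)
        have "Q'.tcoord e (theta j t) = act N (P'.tcoord e t) (v j)"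
        proof (rule E.P.T_hom_eq[OF ft gt _ t])
          fix s f assume "s \<in> carrier E.N" and f: "f \<in> carrier F"
          then have s: "s \<in> carrier S" by simp
          show "Q'.tcoord e (theta j (E.P.pt s f)) = act N (P'.tcoord e (E.P.pt s f)) (v j)"
            using s f v_closed[OF delta(1)] Q'.tcoord_pt[of "act N s (v j)" f e] P'.tcoord_pt[of s f e] \<beta>_closed[OF bas.coeffs_closed[OF f]]
            by (simp add: theta_pt[OF delta(1)] N.act_closed N.act_mult)
        qed
        then show ?case using t Pt.coord_closed[OF e t]
          by (simp add: \<Theta>_delta[OF delta(1)] dl \<Lambda>_delta[OF delta(1)])
      next
        case (add x y)
        then show ?case using ahom_add[OF h1, of x y] ahom_add[OF h2, of x y] by simp
      qed
    qed
    fix y x assume yx: "y \<in> carrier SR.T" "x \<in> carrier NB" "diff SR.T y = \<zero>\<^bsub>SR.T\<^esub>" "\<Lambda> y = diff NB x"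
    then show "\<exists>y'\<in>carrier SR.T. \<exists>x'\<in>carrier NB. diff SR.T y' = y \<and> \<Lambda> y' = x \<oplus>\<^bsub>NB\<^esub> diff NB x'"
      using q unfolding qi_def restrict_scalars_simps by blast
  qed
qed

end

lemma tensor_map_ltensor:
  assumes "scalar_extension S B F \<beta>" "dg_module_morphism B F F \<phi>"
  shows "dg_module_morphism S (ltensor S B \<beta> F) (ltensor S B \<beta> F) (tensor_map B (restrict_scalars \<beta> (right_regular S)) F F \<phi>)"
proof -
  interpret scalar_extension S B F \<beta> by fact
  note tm = tensor_map[OF P.tensor_pair_axioms P.tensor_pair_axioms assms(2)]
  have \<phi>c: "f \<in> carrier F \<Longrightarrow> \<phi> f \<in> carrier F" for f using ahom_closed[OF chain_mapD(1)[OF dg_module_morphismD(1)[OF assms(2)]]] .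
  show ?thesis unfolding dg_module_morphism_def
  proof (intro conjI ballI)
    show "chain_map (ltensor S B \<beta> F) (ltensor S B \<beta> F) (tensor_map B N F F \<phi>)"
      using tm(1) same_dg_chain_map(1)[OF same_dg_ltensor] same_dg_chain_map(2)[OF same_dg_ltensor] by blast
    fix s x assume s: "s \<in> carrier S" and "x \<in> carrier (ltensor S B \<beta> F)"
    then have x: "x \<in> carrier P.T" by simp
    show "tensor_map B N F F \<phi> (act (ltensor S B \<beta> F) s x) = act (ltensor S B \<beta> F) s (tensor_map B N F F \<phi> x)"
      by (rule P.T_hom_eq[OF ahom_comp[OF act_hom[OF s] chain_mapD(1)[OF tm(1)]] ahom_comp[OF chain_mapD(1)[OF tm(1)] act_hom[OF s]] _ x])
        (use s in \<open>simp add: act_pt tm(2) \<phi>c del: ltensor_simps\<close>)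
  qed
qed

lemma (in twisted_tensor) \<Theta>_scalar:
  assumes \<phi>: "dg_module_morphism B F F \<phi>" and x: "x \<in> carrier SF.T"
  shows "\<Theta> (\<lambda>i. tensor_map B E.N F F \<phi> (x i)) = tensor_map B NB F F \<phi> (\<Theta> x)"
proof -
  note tP = tensor_map[OF E.P.tensor_pair_axioms E.P.tensor_pair_axioms \<phi>]
  note tQ = tensor_map[OF Q.tensor_pair_axioms Q.tensor_pair_axioms \<phi>]
  have \<phi>c: "f \<in> carrier F \<Longrightarrow> \<phi> f \<in> carrier F" for f using ahom_closed[OF chain_mapD(1)[OF dg_module_morphismD(1)[OF \<phi>]]] .
  have th: "tensor_map B E.N F F \<phi> \<in> ahom SF SF" using chain_mapD(1)[OF tP(1)] by (simp add: hom_def)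
  have p: "(\<lambda>x i. tensor_map B E.N F F \<phi> (x i)) \<in> ahom SF.T SF.T"
    by (rule ahom_pointwise[OF SF.twisted_module_axioms SF.twisted_module_axioms th refl])
  have h1: "(\<lambda>x. \<Theta> (\<lambda>i. tensor_map B E.N F F \<phi> (x i))) \<in> ahom SF.T Q.T"
    by (rule ahom_comp[OF p chain_mapD(1)[OF \<Theta>_chain_map]])
  have h2: "(\<lambda>x. tensor_map B NB F F \<phi> (\<Theta> x)) \<in> ahom SF.T Q.T"
    by (rule ahom_comp[OF chain_mapD(1)[OF \<Theta>_chain_map] chain_mapD(1)[OF tQ(1)]])
  have "x \<in> fsupp I SF" using x by simp
  then show ?thesis
  proof (induction x rule: SF.M.fsupp_induct)
    case zero
    show ?case using ahom_zero[OF SF.T_abelian Q.T_abelian h1] ahom_zero[OF SF.T_abelian Q.T_abelian h2] by simp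
  next
    case (delta j t)
    then have t: "t \<in> carrier E.P.T" by simp
    have "tensor_map B E.N F F \<phi> \<zero>\<^bsub>SF\<^esub> = \<zero>\<^bsub>SF\<^esub>" using ahom_zero[OF E.P.T_abelian E.P.T_abelian chain_mapD(1)[OF tP(1)]] by simp
    then have dl: "(\<lambda>i. tensor_map B E.N F F \<phi> (delta SF j t i)) = delta SF j (tensor_map B E.N F F \<phi> t)" by (intro ext) (simp add: delta_def)
    have "theta j (tensor_map B E.N F F \<phi> t) = tensor_map B NB F F \<phi> (theta j t)"
      by (rule E.P.T_hom_eq[OF ahom_comp[OF chain_mapD(1)[OF tP(1)] theta_hom[OF delta(1)]] ahom_comp[OF theta_hom[OF delta(1)] chain_mapD(1)[OF tQ(1)]] _ t])
        (simp add: tP(2) tQ(2) \<phi>c theta_pt[OF delta(1)] N.act_closed v_closed[OF delta(1)])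
    then show ?case using t ahom_closed[OF chain_mapD(1)[OF tP(1)] t] by (simp add: dl \<Theta>_delta[OF delta(1)])
  next
    case (add x y)
    then show ?case using ahom_add[OF h1, of x y] ahom_add[OF h2, of x y] by simp
  qed
qed

section \<open>Universal resolutions\<close>

text \<open>A cell has a single degree, so a construction by cells solves the cone condition for
  homogeneous pairs only. As differentials and \<open>f\<close> are homogeneous, a general pair can
  be treated one degree at a time.\<close>

lemma qi_homogeneousI:
  assumes M: "dg_group M" and N: "dg_group N" and f: "chain_map M N f"
    and hom: "\<And>n y x. y \<in> gr M (n - 1) \<Longrightarrow> x \<in> gr N n \<Longrightarrow> diff M y = \<zero>\<^bsub>M\<^esub> \<Longrightarrow> f y = diff N x \<Longrightarrow>
      \<exists>y'\<in>carrier M. \<exists>x'\<in>carrier N. diff M y' = y \<and> f y' = x \<oplus>\<^bsub>N\<^esub> diff N x'"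
  shows "qi M N f"
proof (rule qiI[OF f])
  interpret M: dg_group M by fact
  interpret N: dg_group N by fact
  note fh = chain_mapD(1)[OF f]
  note agM = M.abelian_group_axioms and agN = N.abelian_group_axioms
  have "\<exists>y'\<in>carrier M. \<exists>x'\<in>carrier N. diff M y' = y \<and> f y' = x \<oplus>\<^bsub>N\<^esub> diff N x'"
    if "finite D" "y \<in> carrier M" "x \<in> carrier N" "diff M y = \<zero>\<^bsub>M\<^esub>" "f y = diff N x"
      "\<And>n. n \<notin> D \<Longrightarrow> hcomp M y (n - 1) = \<zero>\<^bsub>M\<^esub> \<and> hcomp N x n = \<zero>\<^bsub>N\<^esub>" for D y x
    using that
  proof (induction D arbitrary: y x rule: finite_induct)
    case empty
    have "hcomp M y n = \<zero>\<^bsub>M\<^esub>" for n using empty(5)[of "n + 1"] by simp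
    then have "y = \<zero>\<^bsub>M\<^esub>" "x = \<zero>\<^bsub>N\<^esub>" using empty M.hcomp_zero_iff N.hcomp_zero_iff by auto
    then show ?case using ahom_zero[OF agM agN fh]
      by (intro bexI[of _ "\<zero>\<^bsub>M\<^esub>"] bexI[of _ "\<zero>\<^bsub>N\<^esub>"]) auto
  next
    case (insert n D)
    let ?y = "hcomp M y (n - 1)" and ?x = "hcomp N x n"
    have y: "?y \<in> gr M (n - 1)" "?y \<in> carrier M" and x: "?x \<in> gr N n" "?x \<in> carrier N"
      using insert.prems M.hcomp_gr M.hcomp_closed N.hcomp_gr N.hcomp_closed by auto
    have dy: "diff M ?y = \<zero>\<^bsub>M\<^esub>"
      using M.hcomp_diff[OF insert.prems(1), of "n - 1 - 1"] insert.prems(3) M.hcomp_homogeneous[OF M.gr_zero, of "n - 1 - 1"] by simp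
    have fy: "f ?y = diff N ?x"
      using hcomp_hom[OF M.graded_group_axioms N.graded_group_axioms fh, of 0 y "n - 1"] chain_mapD(2)[OF f]
        N.hcomp_diff[OF insert.prems(2), of "n - 1"] insert.prems by simp
    obtain y1 x1 where 1: "y1 \<in> carrier M" "x1 \<in> carrier N" "diff M y1 = ?y" "f y1 = ?x \<oplus>\<^bsub>N\<^esub> diff N x1"
      using hom[OF y(1) x(1) dy fy] by blast
    let ?y2 = "y \<ominus>\<^bsub>M\<^esub> ?y" and ?x2 = "x \<ominus>\<^bsub>N\<^esub> ?x"
    have c: "?y2 \<in> carrier M" "?x2 \<in> carrier N" using y x insert.prems by auto
    have "diff M ?y2 = \<zero>\<^bsub>M\<^esub>" using insert.prems y dy by (simp add: M.diff_minus M.minus_zero)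
    moreover have "f ?y2 = diff N ?x2"
      using ahom_minus[OF agM agN fh insert.prems(1) y(2)] insert.prems x fy by (simp add: N.diff_minus)
    moreover have "hcomp M ?y2 (m - 1) = \<zero>\<^bsub>M\<^esub> \<and> hcomp N ?x2 m = \<zero>\<^bsub>N\<^esub>" if m: "m \<notin> D" for m
    proof -
      have "hcomp M ?y2 (m - 1) = hcomp M y (m - 1) \<ominus>\<^bsub>M\<^esub> hcomp M ?y (m - 1)"
        using ahom_minus[OF agM agM M.hcomp_ahom] insert.prems y by simp
      moreover have "hcomp N ?x2 m = hcomp N x m \<ominus>\<^bsub>N\<^esub> hcomp N ?x m"
        using ahom_minus[OF agN agN N.hcomp_ahom] insert.prems x by simp
      ultimately show ?thesis
        using insert.prems(5)[of m] m M.hcomp_homogeneous[OF y(1), of "m - 1"] N.hcomp_homogeneous[OF x(1), of m]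
          M.eq_iff_minus[of ?y ?y] N.eq_iff_minus[of ?x ?x] y x
        by (cases "m = n") (simp_all add: M.minus_zero N.minus_zero)
    qed
    ultimately obtain y3 x3 where 3: "y3 \<in> carrier M" "x3 \<in> carrier N" "diff M y3 = ?y2" "f y3 = ?x2 \<oplus>\<^bsub>N\<^esub> diff N x3"
      using insert.IH[OF c] by blast
    have "diff M (y1 \<oplus>\<^bsub>M\<^esub> y3) = y" using 1 3 y insert.prems by (simp add: M.diff_add M.minus_cancel)
    moreover have "f (y1 \<oplus>\<^bsub>M\<^esub> y3) = x \<oplus>\<^bsub>N\<^esub> diff N (x1 \<oplus>\<^bsub>N\<^esub> x3)"
    proof -
      have "f (y1 \<oplus>\<^bsub>M\<^esub> y3) = (?x \<oplus>\<^bsub>N\<^esub> ?x2) \<oplus>\<^bsub>N\<^esub> (diff N x1 \<oplus>\<^bsub>N\<^esub> diff N x3)"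
        using ahom_add[OF fh 1(1) 3(1)] 1 3 c x by (simp add: N.a_ac)
      then show ?thesis using 1 3 x insert.prems by (simp add: N.minus_cancel N.diff_add)
    qed
    ultimately show ?case using 1 3 M.a_closed N.a_closed by blast
  qed
  note key = this
  fix y x assume yx: "y \<in> carrier M" "x \<in> carrier N" "diff M y = \<zero>\<^bsub>M\<^esub>" "f y = diff N x"
  \<comment> \<open>Degree \<open>n\<close> of the cone consists of \<open>y\<close> in degree
    \<open>n - 1\<close> and \<open>x\<close> in degree \<open>n\<close>; hence the shift in the
    first part.\<close>
  let ?D = "(\<lambda>n. n + 1) ` {n. hcomp M y n \<noteq> \<zero>\<^bsub>M\<^esub>} \<union> {n. hcomp N x n \<noteq> \<zero>\<^bsub>N\<^esub>}"
  have "finite ?D" using M.hcomp_finite[OF yx(1)] N.hcomp_finite[OF yx(2)] by simp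
  moreover have "hcomp M y (n - 1) = \<zero>\<^bsub>M\<^esub> \<and> hcomp N x n = \<zero>\<^bsub>N\<^esub>" if "n \<notin> ?D" for n
    using that by (force simp: image_iff)
  ultimately show "\<exists>y'\<in>carrier M. \<exists>x'\<in>carrier N. diff M y' = y \<and> f y' = x \<oplus>\<^bsub>N\<^esub> diff N x'"
    by (intro key[OF _ yx])
qed

text \<open>
  A cell records its degree, its boundary (a combination of earlier cells) and its image in the
  module that is being resolved; adjoining all admissible cells at once kills all cycles.
\<close>

datatype ('r, 'n) cell = Cell (cell_deg: int) (cell_bd: "(('r, 'n) cell \<times> 'r) list") (cell_val: 'n)

text \<open>Reads the boundary list as a finitely supported column. Of repeated entries the first
  one counts; different lists for the same column merely give several cells with equal boundary,
  which does no harm.\<close>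

definition cell_coeff :: "('r, 'p) dg_scheme \<Rightarrow> ('r, 'n) cell \<Rightarrow> ('r, 'n) cell \<Rightarrow> 'r" where
  "cell_coeff R i j = (case map_of (cell_bd j) i of Some b \<Rightarrow> b | None \<Rightarrow> \<zero>\<^bsub>R\<^esub>)"

definition cell_rel :: "(('r, 'n) cell \<times> ('r, 'n) cell) set" where
  "cell_rel = {(i, j). i \<in> fst ` set (cell_bd j)}"

text \<open>The conditions say that the boundary of \<open>j\<close> is a cycle of degree
  \<open>cell_deg j - 1\<close> on earlier cells and that its image in \<open>N\<close> is the
  differential of \<open>cell_val j\<close>. These are the premises of the cone condition, so each
  homogeneous instance of it is solved by a cell of its own.\<close>

inductive_set cells :: "('r, 'p) dg_scheme \<Rightarrow> ('r, 'n, 'm) dgmod_scheme \<Rightarrow> ('r, 'n) cell set"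
  for R :: "('r, 'p) dg_scheme" and N :: "('r, 'n, 'm) dgmod_scheme" where
  cell: "\<lbrakk>\<forall>p\<in>set (cell_bd j). fst p \<in> cells R N; cell_val j \<in> gr N (cell_deg j);
    \<forall>i. cell_coeff R i j \<in> gr R (cell_deg j - cell_deg i - 1);
    \<forall>i. (\<Oplus>\<^bsub>R\<^esub>l\<in>{l. cell_coeff R l j \<noteq> \<zero>\<^bsub>R\<^esub>}. cell_coeff R i l \<otimes>\<^bsub>R\<^esub> cell_coeff R l j) \<oplus>\<^bsub>R\<^esub>
      koszul R (cell_deg i) (diff R (cell_coeff R i j)) = \<zero>\<^bsub>R\<^esub>;
    diff N (cell_val j) = (\<Oplus>\<^bsub>N\<^esub>l\<in>{l. cell_coeff R l j \<noteq> \<zero>\<^bsub>R\<^esub>}. act N (cell_coeff R l j) (cell_val l))\<rbrakk>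
    \<Longrightarrow> j \<in> cells R N"

lemma wf_cell_rel: "wf cell_rel"
proof (rule wfUNIVI)
  fix P :: "('r, 'n) cell \<Rightarrow> bool" and j
  assume step: "\<forall>j. (\<forall>i. (i, j) \<in> cell_rel \<longrightarrow> P i) \<longrightarrow> P j"
  show "P j"
  proof (induction j)
    case (Cell n z y)
    show ?case
    proof (rule step[rule_format])
      fix i assume "(i, Cell n z y) \<in> cell_rel"
      then obtain p where "p \<in> set z" "i = fst p" by (auto simp: cell_rel_def)
      then show "P i" using Cell by (metis Basic_BNFs.fsts.intros)
    qed
  qed
qed

lemma cell_coeff_nonzero: "cell_coeff R i j \<noteq> \<zero>\<^bsub>R\<^esub> \<Longrightarrow> i \<in> fst ` set (cell_bd j)"
  by (auto simp: cell_coeff_def split: option.splits dest: map_of_SomeD intro: rev_image_eqI)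

lemma twisting_cells:
  assumes "gc_dg_ring R"
  shows "twisting R (cells R N) cell_deg (cell_coeff R) cell_rel"
proof (intro twisting.intro twisting_axioms.intro assms wf_cell_rel)
  fix i j :: "('a, 'c) cell" assume j: "j \<in> cells R N"
  from j show "cell_coeff R i j \<in> gr R (cell_deg j - cell_deg i - 1)" by cases blast
  from j show "(\<Oplus>\<^bsub>R\<^esub>l\<in>{l. cell_coeff R l j \<noteq> \<zero>\<^bsub>R\<^esub>}. cell_coeff R i l \<otimes>\<^bsub>R\<^esub> cell_coeff R l j) \<oplus>\<^bsub>R\<^esub>
      koszul R (cell_deg i) (diff R (cell_coeff R i j)) = \<zero>\<^bsub>R\<^esub>" by cases blast
  show "i \<in> cells R N \<and> (i, j) \<in> cell_rel" if "cell_coeff R i j \<noteq> \<zero>\<^bsub>R\<^esub>"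
    using j cell_coeff_nonzero[OF that] by (cases rule: cells.cases) (auto simp: cell_rel_def)
  show "finite {i. cell_coeff R i j \<noteq> \<zero>\<^bsub>R\<^esub>}"
    by (rule finite_subset[of _ "fst ` set (cell_bd j)"]) (auto dest: cell_coeff_nonzero)
qed

lemma twisted_map_cells:
  assumes R: "gc_dg_ring R" and S: "dg_ring S" and N: "right_dg_module S N" and \<gamma>: "dg_ring_morphism R S \<gamma>"
  shows "twisted_map R (cells R (restrict_scalars \<gamma> N)) cell_deg (cell_coeff R) cell_rel S N \<gamma> cell_val"
proof (intro twisted_map.intro twisted_map_axioms.intro twisting_cells R S N \<gamma>)
  fix j assume j: "j \<in> cells R (restrict_scalars \<gamma> N)"
  from j show "cell_val j \<in> gr N (cell_deg j)" by cases auto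
  from j show "diff N (cell_val j) = (\<Oplus>\<^bsub>N\<^esub>i\<in>{i. cell_coeff R i j \<noteq> \<zero>\<^bsub>R\<^esub>}. act N (\<gamma> (cell_coeff R i j)) (cell_val i))"
    by cases (simp add: same_dg_finsum[OF same_dg_restrict[of N \<gamma>]])
qed

lemma dg_ring_morphism_id: "dg_ring_morphism R R id"
  by (auto simp: dg_ring_morphism_def ring_hom_def chain_map_def hom_def)

lemma restrict_scalars_id: "restrict_scalars id M = M"
  by (cases M) (simp add: restrict_scalars_def dg.defs dgmod.defs)

text \<open>For a homogeneous pair as in the cone condition, the cell with boundary \<open>y\<close>
  and value \<open>x\<close> is admissible. As an element of the twisted sum it has differential
  \<open>y\<close> and image exactly \<open>x\<close>.\<close>

lemma cells_qi_regular:
  fixes R :: "'r dg" and N :: "('r, 'n) dgmod"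
  assumes R: "gc_dg_ring R" and N: "right_dg_module R N"
  shows "qi (twisted (cells R N) cell_deg (cell_coeff R) R (left_regular R)) N (fs_ext R N (\<lambda>i s. act N s (cell_val i)))"
proof -
  interpret R: gc_dg_ring R by fact
  interpret twisted_map R "cells R N" cell_deg "cell_coeff R" cell_rel R N id cell_val
    using twisted_map_cells[OF R R.dg_ring_axioms N dg_ring_morphism_id] by (simp add: restrict_scalars_id)
  have SR: "SR = left_regular R" by (rule restrict_scalars_id)
  have "qi SR.T N \<Lambda>"
  proof (rule qi_homogeneousI[OF SR.T_dg N.M.dg_group_axioms \<Lambda>_chain_map])
    fix n y x assume "y \<in> gr SR.T (n - 1)" and x: "x \<in> gr N n" and dy: "diff SR.T y = \<zero>\<^bsub>SR.T\<^esub>" and Ly: "\<Lambda> y = diff N x"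
    then have y: "y \<in> fsupp (cells R N) SR" "\<And>i. y i \<in> gr R (n - 1 - cell_deg i)" by auto
    let ?supp = "{i. y i \<noteq> \<zero>\<^bsub>R\<^esub>}"
    have fin: "finite ?supp" using fsuppD(3)[OF y(1)] by simp
    then obtain xs where xs: "set xs = ?supp" using finite_list by blast
    \<comment> \<open>The list enumerates the support of \<open>y\<close>; its order does not affect
      the coefficients.\<close>
    define j where "j = Cell n (map (\<lambda>i. (i, y i)) xs) x"
    have yc: "y i \<in> carrier R" for i using R.gr_closed[OF y(2)] .
    have "map_of (map (\<lambda>i. (i, y i)) xs) i = (if i \<in> set xs then Some (y i) else None)" for i
      by (auto simp: map_of_map_restrict restrict_map_def)
    then have co: "cell_coeff R i j = y i" for i using xs by (auto simp: cell_coeff_def j_def)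
    have jc: "j \<in> cells R N"
    proof (rule cells.cell)
      show "\<forall>p\<in>set (cell_bd j). fst p \<in> cells R N" using xs fsuppD(2)[OF y(1)] by (auto simp: j_def)
      show "cell_val j \<in> gr N (cell_deg j)" using x by (simp add: j_def)
      show "\<forall>i. cell_coeff R i j \<in> gr R (cell_deg j - cell_deg i - 1)"
        using y(2) unfolding co by (simp add: j_def algebra_simps)
      show "\<forall>i. (\<Oplus>\<^bsub>R\<^esub>l\<in>{l. cell_coeff R l j \<noteq> \<zero>\<^bsub>R\<^esub>}. cell_coeff R i l \<otimes>\<^bsub>R\<^esub> cell_coeff R l j) \<oplus>\<^bsub>R\<^esub>
          koszul R (cell_deg i) (diff R (cell_coeff R i j)) = \<zero>\<^bsub>R\<^esub>"
      proof
        fix i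
        have "diff SR.T y i = \<zero>\<^bsub>R\<^esub>" using dy by simp
        then show "(\<Oplus>\<^bsub>R\<^esub>l\<in>{l. cell_coeff R l j \<noteq> \<zero>\<^bsub>R\<^esub>}. cell_coeff R i l \<otimes>\<^bsub>R\<^esub> cell_coeff R l j) \<oplus>\<^bsub>R\<^esub>
            koszul R (cell_deg i) (diff R (cell_coeff R i j)) = \<zero>\<^bsub>R\<^esub>"
          unfolding co
          by (simp add: SR.diff_T fs_ext_def same_dg_finsum[OF S_SR] same_dg_koszul[OF S_SR])
      qed
      show "diff N (cell_val j) = (\<Oplus>\<^bsub>N\<^esub>l\<in>{l. cell_coeff R l j \<noteq> \<zero>\<^bsub>R\<^esub>}. act N (cell_coeff R l j) (cell_val l))"
        using Ly unfolding co by (simp add: \<Lambda>_def fs_ext_def j_def)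
    qed
    \<comment> \<open>The unit has zero differential, so only the column of \<open>j\<close>
      remains.\<close>
    have "diff SR.T (delta SR j \<one>\<^bsub>R\<^esub>) = y"
    proof
      fix i
      have "diff SR.T (delta SR j \<one>\<^bsub>R\<^esub>) i = act SR (cell_coeff R i j) \<one>\<^bsub>R\<^esub> \<oplus>\<^bsub>SR\<^esub> delta SR j (koszul SR (cell_deg j) (diff SR \<one>\<^bsub>R\<^esub>)) i"
        using SR.diff_delta[OF jc, of "\<one>\<^bsub>R\<^esub>"] by simp
      also have "\<dots> = y i" using SR.M.koszul_zero yc[of i] by (simp add: co R.diff_one delta_def)
      finally show "diff SR.T (delta SR j \<one>\<^bsub>R\<^esub>) i = y i" .
    qed
    moreover have "\<Lambda> (delta SR j \<one>\<^bsub>R\<^esub>) = x \<oplus>\<^bsub>N\<^esub> diff N \<zero>\<^bsub>N\<^esub>"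
      using \<Lambda>_delta[OF jc, of "\<one>\<^bsub>R\<^esub>"] N.M.gr_closed[OF x] by (simp add: j_def N.act_one)
    moreover have "delta SR j \<one>\<^bsub>R\<^esub> \<in> carrier SR.T" using SR.M.fsupp_delta[OF jc, of "\<one>\<^bsub>R\<^esub>"] by simp
    ultimately show "\<exists>y'\<in>carrier SR.T. \<exists>x'\<in>carrier N. diff SR.T y' = y \<and> \<Lambda> y' = x \<oplus>\<^bsub>N\<^esub> diff N x'"
      using N.zero_closed by blast
  qed
  then show ?thesis by (simp add: SR \<Lambda>_def)
qed

text \<open>With T built over \<open>R\<close>, the map from T \<otimes> R to T \<otimes> S is a
  quasi-isomorphism because \<gamma> is one, and its composite with \<Lambda> is the resolution over
  \<open>R\<close>. Cancelling the first map leaves \<Lambda>. With A for \<open>R\<close> and C for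
  \<open>S\<close> this is how a resolution over A comes to compute tensor products over C.\<close>

lemma cells_qi:
  fixes R :: "'r dg" and S :: "'s dg" and N :: "('s, 'n) dgmod"
  assumes R: "gc_dg_ring R" and S: "dg_ring S" and N: "right_dg_module S N" and \<gamma>: "dg_ring_morphism R S \<gamma>" and q: "qi R S \<gamma>"
  shows "qi (twisted (cells R (restrict_scalars \<gamma> N)) cell_deg (cell_coeff R) R (restrict_scalars \<gamma> (left_regular S))) N
    (fs_ext S N (\<lambda>i s. act N s (cell_val i)))"
proof -
  interpret R: gc_dg_ring R by fact
  interpret twisted_map R "cells R (restrict_scalars \<gamma> N)" cell_deg "cell_coeff R" cell_rel S N \<gamma> cell_val
    by (rule twisted_map_cells[OF R S N \<gamma>])
  let ?N = "restrict_scalars \<gamma> N"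
  have RM: "left_dg_module R (left_regular R)" by (rule left_regular[OF R.dg_ring_axioms])
  interpret RT: twisted_module R "cells R ?N" cell_deg "cell_coeff R" cell_rel "left_regular R"
    by (rule twisted_moduleI[OF RM])
  have "dg_module_morphism R (left_regular R) SR \<gamma>"
    using \<gamma> same_dg_chain_map(1)[OF same_dg_regular(1)[of R]] same_dg_chain_map(2)[OF S_SR]
    by (auto simp: dg_module_morphism_def dg_ring_morphism_def ring_hom_def)
  moreover have "qi (left_regular R) SR \<gamma>"
    using q same_dg_qi(1)[OF same_dg_regular(1)[of R]] same_dg_qi(2)[OF S_SR] by blast
  ultimately have qT: "qi RT.T SR.T (\<lambda>x i. \<gamma> (x i))" by (rule twisted_qi[OF RM SR_module])
  have "qi RT.T ?N (fs_ext R ?N (\<lambda>i s. act ?N s (cell_val i)))"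
    by (rule cells_qi_regular[OF R right_restrict[OF R.dg_ring_axioms \<gamma> N]])
  then have qR: "qi RT.T N (fs_ext R ?N (\<lambda>i s. act ?N s (cell_val i)))"
    using same_dg_qi(2)[OF same_dg_restrict[of N \<gamma>]] by blast
  have \<gamma>0: "\<gamma> \<zero>\<^bsub>R\<^esub> = \<zero>\<^bsub>S\<^esub>" using ahom_zero[OF R.abelian_group_axioms S.abelian_group_axioms dg_ring_morphismD(1)[OF \<gamma>]] .
  have "\<Lambda> (\<lambda>i. \<gamma> (x i)) = fs_ext R ?N (\<lambda>i s. act ?N s (cell_val i)) x" if "x \<in> carrier RT.T" for x
  proof -
    have x: "x \<in> fsupp (cells R ?N) (left_regular R)" using that by simp
    have "(\<lambda>i. \<gamma> (x i)) \<in> fsupp (cells R ?N) SR"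
      using x \<gamma>0 dg_ring_morphismD(6)[OF \<gamma>] by (intro SR.M.fsupp_map[where M="left_regular R" and f="\<lambda>i. \<gamma>"]) auto
    then have "\<Lambda> (\<lambda>i. \<gamma> (x i)) = (\<Oplus>\<^bsub>N\<^esub>i\<in>{i. x i \<noteq> \<zero>\<^bsub>R\<^esub>}. act N (\<gamma> (x i)) (cell_val i))"
      unfolding \<Lambda>_eq using fsuppD[OF x] \<gamma>0 by (intro \<Lambda>.fs_ext_superset) auto
    then show ?thesis by (simp add: fs_ext_def same_dg_finsum[OF same_dg_restrict[of N \<gamma>]])
  qed
  then have "qi RT.T N (\<lambda>x. \<Lambda> (\<lambda>i. \<gamma> (x i)))"
    by (intro qi_cong[OF qR _ RT.T_dg]) simp
  then have "qi SR.T N \<Lambda>"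
    by (rule qi_cancel[OF RT.T_dg SR.T_dg N.M.dg_group_axioms qT \<Lambda>_chain_map])
  then show ?thesis by (simp add: \<Lambda>_def)
qed

section \<open>The unit isomorphism\<close>

text \<open>The isomorphism of B \<otimes> F over B with \<open>F\<close>. The comparisons are
  stated uniformly for S \<otimes> F, also when S is B, and this map returns to \<open>F\<close> in
  that case.\<close>

definition unit_map :: "'b dg \<Rightarrow> ('b, 'f) dgmod \<Rightarrow> ('b \<times> 'f \<Rightarrow>\<^sub>0 int) set \<Rightarrow> 'f" where
  "unit_map B F = tlift B (right_regular B) F F (\<lambda>b f. act F b f)"

context
  fixes B :: "'b dg" and F :: "('b, 'f) dgmod"
  assumes BF: "left_dg_module B F"
begin

interpretation F: left_dg_module B F by (rule BF)

lemma scalar_extension_id: "scalar_extension B B F id"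
  by (intro scalar_extension.intro scalar_extension_axioms.intro F.B.dg_ring_axioms BF dg_ring_morphism_id)

interpretation e: scalar_extension B B F id by (rule scalar_extension_id)

lemma unit_map:
  shows "dg_module_morphism B (ltensor B B id F) F (unit_map B F)"
    and "bij_betw (unit_map B F) (carrier (ltensor B B id F)) (carrier F)"
    and "dg_module_morphism B F F \<phi> \<Longrightarrow> x \<in> carrier (ltensor B B id F) \<Longrightarrow>
      unit_map B F (tensor_map B (restrict_scalars id (right_regular B)) F F \<phi> x) = \<phi> (unit_map B F x)"
proof -
  have N: "e.N = right_regular B" by (rule restrict_scalars_id)
  have bal: "balanced B e.N F F (\<lambda>b f. act F b f)"
  proof (rule balancedI)
    show "act F b \<in> ahom F F" if "b \<in> carrier e.N" for b using that F.act_right by simp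
    show "(\<lambda>b. act F b f) \<in> ahom e.N F" if "f \<in> carrier F" for f using F.act_left[OF that] by (simp add: hom_def)
    show "act F (act e.N b l) f = act F l (act F b f)" if "b \<in> carrier B" "l \<in> carrier e.N" "f \<in> carrier F" for b l f
      using that by (simp add: F.act_mult)
  qed
  have h: "unit_map B F \<in> ahom e.P.T F" and pt: "\<And>b f. b \<in> carrier B \<Longrightarrow> f \<in> carrier F \<Longrightarrow> unit_map B F (e.P.pt b f) = act F b f"
    using e.P.tlift[OF F.M.abelian_group_axioms bal] by (simp_all add: unit_map_def N)
  have ch: "chain_map e.P.T F (unit_map B F)"
  proof (rule chain_mapI[OF h])
    show "unit_map B F x \<in> gr F n" if "x \<in> gr e.P.T n" for n x
      using that
    proof (induction x rule: e.P.gr_T_induct)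
      case (pure i b f)
      then have "b \<in> gr B i" "b \<in> carrier B" "f \<in> carrier F" using F.B.gr_closed F.M.gr_closed by auto
      then show ?case using F.act_degree[of b i f "n - i"] pure by (simp add: pt)
    next
      case (diff x y)
      then show ?case using ahom_minus[OF e.P.T_abelian F.M.abelian_group_axioms h] F.M.gr_minus by simp
    qed
    show "unit_map B F (diff e.P.T x) = diff F (unit_map B F x)" if x: "x \<in> carrier e.P.T" for x
    proof (rule e.P.T_hom_eq[OF ahom_comp[OF e.P.diff_T h] ahom_comp[OF h F.diff_hom] _ x])
      fix b f assume "b \<in> carrier e.N" and f: "f \<in> carrier F"
      then have b: "b \<in> carrier B" by simp
      have "e.P.pt (diff B b) f \<in> carrier e.P.T" "e.P.pt (signed B b) (diff F f) \<in> carrier e.P.T"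
        using b f e.P.pt_closed[of "diff B b" f] e.P.pt_closed[of "signed B b" "diff F f"] by simp_all
      then show "unit_map B F (diff e.P.T (e.P.pt b f)) = diff F (unit_map B F (e.P.pt b f))"
        using b f e.P.diff_pt[of b f] by (simp add: e.signed_N ahom_add[OF h] pt F.act_leibniz_signed)
    qed
  qed
  show "dg_module_morphism B (ltensor B B id F) F (unit_map B F)"
    unfolding dg_module_morphism_def
  proof (intro conjI ballI)
    show "chain_map (ltensor B B id F) F (unit_map B F)" using ch same_dg_chain_map(1)[OF same_dg_ltensor] by blast
    fix b x assume b: "b \<in> carrier B" and "x \<in> carrier (ltensor B B id F)"
    then have x: "x \<in> carrier e.P.T" by simp
    show "unit_map B F (act (ltensor B B id F) b x) = act F b (unit_map B F x)"
      by (rule e.P.T_hom_eq[OF ahom_comp[OF e.act_hom[OF b] h] ahom_comp[OF h F.act_right[OF b]] _ x])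
        (use b in \<open>simp add: e.act_pt pt F.act_mult del: ltensor_simps\<close>)
  qed
  show "bij_betw (unit_map B F) (carrier (ltensor B B id F)) (carrier F)"
  proof (rule bij_betwI[where g="e.P.pt \<one>\<^bsub>B\<^esub>"])
    show "unit_map B F \<in> carrier (ltensor B B id F) \<rightarrow> carrier F" using ahom_closed[OF h] by simp
    show "e.P.pt \<one>\<^bsub>B\<^esub> \<in> carrier F \<rightarrow> carrier (ltensor B B id F)" using e.P.pt_closed[of "\<one>\<^bsub>B\<^esub>"] by simp
    show "unit_map B F (e.P.pt \<one>\<^bsub>B\<^esub> f) = f" if "f \<in> carrier F" for f using that by (simp add: pt F.act_one)
    fix x assume "x \<in> carrier (ltensor B B id F)"
    then have x: "x \<in> carrier e.P.T" by simp
    have one: "\<one>\<^bsub>B\<^esub> \<in> carrier e.N" by simp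
    have id: "(\<lambda>x. x) \<in> ahom e.P.T e.P.T" by (intro ahomI) auto
    show "e.P.pt \<one>\<^bsub>B\<^esub> (unit_map B F x) = x"
    proof (rule e.P.T_hom_eq[OF ahom_comp[OF h e.P.pt_right[OF one]] id _ x])
      fix b f assume "b \<in> carrier e.N" "f \<in> carrier F"
      then show "e.P.pt \<one>\<^bsub>B\<^esub> (unit_map B F (e.P.pt b f)) = e.P.pt b f"
        using e.P.pt_act[of b "\<one>\<^bsub>B\<^esub>" f, symmetric] by (simp add: pt)
    qed
  qed
  assume \<phi>: "dg_module_morphism B F F \<phi>" and "x \<in> carrier (ltensor B B id F)"
  then have x: "x \<in> carrier e.P.T" by simp
  note tm = tensor_map[OF e.P.tensor_pair_axioms e.P.tensor_pair_axioms \<phi>]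
  note \<phi>h = chain_mapD(1)[OF dg_module_morphismD(1)[OF \<phi>]]
  show "unit_map B F (tensor_map B e.N F F \<phi> x) = \<phi> (unit_map B F x)"
    by (rule e.P.T_hom_eq[OF ahom_comp[OF chain_mapD(1)[OF tm(1)] h] ahom_comp[OF h \<phi>h] _ x])
      (simp add: tm(2) pt ahom_closed[OF \<phi>h] dg_module_morphismD(2)[OF \<phi>])
qed

end

section \<open>Fields in degree zero\<close>

lemma concentrated_simps [simp]:
  "carrier (concentrated K) = carrier K" "monoid.mult (concentrated K) = monoid.mult K" "\<one>\<^bsub>concentrated K\<^esub> = \<one>\<^bsub>K\<^esub>"
  "\<zero>\<^bsub>concentrated K\<^esub> = \<zero>\<^bsub>K\<^esub>" "ring.add (concentrated K) = ring.add K"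
  "gr (concentrated K) n = (if n = 0 then carrier K else {\<zero>\<^bsub>K\<^esub>})" "diff (concentrated K) x = \<zero>\<^bsub>K\<^esub>"
  by (simp_all add: concentrated_def)

lemma concentrated_gc:
  assumes "field K"
  shows "gc_dg_ring (concentrated K)"
proof -
  interpret K: field K by fact
  let ?K = "concentrated K"
  have ring: "ring ?K"
    by (rule ringI[OF abelian_groupI monoidI]) (auto simp: K.a_ac K.m_assoc K.l_distr K.r_distr intro: K.l_neg bexI[of _ "\<ominus>\<^bsub>K\<^esub> _"])
  interpret R: ring ?K by (rule ring)
  have gr: "graded_group ?K"
  proof (rule graded_groupI[where p="\<lambda>n x. if n = 0 then x else \<zero>\<^bsub>K\<^esub>"])
    show "abelian_group ?K" by (rule R.abelian_group_axioms)
    show "subgroup (gr ?K n) (add_monoid ?K)" for n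
    proof (rule subgroup_addI[OF R.abelian_group_axioms])
      show "\<ominus>\<^bsub>?K\<^esub> x \<in> gr ?K n" if "x \<in> gr ?K n" for x
        using that R.a_inv_closed[of x] R.minus_zero by (auto split: if_splits)
    qed (auto split: if_splits)
    show "(\<lambda>x. if n = 0 then x else \<zero>\<^bsub>K\<^esub>) \<in> ahom ?K ?K" for n by (intro ahomI) auto
    show "P x" if "x \<in> carrier ?K" "\<And>n x. x \<in> gr ?K n \<Longrightarrow> P x" for x and P :: "'a \<Rightarrow> bool"
      using that(1) that(2)[of x 0] by simp
  qed (auto split: if_splits)
  have dg: "dg_group ?K"
  proof (rule dg_groupI[OF gr])
    show "diff ?K \<in> ahom ?K ?K" by (intro ahomI) auto
  qed auto
  interpret D: dg_group ?K by (rule dg)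
  have k0: "koszul ?K i \<zero>\<^bsub>K\<^esub> = \<zero>\<^bsub>K\<^esub>" for i using D.koszul_zero[of i] by simp
  have kc: "koszul ?K i x \<in> carrier K" if "x \<in> carrier K" for i x using D.koszul_closed[of x i] that by simp
  have "dg_ring ?K"
    by (intro dg_ring.intro dg_ring_axioms.intro ring dg) (auto simp: k0 split: if_splits)
  moreover have "koszul ?K 0 x = x" for x by (simp add: koszul_def)
  ultimately show ?thesis
    by (intro gc_dg_ring.intro gc_dg_ring_axioms.intro) (auto simp: k0 K.m_comm split: if_splits)
qed

lemmas concentrated_dg_ring = gc_dg_ring.axioms(1)[OF concentrated_gc]

section \<open>Lifting scalars\<close>

text \<open>\<open>xt (cf f)\<close> is the value at \<open>f\<close> of the B-linear extension of
  \<open>g\<close>. Since \<open>g\<close> is arbitrary on the basis, the extension can be used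
  while a lift is still under construction.\<close>

locale based_ext = based_module B F E + M: left_dg_module B M
  for B :: "('b, 'p) dg_scheme" and F :: "('b, 'f, 'n) dgmod_scheme" and E :: "'f set" and M :: "('b, 'm, 'q) dgmod_scheme" +
  fixes g :: "'f \<Rightarrow> 'm"
  assumes g_closed: "e \<in> E \<Longrightarrow> g e \<in> carrier M"
begin

sublocale g: ab_hom_family B M E "\<lambda>e b. act M b (g e)"
  by unfold_locales (simp add: M.act_left g_closed)

abbreviation "xt \<equiv> fs_ext B M (\<lambda>e b. act M b (g e))"

lemma xt_scale: "b \<in> carrier B \<Longrightarrow> c \<in> fsupp E B \<Longrightarrow> xt (\<lambda>e. b \<otimes>\<^bsub>B\<^esub> c e) = act M b (xt c)"
proof -
  assume b: "b \<in> carrier B" and c: "c \<in> fsupp E B"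
  show ?thesis using c
  proof (induction c rule: F.B.fsupp_induct)
    case zero
    then show ?case using b by (simp add: g.fs_ext_zero)
  next
    case (delta e m)
    have "(\<lambda>e'. b \<otimes>\<^bsub>B\<^esub> delta B e m e') = delta B e (b \<otimes>\<^bsub>B\<^esub> m)" using b by (auto simp: delta_def)
    then show ?case using b delta by (simp add: g.fs_ext_delta M.act_mult g_closed)
  next
    case (add x y)
    have "(\<lambda>e. b \<otimes>\<^bsub>B\<^esub> (x e \<oplus>\<^bsub>B\<^esub> y e)) = (\<lambda>e. b \<otimes>\<^bsub>B\<^esub> x e \<oplus>\<^bsub>B\<^esub> b \<otimes>\<^bsub>B\<^esub> y e)"
      using add b by (auto simp: fsuppD(1)[OF add(1)] fsuppD(1)[OF add(2)] F.B.r_distr)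
    then show ?case
      using add b g.fs_ext_add[OF scale_fsupp[OF b add(1)] scale_fsupp[OF b add(2)]]
      by (simp add: g.fs_ext_add M.act_add_right g.fs_ext_closed)
  qed
qed

lemma xt_gr:
  assumes "f \<in> gr F n" "\<And>e. e \<in> E \<Longrightarrow> cf f e \<noteq> \<zero>\<^bsub>B\<^esub> \<Longrightarrow> g e \<in> gr M (some_degree F e)"
  shows "xt (cf f) \<in> gr M n"
  unfolding fs_ext_def
proof (rule M.M.gr_finsum)
  have f: "f \<in> carrier F" using assms(1) F.M.gr_closed by blast
  show "finite {e. cf f e \<noteq> \<zero>\<^bsub>B\<^esub>}" by (rule fsuppD(3)[OF coeffs_fsupp[OF f]])
  fix e assume "e \<in> {e. cf f e \<noteq> \<zero>\<^bsub>B\<^esub>}"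
  then have e: "cf f e \<noteq> \<zero>\<^bsub>B\<^esub>" "e \<in> E" using fsuppD(2)[OF coeffs_fsupp[OF f]] by auto
  show "act M (cf f e) (g e) \<in> gr M n"
    using M.act_degree[OF coeffs_gr[OF assms(1) e(2)] assms(2)[OF e(2,1)]] by simp
qed

lemma xt_cong:
  assumes "c \<in> fsupp E B" "\<And>e. c e \<noteq> \<zero>\<^bsub>B\<^esub> \<Longrightarrow> g' e = g e"
  shows "fs_ext B M (\<lambda>e b. act M b (g' e)) c = xt c"
  unfolding fs_ext_def using assms fsuppD[OF assms(1)]
  by (intro M.finsum_cong' refl Pi_I) (auto intro!: M.act_closed g_closed)

lemma xt_ahom: "(\<lambda>f. xt (cf f)) \<in> ahom F M"
  by (intro ahomI) (simp_all add: g.fs_ext_closed coeffs_fsupp coeffs_add g.fs_ext_add)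

lemma xt_act: "b \<in> carrier B \<Longrightarrow> f \<in> carrier F \<Longrightarrow> xt (cf (act F b f)) = act M b (xt (cf f))"
  by (simp add: coeffs_act xt_scale coeffs_fsupp)

lemma xt_basis: "e \<in> E \<Longrightarrow> xt (cf e) = g e"
  by (simp add: coeffs_basis g.fs_ext_delta M.act_one g_closed)

text \<open>Stated for a part \<open>U\<close> of the basis because lifts are constructed along the well-order.\<close>

lemma xt_diff:
  assumes U: "U \<subseteq> E" and d: "\<And>e. e \<in> U \<Longrightarrow> diff M (g e) = xt (cf (diff F e))" and c: "c \<in> fsupp U B"
  shows "diff M (xt c) = xt (cf (diff F (lin_comb B F c)))"
proof -
  have sub: "x \<in> fsupp E B" if "x \<in> fsupp U B" for x using that U by (auto simp: fsupp_def)
  show ?thesis using c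
  proof (induction c rule: F.B.fsupp_induct)
    case zero
    show ?case using ahom_zero[OF F.M.abelian_group_axioms M.M.abelian_group_axioms xt_ahom]
      by (simp add: g.fs_ext_zero lin_comb_fs_ext lc.fs_ext_zero)
  next
    case (delta e b)
    then have e: "e \<in> E" "e \<in> carrier F" using U E_closed by auto
    have "diff F (act F b e) = act F (diff B b) e \<oplus>\<^bsub>F\<^esub> act F (signed B b) (diff F e)"
      using delta e by (simp add: F.act_leibniz_signed)
    then have "xt (cf (diff F (act F b e))) = act M (diff B b) (g e) \<oplus>\<^bsub>M\<^esub> act M (signed B b) (xt (cf (diff F e)))"
      using delta e ahom_add[OF xt_ahom, of "act F (diff B b) e" "act F (signed B b) (diff F e)"]
      by (simp add: F.act_closed xt_act xt_basis)
    then show ?case using delta e d[OF delta(1)]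
      by (simp add: lin_comb_fs_ext lc.fs_ext_delta g.fs_ext_delta M.act_leibniz_signed g_closed)
  next
    case (add x y)
    then show ?case
      using ahom_add[OF xt_ahom, of "diff F (lin_comb B F x)" "diff F (lin_comb B F y)"] sub lin_comb_closed
      by (simp add: g.fs_ext_add lin_comb_fs_ext lc.fs_ext_add lc.fs_ext_closed F.diff_add M.diff_add g.fs_ext_closed)
  qed
qed

end

text \<open>Recursion along the semibasis. At \<open>e\<close> the boundary of the new value is
  prescribed by the values below; it is a cycle that \<pi> sends to zero. The cone condition for
  \<pi> provides an element with this boundary whose image is exactly \<open>c\<close> times that of
  \<open>e\<close>, because the differential of \<open>k\<close> vanishes.\<close>

lemma scalar_lift_exists:
  fixes K :: "'k ring" and B :: "'b dg" and F :: "('b, 'f) dgmod" and \<pi> :: "'f \<Rightarrow> 'k" and \<delta> :: "'b \<Rightarrow> 'k"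
  assumes K: "field K" and B: "dg_ring B" and \<delta>: "dg_ring_morphism B (concentrated K) \<delta>"
    and res: "semifree_resolution B (restrict_scalars \<delta> (left_regular (concentrated K))) F \<pi>"
    and c: "c \<in> carrier K"
  shows "\<exists>\<phi>. dg_module_morphism B F F \<phi> \<and> (\<forall>x\<in>carrier F. \<pi> (\<phi> x) = c \<otimes>\<^bsub>K\<^esub> \<pi> x)"
proof -
  let ?k = "restrict_scalars \<delta> (left_regular (concentrated K))"
  interpret K: field K by fact
  have km: "left_dg_module B ?k"
    by (rule left_restrict[OF B \<delta> left_regular[OF concentrated_dg_ring[OF K]]])
  interpret k: left_dg_module B ?k by (rule km)
  obtain E r where sb: "semibasis B F E r" and F: "left_dg_module B F"
    using res by (auto simp: semifree_resolution_def semifree_def)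
  interpret based_module B F E
    using sb F by (simp add: based_module_def based_module_axioms_def semibasis_def)
  have \<pi>: "dg_module_morphism B F ?k \<pi>" and q: "qi F ?k \<pi>"
    using res quasi_isomorphism_qi[OF F.M.dg_group_axioms k.M.dg_group_axioms] by (auto simp: semifree_resolution_def)
  note \<pi>D = chain_mapD[OF dg_module_morphismD(1)[OF \<pi>]] and \<pi>l = dg_module_morphismD(2)[OF \<pi>]
  note agF = F.M.abelian_group_axioms and agk = k.M.abelian_group_axioms
  have \<pi>c: "x \<in> carrier F \<Longrightarrow> \<pi> x \<in> carrier K" for x using ahom_closed[OF \<pi>D(1), of x] by simp
  have \<pi>a: "\<pi> (x \<oplus>\<^bsub>F\<^esub> y) = \<pi> x \<oplus>\<^bsub>K\<^esub> \<pi> y" if "x \<in> carrier F" "y \<in> carrier F" for x y using ahom_add[OF \<pi>D(1) that] by simp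
  have \<pi>act: "\<pi> (act F b x) = \<delta> b \<otimes>\<^bsub>K\<^esub> \<pi> x" if "b \<in> carrier B" "x \<in> carrier F" for b x using \<pi>l[OF that] by simp
  have \<delta>c: "b \<in> carrier B \<Longrightarrow> \<delta> b \<in> carrier K" for b using dg_ring_morphismD(6)[OF \<delta>] by simp
  have \<pi>d: "\<pi> (diff F x) = \<zero>\<^bsub>K\<^esub>" if "x \<in> carrier F" for x using \<pi>D(3)[OF that] by simp
  have \<pi>0: "\<pi> \<zero>\<^bsub>F\<^esub> = \<zero>\<^bsub>K\<^esub>" using ahom_zero[OF agF agk \<pi>D(1)] by simp
  let ?r = "r - Id"
  have wf: "wf ?r" and tr: "trans ?r" and rE: "(e', e) \<in> ?r \<Longrightarrow> e' \<in> E" for e' e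
    using sb well_order_on_domain[of E r]
    by (auto simp: semibasis_def well_order_on_def linear_order_on_def partial_order_on_def preorder_on_def
        intro!: trans_diff_Id)
  note low = semibasis_coeffs[OF F sb]
  \<comment> \<open>The partial lift applied to the differential of \<open>e\<close>. Values not
    below \<open>e\<close> are replaced by zero, so that the requirement at \<open>e\<close> depends
    on earlier values alone.\<close>
  let ?x = "\<lambda>f e. fs_ext B F (\<lambda>e' b. act F b (if (e', e) \<in> ?r then f e' else \<zero>\<^bsub>F\<^esub>)) (cf (diff F e))"
  define P where "P f e y \<longleftrightarrow> (e \<in> E \<longrightarrow> y \<in> gr F (some_degree F e) \<and> diff F y = ?x f e \<and> \<pi> y = c \<otimes>\<^bsub>K\<^esub> \<pi> e)"
    for f :: "'f \<Rightarrow> 'f" and e y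
  have "\<exists>f. \<forall>e. P f e (f e)"
  proof (rule dependent_wf_choice[OF wf])
    show "P f e y = P f' e y" if "\<And>z. (z, e) \<in> ?r \<Longrightarrow> f z = f' z" for f f' e y
    proof -
      have "(\<lambda>e'. if (e', e) \<in> ?r then f e' else \<zero>\<^bsub>F\<^esub>) = (\<lambda>e'. if (e', e) \<in> ?r then f' e' else \<zero>\<^bsub>F\<^esub>)"
        by (rule ext) (use that in simp)
      then have "?x f e = ?x f' e" by (metis (lifting))
      then show ?thesis by (simp add: P_def)
    qed
    fix e f assume IH: "\<And>e'. (e', e) \<in> ?r \<Longrightarrow> P f e' (f e')"
    show "\<exists>y. P f e y"
    proof (cases "e \<in> E")
      case False then show ?thesis by (simp add: P_def)
    next
      case e: True
      define U where "U = {e'. (e', e) \<in> ?r}"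
      \<comment> \<open>Truncation makes every value a member of \<open>F\<close>, even where
        nothing is known yet about \<open>f\<close>.\<close>
      define g where "g e' = (if e' \<in> U then f e' else \<zero>\<^bsub>F\<^esub>)" for e'
      have UE: "U \<subseteq> E" using rE by (auto simp: U_def)
      have IHU: "g e' \<in> gr F (some_degree F e')" "diff F (g e') = ?x f e'" "\<pi> (g e') = c \<otimes>\<^bsub>K\<^esub> \<pi> e'"
        if "e' \<in> U" for e'
        using IH[of e'] that UE by (auto simp: P_def g_def U_def)
      interpret based_ext B F E F g
        using IHU(1) F.M.gr_closed by unfold_locales (auto simp: g_def)
      have fg: "?x f e' = xt (cf (diff F e'))" if e': "e' \<in> U \<or> e' = e" "e' \<in> E" for e'
      proof (rule xt_cong)
        show "cf (diff F e') \<in> fsupp E B" using coeffs_fsupp E_closed[OF e'(2)] by simp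
        fix e'' assume "cf (diff F e') e'' \<noteq> \<zero>\<^bsub>B\<^esub>"
        then have "(e'', e') \<in> ?r" using low[OF e'(2)] by blast
        moreover have "e'' \<in> U" using calculation e'(1) transD[OF tr, of e'' e' e] by (auto simp: U_def)
        ultimately show "(if (e'', e') \<in> ?r then f e'' else \<zero>\<^bsub>F\<^esub>) = g e''" by (simp add: g_def)
      qed
      have dg: "diff F (g e') = xt (cf (diff F e'))" if "e' \<in> U" for e' using IHU(2) fg that UE by auto
      have de: "diff F e \<in> carrier F" "diff F e \<in> gr F (some_degree F e - 1)"
        using E_closed[OF e] F.diff_degree[OF E_gr[OF e]] by auto
      have cU: "cf (diff F e) \<in> fsupp U B"
        using coeffs_fsupp[OF de(1)] low[OF e] by (auto simp: fsupp_def U_def)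
      let ?z = "xt (cf (diff F e))"
      have zc: "?z \<in> carrier F" by (rule g.fs_ext_closed[OF coeffs_fsupp[OF de(1)]])
      have "diff F ?z = xt (cf (diff F (lin_comb B F (cf (diff F e)))))" by (rule xt_diff[OF UE dg cU])
      also have "\<dots> = xt (cf \<zero>\<^bsub>F\<^esub>)" using E_closed[OF e] by (simp add: lin_comb_coeffs F.M.diff_diff)
      also have "\<dots> = \<zero>\<^bsub>F\<^esub>" using ahom_zero[OF agF agF xt_ahom] .
      finally have dz: "diff F ?z = \<zero>\<^bsub>F\<^esub>" .
      have zg: "?z \<in> gr F (some_degree F e - 1)"
        using low[OF e] IHU(1) by (intro xt_gr[OF de(2)]) (auto simp: U_def)
      have "\<pi> (xt d) = c \<otimes>\<^bsub>K\<^esub> \<pi> (lin_comb B F d)" if "d \<in> fsupp U B" for d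
        using that
      proof (induction d rule: k.B.fsupp_induct)
        case zero
        show ?case using c by (simp add: g.fs_ext_zero lin_comb_fs_ext lc.fs_ext_zero \<pi>0)
      next
        case (delta e' b)
        then have "e' \<in> E" using UE by auto
        then show ?case using delta c E_closed IHU(3)[OF delta(1)] \<pi>c \<delta>c
          by (simp add: g.fs_ext_delta lin_comb_fs_ext lc.fs_ext_delta \<pi>act g_closed K.m_lcomm)
      next
        case (add x y)
        have "x \<in> fsupp E B" "y \<in> fsupp E B" using add UE by (auto simp: fsupp_def)
        then show ?case using add c \<pi>c by (simp add: g.fs_ext_add g.fs_ext_closed lin_comb_fs_ext lc.fs_ext_add lc.fs_ext_closed \<pi>a K.r_distr)
      qed
      from this[OF cU] have "\<pi> ?z = c \<otimes>\<^bsub>K\<^esub> \<pi> (diff F e)" by (simp add: lin_comb_coeffs[OF de(1)])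
      then have \<pi>z: "\<pi> ?z = \<zero>\<^bsub>K\<^esub>" using \<pi>d[OF E_closed[OF e]] c by simp
      have x: "c \<otimes>\<^bsub>K\<^esub> \<pi> e \<in> carrier K" using c \<pi>c E_closed[OF e] by simp
      obtain y x' where y: "y \<in> carrier F" "diff F y = ?z" "\<pi> y = c \<otimes>\<^bsub>K\<^esub> \<pi> e"
        using qiE[OF q zc _ dz, of "c \<otimes>\<^bsub>K\<^esub> \<pi> e"] x \<pi>z by (auto simp: restrict_scalars_def)
      \<comment> \<open>The element found may be inhomogeneous. The prescribed boundary and image
        are homogeneous, so its component of the degree of \<open>e\<close> has the same
        ones.\<close>
      let ?n = "some_degree F e"
      let ?y = "hcomp F y ?n"
      have "diff F ?y = ?z" using F.M.hcomp_diff[OF y(1), of "?n - 1"] y(2) F.M.hcomp_homogeneous[OF zg] by simp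
      moreover have "\<pi> ?y = c \<otimes>\<^bsub>K\<^esub> \<pi> e"
      proof -
        have "c \<otimes>\<^bsub>K\<^esub> \<pi> e \<in> gr ?k ?n" using \<pi>D(2)[OF E_gr[OF e]] c by (auto split: if_splits)
        then have "hcomp ?k (\<pi> y) ?n = c \<otimes>\<^bsub>K\<^esub> \<pi> e" using y(3) k.M.hcomp_homogeneous by simp
        then show ?thesis using hcomp_hom[OF F.M.graded_group_axioms k.M.graded_group_axioms \<pi>D(1), of 0 y ?n] \<pi>D(2) y(1) by simp
      qed
      ultimately have "P f e ?y" using F.M.hcomp_gr[OF y(1)] fg[of e] e by (simp add: P_def)
      then show ?thesis by blast
    qed
  qed
  then obtain f where f: "\<And>e. e \<in> E \<Longrightarrow> f e \<in> gr F (some_degree F e)" "\<And>e. e \<in> E \<Longrightarrow> diff F (f e) = ?x f e"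
    "\<And>e. e \<in> E \<Longrightarrow> \<pi> (f e) = c \<otimes>\<^bsub>K\<^esub> \<pi> e" unfolding P_def by blast
  interpret based_ext B F E F f
    using f(1) F.M.gr_closed by unfold_locales blast
  have df: "diff F (f e) = xt (cf (diff F e))" if "e \<in> E" for e
    unfolding f(2)[OF that] using low[OF that] coeffs_fsupp E_closed[OF that] by (intro xt_cong) auto
  have "dg_module_morphism B F F (\<lambda>x. xt (cf x))"
    unfolding dg_module_morphism_def
  proof (intro conjI ballI chain_mapI xt_ahom)
    show "xt (cf x) \<in> gr F n" if "x \<in> gr F n" for n x using that f(1) by (rule xt_gr)
    show "xt (cf (diff F x)) = diff F (xt (cf x))" if "x \<in> carrier F" for x
      using xt_diff[OF subset_refl df coeffs_fsupp[OF that]] lin_comb_coeffs[OF that] by simp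
  qed (rule xt_act)
  moreover have "\<pi> (xt (cf x)) = c \<otimes>\<^bsub>K\<^esub> \<pi> x" if "x \<in> carrier F" for x
    using that
  proof (induction x rule: basis_induct)
    case zero
    show ?case using ahom_zero[OF agF agF xt_ahom] c by (simp add: \<pi>0)
  next
    case (basis b e)
    then show ?case using c E_closed \<pi>c \<delta>c g_closed f(3) by (simp add: xt_act xt_basis \<pi>act K.m_lcomm)
  next
    case (add x y)
    then show ?case using c \<pi>c ahom_add[OF xt_ahom, of x y] by (simp add: \<pi>a ahom_closed[OF xt_ahom] K.r_distr)
  qed
  ultimately show ?thesis by blast
qed

section \<open>Graded vector spaces\<close>

lemma (in dg_group) dg_group_homology: "dg_group (homology M)"
proof -
  interpret H: graded_group "homology M" by (rule graded_group_homology)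
  have d: "diff (homology M) x = \<zero>\<^bsub>homology M\<^esub>" for x by (simp add: homology_def)
  show ?thesis
  proof (rule dg_groupI[OF graded_group_homology])
    show "diff (homology M) \<in> ahom (homology M) (homology M)" by (intro ahomI) (simp_all add: d)
  qed (simp_all add: d)
qed

lemma same_dg_hscal: "same_dg (homology M) (hscal M s)"
  by (simp add: same_dg_def)

lemma dg_group_hscal: "dg_group M \<Longrightarrow> dg_group (hscal M s)"
  by (rule same_dg_group[OF same_dg_hscal dg_group.dg_group_homology])

lemma hscal_diff: "diff (hscal M s) x = \<zero>\<^bsub>hscal M s\<^esub>"
  by (simp add: homology_def)

text \<open>A strict action of \<open>K\<close> by chain maps, as on twisted sums over
  \<open>k\<close>. It makes homology a vector space; for the chosen lifts it may fail.\<close>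

definition scalar_maps :: "('k, 'p) ring_scheme \<Rightarrow> ('a, 'm) dg_scheme \<Rightarrow> ('k \<Rightarrow> 'a \<Rightarrow> 'a) \<Rightarrow> bool" where
  "scalar_maps K M s \<longleftrightarrow> (\<forall>c\<in>carrier K. chain_map M M (s c)) \<and>
     (\<forall>c\<in>carrier K. \<forall>d\<in>carrier K. \<forall>x\<in>carrier M. s (c \<oplus>\<^bsub>K\<^esub> d) x = s c x \<oplus>\<^bsub>M\<^esub> s d x \<and> s (c \<otimes>\<^bsub>K\<^esub> d) x = s c (s d x)) \<and>
     (\<forall>x\<in>carrier M. s \<one>\<^bsub>K\<^esub> x = x)"

lemma hscal_vector_space:
  assumes K: "field K" and M: "dg_group M" and s: "scalar_maps K M s"
  shows "graded_vector_space K (hscal M s)"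
proof -
  interpret K: field K by fact
  interpret M: dg_group M by fact
  interpret H: dg_group "hscal M s" by (rule dg_group_hscal[OF M])
  have sc: "chain_map M M (s c)" if "c \<in> carrier K" for c using s that by (simp add: scalar_maps_def)
  have hm: "homology_map M M (s c) (homology_class M x) = homology_class M (s c x)"
    if "c \<in> carrier K" "x \<in> carrier M" for c x
    by (rule homology_map_chain_map[OF M M sc[OF that(1)] that(2)])
  have cl: "s c x \<in> carrier M" if "c \<in> carrier K" "x \<in> carrier M" for c x using ahom_closed[OF chain_mapD(1)[OF sc]] that by blast
  have cy: "s c x \<in> cycles M" if "c \<in> carrier K" "x \<in> cycles M" for c x using chain_map_cycles[OF M M sc] that by blast
  have ca: "x \<in> carrier M" if "x \<in> cycles M" for x using that by (rule M.cyclesD)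
  have sr: "s (c \<oplus>\<^bsub>K\<^esub> d) x = s c x \<oplus>\<^bsub>M\<^esub> s d x" "s (c \<otimes>\<^bsub>K\<^esub> d) x = s c (s d x)" "s \<one>\<^bsub>K\<^esub> x = x"
    if "c \<in> carrier K" "d \<in> carrier K" "x \<in> carrier M" for c d x
    using s that by (auto simp: scalar_maps_def)
  show ?thesis
  proof (intro graded_vector_space.intro graded_vector_space_axioms.intro K.field_axioms H.graded_group_axioms)
    fix c v assume c: "c \<in> carrier K" and "v \<in> carrier (hscal M s)"
    then obtain x where x: "x \<in> cycles M" "v = homology_class M x" by (auto simp: M.carrier_homology)
    show "act (hscal M s) c v \<in> carrier (hscal M s)" using c x ca cy by (simp add: hm M.carrier_homology)
    fix w assume "w \<in> carrier (hscal M s)"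
    then obtain y where y: "y \<in> cycles M" "w = homology_class M y" by (auto simp: M.carrier_homology)
    show "act (hscal M s) c (v \<oplus>\<^bsub>hscal M s\<^esub> w) = act (hscal M s) c v \<oplus>\<^bsub>hscal M s\<^esub> act (hscal M s) c w"
      using c x y ca cl ahom_add[OF chain_mapD(1)[OF sc[OF c]]] by (simp add: hm M.add_homology)
  next
    fix c d v assume c: "c \<in> carrier K" "d \<in> carrier K" and "v \<in> carrier (hscal M s)"
    then obtain x where x: "x \<in> cycles M" "v = homology_class M x" by (auto simp: M.carrier_homology)
    show "act (hscal M s) (c \<oplus>\<^bsub>K\<^esub> d) v = act (hscal M s) c v \<oplus>\<^bsub>hscal M s\<^esub> act (hscal M s) d v"
      using c x ca cl by (simp add: hm sr M.add_homology)
    show "act (hscal M s) (c \<otimes>\<^bsub>K\<^esub> d) v = act (hscal M s) c (act (hscal M s) d v)"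
      using c x ca cl by (simp add: hm sr)
  next
    fix v assume "v \<in> carrier (hscal M s)"
    then obtain x where x: "x \<in> cycles M" "v = homology_class M x" by (auto simp: M.carrier_homology)
    then show "act (hscal M s) \<one>\<^bsub>K\<^esub> v = v" using ca s by (simp add: hm scalar_maps_def)
  next
    fix c v n assume c: "c \<in> carrier K" and "v \<in> gr (hscal M s) n"
    then obtain x where x: "x \<in> cycles M" "x \<in> gr M n" "v = homology_class M x" by (auto simp: M.gr_homology)
    then have "s c x \<in> gr M n" "s c x \<in> cycles M" using chain_mapD(2)[OF sc[OF c]] cy[OF c] by auto
    then show "act (hscal M s) c v \<in> gr (hscal M s) n" using x c ca by (simp add: hm M.gr_homology)
  qed
qed

text \<open>This is the source of the vector space axioms for \<open>Tor\<close>: they hold in the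
  homology of a complex with a strict action and pass along a bijection that respects sums and
  scalars.\<close>

lemma giso_vector_space:
  assumes h: "giso K V W h" and V: "graded_vector_space K V" and W: "graded_group W"
  shows "graded_vector_space K W"
proof -
  interpret V: graded_vector_space K V by fact
  interpret W: graded_group W by fact
  have hb: "bij_betw h (carrier V) (carrier W)" "h \<in> ahom V W" "\<And>n. h ` gr V n = gr W n"
    and hs: "\<And>c v. c\<in>carrier K \<Longrightarrow> v\<in>carrier V \<Longrightarrow> act W c (h v) = h (act V c v)"
    using h by (auto simp: giso_def)
  have hW: "\<exists>v\<in>carrier V. w = h v" if "w \<in> carrier W" for w using hb(1) that by (auto simp: bij_betw_def)
  note ha = ahom_add[OF hb(2), symmetric] and hc = ahom_closed[OF hb(2)]
  show ?thesis
  proof (intro graded_vector_space.intro graded_vector_space_axioms.intro W V.K.field_axioms)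
    fix c w assume c: "c \<in> carrier K" and "w \<in> carrier W"
    then obtain v where v: "v \<in> carrier V" "w = h v" using hW by blast
    show "act W c w \<in> carrier W" using c v by (simp add: hs hc V.scale_closed)
    fix w' assume "w' \<in> carrier W"
    then obtain v' where v': "v' \<in> carrier V" "w' = h v'" using hW by blast
    show "act W c (w \<oplus>\<^bsub>W\<^esub> w') = act W c w \<oplus>\<^bsub>W\<^esub> act W c w'"
      using c v v' by (simp add: ha hs V.scale_closed V.scale_add_right)
  next
    fix c d w assume c: "c \<in> carrier K" "d \<in> carrier K" and "w \<in> carrier W"
    then obtain v where v: "v \<in> carrier V" "w = h v" using hW by blast
    show "act W (c \<oplus>\<^bsub>K\<^esub> d) w = act W c w \<oplus>\<^bsub>W\<^esub> act W d w"
      using c v by (simp add: ha hs V.scale_closed V.scale_add_left)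
    show "act W (c \<otimes>\<^bsub>K\<^esub> d) w = act W c (act W d w)"
      using c v by (simp add: hs V.scale_closed V.scale_mult)
  next
    fix w assume "w \<in> carrier W"
    then obtain v where v: "v \<in> carrier V" "w = h v" using hW by blast
    then show "act W \<one>\<^bsub>K\<^esub> w = w" by (simp add: hs V.scale_one)
  next
    fix c w n assume c: "c \<in> carrier K" and "w \<in> gr W n"
    then obtain v where v: "v \<in> gr V n" "w = h v" unfolding hb(3)[symmetric] by blast
    then have "act W c w = h (act V c v)" using hs[OF c] V.gr_closed by simp
    then show "act W c w \<in> gr W n" using V.scale_degree[OF c v(1)] unfolding hb(3)[symmetric] by blast
  qed
qed

lemma giso_graded_vector_space_iso:
  assumes "giso K V W h" "graded_vector_space K V" "graded_group W"
  shows "graded_vector_space_iso K V W h"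
  using giso_vector_space[OF assms] assms by (simp add: giso_def graded_vector_space_iso_def)

text \<open>If \<open>w\<close> has degree \<open>n\<close>, the component of degree
  \<open>n\<close> of its preimage is again a preimage. So a bijection that preserves degrees maps
  each graded piece onto its counterpart.\<close>

lemma gisoI:
  assumes V: "graded_group V" and W: "graded_group W"
    and h: "bij_betw h (carrier V) (carrier W)" "h \<in> ahom V W"
      "\<And>c v. c \<in> carrier K \<Longrightarrow> v \<in> carrier V \<Longrightarrow> h (act V c v) = act W c (h v)"
      "\<And>n v. v \<in> gr V n \<Longrightarrow> h v \<in> gr W n"
  shows "giso K V W h"
  unfolding giso_def
proof (intro conjI ballI allI h)
  interpret V: graded_group V by fact
  interpret W: graded_group W by fact
  fix n show "h ` gr V n = gr W n"
  proof
    show "gr W n \<subseteq> h ` gr V n"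
    proof
      fix w assume w: "w \<in> gr W n"
      then obtain v where v: "v \<in> carrier V" "w = h v" using h(1) W.gr_closed unfolding bij_betw_def by (metis imageE)
      have "h (hcomp V v n) = w"
        using hcomp_hom[OF V W h(2), of 0 v n] h(4) v w by (simp add: W.hcomp_homogeneous)
      then show "w \<in> h ` gr V n" using V.hcomp_gr[OF v(1)] by blast
    qed
  qed (use h(4) in auto)
qed

lemma vector_space_left_module:
  assumes V: "graded_vector_space K V" and D: "dg_group V" and d: "\<And>x. x \<in> carrier V \<Longrightarrow> diff V x = \<zero>\<^bsub>V\<^esub>"
  shows "left_dg_module (concentrated K) V"
proof -
  interpret V: graded_vector_space K V by fact
  interpret D: dg_group V by fact
  have z: "act V \<zero>\<^bsub>K\<^esub> x = \<zero>\<^bsub>V\<^esub>" if "x \<in> carrier V" for x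
  proof -
    have "act V \<zero>\<^bsub>K\<^esub> x \<oplus>\<^bsub>V\<^esub> act V \<zero>\<^bsub>K\<^esub> x = act V \<zero>\<^bsub>K\<^esub> x"
      using V.scale_add_left[of "\<zero>\<^bsub>K\<^esub>" "\<zero>\<^bsub>K\<^esub>" x] that by simp
    then show ?thesis using V.scale_closed[of "\<zero>\<^bsub>K\<^esub>" x] that by (metis V.V.add.r_cancel_one' V.K.zero_closed)
  qed
  have z': "act V c \<zero>\<^bsub>V\<^esub> = \<zero>\<^bsub>V\<^esub>" if "c \<in> carrier K" for c
  proof -
    have "act V c \<zero>\<^bsub>V\<^esub> \<oplus>\<^bsub>V\<^esub> act V c \<zero>\<^bsub>V\<^esub> = act V c \<zero>\<^bsub>V\<^esub>"
      using V.scale_add_right[of c "\<zero>\<^bsub>V\<^esub>" "\<zero>\<^bsub>V\<^esub>"] that by simp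
    then show ?thesis using V.scale_closed[of c "\<zero>\<^bsub>V\<^esub>"] that by (metis V.V.add.r_cancel_one' V.V.zero_closed)
  qed
  show ?thesis
    by (intro left_dg_module.intro left_dg_module_axioms.intro concentrated_dg_ring V.K.field_axioms D)
      (use V.V.gr_closed in \<open>auto simp: V.scale_closed V.scale_add_left V.scale_add_right V.scale_one V.scale_mult V.scale_degree d z z'
        split: if_splits\<close>)
qed

lemma vector_space_right_module:
  assumes V: "graded_vector_space K V" and D: "dg_group V" and d: "\<And>x. x \<in> carrier V \<Longrightarrow> diff V x = \<zero>\<^bsub>V\<^esub>"
  shows "right_dg_module (concentrated K) V"
proof -
  interpret V: graded_vector_space K V by fact
  interpret L: left_dg_module "concentrated K" V by (rule vector_space_left_module[OF assms])
  have z: "act V \<zero>\<^bsub>K\<^esub> x = \<zero>\<^bsub>V\<^esub>" if "x \<in> carrier V" for x using L.act_zero_left[OF that] by simp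
  have z': "act V c \<zero>\<^bsub>V\<^esub> = \<zero>\<^bsub>V\<^esub>" if "c \<in> carrier K" for c using L.act_zero_right[of c] that by simp
  have m: "act V (b \<otimes>\<^bsub>K\<^esub> c) x = act V c (act V b x)" if "b \<in> carrier K" "c \<in> carrier K" "x \<in> carrier V" for b c x
    using that V.scale_mult[of c b x] by (simp add: V.K.m_comm)
  show ?thesis
    by (intro right_dg_module.intro right_dg_module_axioms.intro concentrated_dg_ring V.K.field_axioms D)
      (use V.V.gr_closed in \<open>auto simp: V.scale_closed V.scale_add_left V.scale_add_right V.scale_one m V.scale_degree d z z'
        split: if_splits\<close>)
qed

text \<open>Zorn's lemma for independent sets of homogeneous elements. A maximal one spans every
  homogeneous element, since an element outside the span could be adjoined, and hence it spans
  everything.\<close>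

lemma graded_basis_exists:
  fixes K :: "('k, 'p) ring_scheme" and V :: "('k, 'v, 'm) dgmod_scheme"
  assumes K: "field K" and V: "left_dg_module (concentrated K) V"
  shows "\<exists>E. graded_basis (concentrated K) V E"
proof -
  interpret K: field K by fact
  interpret V: left_dg_module "concentrated K" V by fact
  let ?K = "concentrated K"
  let ?lc = "fs_ext ?K V (\<lambda>e b. act V b e)"
  define \<F> where "\<F> = {E. E \<subseteq> (\<Union>n. gr V n) \<and> (\<forall>c\<in>fsupp E ?K. ?lc c = \<zero>\<^bsub>V\<^esub> \<longrightarrow> c = (\<lambda>_. \<zero>\<^bsub>K\<^esub>))}"
  have fam: "ab_hom_family ?K V E (\<lambda>e b. act V b e)" if "E \<subseteq> (\<Union>n. gr V n)" for E
    using that V.M.gr_closed V.act_left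
    by (intro ab_hom_family.intro ab_hom_family_axioms.intro V.B.abelian_group_axioms V.M.abelian_group_axioms) blast
  have "\<exists>E\<in>\<F>. \<forall>E'\<in>\<F>. E \<subseteq> E' \<longrightarrow> E' = E"
  proof (rule subset_Zorn')
    fix \<C> assume "subset.chain \<F> \<C>"
    then have C: "\<C> \<subseteq> \<F>" "\<And>E E'. E \<in> \<C> \<Longrightarrow> E' \<in> \<C> \<Longrightarrow> E \<subseteq> E' \<or> E' \<subseteq> E"
      by (auto simp: subset.chain_def)
    show "\<Union>\<C> \<in> \<F>" unfolding \<F>_def
    proof (intro CollectI conjI ballI impI)
      show "\<Union>\<C> \<subseteq> (\<Union>n. gr V n)" using C(1) by (auto simp: \<F>_def)
      fix c assume c: "c \<in> fsupp (\<Union>\<C>) ?K" and z: "?lc c = \<zero>\<^bsub>V\<^esub>"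
      let ?S = "{e. c e \<noteq> \<zero>\<^bsub>K\<^esub>}"
      have fin: "finite ?S" using fsuppD(3)[OF c] by simp
      have sub: "?S \<subseteq> \<Union>\<C>" using fsuppD(2)[OF c] by auto
      show "c = (\<lambda>_. \<zero>\<^bsub>K\<^esub>)"
      proof (cases "?S = {}")
        case False
        then have "\<C> \<noteq> {}" using sub by auto
        then obtain E where E: "E \<in> \<C>" "?S \<subseteq> E"
          using finite_subset_Union_chain[OF fin sub, of "\<F>"] \<open>subset.chain \<F> \<C>\<close> by (auto simp: subset.chain_def)
        have "c \<in> fsupp E ?K" using c E(2) by (auto simp: fsupp_def)
        then show ?thesis using E(1) C(1) z by (auto simp: \<F>_def)
      qed auto
    qed
  qed
  then obtain E where E: "E \<in> \<F>" and max: "\<And>E'. E' \<in> \<F> \<Longrightarrow> E \<subseteq> E' \<Longrightarrow> E' = E" by blast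
  have Eg: "E \<subseteq> (\<Union>n. gr V n)" and ind: "\<And>c. c \<in> fsupp E ?K \<Longrightarrow> ?lc c = \<zero>\<^bsub>V\<^esub> \<Longrightarrow> c = (\<lambda>_. \<zero>\<^bsub>K\<^esub>)"
    using E by (auto simp: \<F>_def)
  interpret lc: ab_hom_family ?K V E "\<lambda>e b. act V b e" by (rule fam[OF Eg])
  have scale: "\<exists>c'\<in>fsupp E ?K. ?lc c' = act V b (?lc c)" if b: "b \<in> carrier K" and c: "c \<in> fsupp E ?K" for b c
    using c
  proof (induction c rule: V.B.fsupp_induct)
    case zero
    show ?case using V.B.fsupp_zero[of E] b by (intro bexI[of _ "\<lambda>_. \<zero>\<^bsub>?K\<^esub>"]) (auto simp: lc.fs_ext_zero[simplified])
  next
    case (delta e m)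
    then have "e \<in> carrier V" using Eg V.M.gr_closed by blast
    then show ?case using delta b V.act_mult[of b m e]
      by (intro bexI[of _ "delta ?K e (b \<otimes>\<^bsub>K\<^esub> m)"]) (simp_all add: lc.fs_ext_delta V.B.fsupp_delta)
  next
    case (add x y)
    then obtain x' y' where "x' \<in> fsupp E ?K" "y' \<in> fsupp E ?K" "?lc x' = act V b (?lc x)" "?lc y' = act V b (?lc y)" by blast
    then show ?case using add b V.act_add_right[of b "?lc x" "?lc y"] lc.fs_ext_add[of x' y'] lc.fs_ext_add[of x y]
      by (intro bexI[of _ "\<lambda>e. x' e \<oplus>\<^bsub>?K\<^esub> y' e"]) (simp_all add: V.B.fsupp_add[simplified] lc.fs_ext_closed)
  qed
  have hom: "\<exists>c\<in>fsupp E ?K. v = ?lc c" if v: "v \<in> gr V n" for v n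
  proof (rule ccontr)
    assume no: "\<not> (\<exists>c\<in>fsupp E ?K. v = ?lc c)"
    have vc: "v \<in> carrier V" using V.M.gr_closed[OF v] .
    have Ev: "insert v E \<subseteq> (\<Union>n. gr V n)" using Eg v by blast
    interpret lv: ab_hom_family ?K V "insert v E" "\<lambda>e b. act V b e" by (rule fam[OF Ev])
    have "c = (\<lambda>_. \<zero>\<^bsub>K\<^esub>)" if c: "c \<in> fsupp (insert v E) ?K" and z: "?lc c = \<zero>\<^bsub>V\<^esub>" for c
    proof (cases "c v = \<zero>\<^bsub>K\<^esub>")
      case True
      then have "c \<in> fsupp E ?K" using c by (auto simp: fsupp_def)
      then show ?thesis using ind z by blast
    next
      case False
      \<comment> \<open>A nonzero coefficient of \<open>v\<close> is invertible, so the relation can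
        be solved for \<open>v\<close> in terms of \<open>E\<close>, contrary to the choice of
        \<open>v\<close>.\<close>
      let ?c = "c(v := \<zero>\<^bsub>K\<^esub>)"
      have cv: "c v \<in> carrier K" using fsuppD(1)[OF c, of v] by simp
      have vE: "v \<notin> E"
      proof
        assume "v \<in> E"
        then have "v = ?lc (delta ?K v \<one>\<^bsub>K\<^esub>)" "delta ?K v \<one>\<^bsub>K\<^esub> \<in> fsupp E ?K"
          using lc.fs_ext_delta[of v "\<one>\<^bsub>K\<^esub>"] V.act_one[OF vc] V.B.fsupp_delta[of v E "\<one>\<^bsub>K\<^esub>"] by simp_all
        then show False using no by blast
      qed
      have c': "?c \<in> fsupp E ?K" "?c \<in> fsupp (insert v E) ?K"
      proof -
        have "finite {i. ?c i \<noteq> \<zero>\<^bsub>K\<^esub>}" by (rule finite_subset[OF _ fsuppD(3)[OF c]]) auto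
        then show "?c \<in> fsupp E ?K" "?c \<in> fsupp (insert v E) ?K" using c by (auto simp: fsupp_def)
      qed
      have "c = (\<lambda>e. delta ?K v (c v) e \<oplus>\<^bsub>?K\<^esub> ?c e)"
        using fsuppD(1)[OF c] by (intro ext) (auto simp: delta_def)
      then have "?lc c = ?lc (delta ?K v (c v)) \<oplus>\<^bsub>V\<^esub> ?lc ?c"
        using lv.fs_ext_add[OF V.B.fsupp_delta[of v "insert v E" "c v"] c'(2)] cv by simp
      then have sum: "act V (c v) v \<oplus>\<^bsub>V\<^esub> ?lc ?c = \<zero>\<^bsub>V\<^esub>" using z lv.fs_ext_delta[of v "c v"] cv by simp
      have lcc: "?lc ?c \<in> carrier V" by (rule lc.fs_ext_closed[OF c'(1)])
      have acv: "act V (c v) v \<in> carrier V" using V.act_closed[of "c v" v] cv vc by simp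
      have "act V (c v) v = \<ominus>\<^bsub>V\<^esub> ?lc ?c" using V.M.minus_equality[OF sum lcc acv] by simp
      moreover have i: "inv\<^bsub>K\<^esub> (c v) \<in> carrier K" "inv\<^bsub>K\<^esub> (c v) \<otimes>\<^bsub>K\<^esub> c v = \<one>\<^bsub>K\<^esub>"
        using cv False K.field_Units by auto
      have "v = act V (inv\<^bsub>K\<^esub> (c v)) (act V (c v) v)"
        using V.act_mult[of "inv\<^bsub>K\<^esub> (c v)" "c v" v] i cv vc V.act_one[OF vc] by simp
      ultimately have "v = act V (inv\<^bsub>K\<^esub> (c v)) (\<ominus>\<^bsub>V\<^esub> ?lc ?c)" by simp
      also have "\<dots> = act V (\<ominus>\<^bsub>K\<^esub> (inv\<^bsub>K\<^esub> (c v))) (?lc ?c)"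
      proof -
        have n: "\<ominus>\<^bsub>?K\<^esub> x = \<ominus>\<^bsub>K\<^esub> x" for x by (simp add: a_inv_def m_inv_def)
        show ?thesis
          using ahom_neg[OF V.ag(2,2) V.act_right[of "inv\<^bsub>K\<^esub> (c v)"] lcc] ahom_neg[OF V.ag V.act_left[OF lcc], of "inv\<^bsub>K\<^esub> (c v)"] i
          by (simp add: n)
      qed
      finally have "\<exists>c\<in>fsupp E ?K. v = ?lc c" using scale[OF _ c'(1), of "\<ominus>\<^bsub>K\<^esub> (inv\<^bsub>K\<^esub> (c v))"] i by auto
      then show ?thesis using no by blast
    qed
    then have "insert v E \<in> \<F>" using Ev by (auto simp: \<F>_def)
    then have "v \<in> E" using max[of "insert v E"] by blast
    then have "v = ?lc (delta ?K v \<one>\<^bsub>K\<^esub>)" "delta ?K v \<one>\<^bsub>K\<^esub> \<in> fsupp E ?K"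
      using lc.fs_ext_delta[of v "\<one>\<^bsub>K\<^esub>"] V.act_one[OF vc] V.B.fsupp_delta[of v E "\<one>\<^bsub>K\<^esub>"] by simp_all
    then show False using no by blast
  qed
  have span: "\<exists>c\<in>fsupp E ?K. v = ?lc c" if "v \<in> carrier V" for v
    using that
  proof (induction v rule: V.M.graded_induct)
    case (homogeneous n v) then show ?case by (rule hom)
  next
    case (add v w)
    then obtain c d where "c \<in> fsupp E ?K" "d \<in> fsupp E ?K" "v = ?lc c" "w = ?lc d" by blast
    then show ?case using lc.fs_ext_add[of c d] V.B.fsupp_add[of c E d]
      by (intro bexI[of _ "\<lambda>e. c e \<oplus>\<^bsub>?K\<^esub> d e"]) simp_all
  qed
  have uniq: "c = d" if "c \<in> fsupp E ?K" "d \<in> fsupp E ?K" "?lc c = ?lc d" for c d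
  proof -
    have nd: "(\<lambda>e. \<ominus>\<^bsub>?K\<^esub> d e) \<in> fsupp E ?K" by (rule V.B.fsupp_neg[OF that(2)])
    have "?lc d \<oplus>\<^bsub>V\<^esub> ?lc (\<lambda>e. \<ominus>\<^bsub>?K\<^esub> d e) = ?lc (\<lambda>e. \<zero>\<^bsub>?K\<^esub>)"
      using lc.fs_ext_add[OF that(2) nd] fsuppD(1)[OF that(2)] V.B.r_neg by simp
    then have "?lc (\<lambda>e. c e \<oplus>\<^bsub>?K\<^esub> \<ominus>\<^bsub>?K\<^esub> d e) = \<zero>\<^bsub>V\<^esub>"
      using lc.fs_ext_add[OF that(1) nd] that(3) lc.fs_ext_zero by simp
    then have "(\<lambda>e. c e \<oplus>\<^bsub>?K\<^esub> \<ominus>\<^bsub>?K\<^esub> d e) = (\<lambda>_. \<zero>\<^bsub>K\<^esub>)"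
      using ind V.B.fsupp_add[OF that(1) nd] by blast
    then have "c e \<ominus>\<^bsub>?K\<^esub> d e = \<zero>\<^bsub>?K\<^esub>" for e by (simp add: a_minus_def fun_eq_iff)
    then show ?thesis using V.B.eq_iff_minus[OF fsuppD(1)[OF that(1)] fsuppD(1)[OF that(2)]] by auto
  qed
  have "graded_basis ?K V E"
    unfolding graded_basis_def coeff_family_fsupp lin_comb_fs_ext
  proof (intro conjI ballI Eg)
    fix v assume "v \<in> carrier V"
    then obtain c where "c \<in> fsupp E ?K" "v = ?lc c" using span by blast
    then show "\<exists>!c. c \<in> fsupp E ?K \<and> v = ?lc c" using uniq by metis
  qed
  then show ?thesis by blast
qed

section \<open>Homology of a sum of copies\<close>

lemma restrict_scalars_comp: "restrict_scalars f (restrict_scalars g M) = restrict_scalars (g \<circ> f) M"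
  by (simp add: restrict_scalars_def dg.defs dgmod.defs comp_def)

lemma dg_ring_morphism_comp:
  "dg_ring_morphism R S f \<Longrightarrow> dg_ring_morphism S U g \<Longrightarrow> dg_ring_morphism R U (g \<circ> f)"
  unfolding dg_ring_morphism_def using ring_hom_trans[of f R S g U] chain_map_comp[of R S f U g] by (simp add: comp_def)

lemma restrict_morphism:
  assumes "dg_ring_morphism R S g" "dg_module_morphism S M N f"
  shows "dg_module_morphism R (restrict_scalars g M) (restrict_scalars g N) f"
proof -
  have "chain_map (restrict_scalars g M) (restrict_scalars g N) f"
    by (rule iffD1[OF same_dg_chain_map(1)[OF same_dg_restrict[of M g]]
          iffD1[OF same_dg_chain_map(2)[OF same_dg_restrict[of N g]] dg_module_morphismD(1)[OF assms(2)]]])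
  then show ?thesis
    using assms(2) dg_ring_morphismD(6)[OF assms(1)] by (simp add: dg_module_morphism_def)
qed

lemma dg_module_morphism_comp:
  assumes "dg_module_morphism B M N f" "dg_module_morphism B N P g"
  shows "dg_module_morphism B M P (\<lambda>x. g (f x))"
  using assms chain_map_comp[OF dg_module_morphismD(1)[OF assms(1)] dg_module_morphismD(1)[OF assms(2)]]
    ahom_closed[OF chain_mapD(1)[OF dg_module_morphismD(1)[OF assms(1)]]]
  by (simp add: dg_module_morphism_def)

definition module_scalars :: "('k, 'p) ring_scheme \<Rightarrow> ('r, 'q) dg_scheme \<Rightarrow> ('r, 'm) dgmod \<Rightarrow> ('k \<Rightarrow> 'm \<Rightarrow> 'm) \<Rightarrow> bool" where
  "module_scalars K R M s \<longleftrightarrow> scalar_maps K M s \<and> (\<forall>c\<in>carrier K. dg_module_morphism R M M (s c))"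

lemma (in twisting) module_scalars_twisted:
  assumes M: "left_dg_module R M" and s: "module_scalars K R M s"
  shows "module_scalars K R (twisted I wt a R M) (\<lambda>c x i. s c (x i))"
proof -
  interpret M: twisted_module R I wt a r M by (rule twisted_moduleI[OF M])
  have m: "dg_module_morphism R M.T M.T (\<lambda>x i. s c (x i))" if "c \<in> carrier K" for c
    using s that twisted_map[OF M M] by (auto simp: module_scalars_def)
  have sc: "s (c \<oplus>\<^bsub>K\<^esub> d) y = s c y \<oplus>\<^bsub>M\<^esub> s d y" "s (c \<otimes>\<^bsub>K\<^esub> d) y = s c (s d y)" "s \<one>\<^bsub>K\<^esub> y = y"
    if "c \<in> carrier K" "d \<in> carrier K" "y \<in> carrier M" for c d y
    using s that by (simp_all add: module_scalars_def scalar_maps_def)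
  have one: "s \<one>\<^bsub>K\<^esub> y = y" if "y \<in> carrier M" for y
    using s that by (simp add: module_scalars_def scalar_maps_def)
  have x: "x i \<in> carrier M" if "x \<in> carrier M.T" for x i
    using that fsuppD(1)[of x I M i] by simp
  show ?thesis
    unfolding module_scalars_def scalar_maps_def
  proof (intro conjI ballI)
    fix c d x assume c: "c \<in> carrier K" "d \<in> carrier K" "x \<in> carrier M.T"
    show "(\<lambda>i. s (c \<oplus>\<^bsub>K\<^esub> d) (x i)) = (\<lambda>i. s c (x i)) \<oplus>\<^bsub>M.T\<^esub> (\<lambda>i. s d (x i))"
      by (simp add: sc(1)[OF c(1,2) x[OF c(3)]])
    show "(\<lambda>i. s (c \<otimes>\<^bsub>K\<^esub> d) (x i)) = (\<lambda>i. s c (s d (x i)))"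
      by (simp add: sc(2)[OF c(1,2) x[OF c(3)]])
  next
    fix x assume "x \<in> carrier M.T"
    then show "(\<lambda>i. s \<one>\<^bsub>K\<^esub> (x i)) = x" by (simp only: one[OF x])
  qed (simp_all only: m dg_module_morphismD(1)[OF m])
qed

lemma module_scalars_restrict:
  assumes g: "dg_ring_morphism R S g" and s: "module_scalars K S M s"
  shows "module_scalars K R (restrict_scalars g M) s"
  using s restrict_morphism[OF g, of M M] unfolding module_scalars_def scalar_maps_def
  by (simp add: dg_module_morphism_def)

locale augmented = K: field K + R: dg_ring R for K :: "'k ring" and R :: "'r dg" +
  fixes \<delta> :: "'r \<Rightarrow> 'k"
  assumes \<delta>: "dg_ring_morphism R (concentrated K) \<delta>"
begin

abbreviation "k \<equiv> restrict_scalars \<delta> (left_regular (concentrated K))"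

lemma k_module: "left_dg_module R k"
  by (rule left_restrict[OF R.dg_ring_axioms \<delta> left_regular[OF concentrated_dg_ring[OF K.field_axioms]]])

lemma \<delta>_closed: "b \<in> carrier R \<Longrightarrow> \<delta> b \<in> carrier K"
  using dg_ring_morphismD(6)[OF \<delta>] by simp

text \<open>For degree reasons \<delta> kills everything outside degree 0, where
  \<open>signed\<close> is the identity. Signs in the action on twisted sums over \<open>k\<close>
  therefore disappear and the ring acts by scalars.\<close>

lemma \<delta>_signed: "b \<in> carrier R \<Longrightarrow> \<delta> (signed R b) = \<delta> b"
proof (induction b rule: R.graded_induct)
  case (homogeneous n b)
  show ?case
  proof (cases "n = 0")
    case True
    then show ?thesis using R.signed_homogeneous[OF homogeneous] by (simp add: koszul_def)
  next
    case False
    have "\<delta> b = \<zero>\<^bsub>K\<^esub>" "\<delta> (signed R b) = \<zero>\<^bsub>K\<^esub>"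
      using dg_ring_morphismD(2)[OF \<delta> homogeneous] dg_ring_morphismD(2)[OF \<delta> R.signed_gr[OF homogeneous]] False by simp_all
    then show ?thesis by simp
  qed
next
  case (add b c)
  then show ?case using dg_ring_morphismD(7)[OF \<delta>] by (simp add: R.signed_add)
qed

lemma module_scalars_k: "module_scalars K R k (\<lambda>c x. c \<otimes>\<^bsub>K\<^esub> x)"
proof -
  have m: "dg_module_morphism R k k (\<lambda>x. c \<otimes>\<^bsub>K\<^esub> x)" if "c \<in> carrier K" for c
    unfolding dg_module_morphism_def
  proof (intro conjI ballI chain_mapI)
    show "(\<lambda>x. c \<otimes>\<^bsub>K\<^esub> x) \<in> ahom k k" using that by (intro ahomI) (simp_all add: K.r_distr)
  qed (use that in \<open>auto simp: \<delta>_closed K.m_lcomm split: if_splits\<close>)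
  then show ?thesis
    using dg_module_morphismD(1)[OF m] by (auto simp: module_scalars_def scalar_maps_def K.l_distr K.m_assoc)
qed

end

lemma (in gc_dg_ring) twisting_zero: "twisting R I wt (\<lambda>_ _. \<zero>) {}"
  by unfold_locales (auto simp: finsum_empty)

lemma tensor_space_simps [simp]:
  "carrier (tensor_space K V W) = carrier (tensor (concentrated K) V W)"
  "ring.add (tensor_space K V W) = ring.add (tensor (concentrated K) V W)"
  "ring.zero (tensor_space K V W) = ring.zero (tensor (concentrated K) V W)"
  "gr (tensor_space K V W) = gr (tensor (concentrated K) V W)"
  "act (tensor_space K V W) c = tensor_map (concentrated K) V W W (act W c)"
  by (simp_all add: tensor_space_def)

lemma same_dg_tensor_space: "same_dg (tensor (concentrated K) V W) (tensor_space K V W)"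
  by (simp add: same_dg_def tensor_space_def)

text \<open>Regards a graded vector space as a complex with zero differential, the form in which
  homology spaces can be tensored over \<open>concentrated K\<close>.\<close>

locale zero_graded = vs: graded_vector_space K V + D: dg_group V
  for K :: "'k ring" and V :: "('k, 'v) dgmod" +
  assumes no_diff: "x \<in> carrier V \<Longrightarrow> diff V x = \<zero>\<^bsub>V\<^esub>"
begin

lemma left: "left_dg_module (concentrated K) V"
  by (rule vector_space_left_module[OF vs.graded_vector_space_axioms D.dg_group_axioms no_diff])

lemma right: "right_dg_module (concentrated K) V"
  by (rule vector_space_right_module[OF vs.graded_vector_space_axioms D.dg_group_axioms no_diff])

end

lemma zero_graded_hscal:
  assumes "field K" "dg_group M" "graded_vector_space K (hscal M s)"
  shows "zero_graded K (hscal M s)"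
  using assms dg_group_hscal[OF assms(2)] hscal_diff[of M s]
  by (simp add: zero_graded_def zero_graded_axioms_def)

text \<open>\<open>P\<close> is the sum of copies of \<open>k\<close>, one for each basis element of
  \<open>V\<close> and shifted to its degree: a model of \<open>V\<close> on which \<open>R\<close>
  acts through \<delta>.\<close>

locale copies = augmented K R \<delta> + gc: gc_dg_ring R + V: zero_graded K V
  for K :: "'k ring" and R :: "'r dg" and \<delta> :: "'r \<Rightarrow> 'k" and V :: "('k, 'v) dgmod" +
  fixes E :: "'v set"
  assumes basis: "graded_basis (concentrated K) V E"
begin

abbreviation "dv \<equiv> some_degree V"
abbreviation "P \<equiv> twisted E dv (\<lambda>_ _. \<zero>\<^bsub>R\<^esub>) R k"
sublocale zt: twisting R E dv "\<lambda>_ _. \<zero>\<^bsub>R\<^esub>" "{}"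
  by (rule gc.twisting_zero)

sublocale P: twisted_module R E dv "\<lambda>_ _. \<zero>\<^bsub>R\<^esub>" "{}" k
  by (rule zt.twisted_moduleI[OF k_module])

lemma diff_P: "x \<in> carrier P \<Longrightarrow> diff P x = \<zero>\<^bsub>P\<^esub>"
proof -
  assume "x \<in> carrier P"
  then have "x \<in> fsupp E k" by simp
  then show ?thesis
  proof (induction x rule: P.M.fsupp_induct)
    case zero
    show ?case by (simp add: P.diff_T_zero[simplified])
  next
    case (delta e m)
    then show ?case using P.diff_delta[OF delta] P.M.koszul_zero[of "dv e"] P.M.act_zero_left[of m]
      by (simp add: delta_def fun_eq_iff)
  next
    case (add x y)
    then show ?case using P.diff_T_add[of x y] by simp
  qed
qed

lemma act_P: "b \<in> carrier R \<Longrightarrow> x \<in> carrier P \<Longrightarrow> act P b x = (\<lambda>v. \<delta> b \<otimes>\<^bsub>K\<^esub> x v)"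
  by (auto simp: \<delta>_signed)

lemma ev_hom: "(\<lambda>p. p v) \<in> ahom P k"
  by (intro ahomI) (auto dest: fsuppD(1))

lemma module_scalars_P: "module_scalars K R P (\<lambda>c x v. c \<otimes>\<^bsub>K\<^esub> x v)"
  by (rule zt.module_scalars_twisted[OF k_module module_scalars_k])

text \<open>A complex of vector spaces is quasi-isomorphic to its homology: each basis element is
  sent to a representing cycle. The map is linear over \<open>R\<close> because \<open>R\<close>
  acts on \<open>W\<close> by scalars only, and this is the reason for replacing C \<otimes> F by D
  \<otimes> k.\<close>

lemma basis_qi:
  assumes W: "left_dg_module R W" and s: "scalar_maps K W s"
    and act: "\<And>b x. b \<in> carrier R \<Longrightarrow> x \<in> carrier W \<Longrightarrow> act W b x = s (\<delta> b) x"
    and \<psi>: "giso K (hscal W s) V \<psi>"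
  shows "\<exists>g. dg_module_morphism R P W g \<and> qi P W g \<and> (\<forall>c\<in>carrier K. \<forall>x\<in>carrier P. g (\<lambda>v. c \<otimes>\<^bsub>K\<^esub> x v) = s c (g x))"
proof -
  let ?K = "concentrated K"
  interpret W: left_dg_module R W by (rule W)
  interpret VL: left_dg_module ?K V by (rule V.left)
  interpret b: based_module ?K V E by (intro based_module.intro based_module_axioms.intro V.left basis)
  have agV: "abelian_group V" using V.left by (simp add: left_dg_module_def dg_group_def graded_group_def)
  have sc: "chain_map W W (s c)" if "c \<in> carrier K" for c using s that by (simp add: scalar_maps_def)
  note sh = chain_mapD(1)[OF sc]
  have sdist: "s (c \<oplus>\<^bsub>K\<^esub> d) x = s c x \<oplus>\<^bsub>W\<^esub> s d x" "s (c \<otimes>\<^bsub>K\<^esub> d) x = s c (s d x)"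
    if "c \<in> carrier K" "d \<in> carrier K" "x \<in> carrier W" for c d x using s that by (simp_all add: scalar_maps_def)
  have scc: "s c x \<in> carrier W" if "c \<in> carrier K" "x \<in> carrier W" for c x using ahom_closed[OF sh] that .
  have s_hom: "(\<lambda>c. s c x) \<in> ahom k W" if "x \<in> carrier W" for x
    using that by (intro ahomI) (simp_all add: sdist scc)
  have \<psi>b: "bij_betw \<psi> (carrier (homology W)) (carrier V)" "\<psi> \<in> ahom (homology W) V"
    "\<And>c v. c \<in> carrier K \<Longrightarrow> v \<in> carrier (homology W) \<Longrightarrow> \<psi> (homology_map W W (s c) v) = act V c (\<psi> v)"
    "\<And>n. \<psi> ` gr (homology W) n = gr V n"
    using \<psi> by (auto simp: giso_def hom_def)
  have H: "homology_class W x \<in> carrier (homology W)" if "x \<in> cycles W" for x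
    using that by (auto simp: W.M.carrier_homology)
  \<comment> \<open>\<psi> maps each graded piece onto its counterpart, so a representing cycle can
    be taken in the degree of \<open>v\<close>.\<close>
  have "\<exists>w. v \<in> E \<longrightarrow> w \<in> cycles W \<and> w \<in> gr W (dv v) \<and> \<psi> (homology_class W w) = v" for v
  proof (cases "v \<in> E")
    case True
    then have "v \<in> \<psi> ` gr (homology W) (dv v)" using b.E_gr \<psi>b(4) by simp
    then show ?thesis unfolding W.M.gr_homology by blast
  qed simp
  from choice[OF allI[OF this]] obtain w where "\<forall>v. v \<in> E \<longrightarrow> w v \<in> cycles W \<and> w v \<in> gr W (dv v) \<and> \<psi> (homology_class W (w v)) = v"
    by (rule exE)
  then have w: "w v \<in> cycles W" "w v \<in> gr W (dv v)" "\<psi> (homology_class W (w v)) = v" if "v \<in> E" for v using that by blast+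
  note wc = W.M.cyclesD(1)[OF w(1)]
  let ?u = "\<lambda>v c. s c (w v)"
  let ?g = "fs_ext k W ?u"
  interpret u: ab_hom_family k W E ?u
    by (intro ab_hom_family.intro ab_hom_family_axioms.intro P.M.M.abelian_group_axioms W.M.abelian_group_axioms s_hom wc)
  have gc: "chain_map P W ?g"
  proof (rule P.T_hom[OF W.M.dg_group_axioms u.hom])
    fix v n x assume v: "v \<in> E" and x: "x \<in> gr k n"
    show "s x (w v) \<in> gr W (n + dv v)"
    proof (cases "n = 0")
      case True
      then show ?thesis using x chain_mapD(2)[OF sc w(2)[OF v]] by simp
    next
      case False
      then show ?thesis using x ahom_zero[OF P.M.M.abelian_group_axioms W.M.abelian_group_axioms s_hom[OF wc[OF v]]] by simp
    qed
  next
    fix j m assume j: "j \<in> E" and m: "m \<in> carrier k"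
    have "s \<zero>\<^bsub>K\<^esub> (w j) = \<zero>\<^bsub>W\<^esub>" using ahom_zero[OF P.M.M.abelian_group_axioms W.M.abelian_group_axioms s_hom[OF wc[OF j]]] by simp
    moreover have "diff W (s m (w j)) = \<zero>\<^bsub>W\<^esub>"
      using chain_mapD(3)[OF sc wc[OF j], of m] m W.M.cyclesD(2)[OF w(1)[OF j]]
        ahom_zero[OF W.M.abelian_group_axioms W.M.abelian_group_axioms sh, of m] by simp
    ultimately show "(\<Oplus>\<^bsub>W\<^esub>i\<in>{i. \<zero>\<^bsub>R\<^esub> \<noteq> \<zero>\<^bsub>R\<^esub>}. s (act k \<zero>\<^bsub>R\<^esub> m) (w i)) \<oplus>\<^bsub>W\<^esub> koszul W (dv j) (s (diff k m) (w j)) = diff W (s m (w j))"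
      by (simp add: W.M.koszul_zero)
  qed
  note gh = chain_mapD(1)[OF gc]
  note agP = P.T_abelian W.M.abelian_group_axioms
  have gs: "?g (\<lambda>v. c \<otimes>\<^bsub>K\<^esub> x v) = s c (?g x)" if c: "c \<in> carrier K" and "x \<in> carrier P" for c x
  proof -
    have m: "(\<lambda>x v. c \<otimes>\<^bsub>K\<^esub> x v) \<in> ahom P P"
      by (rule chain_mapD(1)) (use module_scalars_P c in \<open>simp add: module_scalars_def scalar_maps_def\<close>)
    note h1 = ahom_comp[OF m gh] and h2 = ahom_comp[OF gh sh[OF c]]
    have "x \<in> fsupp E k" using \<open>x \<in> carrier P\<close> by simp
    then show ?thesis
    proof (induction x rule: P.M.fsupp_induct)
      case zero
      show ?case using ahom_zero[OF agP h1] ahom_zero[OF agP h2] by (simp only: twisted_simps(2))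
    next
      case (delta j m)
      then have m: "m \<in> carrier K" by simp
      have "(\<lambda>v. c \<otimes>\<^bsub>K\<^esub> delta k j m v) = delta k j (c \<otimes>\<^bsub>K\<^esub> m)" using c by (auto simp: delta_def)
      then show ?case using u.fs_ext_delta[OF delta(1)] c m by (simp add: sdist wc[OF delta(1)])
    next
      case (add x y)
      then show ?case using ahom_add[OF h1, of x y] ahom_add[OF h2, of x y] by (simp only: twisted_simps(1,3))
    qed
  qed
  have gact: "?g (act P b x) = act W b (?g x)" if "b \<in> carrier R" "x \<in> carrier P" for b x
    using gs[OF \<delta>_closed[OF that(1)] that(2)] act_P[OF that] act[OF that(1) ahom_closed[OF gh that(2)]] by (simp only:)
  have gcy: "?g x \<in> cycles W" if "x \<in> carrier P" for x
  proof (rule W.M.cyclesI[OF ahom_closed[OF gh that]])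
    show "diff W (?g x) = \<zero>\<^bsub>W\<^esub>"
      using chain_mapD(3)[OF gc that] diff_P[OF that] ahom_zero[OF agP gh] by (simp only:)
  qed
  have sup: "fsupp E k = fsupp E ?K" by (simp add: fsupp_def)
  \<comment> \<open>Through \<psi> the map in homology becomes the passage from coefficients to
    linear combinations, which is bijective by the basis property.\<close>
  have g\<psi>: "\<psi> (homology_class W (?g x)) = lin_comb ?K V x" if "x \<in> carrier P" for x
  proof -
    have "x \<in> fsupp E ?K" using that sup by simp
    then show ?thesis
    proof (induction x rule: VL.B.fsupp_induct)
      case zero
      have "homology_class W (?g (\<lambda>i. \<zero>\<^bsub>?K\<^esub>)) = \<zero>\<^bsub>homology W\<^esub>"
        using u.fs_ext_zero by (simp add: W.M.zero_homology)
      then show ?case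
        using ahom_zero[OF W.M.abelian_group_homology agV \<psi>b(2)] b.lc.fs_ext_zero
        by (simp add: lin_comb_fs_ext)
    next
      case (delta j m)
      then have m: "m \<in> carrier K" by simp
      have "delta ?K j m = delta k j m" by (intro ext) (simp add: delta_def)
      then have "?g (delta ?K j m) = s m (w j)" using u.fs_ext_delta[OF delta(1), of m] m by simp
      then have "homology_class W (?g (delta ?K j m)) = homology_map W W (s m) (homology_class W (w j))"
        using homology_map_chain_map[OF W.M.dg_group_axioms W.M.dg_group_axioms sc[OF m] wc[OF delta(1)]] by simp
      then show ?case
        using \<psi>b(3)[OF m H[OF w(1)[OF delta(1)]]] w(3)[OF delta(1)] b.lc.fs_ext_delta[OF delta] by (simp add: lin_comb_fs_ext)
    next
      case (add x y)
      have xy: "x \<in> carrier P" "y \<in> carrier P" using add(1,2) sup by simp_all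
      have "?g (\<lambda>i. x i \<oplus>\<^bsub>?K\<^esub> y i) = ?g x \<oplus>\<^bsub>W\<^esub> ?g y" using ahom_add[OF gh xy] by simp
      then have "homology_class W (?g (\<lambda>i. x i \<oplus>\<^bsub>?K\<^esub> y i)) = homology_class W (?g x) \<oplus>\<^bsub>homology W\<^esub> homology_class W (?g y)"
        using W.M.add_homology[OF ahom_closed[OF gh xy(1)] ahom_closed[OF gh xy(2)]] by simp
      then show ?case
        using ahom_add[OF \<psi>b(2) H[OF gcy[OF xy(1)]] H[OF gcy[OF xy(2)]]] add(3,4) b.lc.fs_ext_add[OF add(1,2)]
        by (simp add: lin_comb_fs_ext)
    qed
  qed
  have "qi P W ?g"
  proof (rule qiI[OF gc])
    fix y x assume y: "y \<in> carrier P" and x: "x \<in> carrier W" and "diff P y = \<zero>\<^bsub>P\<^esub>" and eq: "?g y = diff W x"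
    have "homology_class W (?g y) = \<zero>\<^bsub>homology W\<^esub>"
      using W.M.homology_class_zero_iff[OF ahom_closed[OF gh y]] eq x by blast
    then have "lin_comb ?K V y = \<zero>\<^bsub>V\<^esub>"
      using g\<psi>[OF y] ahom_zero[OF W.M.abelian_group_homology agV \<psi>b(2)] by simp
    moreover have "lin_comb ?K V (\<lambda>v. \<zero>\<^bsub>?K\<^esub>) = \<zero>\<^bsub>V\<^esub>" using b.lc.fs_ext_zero by (simp only: lin_comb_fs_ext)
    moreover have "y \<in> fsupp E ?K" using y sup by simp
    ultimately have y0: "y = (\<lambda>v. \<zero>\<^bsub>?K\<^esub>)"
      using b.coeffs_lin_comb[of y] b.coeffs_lin_comb[OF VL.B.fsupp_zero] by (simp only:)
    have "diff W x = \<zero>\<^bsub>W\<^esub>" using eq y0 u.fs_ext_zero by simp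
    then have xcy: "x \<in> cycles W" using x by (intro W.M.cyclesI)
    then have V: "\<psi> (homology_class W x) \<in> carrier V" using ahom_closed[OF \<psi>b(2) H] by blast
    define y' where "y' = b.cf (\<psi> (homology_class W x))"
    have y': "y' \<in> carrier P" using b.coeffs_fsupp[OF V] sup by (simp add: y'_def)
    have "\<psi> (homology_class W (?g y')) = \<psi> (homology_class W x)"
      using g\<psi>[OF y'] b.lin_comb_coeffs[OF V] by (simp only: y'_def)
    then have "homology_class W (?g y') = homology_class W x"
      using \<psi>b(1) H[OF gcy[OF y']] H[OF xcy] by (auto simp: bij_betw_def dest: inj_onD)
    then obtain x' where "x' \<in> carrier W" "?g y' = x \<oplus>\<^bsub>W\<^esub> diff W x'"
      using W.M.homology_class_eq_iff[OF ahom_closed[OF gh y'] x] by blast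
    moreover have "diff P y' = y" using diff_P[OF y'] y0 by simp
    ultimately show "\<exists>y'\<in>carrier P. \<exists>x'\<in>carrier W. diff P y' = y \<and> ?g y' = x \<oplus>\<^bsub>W\<^esub> diff W x'"
      using y' by blast
  qed
  then show ?thesis using gc gact gs by (intro exI[of _ ?g]) (simp add: dg_module_morphism_def del: twisted_simps)
qed

end

section \<open>The Kuenneth isomorphism over \<open>k\<close>\<close>

locale kunneth = copies K R \<delta> V E + tw: twisting R I wt a r + U: zero_graded K U
  for K :: "'k ring" and R :: "'r dg" and \<delta> :: "'r \<Rightarrow> 'k" and V :: "('k, 'v) dgmod" and E :: "'v set"
    and I :: "'g set" and wt :: "'g \<Rightarrow> int" and a :: "'g \<Rightarrow> 'g \<Rightarrow> 'r" and r :: "('g \<times> 'g) set" and U :: "('k, 'u) dgmod"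
begin

abbreviation "X0 \<equiv> twisted I wt a R k"
abbreviation "X1 \<equiv> twisted I wt a R P"
abbreviation "s0 \<equiv> \<lambda>c x i. c \<otimes>\<^bsub>K\<^esub> x i"
abbreviation "s1 \<equiv> \<lambda>c x i v. c \<otimes>\<^bsub>K\<^esub> x i v"

sublocale X0: twisted_module R I wt a r k
  by (rule tw.twisted_moduleI[OF k_module])

sublocale X1: twisted_module R I wt a r P
  by (rule tw.twisted_moduleI[OF P.T_left_dg_module])

lemma pr_hom: "(\<lambda>x i. x i v) \<in> ahom X1 X0"
  by (rule ahom_pointwise[OF X1.twisted_module_axioms X0.twisted_module_axioms ev_hom refl])

text \<open>The ring acts on each copy of \<open>k\<close> in \<open>P\<close> through \<delta>,
  without signs, and \<open>P\<close> has zero differential; so the twisted differential is computed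
  copy by copy. The projection shifts degrees by \<open>dv v\<close> and is thus not a
  \<open>chain_map\<close> in general.\<close>

lemma pr_diff: "x \<in> carrier X1 \<Longrightarrow> (\<lambda>i. diff X1 x i v) = diff X0 (\<lambda>i. x i v)"
proof -
  assume "x \<in> carrier X1"
  then have "x \<in> fsupp I P" by simp
  have h1: "(\<lambda>x i. diff X1 x i v) \<in> ahom X1 X0" by (rule ahom_comp[OF X1.diff_T_ahom pr_hom])
  have h2: "(\<lambda>x. diff X0 (\<lambda>i. x i v)) \<in> ahom X1 X0" by (rule ahom_comp[OF pr_hom X0.diff_T_ahom])
  from \<open>x \<in> fsupp I P\<close> show ?thesis
  proof (induction x rule: X1.M.fsupp_induct)
    case zero
    have "(\<lambda>i. \<zero>\<^bsub>P\<^esub> v) = (\<lambda>i. \<zero>\<^bsub>k\<^esub>)" by simp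
    then show ?case
      using ahom_zero[OF X1.T_abelian X0.T_abelian h1] ahom_zero[OF X1.T_abelian X0.T_abelian h2] by simp
  next
    case (delta j p)
    have pv: "p v \<in> carrier k" using ahom_closed[OF ev_hom delta(2)] .
    have "(\<lambda>i. delta P j p i v) = delta k j (p v)" by (intro ext) (simp add: delta_def)
    moreover have "diff X1 (delta P j p) i v = diff X0 (delta k j (p v)) i" for i
    proof -
      have aij: "a i j \<in> carrier R" using tw.a_closed[OF delta(1)] .
      have "koszul P (wt j) (diff P p) = \<zero>\<^bsub>P\<^esub>" using diff_P[OF delta(2)] X1.M.koszul_zero by simp
      then have "diff X1 (delta P j p) i = act P (a i j) p"
        using X1.diff_delta[OF delta] X1.M.act_closed[OF aij delta(2)]
        by (simp add: delta_def X1.M.r_zero del: twisted_simps restrict_scalars_simps)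
      moreover have "diff X0 (delta k j (p v)) i = act k (a i j) (p v)"
        using X0.diff_delta[OF delta(1) pv] pv aij P.M.koszul_zero[of "wt j"] \<delta>_closed[OF aij] by (simp add: delta_def)
      ultimately show ?thesis using act_P[OF aij delta(2)] by simp
    qed
    ultimately show ?case by simp
  next
    case (add x y)
    show ?case using ahom_add[OF h1, of x y] ahom_add[OF h2, of x y] add by simp
  qed
qed

lemma scalar_maps_s0: "scalar_maps K X0 s0"
  using tw.module_scalars_twisted[OF k_module module_scalars_k] by (simp add: module_scalars_def)

lemma scalar_maps_s1: "scalar_maps K X1 s1"
  using tw.module_scalars_twisted[OF P.T_left_dg_module module_scalars_P] by (simp add: module_scalars_def)

text \<open>T \<otimes> P is a direct sum of copies of T \<otimes> k over the basis
  \<open>E\<close>, and homology commutes with direct sums; U \<otimes> V is a direct sum of copies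
  of \<open>U\<close> over the same basis. The coordinates on the two sides are matched by
  \<theta>.\<close>

lemma kunneth:
  assumes \<theta>: "giso K (hscal X0 s0) U \<theta>"
  shows "\<exists>h. giso K (hscal X1 s1) (tensor_space K U V) h"
proof -
  let ?K = "concentrated K"
  interpret UR: right_dg_module ?K U by (rule U.right)
  interpret VL: left_dg_module ?K V by (rule V.left)
  interpret tp: tensor_pair ?K U V by (intro tensor_pair.intro U.right V.left)
  interpret b: based_module ?K V E by (intro based_module.intro based_module_axioms.intro V.left basis)
  interpret tb: tensor_basis ?K U V E by (intro tensor_basis.intro tp.tensor_pair_axioms b.based_module_axioms)
  interpret T: dg_group tp.T by (rule tp.T_dg)
  interpret D0: dg_group X0 by (rule X0.T_dg)
  interpret D1: dg_group X1 by (rule X1.T_dg)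
  interpret H1: dg_group "hscal X1 s1" by (rule dg_group_hscal[OF X1.T_dg])
  have \<theta>b: "bij_betw \<theta> (carrier (hscal X0 s0)) (carrier U)" "\<theta> \<in> ahom (hscal X0 s0) U"
    "\<And>c v. c\<in>carrier K \<Longrightarrow> v\<in>carrier (hscal X0 s0) \<Longrightarrow> \<theta> (act (hscal X0 s0) c v) = act U c (\<theta> v)"
    "\<And>n. \<theta> ` gr (hscal X0 s0) n = gr U n"
    using \<theta> by (auto simp: giso_def)
  have \<theta>h: "\<theta> \<in> ahom (homology X0) U" using \<theta>b(2) by (simp add: hom_def)
  let ?pr = "\<lambda>v x i. x i v"
  have prc: "?pr v x \<in> carrier X0" if "x \<in> carrier X1" for v x using ahom_closed[OF pr_hom that] .
  have prb: "\<exists>w\<in>carrier X0. ?pr v (diff X1 z) = diff X0 w" if "z \<in> carrier X1" for z v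
    using pr_diff[OF that, of v] prc[OF that, of v] by blast
  have prcy: "?pr v z \<in> cycles X0" if "z \<in> cycles X1" for z v
  proof -
    have "z \<in> carrier X1" "diff X1 z = \<zero>\<^bsub>X1\<^esub>" using that by (auto simp: cycles_def)
    then have "diff X0 (?pr v z) = \<zero>\<^bsub>X0\<^esub>" using pr_diff[of z v] by simp
    then show ?thesis using prc[OF \<open>z \<in> carrier X1\<close>] by (simp add: cycles_def)
  qed
  have hmc: "homology_map X1 X0 (?pr v) (homology_class X1 x) = homology_class X0 (?pr v x)" if "x \<in> carrier X1" for v x
    by (rule homology_map_class[OF X1.T_dg X0.T_dg pr_hom prb that])
  have hm_hom: "homology_map X1 X0 (?pr v) \<in> ahom (homology X1) (homology X0)" for v
    by (rule homology_map_ahom[OF X1.T_dg X0.T_dg pr_hom]) (rule prb prcy, assumption)+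
  \<comment> \<open>The coordinate of a homology class at the basis element \<open>v\<close>,
    carried over to \<open>U\<close>.\<close>
  define hv where "hv v Q = \<theta> (homology_map X1 X0 (?pr v) Q)" for v Q
  have hv_hom: "hv v \<in> ahom (homology X1) U" for v
    unfolding hv_def by (rule ahom_comp[OF hm_hom \<theta>h])
  have hv_class: "hv v (homology_class X1 x) = \<theta> (homology_class X0 (?pr v x))" if "x \<in> carrier X1" for v x
    by (simp add: hv_def hmc[OF that])
  have H0: "homology_class X0 y \<in> carrier (homology X0)" if "y \<in> cycles X0" for y using that by (auto simp: D0.carrier_homology)
  have \<theta>0: "\<theta> (homology_class X0 \<zero>\<^bsub>X0\<^esub>) = \<zero>\<^bsub>U\<^esub>"
    using ahom_zero[OF D0.abelian_group_homology tp.agL \<theta>h] by (simp only: D0.zero_homology)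
  have Hcy: "\<exists>x\<in>cycles X1. Q = homology_class X1 x" if "Q \<in> carrier (homology X1)" for Q
    using that by (auto simp: D1.carrier_homology)
  have X1f: "x i v \<in> carrier K" "v \<notin> E \<Longrightarrow> x i v = \<zero>\<^bsub>K\<^esub>" "i \<notin> I \<Longrightarrow> x i = (\<lambda>v. \<zero>\<^bsub>K\<^esub>)" if "x \<in> carrier X1" for x i v
    using that fsuppD(1)[of x I P i] fsuppD(2)[of x I P i] fsuppD(1)[of "x i" E k v] fsuppD(2)[of "x i" E k v] by simp_all
  have finv: "finite {v. ?pr v x \<noteq> \<zero>\<^bsub>X0\<^esub>}" if x: "x \<in> carrier X1" for x
  proof (rule finite_subset)
    show "{v. ?pr v x \<noteq> \<zero>\<^bsub>X0\<^esub>} \<subseteq> (\<Union>i\<in>{i. x i \<noteq> \<zero>\<^bsub>P\<^esub>}. {v. x i v \<noteq> \<zero>\<^bsub>K\<^esub>})"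
      by (auto simp: fun_eq_iff)
    show "finite (\<Union>i\<in>{i. x i \<noteq> \<zero>\<^bsub>P\<^esub>}. {v. x i v \<noteq> \<zero>\<^bsub>K\<^esub>})"
    proof (rule finite_UN_I)
      show "finite {i. x i \<noteq> \<zero>\<^bsub>P\<^esub>}" using x fsuppD(3)[of x I P] by simp
      show "finite {v. x i v \<noteq> \<zero>\<^bsub>K\<^esub>}" for i using x fsuppD(1)[of x I P i] fsuppD(3)[of "x i" E k] by simp
    qed
  qed
  have hvs: "(\<lambda>v. hv v Q) \<in> fsupp E U" if "Q \<in> carrier (homology X1)" for Q
  proof -
    obtain x where x: "x \<in> cycles X1" "Q = homology_class X1 x" using Hcy \<open>Q \<in> _\<close> by blast
    have xc: "x \<in> carrier X1" using x(1) by (rule D1.cyclesD)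
    have z: "hv v Q = \<zero>\<^bsub>U\<^esub>" if "?pr v x = \<zero>\<^bsub>X0\<^esub>" for v using that hv_class[OF xc] x \<theta>0 by simp
    show ?thesis
    proof (rule fsuppI[OF finv[OF xc] _ _ _ tp.agL])
      show "{v. ?pr v x \<noteq> \<zero>\<^bsub>X0\<^esub>} \<subseteq> E" using X1f(2)[OF xc] by auto
      show "hv v Q = \<zero>\<^bsub>U\<^esub>" if "v \<notin> {v. ?pr v x \<noteq> \<zero>\<^bsub>X0\<^esub>}" for v using that z by simp
      show "hv v Q \<in> carrier U" for v using ahom_closed[OF hv_hom \<open>Q \<in> _\<close>] .
    qed
  qed
  let ?pt = "fs_ext U tp.T (\<lambda>v u. tp.pt u v)"
  define h where "h Q = ?pt (\<lambda>v. hv v Q)" for Q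
  have hc: "h Q \<in> carrier tp.T" if "Q \<in> carrier (homology X1)" for Q
    unfolding h_def by (rule tb.ex.fs_ext_closed[OF hvs[OF that]])
  have th: "tb.tcoord v (h Q) = hv v Q" if "Q \<in> carrier (homology X1)" for Q v
    unfolding h_def by (rule tb.tcoord_ext[OF hvs[OF that]])
  have hh: "h \<in> ahom (homology X1) tp.T"
  proof (rule ahomI)
    fix Q Q' assume Q: "Q \<in> carrier (homology X1)" "Q' \<in> carrier (homology X1)"
    have "(\<lambda>v. hv v (Q \<oplus>\<^bsub>homology X1\<^esub> Q')) = (\<lambda>v. hv v Q \<oplus>\<^bsub>U\<^esub> hv v Q')"
      using ahom_add[OF hv_hom Q] by blast
    then show "h (Q \<oplus>\<^bsub>homology X1\<^esub> Q') = h Q \<oplus>\<^bsub>tp.T\<^esub> h Q'"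
      unfolding h_def using tb.ex.fs_ext_add[OF hvs[OF Q(1)] hvs[OF Q(2)]] by simp
  qed (rule hc)
  have \<theta>inj: "Q = Q'" if "Q \<in> carrier (homology X0)" "Q' \<in> carrier (homology X0)" "\<theta> Q = \<theta> Q'" for Q Q'
    using \<theta>b(1) that by (simp add: bij_betw_def inj_on_def)
  \<comment> \<open>A family of elements of T \<otimes> k that is indexed by \<open>E\<close> and
    has finitely many nonzero members is the same as an element of T \<otimes> P.\<close>
  have lift: "\<exists>y\<in>carrier X1. \<forall>v. ?pr v y = f v"
    if f: "\<And>v. f v \<in> carrier X0" "finite {v. f v \<noteq> \<zero>\<^bsub>X0\<^esub>}" "\<And>v. v \<notin> E \<Longrightarrow> f v = \<zero>\<^bsub>X0\<^esub>" for f
  proof -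
    have fv: "f v i \<in> carrier K" "i \<notin> I \<Longrightarrow> f v i = \<zero>\<^bsub>K\<^esub>" "finite {i. f v i \<noteq> \<zero>\<^bsub>K\<^esub>}" for v i
      using f(1)[of v] fsuppD[of "f v" I k] by simp_all
    have 1: "(\<lambda>v. f v i) \<in> carrier P" for i
    proof -
      have "{v. f v i \<noteq> \<zero>\<^bsub>K\<^esub>} \<subseteq> {v. f v \<noteq> \<zero>\<^bsub>X0\<^esub>}" by auto
      then show ?thesis using f(2,3) fv(1) finite_subset by (auto simp: fsupp_def)
    qed
    have fin: "finite (\<Union>v\<in>{v. f v \<noteq> \<zero>\<^bsub>X0\<^esub>}. {i. f v i \<noteq> \<zero>\<^bsub>K\<^esub>})" using f(2) fv(3) by blast
    have "(\<lambda>i v. f v i) \<in> fsupp I P"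
    proof (rule fsuppI[OF fin _ _ 1 P.T_abelian])
      show "(\<Union>v\<in>{v. f v \<noteq> \<zero>\<^bsub>X0\<^esub>}. {i. f v i \<noteq> \<zero>\<^bsub>K\<^esub>}) \<subseteq> I" using fv(2) by auto
      show "(\<lambda>v. f v i) = \<zero>\<^bsub>P\<^esub>" if "i \<notin> (\<Union>v\<in>{v. f v \<noteq> \<zero>\<^bsub>X0\<^esub>}. {i. f v i \<noteq> \<zero>\<^bsub>K\<^esub>})" for i
        using that by (auto simp: fun_eq_iff)
    qed
    then show ?thesis by (intro bexI[of _ "\<lambda>i v. f v i"]) auto
  qed
  have inj: "inj_on h (carrier (homology X1))"
  proof (rule inj_onI)
    fix Q Q' assume Q: "Q \<in> carrier (homology X1)" "Q' \<in> carrier (homology X1)" and eq: "h Q = h Q'"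
    obtain x x' where x: "x \<in> cycles X1" "Q = homology_class X1 x" "x' \<in> cycles X1" "Q' = homology_class X1 x'"
      using Hcy Q by blast
    have xc: "x \<in> carrier X1" "x' \<in> carrier X1" using x D1.cyclesD by auto
    \<comment> \<open>The last conjunct forces the choice of zero wherever the coordinates agree,
      which keeps the chosen family finitely supported, as \<open>lift\<close> requires.\<close>
    have ex: "\<forall>v. \<exists>y. y \<in> carrier X0 \<and> ?pr v x = ?pr v x' \<oplus>\<^bsub>X0\<^esub> diff X0 y \<and> (?pr v x = ?pr v x' \<longrightarrow> y = \<zero>\<^bsub>X0\<^esub>)"
    proof (rule allI)
      fix v show "\<exists>y. y \<in> carrier X0 \<and> ?pr v x = ?pr v x' \<oplus>\<^bsub>X0\<^esub> diff X0 y \<and> (?pr v x = ?pr v x' \<longrightarrow> y = \<zero>\<^bsub>X0\<^esub>)"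
    proof (cases "?pr v x = ?pr v x'")
      case True
      then show ?thesis using prc[OF xc(2), of v] by (intro exI[of _ "\<zero>\<^bsub>X0\<^esub>"]) (simp del: twisted_simps)
    next
      case False
      have "\<theta> (homology_class X0 (?pr v x)) = \<theta> (homology_class X0 (?pr v x'))"
        using th[OF Q(1), of v] th[OF Q(2), of v] eq hv_class[OF xc(1), of v] hv_class[OF xc(2), of v] x by simp
      then have "homology_class X0 (?pr v x) = homology_class X0 (?pr v x')"
        by (intro \<theta>inj H0 prcy x)
      then show ?thesis using D0.homology_class_eq_iff[OF prc[OF xc(1)] prc[OF xc(2)]] False by blast
    qed
    qed
    from choice[OF ex] obtain f where F: "\<forall>v. f v \<in> carrier X0 \<and> ?pr v x = ?pr v x' \<oplus>\<^bsub>X0\<^esub> diff X0 (f v) \<and> (?pr v x = ?pr v x' \<longrightarrow> f v = \<zero>\<^bsub>X0\<^esub>)"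
      by (rule exE)
    note f = conjunct1[OF spec[OF F]] conjunct1[OF conjunct2[OF spec[OF F]]] mp[OF conjunct2[OF conjunct2[OF spec[OF F]]]]
    have "finite {v. f v \<noteq> \<zero>\<^bsub>X0\<^esub>}"
      by (rule finite_subset[OF _ finite_UnI[OF finv[OF xc(1)] finv[OF xc(2)]]]) (use f(3) in force)
    moreover have "f v = \<zero>\<^bsub>X0\<^esub>" if "v \<notin> E" for v
      using f(3)[of v] X1f(2)[OF xc(1) that] X1f(2)[OF xc(2) that] by simp
    ultimately have "\<exists>y\<in>carrier X1. \<forall>v. ?pr v y = f v" by (rule lift[of f, OF f(1)])
    then obtain y where y: "y \<in> carrier X1" "\<And>v. ?pr v y = f v" by blast
    have "x = x' \<oplus>\<^bsub>X1\<^esub> diff X1 y"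
    proof (intro ext)
      fix i v
      have "?pr v x i = (?pr v x' \<oplus>\<^bsub>X0\<^esub> ?pr v (diff X1 y)) i"
        unfolding pr_diff[OF y(1)] y(2) by (rule fun_cong[OF f(2)])
      then show "x i v = (x' \<oplus>\<^bsub>X1\<^esub> diff X1 y) i v" by simp
    qed
    then show "Q = Q'" using D1.homology_class_eqI[OF xc y(1)] x by simp
  qed
  have surj: "\<exists>Q\<in>carrier (homology X1). t = h Q" if t: "t \<in> carrier tp.T" for t
  proof -
    \<comment> \<open>Zero is chosen over zero coordinates for the same reason: only finitely many
      representatives may be nonzero.\<close>
    have ex: "\<forall>v. \<exists>y. y \<in> cycles X0 \<and> \<theta> (homology_class X0 y) = tb.tcoord v t \<and> (tb.tcoord v t = \<zero>\<^bsub>U\<^esub> \<longrightarrow> y = \<zero>\<^bsub>X0\<^esub>)"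
    proof (rule allI)
      fix v show "\<exists>y. y \<in> cycles X0 \<and> \<theta> (homology_class X0 y) = tb.tcoord v t \<and> (tb.tcoord v t = \<zero>\<^bsub>U\<^esub> \<longrightarrow> y = \<zero>\<^bsub>X0\<^esub>)"
    proof (cases "tb.tcoord v t = \<zero>\<^bsub>U\<^esub>")
      case True
      then show ?thesis using \<theta>0 D0.cycles_zero by (intro exI[of _ "\<zero>\<^bsub>X0\<^esub>"]) (simp only: simp_thms)
    next
      case False
      have "tb.tcoord v t \<in> carrier U" using ahom_closed[OF tb.tcoord_hom t] .
      then have "tb.tcoord v t \<in> \<theta> ` carrier (homology X0)" using \<theta>b(1) by (simp add: bij_betw_def)
      then obtain y where "y \<in> cycles X0" "tb.tcoord v t = \<theta> (homology_class X0 y)"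
        unfolding D0.carrier_homology by blast
      then show ?thesis using False by (intro exI[of _ y]) simp
    qed
    qed
    from choice[OF ex] obtain f where F: "\<forall>v. f v \<in> cycles X0 \<and> \<theta> (homology_class X0 (f v)) = tb.tcoord v t \<and> (tb.tcoord v t = \<zero>\<^bsub>U\<^esub> \<longrightarrow> f v = \<zero>\<^bsub>X0\<^esub>)"
      by (rule exE)
    note f = conjunct1[OF spec[OF F]] conjunct1[OF conjunct2[OF spec[OF F]]] mp[OF conjunct2[OF conjunct2[OF spec[OF F]]]]
    have fc: "f v \<in> carrier X0" for v using f(1) by (rule D0.cyclesD)
    have "finite {v. f v \<noteq> \<zero>\<^bsub>X0\<^esub>}"
      by (rule finite_subset[OF _ fsuppD(3)[OF tb.tcoord_fsupp[OF t]]]) (use f(3) in auto)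
    moreover have "f v = \<zero>\<^bsub>X0\<^esub>" if "v \<notin> E" for v using f(3) fsuppD(2)[OF tb.tcoord_fsupp[OF t] that] by blast
    ultimately have "\<exists>y\<in>carrier X1. \<forall>v. ?pr v y = f v" by (rule lift[of f, OF fc])
    then obtain y where y: "y \<in> carrier X1" "\<And>v. ?pr v y = f v" by blast
    have "diff X1 y = \<zero>\<^bsub>X1\<^esub>"
    proof (intro ext)
      fix i v
      have "?pr v (diff X1 y) = \<zero>\<^bsub>X0\<^esub>" using pr_diff[OF y(1), of v] y(2)[of v] D0.cyclesD(2)[OF f(1)[of v]] by simp
      then show "diff X1 y i v = \<zero>\<^bsub>X1\<^esub> i v" by (simp add: fun_eq_iff)
    qed
    then have yc: "y \<in> cycles X1" using y(1) by (simp add: cycles_def)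
    have Q: "homology_class X1 y \<in> carrier (homology X1)" using yc by (auto simp: D1.carrier_homology)
    have "t = h (homology_class X1 y)"
      by (rule tb.tcoord_eqI[OF t hc[OF Q]]) (simp add: th[OF Q] hv_class[OF y(1)] y(2) f(2))
    then show ?thesis using Q by blast
  qed
  have sm: "dg_module_morphism ?K V V (act V c)" if c: "c \<in> carrier K" for c
    unfolding dg_module_morphism_def
  proof (intro conjI ballI chain_mapI)
    show "act V c \<in> ahom V V" using VL.act_right[of c] c by simp
    show "act V c x \<in> gr V n" if "x \<in> gr V n" for n x using V.vs.scale_degree[OF c that] .
    show "act V c (diff V x) = diff V (act V c x)" if "x \<in> carrier V" for x
      using that c V.no_diff VL.act_zero_right[of c] V.vs.scale_closed[OF c that] by simp
    show "act V c (act V b x) = act V b (act V c x)" if "b \<in> carrier ?K" "x \<in> carrier V" for b x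
      using that c V.vs.scale_mult[of c b x] V.vs.scale_mult[of b c x] by (simp add: K.m_comm)
  qed
  \<comment> \<open>In \<open>tensor_space\<close> scalars act on the right factor; balancing moves
    them to the coordinate in \<open>U\<close>.\<close>
  have tlin: "tb.tcoord v (tensor_map ?K U V V (act V c) t) = act U c (tb.tcoord v t)"
    if c: "c \<in> carrier K" and t: "t \<in> carrier tp.T" for c v t
  proof -
    note tm = tensor_map[OF tp.tensor_pair_axioms tp.tensor_pair_axioms sm[OF c]]
    have uc: "act U c \<in> ahom U U" using UR.act_right[of c] c by simp
    show ?thesis
    proof (rule tp.T_hom_eq[OF ahom_comp[OF chain_mapD(1)[OF tm(1)] tb.tcoord_hom] ahom_comp[OF tb.tcoord_hom uc] _ t])
      fix l f assume lf: "l \<in> carrier U" "f \<in> carrier V"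
      have cfc: "b.cf f v \<in> carrier K" using b.coeffs_closed[OF lf(2)] by simp
      have "tp.pt l (act V c f) = tp.pt (act U c l) f" using tp.pt_act[of c l f] c lf by simp
      then show "tb.tcoord v (tensor_map ?K U V V (act V c) (tp.pt l f)) = act U c (tb.tcoord v (tp.pt l f))"
        using lf c cfc U.vs.scale_closed[OF c lf(1)] U.vs.scale_mult[of c "b.cf f v" l] U.vs.scale_mult[of "b.cf f v" c l]
        by (simp add: tm(2) tb.tcoord_pt K.m_comm)
    qed
  qed
  have sc1: "chain_map X1 X1 (s1 c)" "chain_map X0 X0 (s0 c)" if "c \<in> carrier K" for c
    using scalar_maps_s1 scalar_maps_s0 that by (auto simp: scalar_maps_def)
  have "giso K (hscal X1 s1) (tensor_space K U V) h"
  proof (rule gisoI)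
    show "graded_group (hscal X1 s1)" by (rule H1.graded_group_axioms)
    show "graded_group (tensor_space K U V)"
      using dg_group.axioms(1)[OF same_dg_group[OF same_dg_tensor_space tp.T_dg]] .
    show "bij_betw h (carrier (hscal X1 s1)) (carrier (tensor_space K U V))"
      unfolding bij_betw_def using inj surj hc by auto
    show "h \<in> ahom (hscal X1 s1) (tensor_space K U V)" using hh by (simp add: hom_def)
  next
    fix c Q assume c: "c \<in> carrier K" and "Q \<in> carrier (hscal X1 s1)"
    then have Q: "Q \<in> carrier (homology X1)" by simp
    obtain x where x: "x \<in> cycles X1" "Q = homology_class X1 x" using Hcy Q by blast
    have xc: "x \<in> carrier X1" using x(1) by (rule D1.cyclesD)
    have sx: "s1 c x \<in> carrier X1" using ahom_closed[OF chain_mapD(1)[OF sc1(1)[OF c]] xc] .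
    have cQ: "homology_map X1 X1 (s1 c) Q = homology_class X1 (s1 c x)"
      unfolding x by (rule homology_map_chain_map[OF X1.T_dg X1.T_dg sc1(1)[OF c] xc])
    have cQc: "homology_class X1 (s1 c x) \<in> carrier (homology X1)"
      using chain_map_cycles[OF X1.T_dg X1.T_dg sc1(1)[OF c] x(1)] by (auto simp: D1.carrier_homology)
    note tm = tensor_map[OF tp.tensor_pair_axioms tp.tensor_pair_axioms sm[OF c]]
    have "h (homology_class X1 (s1 c x)) = tensor_map ?K U V V (act V c) (h Q)"
    proof (rule tb.tcoord_eqI[OF hc[OF cQc]])
      show "tensor_map ?K U V V (act V c) (h Q) \<in> carrier tp.T" using ahom_closed[OF chain_mapD(1)[OF tm(1)] hc[OF Q]] .
      fix v
      have "hv v (homology_class X1 (s1 c x)) = \<theta> (homology_class X0 (s0 c (?pr v x)))"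
        using hv_class[OF sx, of v] by simp
      also have "homology_class X0 (s0 c (?pr v x)) = homology_map X0 X0 (s0 c) (homology_class X0 (?pr v x))"
        by (rule homology_map_chain_map[OF X0.T_dg X0.T_dg sc1(2)[OF c] prc[OF xc], symmetric])
      also have "\<theta> \<dots> = act U c (\<theta> (homology_class X0 (?pr v x)))"
        using \<theta>b(3)[OF c, of "homology_class X0 (?pr v x)"] H0[OF prcy[OF x(1)]] by simp
      finally show "tb.tcoord v (h (homology_class X1 (s1 c x))) = tb.tcoord v (tensor_map ?K U V V (act V c) (h Q))"
        using th[OF cQc, of v] tlin[OF c hc[OF Q], of v] th[OF Q, of v] hv_class[OF xc, of v] x(2) by simp
    qed
    then show "h (act (hscal X1 s1) c Q) = act (tensor_space K U V) c (h Q)" by (simp add: cQ)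
  next
    fix n Q assume "Q \<in> gr (hscal X1 s1) n"
    then have "Q \<in> gr (homology X1) n" by simp
    then obtain x where x: "x \<in> cycles X1" "x \<in> gr X1 n" "Q = homology_class X1 x" by (auto simp: D1.gr_homology)
    have xc: "x \<in> carrier X1" using x(1) by (rule D1.cyclesD)
    have Q: "Q \<in> carrier (homology X1)" using x by (auto simp: D1.carrier_homology)
    \<comment> \<open>The projection to copy \<open>v\<close> lowers degrees by \<open>dv v\<close>,
      and tensoring with \<open>v\<close> restores them.\<close>
    have hvg: "hv v Q \<in> gr U (n - dv v)" for v
    proof -
      have "x i \<in> gr P (n - wt i)" for i using x(2) by simp
      then have "x i v \<in> gr k (n - wt i - dv v)" for i by simp
      then have "x i v \<in> gr k (n - dv v - wt i)" for i by (simp add: algebra_simps)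
      then have "?pr v x \<in> gr X0 (n - dv v)" using prc[OF xc, of v] by simp
      then have "homology_class X0 (?pr v x) \<in> gr (homology X0) (n - dv v)" using prcy[OF x(1), of v] by (auto simp: D0.gr_homology)
      then show ?thesis using \<theta>b(4)[of "n - dv v"] hv_class[OF xc, of v] x(3) by auto
    qed
    have "h Q \<in> gr tp.T n" unfolding h_def fs_ext_def
    proof (rule T.gr_finsum[OF fsuppD(3)[OF hvs[OF Q]]])
      fix v assume "v \<in> {v. hv v Q \<noteq> \<zero>\<^bsub>U\<^esub>}"
      then have "v \<in> E" using fsuppD(2)[OF hvs[OF Q]] by auto
      then show "tp.pt (hv v Q) v \<in> gr tp.T n" using tp.pt_gr[OF hvg b.E_gr, of v v] by simp
    qed
    then show "h Q \<in> gr (tensor_space K U V) n" by simp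
  qed
  then show ?thesis by blast
qed

end

section \<open>Comparison of Tor with twisted sums\<close>

lemma qi_restrict: "qi M N f \<Longrightarrow> qi (restrict_scalars g M) (restrict_scalars g' N) f"
  using same_dg_qi(1)[OF same_dg_restrict[of M g]] same_dg_qi(2)[OF same_dg_restrict[of N g']] by blast

lemma (in twisting) twisted_giso:
  assumes M: "left_dg_module R M" and N: "left_dg_module R N" and f: "dg_module_morphism R M N f" "qi M N f"
    and s: "\<And>c. c \<in> carrier K \<Longrightarrow> dg_module_morphism R M M (s c)" and t: "\<And>c. c \<in> carrier K \<Longrightarrow> dg_module_morphism R N N (t c)"
    and st: "\<And>c x. c \<in> carrier K \<Longrightarrow> x \<in> carrier M \<Longrightarrow> f (s c x) = t c (f x)"
  shows "\<exists>h. giso K (hscal (twisted I wt a R M) (\<lambda>c x i. s c (x i))) (hscal (twisted I wt a R N) (\<lambda>c x i. t c (x i))) h"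
proof -
  interpret M: twisted_module R I wt a r M by (rule twisted_moduleI[OF M])
  interpret N: twisted_module R I wt a r N by (rule twisted_moduleI[OF N])
  have "giso K (hscal M.T (\<lambda>c x i. s c (x i))) (hscal N.T (\<lambda>c x i. t c (x i))) (homology_map M.T N.T (\<lambda>x i. f (x i)))"
  proof (rule qi_giso[OF M.T_dg N.T_dg twisted_qi[OF M N f]])
    show "chain_map M.T M.T (\<lambda>x i. s c (x i))" if "c \<in> carrier K" for c
      by (rule dg_module_morphismD(1)[OF twisted_map[OF M M s[OF that]]])
    show "chain_map N.T N.T (\<lambda>x i. t c (x i))" if "c \<in> carrier K" for c
      by (rule dg_module_morphismD(1)[OF twisted_map[OF N N t[OF that]]])
    show "(\<lambda>i. f (s c (x i))) = (\<lambda>i. t c (f (x i)))" if "c \<in> carrier K" "x \<in> carrier M.T" for c x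
      using that fsuppD(1)[of x I M] by (intro ext st) simp_all
  qed
  then show ?thesis by blast
qed

lemma giso_sym:
  assumes M: "dg_group M" and s: "\<And>c. c \<in> carrier K \<Longrightarrow> chain_map M M (s c)" and h: "\<exists>h. giso K (hscal M s) W h"
  shows "\<exists>h. giso K W (hscal M s) h"
proof -
  interpret M: dg_group M by (rule M)
  interpret H: dg_group "hscal M s" by (rule dg_group_hscal[OF M])
  obtain h where "giso K (hscal M s) W h" using h by blast
  moreover have "act (hscal M s) c v \<in> carrier (hscal M s)" if c: "c \<in> carrier K" and "v \<in> carrier (hscal M s)" for c v
  proof -
    obtain x where x: "x \<in> cycles M" "v = homology_class M x" using \<open>v \<in> _\<close> by (auto simp: M.carrier_homology)
    then show ?thesis
      using homology_map_chain_map[OF M M s[OF c] M.cyclesD(1)[OF x(1)]] chain_map_cycles[OF M M s[OF c] x(1)]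
      by (auto simp: M.carrier_homology)
  qed
  ultimately show ?thesis using giso_inv[OF _ H.graded_group_axioms] by blast
qed

lemma giso_trans: "\<exists>h. giso K U V h \<Longrightarrow> \<exists>h. giso K V W h \<Longrightarrow> \<exists>h. giso K U W h"
  using giso_comp by blast

text \<open>T \<otimes> M over A, with T the universal resolution of \<open>N\<close> over
  \<open>A\<close>.\<close>

abbreviation cell_sum :: "'r dg \<Rightarrow> ('r, 'n) dgmod \<Rightarrow> ('r, 'm) dgmod \<Rightarrow> ('r, ('r, 'n) cell \<Rightarrow> 'm) dgmod" where
  "cell_sum A N M \<equiv> twisted (cells A N) cell_deg (cell_coeff A) A M"

locale resolution = augmented K B \<delta>
  for K :: "'k ring" and B :: "'b dg" and \<delta> :: "'b \<Rightarrow> 'k" +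
  fixes F :: "('b, 'f) dgmod" and \<pi> :: "'f \<Rightarrow> 'k"
  assumes res: "semifree_resolution B k F \<pi>"
begin

lemma F_module: "left_dg_module B F"
  and semibasis_ex: "\<exists>E r. semibasis B F E r"
  and \<pi>_morphism: "dg_module_morphism B F k \<pi>"
  using res by (auto simp: semifree_resolution_def semifree_def)

sublocale F: left_dg_module B F by (rule F_module)
sublocale k: left_dg_module B k by (rule k_module)

lemma \<pi>_qi: "qi F k \<pi>"
  using res by (intro quasi_isomorphism_qi F.M.dg_group_axioms k.M.dg_group_axioms) (simp add: semifree_resolution_def)

abbreviation "\<phi> \<equiv> scalar_lift K B F \<pi>"

lemma \<phi>_spec: "c \<in> carrier K \<Longrightarrow> dg_module_morphism B F F (\<phi> c) \<and> (\<forall>x\<in>carrier F. \<pi> (\<phi> c x) = c \<otimes>\<^bsub>K\<^esub> \<pi> x)"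
  unfolding scalar_lift_def
  by (rule someI_ex[OF scalar_lift_exists[OF K.field_axioms R.dg_ring_axioms \<delta> res]])

lemmas \<phi>_morphism = conjunct1[OF \<phi>_spec] and \<phi>_\<pi> = bspec[OF conjunct2[OF \<phi>_spec]]

abbreviation "BF \<equiv> ltensor B B id F"
abbreviation "t c \<equiv> tensor_map B (restrict_scalars id (right_regular B)) F F (\<phi> c)"
abbreviation "\<mu> x \<equiv> \<pi> (unit_map B F x)"

sublocale BF: left_dg_module B BF
  by (rule scalar_extension.ltensor_module[OF scalar_extension_id[OF F_module]])

lemma t_morphism: "c \<in> carrier K \<Longrightarrow> dg_module_morphism B BF BF (t c)"
  by (rule tensor_map_ltensor[OF scalar_extension_id[OF F_module] \<phi>_morphism])

lemma \<mu>_morphism: "dg_module_morphism B BF k \<mu>"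
  by (rule dg_module_morphism_comp[OF unit_map(1)[OF F_module] \<pi>_morphism])

lemma \<mu>_qi: "qi BF k \<mu>"
  by (rule qi_bij_comp[OF BF.M.dg_group_axioms F.M.dg_group_axioms dg_module_morphismD(1)[OF unit_map(1)[OF F_module]]
        unit_map(2)[OF F_module] \<pi>_qi])

lemma \<mu>_scalar: "c \<in> carrier K \<Longrightarrow> x \<in> carrier BF \<Longrightarrow> \<mu> (t c x) = c \<otimes>\<^bsub>K\<^esub> \<mu> x"
  using unit_map(3)[OF F_module \<phi>_morphism, of c x] \<phi>_\<pi>[of c "unit_map B F x"]
    ahom_closed[OF chain_mapD(1)[OF dg_module_morphismD(1)[OF unit_map(1)[OF F_module]]], of x]
  by (simp del: ltensor_simps)

lemma Tor_hscal: "Tor K B L F \<pi> = hscal (tensor B L F) (\<lambda>c. tensor_map B L F F (\<phi> c))"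
  by (simp add: Tor_def hscal_def)

lemma k_scalar: "c \<in> carrier K \<Longrightarrow> dg_module_morphism B k k (\<lambda>x. c \<otimes>\<^bsub>K\<^esub> x)"
  using module_scalars_k by (simp add: module_scalars_def)

text \<open>T resolves \<open>N\<close> over \<open>A\<close>, and T \<otimes> S is quasi-isomorphic
  to \<open>N\<close> because \<gamma> is a quasi-isomorphism. Tensoring with the semifree module
  \<open>F\<close> over B compares T \<otimes> (S \<otimes> F) with N \<otimes> F, compatibly with
  the lifts of scalars.\<close>

lemma cell_Tor:
  fixes A :: "'a dg" and S :: "'s dg" and N :: "('s, 'n) dgmod"
  assumes A: "gc_dg_ring A" and S: "dg_ring S" and N: "right_dg_module S N" and \<gamma>: "dg_ring_morphism A S \<gamma>" and q: "qi A S \<gamma>"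
    and \<beta>: "dg_ring_morphism B S \<beta>"
  shows "\<exists>h. giso K (hscal (cell_sum A (restrict_scalars \<gamma> N) (restrict_scalars \<gamma> (ltensor S B \<beta> F)))
      (\<lambda>c x i. tensor_map B (restrict_scalars \<beta> (right_regular S)) F F (\<phi> c) (x i)))
    (Tor K B (restrict_scalars \<beta> N) F \<pi>) h"
proof -
  interpret tm: twisted_map A "cells A (restrict_scalars \<gamma> N)" cell_deg "cell_coeff A" cell_rel S N \<gamma> cell_val
    by (rule twisted_map_cells[OF A S N \<gamma>])
  have se: "scalar_extension S B F \<beta>"
    by (intro scalar_extension.intro scalar_extension_axioms.intro S F_module \<beta>)
  interpret tt: twisted_tensor A "cells A (restrict_scalars \<gamma> N)" cell_deg "cell_coeff A" cell_rel S N \<gamma> cell_val B F \<beta>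
    by (intro twisted_tensor.intro se tm.twisted_map_axioms)
  obtain E r where sb: "semibasis B F E r" using semibasis_ex by blast
  have q: "qi tt.SF.T tt.Q.T tt.\<Theta>"
    by (rule tt.\<Theta>_qi[OF sb]) (use cells_qi[OF A S N \<gamma> q] in \<open>simp add: tm.\<Lambda>_def\<close>)
  have "giso K (hscal tt.SF.T (\<lambda>c x i. tensor_map B (restrict_scalars \<beta> (right_regular S)) F F (\<phi> c) (x i)))
    (hscal tt.Q.T (\<lambda>c. tensor_map B (restrict_scalars \<beta> N) F F (\<phi> c))) (homology_map tt.SF.T tt.Q.T tt.\<Theta>)"
  proof (rule qi_giso[OF tt.SF.T_dg tt.Q.T_dg q])
    show "chain_map tt.SF.T tt.SF.T (\<lambda>x i. tensor_map B (restrict_scalars \<beta> (right_regular S)) F F (\<phi> c) (x i))"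
      if "c \<in> carrier K" for c
      by (rule dg_module_morphismD(1)[OF tm.twisted_map[OF tt.SF_module tt.SF_module
              restrict_morphism[OF \<gamma> tensor_map_ltensor[OF se \<phi>_morphism[OF that]]]]])
    show "chain_map tt.Q.T tt.Q.T (tensor_map B (restrict_scalars \<beta> N) F F (\<phi> c))" if "c \<in> carrier K" for c
      by (rule tensor_map(1)[OF tt.Q.tensor_pair_axioms tt.Q.tensor_pair_axioms \<phi>_morphism[OF that]])
  qed (rule tt.\<Theta>_scalar[OF \<phi>_morphism])
  then show ?thesis unfolding Tor_hscal by blast
qed

text \<open>When S is B, the module S \<otimes> F is quasi-isomorphic to \<open>k\<close> by a
  B-linear map. So \<open>F\<close> can be traded for \<open>k\<close>, and the lifts for genuine
  multiplication by scalars.\<close>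

lemma cell_Tor_k:
  fixes A :: "'a dg" and N :: "('b, 'n) dgmod"
  assumes A: "gc_dg_ring A" and N: "right_dg_module B N" and \<gamma>: "dg_ring_morphism A B \<gamma>" and q: "qi A B \<gamma>"
  shows "\<exists>h. giso K (hscal (cell_sum A (restrict_scalars \<gamma> N) (restrict_scalars \<gamma> k)) (\<lambda>c x i. c \<otimes>\<^bsub>K\<^esub> x i)) (Tor K B N F \<pi>) h"
proof -
  interpret A: gc_dg_ring A by (rule A)
  interpret tw: twisting A "cells A (restrict_scalars \<gamma> N)" cell_deg "cell_coeff A" cell_rel by (rule twisting_cells[OF A])
  note res_t = restrict_morphism[OF \<gamma> t_morphism] and res_k = restrict_morphism[OF \<gamma> k_scalar]
  note mBF = left_restrict[OF A.dg_ring_axioms \<gamma> BF.left_dg_module_axioms]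
  interpret T: twisted_module A "cells A (restrict_scalars \<gamma> N)" cell_deg "cell_coeff A" cell_rel "restrict_scalars \<gamma> BF"
    by (rule tw.twisted_moduleI[OF mBF])
  have 1: "\<exists>h. giso K (hscal T.T (\<lambda>c x i. t c (x i)))
      (hscal (cell_sum A (restrict_scalars \<gamma> N) (restrict_scalars \<gamma> k)) (\<lambda>c x i. c \<otimes>\<^bsub>K\<^esub> x i)) h"
    by (rule tw.twisted_giso[OF mBF left_restrict[OF A.dg_ring_axioms \<gamma> k_module] restrict_morphism[OF \<gamma> \<mu>_morphism] qi_restrict[OF \<mu>_qi] res_t res_k])
      (simp_all add: \<mu>_scalar)
  have 2: "chain_map T.T T.T (\<lambda>x i. t c (x i))" if "c \<in> carrier K" for c
    by (rule dg_module_morphismD(1)[OF tw.twisted_map[OF mBF mBF res_t[OF that]]])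
  have "\<exists>h. giso K (hscal T.T (\<lambda>c x i. t c (x i))) (Tor K B (restrict_scalars id N) F \<pi>) h"
    by (rule cell_Tor[OF A R.dg_ring_axioms N \<gamma> q dg_ring_morphism_id])
  then show ?thesis
    using giso_trans[OF giso_sym[OF T.T_dg 2 1]] by (simp add: restrict_scalars_id)
qed

text \<open>
  Graded commutativity of \<open>C\<close> makes the comparison map linear over \<open>B\<close>: the action of \<open>b\<close> on a cell
  of odd degree involves \<open>signed B b\<close>.
\<close>

lemma base_change:
  fixes C :: "'c dg"
  assumes B: "gc_dg_ring B" and C: "gc_dg_ring C" and \<beta>: "dg_ring_morphism B C \<beta>"
  defines "CB \<equiv> restrict_scalars \<beta> (right_regular C)"
  shows "\<exists>f. dg_module_morphism B (cell_sum B CB BF) (restrict_scalars \<beta> (ltensor C B \<beta> F)) f \<and>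
    qi (cell_sum B CB BF) (restrict_scalars \<beta> (ltensor C B \<beta> F)) f \<and>
    (\<forall>c\<in>carrier K. \<forall>x\<in>carrier (cell_sum B CB BF). f (\<lambda>i. t c (x i)) = tensor_map B CB F F (\<phi> c) (f x))"
proof -
  interpret B: gc_dg_ring B by (rule B)
  interpret C: gc_dg_ring C by (rule C)
  have CB: "right_dg_module B CB"
    unfolding CB_def by (rule right_restrict[OF R.dg_ring_axioms \<beta> right_regular[OF C.dg_ring_axioms]])
  have idm: "dg_ring_morphism B B id" by (rule dg_ring_morphism_id)
  interpret tm: twisted_map B "cells B CB" cell_deg "cell_coeff B" cell_rel B CB id cell_val
    using twisted_map_cells[OF B R.dg_ring_axioms CB idm] by (simp add: restrict_scalars_id)
  interpret tt: twisted_tensor B "cells B CB" cell_deg "cell_coeff B" cell_rel B CB id cell_val B F id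
    by (intro twisted_tensor.intro tm.twisted_map_axioms scalar_extension_id[OF F_module])
  interpret ce: scalar_extension C B F \<beta>
    by (intro scalar_extension.intro scalar_extension_axioms.intro C.dg_ring_axioms F_module \<beta>)
  have SF: "tt.SF = BF" and NB: "tt.NB = CB" by (simp_all add: restrict_scalars_id)
  \<comment> \<open>\<open>CB\<close> has two roles: it is the module resolved over B and the left
    factor of C \<otimes> F over B. Hence the target of \<Theta> is C \<otimes> F.\<close>
  have Q: "tt.Q.T = ce.P.T" by (simp add: NB) (simp add: CB_def)
  obtain E r where sb: "semibasis B F E r" using semibasis_ex by blast
  have qL: "qi tm.SR.T CB tm.\<Lambda>"
    using cells_qi_regular[OF B CB] by (simp add: tm.\<Lambda>_def restrict_scalars_id)
  have q: "qi tt.SF.T tt.Q.T tt.\<Theta>" by (rule tt.\<Theta>_qi[OF sb qL])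
  let ?M = "restrict_scalars \<beta> (ltensor C B \<beta> F)"
  have s: "same_dg tt.Q.T ?M" unfolding Q by (simp add: same_dg_def)
  have lin: "tt.\<Theta> (act tt.SF.T b x) = act ?M b (tt.\<Theta> x)" if b: "b \<in> carrier B" and x: "x \<in> carrier tt.SF.T" for b x
  proof -
    interpret T: left_dg_module B tt.SF.T by (rule tt.SF.T_left_dg_module)
    interpret M: left_dg_module B ?M by (rule left_restrict[OF R.dg_ring_axioms \<beta> ce.ltensor_module])
    have TA: "tt.\<Theta> \<in> ahom tt.SF.T ?M"
      using chain_mapD(1)[OF iffD1[OF same_dg_chain_map(2)[OF s] tt.\<Theta>_chain_map]] .
    have th: "tt.theta j \<in> ahom tt.SF ?M" if "j \<in> cells B CB" for j
      using tt.theta_hom[OF that] Q by (simp add: hom_def)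
    have pure: "tt.\<Theta> (act tt.SF.T b (delta tt.SF j (tt.E.P.pt b' f))) = act ?M b (tt.\<Theta> (delta tt.SF j (tt.E.P.pt b' f)))"
      if b: "b \<in> gr B n" and j: "j \<in> cells B CB" and b': "b' \<in> carrier B" and f: "f \<in> carrier F" for b n j b' f
    proof -
      let ?sb = "if even (cell_deg j) then b else signed B b"
      have bc: "b \<in> carrier B" "?sb \<in> carrier B" using R.gr_closed[OF b] by auto
      have v: "cell_val j \<in> gr C (cell_deg j)" using tm.v_gr[OF j] by (simp add: CB_def)
      note vc = C.gr_closed[OF v] and \<beta>c = dg_ring_morphismD(6)[OF \<beta>]
      have \<beta>m: "\<beta> (x \<otimes>\<^bsub>B\<^esub> y) = \<beta> x \<otimes>\<^bsub>C\<^esub> \<beta> y" if "x \<in> carrier B" "y \<in> carrier B" for x y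
        using dg_ring_morphismD(4)[OF \<beta>] that by simp
      have \<beta>n: "\<beta> (\<ominus>\<^bsub>B\<^esub> b) = \<ominus>\<^bsub>C\<^esub> \<beta> b"
        using ahom_neg[OF R.abelian_group_axioms C.abelian_group_axioms _ bc(1), of \<beta>] dg_ring_morphismD(1)[OF \<beta>] by simp
      have key: "cell_val j \<otimes>\<^bsub>C\<^esub> \<beta> ?sb = \<beta> b \<otimes>\<^bsub>C\<^esub> cell_val j"
        using C.graded_commute[OF v dg_ring_morphismD(2)[OF \<beta> b]] vc \<beta>c[OF bc(1)] R.signed_homogeneous[OF b]
        by (auto simp: koszul_def \<beta>n C.r_minus)
      have tS: "tt.E.P.pt b' f \<in> carrier tt.E.P.T" using tt.E.P.pt_closed b' f by simp
      have "act tt.SF.T b (delta tt.SF j (tt.E.P.pt b' f)) = delta tt.SF j (tt.E.P.pt (?sb \<otimes>\<^bsub>B\<^esub> b') f)"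
        using tt.SF.act_T_delta[OF bc(1)] tt.E.act_pt[OF bc(2) b' f] by (simp del: twisted_simps ltensor_simps)
      then have "tt.\<Theta> (act tt.SF.T b (delta tt.SF j (tt.E.P.pt b' f))) = tt.theta j (tt.E.P.pt (?sb \<otimes>\<^bsub>B\<^esub> b') f)"
        using tt.\<Theta>_delta[OF j] tt.E.P.pt_closed[of "?sb \<otimes>\<^bsub>B\<^esub> b'" f] bc b' f by simp
      also have "\<dots> = ce.P.pt (cell_val j \<otimes>\<^bsub>C\<^esub> \<beta> (?sb \<otimes>\<^bsub>B\<^esub> b')) f"
        using tt.theta_pt[OF j _ f, of "?sb \<otimes>\<^bsub>B\<^esub> b'"] bc b' by (simp add: restrict_scalars_id CB_def)
      also have "cell_val j \<otimes>\<^bsub>C\<^esub> \<beta> (?sb \<otimes>\<^bsub>B\<^esub> b') = \<beta> b \<otimes>\<^bsub>C\<^esub> (cell_val j \<otimes>\<^bsub>C\<^esub> \<beta> b')"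
        unfolding \<beta>m[OF bc(2) b'] using key vc \<beta>c bc b' by (simp only: C.m_assoc[symmetric])
      also have "ce.P.pt \<dots> f = act ?M b (ce.P.pt (cell_val j \<otimes>\<^bsub>C\<^esub> \<beta> b') f)"
        using ce.act_pt[OF \<beta>c[OF bc(1)] C.m_closed[OF vc \<beta>c[OF b']] f] by (simp del: ltensor_simps)
      also have "ce.P.pt (cell_val j \<otimes>\<^bsub>C\<^esub> \<beta> b') f = tt.theta j (tt.E.P.pt b' f)"
        using tt.theta_pt[OF j b' f] by (simp add: restrict_scalars_id CB_def)
      also have "\<dots> = tt.\<Theta> (delta tt.SF j (tt.E.P.pt b' f))" using tt.\<Theta>_delta[OF j tS] by simp
      finally show ?thesis .
    qed
    have hom: "tt.\<Theta> (act tt.SF.T b x) = act ?M b (tt.\<Theta> x)" if b: "b \<in> gr B n" and x: "x \<in> fsupp (cells B CB) tt.SF" for b n x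
    proof -
      have bc: "b \<in> carrier B" by (rule R.gr_closed[OF b])
      have h1: "(\<lambda>x. tt.\<Theta> (act tt.SF.T b x)) \<in> ahom tt.SF.T ?M" by (rule ahom_comp[OF T.act_right[OF bc] TA])
      have h2: "(\<lambda>x. act ?M b (tt.\<Theta> x)) \<in> ahom tt.SF.T ?M" by (rule ahom_comp[OF TA M.act_right[OF bc]])
      note ag = T.M.abelian_group_axioms M.M.abelian_group_axioms
      show ?thesis using x
      proof (induction x rule: tt.SF.M.fsupp_induct)
        case zero
        show ?case using ahom_zero[OF ag h1] ahom_zero[OF ag h2] by (simp only: twisted_simps(2))
      next
        case (delta j m)
        note d = tt.SF.delta_ahom[OF delta(1)]
        have d': "delta tt.SF j \<in> ahom tt.E.P.T tt.SF.T" using d by (simp add: hom_def)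
        show ?case
          by (rule tt.E.P.T_hom_eq[OF ahom_comp[OF d' h1] ahom_comp[OF d' h2] pure[OF b delta(1)]]) (use delta(2) in simp_all)
      next
        case (add x y)
        then show ?case using ahom_add[OF h1, of x y] ahom_add[OF h2, of x y] by (simp only: twisted_simps(1,3))
      qed
    qed
    show ?thesis using b
    proof (induction b rule: R.graded_induct)
      case (homogeneous n b)
      then show ?case using hom[OF homogeneous] x by (simp only: twisted_simps(1))
    next
      case (add b c)
      note Tx = ahom_closed[OF TA x]
      have "tt.\<Theta> (act tt.SF.T (b \<oplus>\<^bsub>B\<^esub> c) x) = tt.\<Theta> (act tt.SF.T b x) \<oplus>\<^bsub>?M\<^esub> tt.\<Theta> (act tt.SF.T c x)"
        unfolding T.act_add_left[OF add(1,2) x] by (rule ahom_add[OF TA T.act_closed[OF add(1) x] T.act_closed[OF add(2) x]])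
      then show ?case unfolding add(3,4) M.act_add_left[OF add(1,2) Tx] .
    qed
  qed
  show ?thesis
  proof (intro exI conjI ballI)
    show "dg_module_morphism B (cell_sum B CB BF) ?M tt.\<Theta>"
      unfolding dg_module_morphism_def
      using iffD1[OF same_dg_chain_map(2)[OF s] tt.\<Theta>_chain_map] lin unfolding SF by (intro conjI ballI)
    show "qi (cell_sum B CB BF) ?M tt.\<Theta>"
      using iffD1[OF same_dg_qi(2)[OF s] q] by (simp only: SF)
    show "tt.\<Theta> (\<lambda>i. t c (x i)) = tensor_map B CB F F (\<phi> c) (tt.\<Theta> x)" if "c \<in> carrier K" "x \<in> carrier (cell_sum B CB BF)" for c x
      using tt.\<Theta>_scalar[OF \<phi>_morphism[OF that(1)], of x] that(2) by (simp only: SF NB)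
  qed
qed

end

lemma qi_id: "dg_group M \<Longrightarrow> qi M M id"
proof (rule qiI)
  assume M: "dg_group M"
  interpret M: dg_group M by (rule M)
  show "chain_map M M id" by (intro chain_mapI ahomI) simp_all
  show "\<exists>y'\<in>carrier M. \<exists>x'\<in>carrier M. diff M y' = y \<and> id y' = x \<oplus>\<^bsub>M\<^esub> diff M x'"
    if "x \<in> carrier M" "id y = diff M x" for y x
    using that by (intro bexI[of _ x] bexI[of _ "\<zero>\<^bsub>M\<^esub>"]) simp_all
qed

lemma hscal_restrict: "hscal (restrict_scalars g M) s = hscal M s"
proof -
  have "set_add (restrict_scalars g M) = set_add M" by (intro ext) (simp add: set_add_def set_mult_def)
  moreover have hc: "homology_class (restrict_scalars g M) = homology_class M"
    by (intro ext) (simp add: homology_class_def boundaries_def a_r_coset_def r_coset_def)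
  moreover have "homology_map (restrict_scalars g M) (restrict_scalars g M) f = homology_map M M f" for f
    by (intro ext) (simp add: homology_map_def hc)
  ultimately show ?thesis
    by (simp add: hscal_def homology_def cycles_def boundaries_def)
qed

lemma (in resolution) Tor_dg_group: "right_dg_module B L \<Longrightarrow> dg_group (Tor K B L F \<pi>)"
  unfolding Tor_hscal by (intro dg_group_hscal tensor_pair.T_dg tensor_pair.intro F_module)

lemma (in resolution) Tor_zero_graded:
  assumes L: "right_dg_module B L" and M: "dg_group M" "scalar_maps K M s" and h: "giso K (hscal M s) (Tor K B L F \<pi>) h"
  shows "zero_graded K (Tor K B L F \<pi>)"
proof -
  have "graded_vector_space K (Tor K B L F \<pi>)"
    by (rule giso_vector_space[OF h hscal_vector_space[OF K.field_axioms M] dg_group.axioms(1)[OF Tor_dg_group[OF L]]])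
  then show ?thesis
    unfolding Tor_hscal
    by (intro zero_graded_hscal K.field_axioms tensor_pair.T_dg tensor_pair.intro L F_module)
qed

theorem theorem1p5:
  fixes A :: "'a dg" and B :: "'b dg" and C :: "'c dg" and K :: "'k ring"
    and L :: "('c, 'l) dgmod"
    and F :: "('b, 'f) dgmod" and F' :: "('b, 'g) dgmod" and G :: "('c, 'h) dgmod"
    and \<alpha> :: "'a \<Rightarrow> 'b" and \<beta> :: "'b \<Rightarrow> 'c" and \<epsilon> :: "'c \<Rightarrow> 'k"
    and \<pi> :: "'f \<Rightarrow> 'k" and \<pi>' :: "'g \<Rightarrow> 'k" and \<rho> :: "'h \<Rightarrow> 'k"
  assumes "field K" and "gc_dg_ring B" and "gc_dg_ring C"
    and "dg_ring_morphism B C \<beta>" and "dg_ring_morphism C (concentrated K) \<epsilon>"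
    and "right_dg_module C L"
    and "gc_dg_ring A" and "dg_ring_morphism A B \<alpha>" and "quasi_isomorphism A C (\<beta> \<circ> \<alpha>)"
    and "semifree_resolution B (restrict_scalars (\<epsilon> \<circ> \<beta>) (left_regular (concentrated K))) F \<pi>"
    and "semifree_resolution C (restrict_scalars \<epsilon> (left_regular (concentrated K))) G \<rho>"
    and "semifree_resolution B (restrict_scalars (\<epsilon> \<circ> \<beta>) (left_regular (concentrated K))) F' \<pi>'"
  shows "\<exists>h. graded_vector_space_iso K
    (Tor K B (restrict_scalars \<beta> L) F \<pi>)
    (tensor_space K
      (Tor K C L G \<rho>)
      (Tor K B (restrict_scalars \<beta> (right_regular C)) F' \<pi>')) h"
proof -
  note K = assms(1) and B = assms(2) and C = assms(3) and \<beta> = assms(4) and \<epsilon> = assms(5) and L = assms(6)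
    and A = assms(7) and \<alpha> = assms(8)
  define \<gamma> where "\<gamma> = \<beta> \<circ> \<alpha>"
  note dA = gc_dg_ring.axioms(1)[OF A] and dB = gc_dg_ring.axioms(1)[OF B] and dC = gc_dg_ring.axioms(1)[OF C]
  have \<gamma>: "dg_ring_morphism A C \<gamma>" unfolding \<gamma>_def by (rule dg_ring_morphism_comp[OF \<alpha> \<beta>])
  note \<epsilon>\<beta> = dg_ring_morphism_comp[OF \<beta> \<epsilon>] and \<epsilon>\<gamma> = dg_ring_morphism_comp[OF \<gamma> \<epsilon>]
  interpret rF: resolution K B "\<epsilon> \<circ> \<beta>" F \<pi>
    by (intro resolution.intro augmented.intro augmented_axioms.intro resolution_axioms.intro K dB \<epsilon>\<beta> assms(10))
  interpret rG: resolution K C \<epsilon> G \<rho>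
    by (intro resolution.intro augmented.intro augmented_axioms.intro resolution_axioms.intro K dC \<epsilon> assms(11))
  interpret rF': resolution K B "\<epsilon> \<circ> \<beta>" F' \<pi>'
    by (intro resolution.intro augmented.intro augmented_axioms.intro resolution_axioms.intro K dB \<epsilon>\<beta> assms(12))
  interpret kA: augmented K A "\<epsilon> \<circ> \<gamma>"
    by (intro augmented.intro augmented_axioms.intro K dA \<epsilon>\<gamma>)
  have kC: "restrict_scalars \<gamma> rG.k = kA.k" and restrict_\<gamma>: "\<And>M. restrict_scalars \<alpha> (restrict_scalars \<beta> M) = restrict_scalars \<gamma> M"
    by (simp_all add: restrict_scalars_comp \<gamma>_def)
  have q\<gamma>: "qi A C \<gamma>"
    using quasi_isomorphism_qi[OF dg_ring.axioms(2)[OF dA] dg_ring.axioms(2)[OF dC] assms(9)] by (simp add: \<gamma>_def)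

  \<comment> \<open>\<open>?TA M\<close> is T \<otimes> M over A with T resolving \<open>L\<close>,
    and \<open>?TB M\<close> is D \<otimes> M over B with D resolving \<open>C\<close>.\<close>
  let ?I = "cells A (restrict_scalars \<gamma> L)"
  let ?TA = "\<lambda>M. twisted ?I cell_deg (cell_coeff A) A M"
  let ?CB = "restrict_scalars \<beta> (right_regular C)"
  let ?TB = "\<lambda>M. cell_sum B ?CB M"
  have CB: "right_dg_module B ?CB" by (rule right_restrict[OF dB \<beta> right_regular[OF dC]])
  interpret twA: twisting A ?I cell_deg "cell_coeff A" cell_rel by (rule twisting_cells[OF A])
  interpret twB: twisting B "cells B ?CB" cell_deg "cell_coeff B" cell_rel by (rule twisting_cells[OF B])
  interpret X0: twisted_module A ?I cell_deg "cell_coeff A" cell_rel kA.k by (rule twA.twisted_moduleI[OF kA.k_module])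
  interpret W: twisted_module B "cells B ?CB" cell_deg "cell_coeff B" cell_rel rF.k by (rule twB.twisted_moduleI[OF rF.k_module])
  interpret BF: twisted_module B "cells B ?CB" cell_deg "cell_coeff B" cell_rel rF.BF
    by (rule twB.twisted_moduleI[OF rF.BF.left_dg_module_axioms])

  let ?U = "Tor K C L G \<rho>" and ?V = "Tor K B ?CB F' \<pi>'"
  obtain \<theta> where \<theta>: "giso K (hscal X0.T (\<lambda>c x i. c \<otimes>\<^bsub>K\<^esub> x i)) ?U \<theta>"
    using rG.cell_Tor_k[OF A L \<gamma> q\<gamma>] unfolding kC by blast
  \<comment> \<open>The comparison is applied to the identity of B: D \<otimes> k computes
    \<open>?V\<close>. This complex mentions neither \<open>F\<close> nor \<open>F'\<close>, which
    lets the two resolutions meet in it.\<close>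
  obtain \<psi> where \<psi>: "giso K (hscal W.T (\<lambda>c x i. c \<otimes>\<^bsub>K\<^esub> x i)) ?V \<psi>"
    using rF'.cell_Tor_k[OF B CB dg_ring_morphism_id qi_id[OF dg_ring.axioms(2)[OF dB]]] unfolding restrict_scalars_id by blast
  have s0: "module_scalars K A X0.T (\<lambda>c x i. c \<otimes>\<^bsub>K\<^esub> x i)"
    by (rule twA.module_scalars_twisted[OF kA.k_module kA.module_scalars_k])
  have sW: "module_scalars K B W.T (\<lambda>c x i. c \<otimes>\<^bsub>K\<^esub> x i)"
    by (rule twB.module_scalars_twisted[OF rF.k_module rF.module_scalars_k])
  \<comment> \<open>The two \<open>Tor\<close> spaces are vector spaces by comparison with complexes
    on which \<open>K\<close> acts strictly.\<close>
  have U: "zero_graded K ?U"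
    by (rule rG.Tor_zero_graded[OF L X0.T_dg _ \<theta>]) (use s0 in \<open>simp add: module_scalars_def\<close>)
  have V: "zero_graded K ?V"
    by (rule rF'.Tor_zero_graded[OF CB W.T_dg _ \<psi>]) (use sW in \<open>simp add: module_scalars_def\<close>)
  obtain E where E: "graded_basis (concentrated K) ?V E"
    using graded_basis_exists[OF K zero_graded.left[OF V]] by blast
  interpret cp: copies K A "\<epsilon> \<circ> \<gamma>" ?V E
    by (intro copies.intro copies_axioms.intro kA.augmented_axioms A V E)
  interpret ku: kunneth K A "\<epsilon> \<circ> \<gamma>" ?V E ?I cell_deg "cell_coeff A" cell_rel ?U
    by (intro kunneth.intro cp.copies_axioms twA.twisting_axioms U)
  have kunneth: "\<exists>h. giso K (hscal ku.X1 ku.s1) (tensor_space K ?U ?V) h" by (rule ku.kunneth[OF \<theta>])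

  let ?W = "restrict_scalars \<alpha> W.T" and ?BF = "restrict_scalars \<alpha> BF.T"
  let ?CF = "restrict_scalars \<gamma> (ltensor C B \<beta> F)"
  have W: "left_dg_module A ?W" by (rule left_restrict[OF dA \<alpha> W.T_left_dg_module])
  have BF: "left_dg_module A ?BF" by (rule left_restrict[OF dA \<alpha> BF.T_left_dg_module])
  have se: "scalar_extension C B F \<beta>"
    by (intro scalar_extension.intro scalar_extension_axioms.intro dC \<beta> rF.F_module)
  have CF: "left_dg_module A ?CF" by (rule left_restrict[OF dA \<gamma> scalar_extension.ltensor_module[OF se]])
  have sAW: "module_scalars K A ?W (\<lambda>c x i. c \<otimes>\<^bsub>K\<^esub> x i)" by (rule module_scalars_restrict[OF \<alpha> sW])
  have sBF: "dg_module_morphism A ?BF ?BF (\<lambda>x i. rF.t c (x i))" if "c \<in> carrier K" for c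
    by (rule restrict_morphism[OF \<alpha> twB.twisted_map[OF rF.BF.left_dg_module_axioms rF.BF.left_dg_module_axioms rF.t_morphism[OF that]]])
  have sCF: "dg_module_morphism A ?CF ?CF (tensor_map B ?CB F F (rF.\<phi> c))" if "c \<in> carrier K" for c
    by (rule restrict_morphism[OF \<gamma> tensor_map_ltensor[OF se rF.\<phi>_morphism[OF that]]])
  \<comment> \<open>B acts on D \<otimes> k through \<open>k\<close>, the signs having disappeared,
    so A does too; \<open>basis_qi\<close> then yields an A-linear map from \<open>V\<close> in the
    form of \<open>cp.P\<close>.\<close>
  have act_W: "act ?W b x = (\<lambda>i. (\<epsilon> \<circ> \<gamma>) b \<otimes>\<^bsub>K\<^esub> x i)" if "b \<in> carrier A" for b x
    using rF.\<delta>_signed[OF dg_ring_morphismD(6)[OF \<alpha> that]] by (auto simp: \<gamma>_def)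
  obtain g where g: "dg_module_morphism A cp.P ?W g" "qi cp.P ?W g"
      "\<And>c x. c \<in> carrier K \<Longrightarrow> x \<in> carrier cp.P \<Longrightarrow> g (\<lambda>v. c \<otimes>\<^bsub>K\<^esub> x v) = (\<lambda>i. c \<otimes>\<^bsub>K\<^esub> g x i)"
    using cp.basis_qi[OF W conjunct1[OF sAW[unfolded module_scalars_def]] act_W, of \<psi>] \<psi>
    unfolding hscal_restrict by blast
  \<comment> \<open>D \<otimes> F is compared with C \<otimes> F by a B-linear map, which restricts
    to an A-linear one along \<alpha>.\<close>
  obtain f where f: "dg_module_morphism B BF.T (restrict_scalars \<beta> (ltensor C B \<beta> F)) f"
      "qi BF.T (restrict_scalars \<beta> (ltensor C B \<beta> F)) f"
      "\<And>c x. c \<in> carrier K \<Longrightarrow> x \<in> carrier BF.T \<Longrightarrow> f (\<lambda>i. rF.t c (x i)) = tensor_map B ?CB F F (rF.\<phi> c) (f x)"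
    using rF.base_change[OF B C \<beta>] by blast
  interpret ABF: twisted_module A ?I cell_deg "cell_coeff A" cell_rel ?BF by (rule twA.twisted_moduleI[OF BF])

  \<comment> \<open>The first three comparisons apply T \<otimes> - over A to P \<rightarrow> D
    \<otimes> k \<leftarrow> D \<otimes> F \<rightarrow> C \<otimes> F; the fourth passes from T
    \<otimes> (C \<otimes> F) to L \<otimes> F. Scalars act strictly on P and on D \<otimes> k, and
    through lifts on the other two.\<close>
  have 1: "\<exists>h. giso K (hscal ku.X1 ku.s1) (hscal (?TA ?W) (\<lambda>c x i j. c \<otimes>\<^bsub>K\<^esub> x i j)) h"
    by (rule twA.twisted_giso[OF cp.P.T_left_dg_module W g(1,2), of K "\<lambda>c x v. c \<otimes>\<^bsub>K\<^esub> x v" "\<lambda>c x i. c \<otimes>\<^bsub>K\<^esub> x i"])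
      (use cp.module_scalars_P sAW in \<open>simp_all only: module_scalars_def g(3)\<close>)
  have 2: "\<exists>h. giso K (hscal ABF.T (\<lambda>c x i j. rF.t c (x i j))) (hscal (?TA ?W) (\<lambda>c x i j. c \<otimes>\<^bsub>K\<^esub> x i j)) h"
  proof (rule twA.twisted_giso[OF BF W restrict_morphism[OF \<alpha> twB.twisted_map[OF rF.BF.left_dg_module_axioms rF.k_module rF.\<mu>_morphism]]
        qi_restrict[OF twB.twisted_qi[OF rF.BF.left_dg_module_axioms rF.k_module rF.\<mu>_morphism rF.\<mu>_qi]], where s="\<lambda>c x i. rF.t c (x i)" and t="\<lambda>c x i. c \<otimes>\<^bsub>K\<^esub> x i"])
    show "dg_module_morphism A ?W ?W (\<lambda>x i. c \<otimes>\<^bsub>K\<^esub> x i)" if "c \<in> carrier K" for c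
      using sAW that by (simp add: module_scalars_def)
    show "(\<lambda>i. rF.\<mu> (rF.t c (x i))) = (\<lambda>i. c \<otimes>\<^bsub>K\<^esub> rF.\<mu> (x i))" if "c \<in> carrier K" "x \<in> carrier ?BF" for c x
      using that fsuppD(1)[of x "cells B ?CB" rF.BF] by (intro ext rF.\<mu>_scalar) simp_all
  qed (rule sBF)
  have 3: "\<exists>h. giso K (hscal ABF.T (\<lambda>c x i j. rF.t c (x i j))) (hscal (?TA ?CF) (\<lambda>c x i. tensor_map B ?CB F F (rF.\<phi> c) (x i))) h"
  proof (rule twA.twisted_giso[OF BF CF, where s="\<lambda>c x i. rF.t c (x i)" and t="\<lambda>c. tensor_map B ?CB F F (rF.\<phi> c)"])
    show "dg_module_morphism A ?BF ?CF f" using restrict_morphism[OF \<alpha> f(1)] by (simp only: restrict_\<gamma>)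
    show "qi ?BF ?CF f" using f(2) by (rule qi_restrict[of _ "ltensor C B \<beta> F", OF iffD2[OF same_dg_qi(2)[OF same_dg_restrict]]])
    show "f (\<lambda>i. rF.t c (x i)) = tensor_map B ?CB F F (rF.\<phi> c) (f x)" if "c \<in> carrier K" "x \<in> carrier ?BF" for c x
      using f(3)[OF that(1)] that(2) by simp
  qed (rule sBF sCF, assumption)+
  have 4: "\<exists>h. giso K (hscal (?TA ?CF) (\<lambda>c x i. tensor_map B ?CB F F (rF.\<phi> c) (x i))) (Tor K B (restrict_scalars \<beta> L) F \<pi>) h"
    by (rule rF.cell_Tor[OF A dC L \<gamma> q\<gamma> \<beta>])
  have sABF: "chain_map ABF.T ABF.T (\<lambda>x i j. rF.t c (x i j))" if "c \<in> carrier K" for c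
    by (rule dg_module_morphismD(1)[OF twA.twisted_map[OF BF BF sBF[OF that]]])
  have main: "\<exists>h. giso K (hscal ku.X1 ku.s1) (Tor K B (restrict_scalars \<beta> L) F \<pi>) h"
    by (rule giso_trans[OF 1 giso_trans[OF giso_sym[OF ABF.T_dg sABF 2] giso_trans[OF 3 4]]])
  have s1: "chain_map ku.X1 ku.X1 (ku.s1 c)" if "c \<in> carrier K" for c
    using ku.scalar_maps_s1 that by (simp add: scalar_maps_def)
  have Tor: "dg_group (Tor K B (restrict_scalars \<beta> L) F \<pi>)"
    by (rule rF.Tor_dg_group[OF right_restrict[OF dB \<beta> L]])
  obtain h where h: "giso K (Tor K B (restrict_scalars \<beta> L) F \<pi>) (tensor_space K ?U ?V) h"
    using giso_trans[OF giso_sym[OF ku.X1.T_dg s1 main] kunneth] by blast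
  have "graded_vector_space K (Tor K B (restrict_scalars \<beta> L) F \<pi>)"
    using main giso_vector_space[OF _ hscal_vector_space[OF K ku.X1.T_dg ku.scalar_maps_s1] dg_group.axioms(1)[OF Tor]] by blast
  moreover have "graded_group (tensor_space K ?U ?V)"
    by (intro dg_group.axioms(1) same_dg_group[OF same_dg_tensor_space] tensor_pair.T_dg tensor_pair.intro
        zero_graded.right[OF U] zero_graded.left[OF V])
  ultimately show ?thesis using giso_graded_vector_space_iso[OF h] by blast
qed

end
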